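(* Let $d=2$, $m>2$, $p>1$, let $D=B_5\subset\mathbb R^2$ and, for $\varepsilon>0$, let $D_1,D_2$ be the domains bounded respectively by the curves $$|x_1|^m+|x_2-\varepsilon/2-1|^m=1,\qquad |x_1|^m+|x_2+\varepsilon/2+1|^m=1.$$ Let $\Omega=D\setminus\overline{D_1\cup D_2}$ and let $u\in W^{1,p}(\Omega)$ be the (weak) solution of $$-\mathrm{div}(|\nabla u|^{p-2}\nabla u)=0\ \text{ in }\Omega,\qquad\frac{\partial u}{\partial\nu}=0\ \text{ on }\partial D_i,\ i=1,2,\qquad u=x_1\ \text{ on }\partial D.$$ Then for any $\tau\in(0,m-2)$ and all sufficiently small $\varepsilon>0$, with $t_\varepsilon:=(4m\varepsilon/(m-2-\tau))^{1/m}$: (i) if $1<p\leq m+1$, then $\displaystyle\|\nabla u\|_{L^\infty(\Omega_{t_\varepsilon})}\geq\frac1C\,\varepsilon^{\frac{\tau-1}{m}}$; (ii) if $p>m+1$, then $\displaystyle\|\nabla u\|_{L^\infty(\Omega_{t_\varepsilon})}\geq\frac1C\,\varepsilon^{\frac{2\tau-m}{m(p-1)}}$, where $C=C(m,p,\tau)>0$.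
   Context: $B_5$ is the disc of radius 5 centered at the origin; $\nu$ is the unit outer normal. For $0<t\leq1$, $\Omega_t=\{(x_1,x_2):|x_1|<t,\ |x_2|<\varepsilon/2+1-(1-|x_1|^m)^{1/m}\}$ is the narrow region between $D_1$ and $D_2$. *)

theory Defs
  imports "HOL-Analysis.Analysis" "HOL-Probability.Essential_Supremum"
begin

section \<open>Smooth functions, Lebesgue spaces and Sobolev spaces\<close>

primrec C_k :: "nat \<Rightarrow> ('a::euclidean_space \<Rightarrow> real) \<Rightarrow> bool" where
  "C_k 0 f \<longleftrightarrow> continuous_on UNIV f"
| "C_k (Suc k) f \<longleftrightarrow> (\<forall>x. f differentiable (at x)) \<and>
     (\<forall>b\<in>Basis. C_k k (\<lambda>x. frechet_derivative f (at x) b))"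

definition test_function :: "'a::euclidean_space set \<Rightarrow> ('a \<Rightarrow> real) \<Rightarrow> bool" where
  "test_function U \<phi> \<longleftrightarrow> (\<forall>k. C_k k \<phi>) \<and>
     compact (closure {x. \<phi> x \<noteq> 0}) \<and> closure {x. \<phi> x \<noteq> 0} \<subseteq> U"

definition in_Lp :: "real \<Rightarrow> 'a::euclidean_space set \<Rightarrow> ('a \<Rightarrow> 'b::euclidean_space) \<Rightarrow> bool" where
  "in_Lp p U f \<longleftrightarrow> set_borel_measurable lebesgue U f \<and>
     set_integrable lebesgue U (\<lambda>x. norm (f x) powr p)"

definition Lp_tendsto ::
  "real \<Rightarrow> 'a::euclidean_space set \<Rightarrow> (nat \<Rightarrow> 'a \<Rightarrow> 'b::euclidean_space) \<Rightarrow> ('a \<Rightarrow> 'b) \<Rightarrow> bool" where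
  "Lp_tendsto p U F f \<longleftrightarrow> (\<forall>n. in_Lp p U (F n)) \<and> in_Lp p U f \<and>
     (\<lambda>n. LINT x:U|lebesgue. norm (F n x - f x) powr p) \<longlonglongrightarrow> 0"

definition Linf_norm :: "'a::euclidean_space set \<Rightarrow> ('a \<Rightarrow> 'b::euclidean_space) \<Rightarrow> ennreal" where
  "Linf_norm U f = esssup (restrict_space lebesgue U) (\<lambda>x. ennreal (norm (f x)))"

text \<open>\<open>W1p p U u g\<close>: \<open>u\<close> lies in $W^{1,p}(U)$ and \<open>g\<close> is a representative of its weak gradient.
  Only the values of \<open>u\<close> and \<open>g\<close> on \<open>U\<close> matter.\<close>

definition W1p :: "real \<Rightarrow> 'a::euclidean_space set \<Rightarrow> ('a \<Rightarrow> real) \<Rightarrow> ('a \<Rightarrow> 'a) \<Rightarrow> bool" where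
  "W1p p U u g \<longleftrightarrow> in_Lp p U u \<and> in_Lp p U g \<and>
     (\<forall>\<phi>. test_function U \<phi> \<longrightarrow> (\<forall>b\<in>Basis.
        (LINT x:U|lebesgue. u x * frechet_derivative \<phi> (at x) b) =
        - (LINT x:U|lebesgue. (g x \<bullet> b) * \<phi> x)))"

section \<open>The insulated conductivity problem in the plane\<close>

definition D_outer :: "(real^2) set" where
  "D_outer = ball 0 5"

definition D1 :: "real \<Rightarrow> real \<Rightarrow> (real^2) set" where
  "D1 m \<epsilon> = {x. \<bar>x $ 1\<bar> powr m + \<bar>x $ 2 - \<epsilon>/2 - 1\<bar> powr m < 1}"

definition D2 :: "real \<Rightarrow> real \<Rightarrow> (real^2) set" where
  "D2 m \<epsilon> = {x. \<bar>x $ 1\<bar> powr m + \<bar>x $ 2 + \<epsilon>/2 + 1\<bar> powr m < 1}"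

definition Omega :: "real \<Rightarrow> real \<Rightarrow> (real^2) set" where
  "Omega m \<epsilon> = D_outer - closure (D1 m \<epsilon> \<union> D2 m \<epsilon>)"

definition narrow_region :: "real \<Rightarrow> real \<Rightarrow> real \<Rightarrow> (real^2) set" where
  "narrow_region m \<epsilon> t =
     {x. \<bar>x $ 1\<bar> < t \<and> \<bar>x $ 2\<bar> < \<epsilon>/2 + 1 - (1 - \<bar>x $ 1\<bar> powr m) powr (1/m)}"

text \<open>The trace operator on \<open>\<partial>D\<close>, the circle of radius 5, is the continuous extension to
  $W^{1,p}(U)$ of the restriction map on $W^{1,p}(U) \cap C(\overline{U})$, with values in
  $L^p(\partial D)$; the circle is parametrised by the angle, and arc length is \<open>5\<close> times the angle.\<close>

definition has_trace_outer ::
  "real \<Rightarrow> (real^2) set \<Rightarrow> (real^2 \<Rightarrow> real) \<Rightarrow> (real^2 \<Rightarrow> real^2) \<Rightarrow> (real^2 \<Rightarrow> real) \<Rightarrow> bool" where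
  "has_trace_outer p U u g f \<longleftrightarrow>
     (\<exists>v h. (\<forall>n. continuous_on (closure U) (v n) \<and> W1p p U (v n) (h n)) \<and>
        Lp_tendsto p U v u \<and> Lp_tendsto p U h g \<and>
        (\<lambda>n. LINT \<theta>:{0..2*pi}|lborel.
            5 * \<bar>v n (vector [5 * cos \<theta>, 5 * sin \<theta>]) - f (vector [5 * cos \<theta>, 5 * sin \<theta>])\<bar> powr p)
          \<longlonglongrightarrow> 0)"

text \<open>Testing against all \<open>\<phi>\<close> in $W^{1,p}(\Omega)$ with zero trace on \<open>\<partial>D\<close> only (and no
  restriction on \<open>\<partial>D\<^sub>1\<close>, \<open>\<partial>D\<^sub>2\<close>) encodes both the equation and the
  homogeneous Neumann condition on the inclusions.
  At zeros of \<open>Du\<close> the field $|\nabla u|^{p-2} \nabla u$ is \<open>0\<close>, also for \<open>p < 2\<close>.\<close>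

definition weak_solution ::
  "real \<Rightarrow> real \<Rightarrow> real \<Rightarrow> (real^2 \<Rightarrow> real) \<Rightarrow> (real^2 \<Rightarrow> real^2) \<Rightarrow> bool" where
  "weak_solution m p \<epsilon> u Du \<longleftrightarrow>
     W1p p (Omega m \<epsilon>) u Du \<and>
     has_trace_outer p (Omega m \<epsilon>) u Du (\<lambda>x. x $ 1) \<and>
     (\<forall>\<phi> D\<phi>. W1p p (Omega m \<epsilon>) \<phi> D\<phi> \<and> has_trace_outer p (Omega m \<epsilon>) \<phi> D\<phi> (\<lambda>x. 0) \<longrightarrow>
        (LINT x:Omega m \<epsilon>|lebesgue. (norm (Du x) powr (p - 2) *\<^sub>R Du x) \<bullet> D\<phi> x) = 0)"

definition t_eps :: "real \<Rightarrow> real \<Rightarrow> real \<Rightarrow> real" where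
  "t_eps m \<tau> \<epsilon> = (4 * m * \<epsilon> / (m - 2 - \<tau>)) powr (1/m)"

end

theory Submission
  imports Defs "HOL-Real_Asymp.Real_Asymp" "HOL-Computational_Algebra.Polynomial"
begin

text \<open>By uniqueness \<open>u\<close> is odd in \<open>x\<^sub>1\<close>, so its restriction to the half \<open>x\<^sub>1 > 0\<close> solves the same mixed
  problem there with \<open>u = 0\<close> on the axis, and is compared with subsolutions: functions whose
  \<open>p\<close>-Laplacian is nonnegative and whose flux points out of the inclusions. First \<open>x\<^sub>1\<close> is
  a subsolution, so \<open>u \<ge> x\<^sub>1\<close>. In the neck, of height at most about \<open>\<epsilon> + 2 x\<^sub>1\<^sup>m / m\<close>,
  \<open>(x\<^sub>1\<^sup>2 + \<lambda> x\<^sub>2\<^sup>2)\<^bsup>\<gamma>/2\<^esup>\<close> is a subsolution for \<open>x\<^sub>1 \<ge> a = K \<epsilon>\<^bsup>1/m\<^esup>\<close>, provided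
  \<open>(1 - \<gamma>) (p - 1) < \<lambda> < m\<close>: the lower bound on \<open>\<lambda>\<close> comes from the equation and the upper one
  from the boundary condition. This raises \<open>u\<close> to a multiple of \<open>a\<^bsup>\<gamma>\<^esup>\<close> at \<open>x\<^sub>1 = 8 a\<close>; a linear barrier then
  gives \<open>u \<ge> c a\<^bsup>\<gamma> - 1\<^esup> x\<^sub>1\<close> for \<open>x\<^sub>1 < 8 a\<close>, which forces the gradient to be at least
  \<open>c a\<^bsup>\<gamma> - 1\<^esup>\<close> somewhere in the narrow region.\<close>

section \<open>Mollification\<close>

text \<open>On the line x_2 = 0 the p-Laplacian of the barrier has the sign of \<lambda> - (1 -
  \<gamma>) (p - 1). The inclusions leave x_2 up to about x_1^m / m with slope x_1^(m - 1), so the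
  flux along (x_1, \<lambda> x_2) points out of them as long as \<lambda> / m < 1. Room for
  \<lambda> exists if (1 - \<gamma>) (p - 1) < m: any \<gamma> > 0 will do for p \<le> m + 1,
  otherwise \<gamma> > 1 - m / (p - 1). As a^(\<gamma> - 1) is a multiple of \<epsilon>^((\<gamma> -
  1) / m), these are the two cases of the theorem.

  The obstacle is that u is a Sobolev function whose boundary values are given by approximation on
  the circle and by the weak form alone on the inclusions. So inequalities hold almost everywhere,
  test functions of zero trace are extended by zero across the circle, and the flux condition enters
  through cut-offs of a defining function, whose gradient points out of the inclusion. Comparison
  uses chain and product rules in the Sobolev space, obtained from local C^1 approximation by
  mollification; the smooth kernel comes from exp (-1/s).\<close>

definition flat_exp :: "real poly \<Rightarrow> real \<Rightarrow> real" where
  "flat_exp P s = (if s > 0 then poly P (1/s) * exp (-(1/s)) else 0)"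

lemma poly_times_exp_minus_tendsto_0: "((\<lambda>u. poly P u * exp (-u)) \<longlongrightarrow> (0::real)) at_top"
proof -
  have "((\<lambda>u. \<Sum>i\<le>degree P. coeff P i * (u ^ i / exp u)) \<longlongrightarrow> (\<Sum>i\<le>degree P. coeff P i * 0)) at_top"
    by (intro tendsto_sum tendsto_mult tendsto_const tendsto_power_div_exp_0)
  moreover have "(\<lambda>u. \<Sum>i\<le>degree P. coeff P i * (u ^ i / exp u)) = (\<lambda>u. poly P u * exp (-u))"
    by (simp add: poly_altdef sum_distrib_right exp_minus divide_inverse mult.assoc)
  ultimately show ?thesis by simp
qed

text \<open>With u = 1/s, the chain rule turns P(u) exp (-u) into u^2 (P - P')(u) exp (-u). The
  family \<open>flat_exp P\<close> is therefore closed under differentiation, and iterating one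
  operation on polynomials yields all derivatives of exp (-1/s), including those at 0.\<close>

lemma DERIV_flat_exp:
  "(flat_exp P has_real_derivative flat_exp (monom 1 2 * (P - pderiv P)) s) (at s)"
proof -
  consider "s > 0" | "s < 0" | "s = 0" by linarith
  then show ?thesis
  proof cases
    case 1
    have A: "((\<lambda>s. poly P (1/s) * exp (-(1/s))) has_real_derivative
        flat_exp (monom 1 2 * (P - pderiv P)) s) (at s)"
      using 1 unfolding flat_exp_def
      by (auto intro!: derivative_eq_intros DERIV_chain'[OF _ poly_DERIV]
          simp: poly_monom power2_eq_square divide_inverse algebra_simps)
    have "\<forall>\<^sub>F t in nhds s. t \<in> {0<..}"
      using 1 by (intro eventually_nhds_in_open) auto
    then have ev: "\<forall>\<^sub>F t in nhds s. poly P (1/t) * exp (-(1/t)) = flat_exp P t"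
      by (rule eventually_mono) (simp add: flat_exp_def)
    show ?thesis using A DERIV_cong_ev[OF refl ev refl] by simp
  next
    case 2
    have "\<forall>\<^sub>F t in nhds s. t \<in> {..<0}"
      using 2 by (intro eventually_nhds_in_open) auto
    then have ev: "\<forall>\<^sub>F t in nhds s. flat_exp P t = 0"
      by (rule eventually_mono) (simp add: flat_exp_def)
    have "flat_exp (monom 1 2 * (P - pderiv P)) s = 0" using 2 by (simp add: flat_exp_def)
    then show ?thesis using DERIV_cong_ev[OF refl ev refl, of 0] by simp
  next
    case 3
    \<comment> \<open>At 0 the difference quotient is P(1/h) exp (-1/h) / h; the factor 1/h is the
      extra power of the variable in \<open>pCons 0 P\<close>.\<close>
    have "((\<lambda>u. poly (pCons 0 P) u * exp (-u)) \<longlongrightarrow> 0) at_top"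
      by (rule poly_times_exp_minus_tendsto_0)
    then have "((\<lambda>h. poly (pCons 0 P) (inverse h) * exp (-(inverse h))) \<longlongrightarrow> (0::real)) (at_right 0)"
      by (rule filterlim_compose[OF _ filterlim_inverse_at_top_right])
    then have R: "((\<lambda>h. flat_exp P h / h) \<longlongrightarrow> 0) (at_right 0)"
      by (rule tendsto_cong[THEN iffD1, rotated])
         (auto simp: eventually_at_filter flat_exp_def field_simps)
    have L: "((\<lambda>h. flat_exp P h / h) \<longlongrightarrow> 0) (at_left 0)"
      by (rule tendsto_cong[THEN iffD1, OF _ tendsto_const])
         (auto simp: eventually_at_filter flat_exp_def)
    have "((\<lambda>h. (flat_exp P (0 + h) - flat_exp P 0) / h) \<longlongrightarrow> 0) (at 0)"
      using L R by (simp add: filterlim_at_split flat_exp_def[of P 0])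
    then show ?thesis using 3 by (simp add: DERIV_def flat_exp_def)
  qed
qed

section \<open>Functions of class C^k: sums, products, compositions\<close>

lemma frechet_derivative_eq:
  "(f has_derivative f') (at x) \<Longrightarrow> frechet_derivative f (at x) = f'"
  using frechet_derivative_at by metis

lemma differentiable_has_frechet:
  "f differentiable (at x) \<Longrightarrow> (f has_derivative frechet_derivative f (at x)) (at x)"
  using frechet_derivative_works by blast

lemma C_k_Suc_mono: "C_k (Suc k) f \<Longrightarrow> C_k k f"
proof (induction k arbitrary: f)
  case 0
  then show ?case
    by (auto simp: continuous_on_eq_continuous_at differentiable_imp_continuous_within)
next
  case (Suc k)
  then show ?case using C_k.simps(2) by blast
qed

lemma C_k_const: "C_k k (\<lambda>x. c)"
proof (induction k arbitrary: c)
  case (Suc k)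
  have "frechet_derivative (\<lambda>x. c) (at x) b = 0" for x b :: 'a
    by (subst frechet_derivative_eq[OF has_derivative_const]) auto
  with Suc show ?case by auto
qed auto

lemma C_k_add: "C_k k f \<Longrightarrow> C_k k g \<Longrightarrow> C_k k (\<lambda>x. f x + g x)"
proof (induction k arbitrary: f g)
  case (Suc k)
  have "frechet_derivative (\<lambda>x. f x + g x) (at x) b
      = frechet_derivative f (at x) b + frechet_derivative g (at x) b" for x b
    using Suc.prems
    by (subst frechet_derivative_eq[OF has_derivative_add[OF differentiable_has_frechet differentiable_has_frechet]]) auto
  with Suc show ?case by auto
qed (auto intro: continuous_intros)

lemma C_k_mult: "C_k k f \<Longrightarrow> C_k k g \<Longrightarrow> C_k k (\<lambda>x. f x * g x)"
proof (induction k arbitrary: f g)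
  case (Suc k)
  have "frechet_derivative (\<lambda>x. f x * g x) (at x) b
      = f x * frechet_derivative g (at x) b + frechet_derivative f (at x) b * g x" for x b
    using Suc.prems
    by (subst frechet_derivative_eq[OF has_derivative_mult[OF differentiable_has_frechet differentiable_has_frechet]]) auto
  moreover have "C_k k f" "C_k k g" using Suc.prems C_k_Suc_mono by auto
  ultimately show ?case using Suc by (auto intro!: C_k_add)
qed (auto intro: continuous_intros)

lemma C_k_affine: "C_k k f \<Longrightarrow> C_k k (\<lambda>x. c * f (a + s *\<^sub>R x))"
proof (induction k arbitrary: f c)
  case 0
  have "continuous_on UNIV (\<lambda>x. f (a + s *\<^sub>R x))"
    by (rule continuous_on_compose2[of UNIV f]) (use 0 in \<open>auto intro!: continuous_intros\<close>)
  then show ?case by (auto intro!: continuous_intros)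
next
  case (Suc k)
  have D: "((\<lambda>x. c * f (a + s *\<^sub>R x)) has_derivative
      (\<lambda>h. c * frechet_derivative f (at (a + s *\<^sub>R x)) (s *\<^sub>R h))) (at x)" for x
  proof -
    have "((\<lambda>x. a + s *\<^sub>R x) has_derivative (\<lambda>h. s *\<^sub>R h)) (at x)"
      by (auto intro!: derivative_eq_intros)
    moreover have "(f has_derivative frechet_derivative f (at (a + s *\<^sub>R x))) (at (a + s *\<^sub>R x))"
      using Suc.prems by (intro differentiable_has_frechet) simp
    ultimately show ?thesis
      by (intro has_derivative_mult_right) (rule has_derivative_compose)
  qed
  have "frechet_derivative (\<lambda>x. c * f (a + s *\<^sub>R x)) (at x) b
      = (c * s) * frechet_derivative f (at (a + s *\<^sub>R x)) b" for x b
    using linear_cmul[OF linear_frechet_derivative, of f "at (a + s *\<^sub>R x)" s b] Suc.prems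
    unfolding frechet_derivative_eq[OF D] by simp
  moreover have "C_k k (\<lambda>x. (c * s) * frechet_derivative f (at (a + s *\<^sub>R x)) b)" if "b \<in> Basis" for b
    using Suc.IH[of "\<lambda>x. frechet_derivative f (at x) b" "c * s"] Suc.prems that by auto
  moreover have "(\<lambda>x. c * f (a + s *\<^sub>R x)) differentiable (at x)" for x
    using D differentiable_def by blast
  ultimately show ?case by simp
qed

text \<open>The derivative of \<open>F n\<close> after \<open>r\<close> is \<open>F (Suc n)\<close>
  after \<open>r\<close> times the derivative of \<open>r\<close>; indexing the outer functions by
  the order of derivation lets one induction on \<open>k\<close> treat all of them. The sequence
  will come from iterating \<open>DERIV_flat_exp\<close>.\<close>

lemma C_k_compose:
  assumes F: "\<And>n s. (F n has_real_derivative F (Suc n) s) (at s)" and r: "\<And>k. C_k k r"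
  shows "C_k k (\<lambda>x. F n (r x))"
proof (induction k arbitrary: n)
  case 0
  have "continuous_on UNIV (F n)"
    using DERIV_isCont[OF F] by (simp add: continuous_on_eq_continuous_at)
  then have "continuous_on UNIV (\<lambda>x. F n (r x))"
    by (rule continuous_on_compose2) (use r[of 0] in auto)
  then show ?case by simp
next
  case (Suc k)
  have D: "((\<lambda>x. F n (r x)) has_derivative (\<lambda>h. F (Suc n) (r x) * frechet_derivative r (at x) h)) (at x)" for x
  proof -
    have "(r has_derivative frechet_derivative r (at x)) (at x)"
      using r[of 1] by (intro differentiable_has_frechet) simp
    from has_derivative_compose[OF this F[of n "r x", unfolded has_field_derivative_def]]
    show ?thesis .
  qed
  have "C_k k (\<lambda>x. frechet_derivative r (at x) b)" if "b \<in> Basis" for b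
    using r[of "Suc k"] that by auto
  with Suc D show ?case by (auto simp: differentiable_def frechet_derivative_eq[OF D] intro!: C_k_mult)
qed

lemma C_k_inner: "C_k k (\<lambda>x. x \<bullet> c)"
proof (cases k)
  case (Suc j)
  have D: "((\<lambda>x. x \<bullet> c) has_derivative (\<lambda>h. h \<bullet> c)) (at x)" for x
    by (auto intro!: derivative_eq_intros)
  show ?thesis unfolding Suc
    by (auto simp: differentiable_def frechet_derivative_eq[OF D] intro!: C_k_const D)
qed (auto intro: continuous_intros)

lemma C_k_inner_self: "C_k k (\<lambda>x. x \<bullet> x)"
proof (cases k)
  case (Suc j)
  have D: "((\<lambda>x. x \<bullet> x) has_derivative (\<lambda>h. x \<bullet> (2 *\<^sub>R h))) (at x)" for x :: 'a
    by (auto intro!: derivative_eq_intros simp: inner_commute)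
  show ?thesis unfolding Suc
    using C_k_inner by (auto simp: differentiable_def frechet_derivative_eq[OF D] intro!: D
       simp del: inner_scaleR_right)
qed (auto intro: continuous_intros)

section \<open>Mollifying kernels\<close>

lemma integrable_continuous_bounded_support:
  fixes f :: "'a::euclidean_space \<Rightarrow> 'b::euclidean_space"
  assumes "continuous_on UNIV f" "\<And>x. norm x \<ge> r \<Longrightarrow> f x = 0"
  shows "integrable lborel f"
proof -
  have "set_integrable lborel (cball 0 r) f"
    unfolding set_integrable_def
    by (rule borel_integrable_compact) (auto intro: continuous_on_subset[OF assms(1)])
  then show ?thesis unfolding set_integrable_def
    by (rule Bochner_Integration.integrable_cong[THEN iffD1, rotated 2])
       (use assms(2) in \<open>auto simp: indicator_def\<close>)
qed

text \<open>The classical kernel exp (-1 / (1 - |x|^2)), scaled to radius \<open>d\<close> and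
  divided by its mass. The mass is positive because the kernel is positive on a ball, which is not a
  null set.\<close>

lemma ex_smooth_kernel:
  assumes "d > 0"
  obtains \<rho> :: "'a::euclidean_space \<Rightarrow> real" where
    "\<And>k. C_k k \<rho>" "\<And>x. \<rho> x \<ge> 0" "\<And>x. norm x \<ge> d \<Longrightarrow> \<rho> x = 0" "integral\<^sup>L lborel \<rho> = 1"
proof -
  define \<rho>0 where "\<rho>0 x = flat_exp 1 (1 + (-1) * (x \<bullet> x))" for x :: 'a
  define F where "F n = flat_exp (((\<lambda>P. monom 1 2 * (P - pderiv P)) ^^ n) 1)" for n
  have C0: "C_k k \<rho>0" for k
  proof -
    have "(F n has_real_derivative F (Suc n) s) (at s)" for n s
      unfolding F_def using DERIV_flat_exp by simp
    moreover have "C_k k (\<lambda>x. 1 + (-1) * (x \<bullet> x))" for k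
      by (intro C_k_add C_k_mult C_k_const C_k_inner_self)
    ultimately have "C_k k (\<lambda>x. F 0 (1 + (-1) * (x \<bullet> x)))"
      by (rule C_k_compose)
    moreover have "\<rho>0 = (\<lambda>x. F 0 (1 + (-1) * (x \<bullet> x)))" by (simp add: fun_eq_iff F_def \<rho>0_def)
    ultimately show ?thesis by simp
  qed
  define \<rho>1 where "\<rho>1 x = \<rho>0 ((1/d) *\<^sub>R x)" for x
  have C1: "C_k k \<rho>1" for k
  proof -
    have "\<rho>1 = (\<lambda>x. 1 * \<rho>0 (0 + (1/d) *\<^sub>R x))" by (simp add: fun_eq_iff \<rho>1_def)
    then show ?thesis using C_k_affine[OF C0, of k 1 0 "1/d"] by simp
  qed
  have nn: "\<rho>1 x \<ge> 0" for x by (auto simp: \<rho>1_def \<rho>0_def flat_exp_def)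
  have supp: "\<rho>1 x = 0" if "norm x \<ge> d" for x
  proof -
    have "norm ((1/d) *\<^sub>R x) \<ge> 1" using that assms by (auto simp: field_simps)
    then have "((1/d) *\<^sub>R x) \<bullet> ((1/d) *\<^sub>R x) \<ge> 1"
      unfolding dot_square_norm by (metis one_le_power)
    then show ?thesis by (simp add: \<rho>1_def \<rho>0_def flat_exp_def)
  qed
  have pos: "\<rho>1 x > 0" if "norm x < d" for x
  proof -
    have "norm ((1/d) *\<^sub>R x) < 1" using that assms by (auto simp: field_simps)
    then have "((1/d) *\<^sub>R x) \<bullet> ((1/d) *\<^sub>R x) < 1"
      unfolding dot_square_norm by (simp add: power_less_one_iff)
    then show ?thesis by (simp add: \<rho>1_def \<rho>0_def flat_exp_def)
  qed
  have cont: "continuous_on UNIV \<rho>1" using C1[of 0] by simp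
  have int: "integrable lborel \<rho>1"
    by (rule integrable_continuous_bounded_support[OF cont supp])
  have "integral\<^sup>L lborel \<rho>1 \<noteq> 0"
  proof
    assume "integral\<^sup>L lborel \<rho>1 = 0"
    then have "AE x in lborel. \<rho>1 x = 0"
      using integral_nonneg_eq_0_iff_AE[OF int] nn by auto
    then have "AE x in lborel. x \<notin> ball (0::'a) d" 
    proof eventually_elim
      case (elim x)
      then show ?case using pos[of x] by auto
    qed
    then have "emeasure lborel (ball (0::'a) d) = 0"
      by (subst (asm) AE_iff_measurable[of "ball 0 d"]) auto
    then have "ball (0::'a) d \<in> null_sets lborel" by auto
    then have "negligible (ball (0::'a) d)"
      by (simp add: negligible_iff_null_sets null_sets_completionI)
    then show False using open_not_negligible[of "ball (0::'a) d"] assms by auto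
  qed
  moreover have "integral\<^sup>L lborel \<rho>1 \<ge> 0" by (rule integral_nonneg_AE) (simp add: nn)
  ultimately have c: "integral\<^sup>L lborel \<rho>1 > 0" by linarith
  show thesis
  proof (rule that[of "\<lambda>x. (1 / integral\<^sup>L lborel \<rho>1) * \<rho>1 x"])
    show "C_k k (\<lambda>x. (1 / integral\<^sup>L lborel \<rho>1) * \<rho>1 x)" for k
      by (intro C_k_mult C_k_const C1)
  qed (use c nn supp in auto)
qed

text \<open>The cut-offs used later, such as \<open>ramp\<close> and \<open>bump\<close>, have one
  continuous derivative and no more, so the calculus is set up for C^1 functions. The gradient is
  carried along as an explicit function, which makes product and chain rules statements about
  pairs.\<close>

definition C1_grad :: "('a::euclidean_space \<Rightarrow> real) \<Rightarrow> ('a \<Rightarrow> 'a) \<Rightarrow> bool" where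
  "C1_grad f f' \<longleftrightarrow> (\<forall>x. GDERIV f x :> f' x) \<and> continuous_on UNIV f'"

lemma C1_grad_imp_continuous: "C1_grad f f' \<Longrightarrow> continuous_on UNIV f"
  unfolding C1_grad_def gderiv_def
  by (meson UNIV_I continuous_on_eq_continuous_within has_derivative_continuous has_derivative_at_withinI)

lemma C_k_imp_C1_grad:
  assumes "C_k 1 f"
  shows "C1_grad f (\<lambda>x. \<Sum>b\<in>Basis. frechet_derivative f (at x) b *\<^sub>R b)"
proof -
  have "(f has_derivative frechet_derivative f (at x)) (at x)" for x
    using assms by (auto intro!: differentiable_has_frechet)
  moreover have "frechet_derivative f (at x) = (\<lambda>h. h \<bullet> (\<Sum>b\<in>Basis. frechet_derivative f (at x) b *\<^sub>R b))" for x
  proof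
    fix h
    have lin: "linear (frechet_derivative f (at x))"
      using assms by (intro linear_frechet_derivative) auto
    have "frechet_derivative f (at x) h = frechet_derivative f (at x) (\<Sum>b\<in>Basis. (h \<bullet> b) *\<^sub>R b)"
      by (simp add: euclidean_representation)
    also have "\<dots> = h \<bullet> (\<Sum>b\<in>Basis. frechet_derivative f (at x) b *\<^sub>R b)"
      by (simp add: linear_sum[OF lin] linear_cmul[OF lin] inner_sum_right mult.commute)
    finally show "frechet_derivative f (at x) h = h \<bullet> (\<Sum>b\<in>Basis. frechet_derivative f (at x) b *\<^sub>R b)" .
  qed
  ultimately show ?thesis using assms unfolding C1_grad_def gderiv_def
    by (auto intro!: continuous_intros)
qed

lemma C1_grad_frechet: "C1_grad f f' \<Longrightarrow> frechet_derivative f (at x) b = b \<bullet> f' x"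
  unfolding C1_grad_def gderiv_def by (metis frechet_derivative_eq)

section \<open>Continuity of translations in L^1\<close>

lemma integrable_translate:
  fixes f :: "'a::euclidean_space \<Rightarrow> real"
  assumes "integrable lborel f"
  shows "integrable lborel (\<lambda>x. f (x + z))"
proof -
  have "integrable (distr lborel borel ((+) z)) f" by (simp add: lborel_distr_plus assms)
  then show ?thesis by (subst (asm) integrable_distr_eq) (use assms in \<open>auto simp: add.commute\<close>)
qed

lemma integral_translate:
  fixes f :: "'a::euclidean_space \<Rightarrow> real"
  assumes [measurable]: "f \<in> borel_measurable borel"
  shows "(\<integral>x. f (x + z) \<partial>lborel) = (\<integral>x. f x \<partial>lborel)"
proof -
  have "(\<integral>x. f x \<partial>distr lborel borel ((+) z)) = (\<integral>x. f (z + x) \<partial>lborel)"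
    by (subst integral_distr) auto
  then show ?thesis by (simp add: lborel_distr_plus add.commute)
qed

text \<open>Two of the three terms in the triangle inequality coincide, since the L^1 distance of
  \<open>f\<close> to its approximant is invariant under translation; hence the choice e/3. This
  reduces the continuity of translations to a dense class.\<close>

lemma translation_L1_approx:
  fixes f :: "'a::euclidean_space \<Rightarrow> real"
  assumes f: "integrable lborel f"
    and g: "\<And>e. e > 0 \<Longrightarrow> \<exists>g. integrable lborel g \<and>
       ((\<lambda>z. \<integral>x. \<bar>g (x + z) - g x\<bar> \<partial>lborel) \<longlongrightarrow> 0) (at 0) \<and> (\<integral>x. \<bar>f x - g x\<bar> \<partial>lborel) < e"
  shows "((\<lambda>z. \<integral>x. \<bar>f (x + z) - f x\<bar> \<partial>lborel) \<longlongrightarrow> 0) (at 0)"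
proof (rule tendstoI)
  fix e :: real assume "e > 0"
  then obtain h where h: "integrable lborel h"
      "((\<lambda>z. \<integral>x. \<bar>h (x + z) - h x\<bar> \<partial>lborel) \<longlongrightarrow> 0) (at 0)" "(\<integral>x. \<bar>f x - h x\<bar> \<partial>lborel) < e/3"
    using g[of "e/3"] by auto
  have "\<forall>\<^sub>F z in at 0. (\<integral>x. \<bar>h (x + z) - h x\<bar> \<partial>lborel) < e/3"
    using order_tendstoD(2)[OF h(2), of "e/3"] \<open>e > 0\<close> by auto
  then show "\<forall>\<^sub>F z in at 0. dist (\<integral>x. \<bar>f (x + z) - f x\<bar> \<partial>lborel) 0 < e"
  proof eventually_elim
    case (elim z)
    note int = integrable_translate[OF f, of z] integrable_translate[OF h(1), of z] f h(1)
    have m: "(\<lambda>x. \<bar>f x - h x\<bar>) \<in> borel_measurable borel" using f h(1) by auto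
    have "(\<integral>x. \<bar>f (x + z) - f x\<bar> \<partial>lborel)
        \<le> (\<integral>x. \<bar>f (x + z) - h (x + z)\<bar> + (\<bar>h (x + z) - h x\<bar> + \<bar>f x - h x\<bar>) \<partial>lborel)"
      by (rule integral_mono) (use int in auto)
    also have "\<dots> = (\<integral>x. \<bar>f (x + z) - h (x + z)\<bar> \<partial>lborel)
        + ((\<integral>x. \<bar>h (x + z) - h x\<bar> \<partial>lborel) + (\<integral>x. \<bar>f x - h x\<bar> \<partial>lborel))"
      using int by simp
    also have "(\<integral>x. \<bar>f (x + z) - h (x + z)\<bar> \<partial>lborel) = (\<integral>x. \<bar>f x - h x\<bar> \<partial>lborel)"
      by (rule integral_translate[OF m])
    also have "(\<integral>x. \<bar>f x - h x\<bar> \<partial>lborel) + ((\<integral>x. \<bar>h (x + z) - h x\<bar> \<partial>lborel) + (\<integral>x. \<bar>f x - h x\<bar> \<partial>lborel)) < e"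
      using elim h(3) by auto
    finally show ?case by (simp add: abs_of_nonneg integral_nonneg_AE)
  qed
qed

text \<open>A point of an open set stays in it under small translations, so the part max 0 (1_U(x) -
  1_U(x + z)) tends to 0 pointwise under the bound 1_U. The opposite part has the same integral
  because both indicators have the same mass; hence the factor 2.\<close>

lemma translation_L1_open:
  fixes U :: "'a::euclidean_space set"
  assumes U: "open U" "emeasure lborel U < \<infinity>"
  shows "((\<lambda>z. \<integral>x. \<bar>indicator U (x + z) - indicator U x :: real\<bar> \<partial>lborel) \<longlongrightarrow> 0) (at 0)"
  unfolding tendsto_at_iff_sequentially
proof (intro allI impI)
  fix X :: "nat \<Rightarrow> 'a" assume X: "\<forall>i. X i \<in> UNIV - {0}" "X \<longlonglongrightarrow> 0"
  let ?f = "indicator U :: 'a \<Rightarrow> real"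
  have [measurable]: "U \<in> sets borel" using U by auto
  have i0: "integrable lborel ?f" using U by (auto intro: integrable_real_indicator)
  note int = i0 integrable_translate[OF i0]
  have *: "(\<integral>x. \<bar>?f (x + z) - ?f x\<bar> \<partial>lborel) = 2 * (\<integral>x. max 0 (?f x - ?f (x + z)) \<partial>lborel)" for z
  proof -
    have "(\<integral>x. \<bar>?f (x + z) - ?f x\<bar> \<partial>lborel) = (\<integral>x. 2 * max 0 (?f x - ?f (x + z)) + (?f (x + z) - ?f x) \<partial>lborel)"
      by (rule Bochner_Integration.integral_cong) (auto simp: max_def)
    also have "\<dots> = 2 * (\<integral>x. max 0 (?f x - ?f (x + z)) \<partial>lborel) + ((\<integral>x. ?f (x + z) \<partial>lborel) - (\<integral>x. ?f x \<partial>lborel))"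
      using int by simp
    finally show ?thesis by (subst (asm) integral_translate) auto
  qed
  have "(\<lambda>n. \<integral>x. max 0 (?f x - ?f (x + X n)) \<partial>lborel) \<longlonglongrightarrow> (\<integral>x. 0 \<partial>(lborel :: 'a measure))"
  proof (rule integral_dominated_convergence[where w = ?f])
    show "AE x in lborel. (\<lambda>n. max 0 (?f x - ?f (x + X n))) \<longlonglongrightarrow> 0"
    proof (rule AE_I2)
      fix x
      show "(\<lambda>n. max 0 (?f x - ?f (x + X n))) \<longlonglongrightarrow> 0"
      proof (cases "x \<in> U")
        case True
        have "(\<lambda>n. x + X n) \<longlonglongrightarrow> x + 0" by (intro tendsto_intros X)
        then have "\<forall>\<^sub>F n in sequentially. x + X n \<in> U"
          using topological_tendstoD[of _ x sequentially U] True U by auto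
        then have "\<forall>\<^sub>F n in sequentially. max 0 (?f x - ?f (x + X n)) = 0"
          by eventually_elim (simp add: True)
        then show ?thesis by (rule tendsto_eventually)
      next
        case False
        then have "max 0 (?f x - ?f (x + X n)) = 0" for n by (auto simp: indicator_def)
        then show ?thesis by simp
      qed
    qed
  qed (use i0 in \<open>auto simp: indicator_def\<close>)
  then have "(\<lambda>n. 2 * (\<integral>x. max 0 (?f x - ?f (x + X n)) \<partial>lborel)) \<longlonglongrightarrow> 2 * 0"
    by (intro tendsto_mult tendsto_const) simp
  then show "((\<lambda>z. \<integral>x. \<bar>?f (x + z) - ?f x\<bar> \<partial>lborel) \<circ> X) \<longlonglongrightarrow> 0"
    by (simp add: comp_def *)
qed

text \<open>Outer regularity brings indicators of measurable sets down to open sets; sums and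
  dominated limits then follow from the triangle inequality and
  \<open>translation_L1_approx\<close>.\<close>

lemma translation_L1_tendsto:
  fixes f :: "'a::euclidean_space \<Rightarrow> real"
  assumes "integrable lborel f"
  shows "((\<lambda>z. \<integral>x. \<bar>f (x + z) - f x\<bar> \<partial>lborel) \<longlongrightarrow> 0) (at 0)"
  using assms
proof (induction f rule: integrable_induct)
  case (base A c)
  have [measurable]: "A \<in> sets lborel" by fact
  have ind: "((\<lambda>z. \<integral>x. \<bar>indicator A (x + z) - indicator A x :: real\<bar> \<partial>lborel) \<longlongrightarrow> 0) (at 0)"
  proof (rule translation_L1_approx)
    show iA: "integrable lborel (indicator A :: 'a \<Rightarrow> real)" using base by (auto intro: integrable_real_indicator)
    fix e :: real assume "e > 0"
    then obtain U where U: "open U" "A \<subseteq> U" "emeasure lborel (U - A) < e"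
      by (metis outer_regular_lborel base(1) sets_lborel)
    have "emeasure lborel U = emeasure lborel A + emeasure lborel (U - A)"
      using U base(1) by (subst plus_emeasure) (auto simp: Un_absorb1)
    then have Uf: "emeasure lborel U < \<infinity>" using base U by (auto simp: less_top[symmetric])
    have "(\<integral>x. \<bar>indicator A x - indicator U x :: real\<bar> \<partial>lborel) = (\<integral>x. indicator (U - A) x \<partial>lborel)"
      using U by (intro Bochner_Integration.integral_cong) (auto simp: indicator_def)
    also have "\<dots> = measure lborel (U - A)" by simp
    also have "\<dots> < e"
    proof -
      have "emeasure lborel (U - A) \<noteq> top" using U(3) by auto
      from emeasure_eq_ennreal_measure[OF this] show ?thesis using U(3) \<open>e > 0\<close> by (simp add: ennreal_less_iff)
    qed
    finally show "\<exists>g. integrable lborel g \<and>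
       ((\<lambda>z. \<integral>x. \<bar>g (x + z) - g x\<bar> \<partial>lborel) \<longlongrightarrow> 0) (at 0) \<and> (\<integral>x. \<bar>indicator A x - g x\<bar> \<partial>lborel) < e"
      using U Uf translation_L1_open by (intro exI[of _ "indicator U"]) (auto intro!: integrable_real_indicator)
  qed
  have "(\<integral>x. \<bar>indicator A (x + z) *\<^sub>R c - indicator A x *\<^sub>R c\<bar> \<partial>lborel)
      = \<bar>c\<bar> * (\<integral>x. \<bar>indicator A (x + z) - indicator A x :: real\<bar> \<partial>lborel)" for z
    by (subst integral_mult_right_zero[symmetric])
       (auto intro!: Bochner_Integration.integral_cong simp: left_diff_distrib[symmetric] abs_mult)
  then show ?case using tendsto_mult_right_zero[OF ind] by simp
next
  case (add f g)
  show ?case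
  proof (rule tendsto_sandwich[OF _ _ tendsto_const])
    show "((\<lambda>z. (\<integral>x. \<bar>f (x + z) - f x\<bar> \<partial>lborel) + (\<integral>x. \<bar>g (x + z) - g x\<bar> \<partial>lborel)) \<longlongrightarrow> 0) (at 0)"
      using tendsto_add[OF add.IH] by simp
    show "\<forall>\<^sub>F z in at 0. (\<integral>x. \<bar>f (x + z) + g (x + z) - (f x + g x)\<bar> \<partial>lborel)
      \<le> (\<integral>x. \<bar>f (x + z) - f x\<bar> \<partial>lborel) + (\<integral>x. \<bar>g (x + z) - g x\<bar> \<partial>lborel)"
    proof (rule always_eventually, rule allI)
      fix z
      note int = add.hyps integrable_translate[OF add.hyps(1), of z] integrable_translate[OF add.hyps(2), of z]
      have "(\<integral>x. \<bar>f (x + z) + g (x + z) - (f x + g x)\<bar> \<partial>lborel)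
        \<le> (\<integral>x. \<bar>f (x + z) - f x\<bar> + \<bar>g (x + z) - g x\<bar> \<partial>lborel)"
        by (rule integral_mono) (use int in auto)
      then show "(\<integral>x. \<bar>f (x + z) + g (x + z) - (f x + g x)\<bar> \<partial>lborel)
        \<le> (\<integral>x. \<bar>f (x + z) - f x\<bar> \<partial>lborel) + (\<integral>x. \<bar>g (x + z) - g x\<bar> \<partial>lborel)"
        using int by simp
    qed
  qed (auto intro!: always_eventually integral_nonneg_AE)
next
  case (lim f s)
  show ?case
  proof (rule translation_L1_approx)
    fix e :: real assume "e > 0"
    have "(\<lambda>i. \<integral>x. \<bar>f x - s i x\<bar> \<partial>lborel) \<longlonglongrightarrow> (\<integral>x. 0 \<partial>(lborel :: 'a measure))"
    \<comment> \<open>The approximants satisfy |s i x| \<le> 2 |f x|, hence the bound 3 |f|.\<close>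
    proof (rule integral_dominated_convergence[where w = "\<lambda>x. 3 * \<bar>f x\<bar>"])
      have *: "(\<lambda>i. \<bar>f x - s i x\<bar>) \<longlonglongrightarrow> 0" for x
        using tendsto_rabs_zero[OF tendsto_diff[OF tendsto_const[of "f x"] lim.hyps(2)[of x], simplified]] by simp
      show "AE x in lborel. (\<lambda>i. \<bar>f x - s i x\<bar>) \<longlonglongrightarrow> 0" using * by simp
      show "AE x in lborel. norm \<bar>f x - s i x\<bar> \<le> 3 * \<bar>f x\<bar>" for i
        using lim.hyps(3)[of _ i] by (intro AE_I2) (smt (verit) UNIV_I real_norm_def space_borel space_lborel)
    qed (use lim in auto)
    then have "\<forall>\<^sub>F i in sequentially. (\<integral>x. \<bar>f x - s i x\<bar> \<partial>lborel) < e"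
      using \<open>e > 0\<close> by (intro order_tendstoD(2)) auto
    then obtain i where "(\<integral>x. \<bar>f x - s i x\<bar> \<partial>lborel) < e"
      by (auto simp: eventually_sequentially)
    then show "\<exists>g. integrable lborel g \<and>
       ((\<lambda>z. \<integral>x. \<bar>g (x + z) - g x\<bar> \<partial>lborel) \<longlongrightarrow> 0) (at 0) \<and> (\<integral>x. \<bar>f x - g x\<bar> \<partial>lborel) < e"
      using lim by blast
  qed fact
qed

text \<open>Since the kernel has mass 1, the error is an average over |z| < d of the differences f(x
  + z) - f(x), and Fubini moves the L^1 norm inside. The kernel enters as \<rho>(y - x), so that for
  fixed x it is a function of y centred at x, the form in which a weak derivative can be
  tested.\<close>

lemma smoothing_L1_bound:
  fixes f :: "'a::euclidean_space \<Rightarrow> real"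
  assumes f: "integrable lborel f" and e: "e \<ge> 0"
    and T: "\<And>z. norm z < d \<Longrightarrow> (\<integral>x. \<bar>f (x + z) - f x\<bar> \<partial>lborel) \<le> e"
    and \<rho>: "continuous_on UNIV \<rho>" "\<And>x. \<rho> x \<ge> 0" "\<And>x. norm x \<ge> d \<Longrightarrow> \<rho> x = 0" "integral\<^sup>L lborel \<rho> = 1"
  shows "integrable lborel (\<lambda>x. \<integral>y. \<rho> (y - x) * f y \<partial>lborel)"
    and "(\<integral>x. \<bar>(\<integral>y. \<rho> (y - x) * f y \<partial>lborel) - f x\<bar> \<partial>lborel) \<le> e"
proof -
  have [measurable]: "f \<in> borel_measurable borel" using f by auto
  have [measurable]: "\<rho> \<in> borel_measurable borel" using \<rho>(1) by (rule borel_measurable_continuous_onI)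
  have \<rho>i: "integrable lborel \<rho>" by (rule integrable_continuous_bounded_support[OF \<rho>(1,3)])
  let ?c = "\<lambda>x. \<integral>y. \<rho> (y - x) * f y \<partial>lborel"
  have cm[measurable]: "?c \<in> borel_measurable borel" by measurable
  have "bounded (range \<rho>)"
  proof -
    have "compact (\<rho> ` cball 0 d)" by (intro compact_continuous_image continuous_on_subset[OF \<rho>(1)]) auto
    then have "bounded (insert 0 (\<rho> ` cball 0 d))" by (simp add: compact_imp_bounded)
    moreover have "range \<rho> \<subseteq> insert 0 (\<rho> ` cball 0 d)" using \<rho>(3) by (force simp: not_le)
    ultimately show ?thesis by (rule bounded_subset)
  qed
  then obtain B where B: "\<And>x. \<bar>\<rho> x\<bar> \<le> B" by (auto simp: bounded_iff)
  have shift: "?c x = (\<integral>z. \<rho> z * f (x + z) \<partial>lborel)" for x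
    using integral_translate[of "\<lambda>y. \<rho> (y - x) * f y" x] by (simp add: add.commute)
  have fx: "integrable lborel (\<lambda>z. f (x + z))" for x
    using integrable_translate[OF f, of x] by (simp add: add.commute)
  have i1: "integrable lborel (\<lambda>z. \<rho> z * f (x + z))" for x
    by (rule Bochner_Integration.integrable_bound[OF integrable_mult_right[OF fx[of x], of B]])
       (use order_trans[OF B abs_ge_self] in \<open>auto simp: abs_mult intro!: mult_right_mono\<close>)
  have diff: "?c x - f x = (\<integral>z. \<rho> z * (f (x + z) - f x) \<partial>lborel)" for x
    using i1[of x] \<rho>i \<rho>(4) by (simp add: shift right_diff_distrib)
  have "(\<integral>\<^sup>+x. ennreal \<bar>?c x - f x\<bar> \<partial>lborel) \<le> (\<integral>\<^sup>+x. (\<integral>\<^sup>+z. ennreal (\<rho> z * \<bar>f (x + z) - f x\<bar>) \<partial>lborel) \<partial>lborel)"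
  proof (rule nn_integral_mono)
    fix x
    have "integrable lborel (\<lambda>z. \<rho> z * (f (x + z) - f x))"
      using i1[of x] \<rho>i by (simp add: right_diff_distrib)
    from integral_norm_bound_ennreal[OF this]
    show "ennreal \<bar>?c x - f x\<bar> \<le> (\<integral>\<^sup>+z. ennreal (\<rho> z * \<bar>f (x + z) - f x\<bar>) \<partial>lborel)"
      unfolding diff by (simp add: abs_mult \<rho>(2))
  qed
  also have "\<dots> = (\<integral>\<^sup>+z. (\<integral>\<^sup>+x. ennreal (\<rho> z * \<bar>f (x + z) - f x\<bar>) \<partial>lborel) \<partial>lborel)"
    by (rule lborel_pair.Fubini') measurable
  also have "\<dots> \<le> (\<integral>\<^sup>+z. ennreal (\<rho> z * e) \<partial>lborel)"
  proof (rule nn_integral_mono)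
    fix z
    have "(\<integral>\<^sup>+x. ennreal (\<rho> z * \<bar>f (x + z) - f x\<bar>) \<partial>lborel) = ennreal (\<integral>x. \<rho> z * \<bar>f (x + z) - f x\<bar> \<partial>lborel)"
      using integrable_translate[OF f, of z] f \<rho>(2) by (intro nn_integral_eq_integral) auto
    also have "\<dots> \<le> ennreal (\<rho> z * e)"
    proof (cases "norm z < d")
      case True
      then show ?thesis using T[of z] \<rho>(2)[of z] by (intro ennreal_leI) (simp add: mult_left_mono)
    next
      case False
      then show ?thesis using \<rho>(3)[of z] by simp
    qed
    finally show "(\<integral>\<^sup>+x. ennreal (\<rho> z * \<bar>f (x + z) - f x\<bar>) \<partial>lborel) \<le> ennreal (\<rho> z * e)" .
  qed
  also have "\<dots> = ennreal (\<integral>z. \<rho> z * e \<partial>lborel)"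
    using \<rho>i \<rho>(2) e by (intro nn_integral_eq_integral) auto
  also have "\<dots> = ennreal e" using \<rho>(4) by simp
  finally have b: "(\<integral>\<^sup>+x. ennreal \<bar>?c x - f x\<bar> \<partial>lborel) \<le> ennreal e" .
  have i2: "integrable lborel (\<lambda>x. ?c x - f x)"
    by (rule integrableI_bounded) (use b in \<open>auto simp: le_less_trans\<close>)
  then show "integrable lborel ?c"
    using Bochner_Integration.integrable_add[OF i2 f] by simp
  show "(\<integral>x. \<bar>?c x - f x\<bar> \<partial>lborel) \<le> e"
    using b nn_integral_eq_integral[OF integrable_abs[OF i2]] e by simp
qed

section \<open>Differentiability of the smoothed functions\<close>

lemma GDERIV_line:
  assumes "GDERIV f (a + t *\<^sub>R v) :> D"
  shows "((\<lambda>t. f (a + t *\<^sub>R v)) has_real_derivative (v \<bullet> D)) (at t)"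
proof -
  have "((\<lambda>t. a + t *\<^sub>R v) has_derivative (\<lambda>h. h *\<^sub>R v)) (at t)"
    by (auto intro!: derivative_eq_intros)
  from has_derivative_compose[OF this assms[unfolded gderiv_def]]
  show ?thesis by (simp add: has_field_derivative_def mult.commute[of _ "v \<bullet> D"] mult_commute_abs)
qed

lemma C1_grad_mvt:
  assumes "C1_grad f f'"
  obtains t where "0 < t" "t < 1" "f b - f a = (b - a) \<bullet> f' (a + t *\<^sub>R (b - a))"
proof -
  have "\<exists>z. 0 < z \<and> z < 1 \<and> f (a + 1 *\<^sub>R (b - a)) - f (a + 0 *\<^sub>R (b - a))
      = (1 - 0) * ((b - a) \<bullet> f' (a + z *\<^sub>R (b - a)))"
    by (rule MVT2[where f = "\<lambda>t. f (a + t *\<^sub>R (b - a))"], simp, rule GDERIV_line)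
       (use assms C1_grad_def in blast)
  then show ?thesis using that by auto
qed

lemma GDERIV_eq_zero:
  assumes "GDERIV f x :> D" "open S" "x \<in> S" "\<And>y. y \<in> S \<Longrightarrow> f y = 0"
  shows "D = 0"
proof -
  have "(f has_derivative (\<lambda>h. 0)) (at x)"
    by (rule has_derivative_transform_within_open[OF has_derivative_const[of 0] assms(2,3)])
       (simp add: assms(4))
  then have "(\<lambda>h. h \<bullet> D) = (\<lambda>h. 0)"
    using assms(1) has_derivative_unique unfolding gderiv_def by blast
  then have "D \<bullet> D = 0" by metis
  then show ?thesis by simp
qed

lemma bounded_support_bounded:
  fixes f :: "'a::euclidean_space \<Rightarrow> 'b::real_normed_vector"
  assumes "continuous_on UNIV f" "compact K" "\<And>x. x \<notin> K \<Longrightarrow> f x = 0"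
  obtains B where "B > 0" "\<And>x. norm (f x) \<le> B"
proof -
  have "compact (f ` K)" by (intro compact_continuous_image continuous_on_subset[OF assms(1)] assms) auto
  then have "bounded (f ` K)" by (rule compact_imp_bounded)
  then obtain B where B: "B > 0" "\<And>x. x \<in> K \<Longrightarrow> norm (f x) \<le> B" by (auto simp: bounded_pos)
  have "norm (f x) \<le> B" for x using B assms(3)[of x] by (cases "x \<in> K") auto
  then show ?thesis using that B by blast
qed

lemma bounded_support_uniform:
  fixes f :: "'a::euclidean_space \<Rightarrow> 'b::real_normed_vector"
  assumes c: "continuous_on UNIV f" and z: "\<And>x. norm x > r \<Longrightarrow> f x = 0" and "e > 0"
  obtains d where "d > 0" "\<And>x y. norm (y - x) < d \<Longrightarrow> norm (f y - f x) < e"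
proof -
  have "uniformly_continuous_on (cball 0 (r + 1)) f"
    by (intro compact_uniformly_continuous continuous_on_subset[OF c]) auto
  then obtain d where d: "d > 0"
      "\<And>x y. x \<in> cball 0 (r+1) \<Longrightarrow> y \<in> cball 0 (r+1) \<Longrightarrow> dist y x < d \<Longrightarrow> dist (f y) (f x) < e"
    using \<open>e > 0\<close> unfolding uniformly_continuous_on_def by metis
  have "norm (f y - f x) < e" if n: "norm (y - x) < min d 1" for x y
  proof (cases "norm x \<le> r \<or> norm y \<le> r")
    case True
    have "norm x \<le> norm y + norm (y - x)" "norm y \<le> norm x + norm (y - x)"
      by norm+
    then have "norm x \<le> r + 1" "norm y \<le> r + 1" using True n by auto
    then show ?thesis using d(2)[of x y] n by (simp add: dist_norm)
  next
    case False
    then show ?thesis using z[of x] z[of y] \<open>e > 0\<close> by auto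
  qed
  then show ?thesis using that[of "min d 1"] d(1) by auto
qed

text \<open>Differentiation under the integral sign: the gradient of the kernel has bounded support,
  so it is uniformly continuous, and by the mean value theorem the linearisation error of the kernel
  is at most e |y - x| / (N + 1), with N the L^1 norm of \<open>f\<close>. Dividing by N + 1 instead
  of N covers f = 0. The minus sign comes from differentiating \<rho>(y - x) in x.\<close>

lemma smoothing_C1_grad:
  fixes f :: "'a::euclidean_space \<Rightarrow> real"
  assumes f: "integrable lborel f" and \<rho>: "C1_grad \<rho> \<rho>'" and supp: "\<And>x. norm x \<ge> r \<Longrightarrow> \<rho> x = 0"
  shows "C1_grad (\<lambda>x. \<integral>y. \<rho> (y - x) * f y \<partial>lborel) (\<lambda>x. \<integral>y. f y *\<^sub>R (- \<rho>' (y - x)) \<partial>lborel)"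
    and "integrable lborel (\<lambda>y. f y *\<^sub>R (- \<rho>' (y - x)))"
proof -
  have \<rho>c: "continuous_on UNIV \<rho>" "continuous_on UNIV \<rho>'"
    using \<rho> C1_grad_imp_continuous by (auto simp: C1_grad_def)
  have [measurable]: "\<rho> \<in> borel_measurable borel" "\<rho>' \<in> borel_measurable borel"
    using \<rho>c by (auto intro: borel_measurable_continuous_onI)
  have [measurable]: "f \<in> borel_measurable borel" using f by auto
  have z': "\<rho>' x = 0" if "norm x > r" for x
  proof (rule GDERIV_eq_zero[of \<rho> x _ "{x. norm x > r}"])
    show "open {x::'a. r < norm x}" by (intro open_Collect_less continuous_intros)
  qed (use \<rho> that supp in \<open>auto simp: C1_grad_def\<close>)
  obtain B where B: "B > 0" "\<And>x. norm (\<rho>' x) \<le> B"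
    using bounded_support_bounded[OF \<rho>c(2), of "cball 0 r"] z' by (auto simp: not_le)
  obtain C where C: "C > 0" "\<And>x. norm (\<rho> x) \<le> C"
    using bounded_support_bounded[OF \<rho>c(1), of "cball 0 r"] supp by (auto simp: not_le)
  show i1: "integrable lborel (\<lambda>y. f y *\<^sub>R (- \<rho>' (y - x)))" for x
    by (rule Bochner_Integration.integrable_bound[OF integrable_mult_right[OF f, of B]])
       (use B in \<open>auto simp: abs_mult mult.commute[of B] intro!: mult_left_mono\<close>)
  have i2: "integrable lborel (\<lambda>y. \<rho> (y - x) * f y)" for x
    by (rule Bochner_Integration.integrable_bound[OF integrable_mult_right[OF f, of C]])
       (use C in \<open>auto simp: abs_mult intro!: mult_right_mono\<close>)
  define N where "N = (\<integral>y. \<bar>f y\<bar> \<partial>lborel)"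
  have N: "N \<ge> 0" unfolding N_def by (rule integral_nonneg_AE) auto
  let ?c = "\<lambda>x. \<integral>y. \<rho> (y - x) * f y \<partial>lborel"
  let ?D = "\<lambda>x. \<integral>y. f y *\<^sub>R (- \<rho>' (y - x)) \<partial>lborel"
  have unif: "\<exists>d>0. \<forall>x y. norm (y - x) < d \<longrightarrow> norm (\<rho>' y - \<rho>' x) \<le> e / (N + 1)" if "e > 0" for e
  proof -
    have "e / (N + 1) > 0" using that N by simp
    from bounded_support_uniform[OF \<rho>c(2) z' this] show ?thesis by (metis less_imp_le)
  qed
  have "(?c has_derivative (\<lambda>h. h \<bullet> ?D x)) (at x)" for x
    unfolding has_derivative_at_alt
  proof (intro conjI allI impI)
    show "bounded_linear (\<lambda>h. h \<bullet> ?D x)" by (rule bounded_linear_inner_left)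
    fix e :: real assume "e > 0"
    then obtain d where d: "d > 0" "\<And>x y. norm (y - x) < d \<Longrightarrow> norm (\<rho>' y - \<rho>' x) \<le> e / (N + 1)"
      using unif by blast
    show "\<exists>d>0. \<forall>y. norm (y - x) < d \<longrightarrow> norm (?c y - ?c x - (y - x) \<bullet> ?D x) \<le> e * norm (y - x)"
    proof (intro exI[of _ d] conjI d(1) allI impI)
      fix y assume y: "norm (y - x) < d"
      have pt: "\<bar>\<rho> (w - y) - \<rho> (w - x) + (y - x) \<bullet> \<rho>' (w - x)\<bar> \<le> norm (y - x) * (e / (N + 1))" for w
      proof -
        obtain t where t: "0 < t" "t < 1"
          "\<rho> (w - y) - \<rho> (w - x) = ((w - y) - (w - x)) \<bullet> \<rho>' ((w - x) + t *\<^sub>R ((w - y) - (w - x)))"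
          using C1_grad_mvt[OF \<rho>] by blast
        have "norm ((w - x) + t *\<^sub>R ((w - y) - (w - x)) - (w - x)) \<le> norm (y - x)"
          using t by (simp add: norm_minus_commute mult_left_le_one_le)
        then have n: "norm (\<rho>' ((w - x) + t *\<^sub>R ((w - y) - (w - x))) - \<rho>' (w - x)) \<le> e / (N + 1)"
          using y by (intro d(2)) simp
        have "\<rho> (w - y) - \<rho> (w - x) + (y - x) \<bullet> \<rho>' (w - x)
          = (x - y) \<bullet> (\<rho>' ((w - x) + t *\<^sub>R ((w - y) - (w - x))) - \<rho>' (w - x))"
          unfolding t(3) by (simp add: algebra_simps)
        also have "\<bar>\<dots>\<bar> \<le> norm (x - y) * norm (\<rho>' ((w - x) + t *\<^sub>R ((w - y) - (w - x))) - \<rho>' (w - x))"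
          by (rule Cauchy_Schwarz_ineq2)
        also have "\<dots> \<le> norm (y - x) * (e / (N + 1))"
          unfolding norm_minus_commute[of x y] by (rule mult_left_mono[OF n]) simp
        finally show ?thesis .
      qed
      have "?c y - ?c x - (y - x) \<bullet> ?D x
         = (\<integral>w. f w * (\<rho> (w - y) - \<rho> (w - x) + (y - x) \<bullet> \<rho>' (w - x)) \<partial>lborel)"
      proof -
        have "(y - x) \<bullet> ?D x = (\<integral>w. (y - x) \<bullet> (f w *\<^sub>R (- \<rho>' (w - x))) \<partial>lborel)"
          by (rule integral_inner_right[symmetric]) (rule i1)
        moreover have "integrable lborel (\<lambda>w. (y - x) \<bullet> (f w *\<^sub>R (- \<rho>' (w - x))))"
          by (rule integrable_inner_right) (rule i1)
        ultimately have "?c y - ?c x - (y - x) \<bullet> ?D x =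
          (\<integral>w. \<rho> (w - y) * f w - \<rho> (w - x) * f w - (y - x) \<bullet> (f w *\<^sub>R (- \<rho>' (w - x))) \<partial>lborel)"
          using i2[of y] i2[of x] by (simp only: Bochner_Integration.integral_diff Bochner_Integration.integrable_diff)
        then show ?thesis by (simp add: algebra_simps)
      qed
      also have "\<bar>\<dots>\<bar> \<le> (\<integral>w. \<bar>f w\<bar> * (norm (y - x) * (e / (N + 1))) \<partial>lborel)"
      proof (rule integral_abs_bound[THEN order_trans], rule integral_mono')
        show "integrable lborel (\<lambda>w. \<bar>f w\<bar> * (norm (y - x) * (e / (N + 1))))" using f by auto
        fix w
        show "\<bar>f w * (\<rho> (w - y) - \<rho> (w - x) + (y - x) \<bullet> \<rho>' (w - x))\<bar> \<le> \<bar>f w\<bar> * (norm (y - x) * (e / (N + 1)))"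
          unfolding abs_mult[of "f w"] by (rule mult_left_mono[OF pt]) simp
        show "0 \<le> \<bar>f w\<bar> * (norm (y - x) * (e / (N + 1)))"
          using \<open>e > 0\<close> N by (intro mult_nonneg_nonneg divide_nonneg_nonneg) auto
      qed
      also have "\<dots> = norm (y - x) * e * (N / (N + 1))" by (simp add: N_def)
      also have "\<dots> \<le> norm (y - x) * e * 1"
        using N \<open>e > 0\<close> by (intro mult_left_mono) auto
      finally show "norm (?c y - ?c x - (y - x) \<bullet> ?D x) \<le> e * norm (y - x)"
        by (simp add: mult.commute)
    qed
  qed
  moreover have "continuous_on UNIV ?D"
    unfolding continuous_on_iff
  proof (intro ballI allI impI)
    fix x e :: real and x0 :: 'a assume "e > 0"
    then obtain d where d: "d > 0" "\<And>x y. norm (y - x) < d \<Longrightarrow> norm (\<rho>' y - \<rho>' x) \<le> (e/2) / (N + 1)"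
      using unif[of "e/2"] by auto
    show "\<exists>d>0. \<forall>x'\<in>UNIV. dist x' x0 < d \<longrightarrow> dist (?D x') (?D x0) < e"
    proof (intro exI[of _ d] conjI d(1) ballI impI)
      fix x' assume x': "dist x' x0 < d"
      have "?D x' - ?D x0 = (\<integral>w. f w *\<^sub>R (\<rho>' (w - x0) - \<rho>' (w - x')) \<partial>lborel)"
        using i1[of x'] i1[of x0]
        by (subst Bochner_Integration.integral_diff[symmetric]) (auto simp: algebra_simps)
      also have "norm \<dots> \<le> (\<integral>w. \<bar>f w\<bar> * ((e/2) / (N + 1)) \<partial>lborel)"
      proof (rule integral_norm_bound[THEN order_trans], rule integral_mono')
        show "integrable lborel (\<lambda>w. \<bar>f w\<bar> * ((e/2) / (N + 1)))" using f by auto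
        fix w
        have "norm (\<rho>' (w - x0) - \<rho>' (w - x')) \<le> (e/2) / (N + 1)"
          using x' by (intro d(2)) (simp add: dist_norm)
        then show "norm (f w *\<^sub>R (\<rho>' (w - x0) - \<rho>' (w - x'))) \<le> \<bar>f w\<bar> * ((e/2) / (N + 1))"
          unfolding norm_scaleR by (rule mult_left_mono) simp
      qed (use \<open>e > 0\<close> N in auto)
      also have "\<dots> = e / 2 * (N / (N + 1))" by (simp add: N_def)
      also have "\<dots> \<le> e / 2 * 1" using N \<open>e > 0\<close> by (intro mult_left_mono) auto
      also have "\<dots> < e" using \<open>e > 0\<close> by simp
      finally show "dist (?D x') (?D x0) < e" by (simp add: dist_norm)
    qed
  qed
  ultimately show "C1_grad ?c ?D" by (simp add: C1_grad_def gderiv_def)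
qed

section \<open>Local approximation of Sobolev functions by C^1 functions\<close>

lemma in_Lp_imp_set_integrable:
  assumes "in_Lp p U f" "p \<ge> 1" "U \<in> lmeasurable"
  shows "set_integrable lebesgue U f"
proof -
  have "set_integrable lebesgue U (\<lambda>x. 1 + norm (f x) powr p)"
    using assms unfolding in_Lp_def
    by (intro set_integral_add) (auto simp: set_integrable_def lmeasurable_iff_integrable)
  then show ?thesis
  proof (rule set_integrable_bound)
    show "set_borel_measurable lebesgue U f" using assms by (simp add: in_Lp_def)
    have "norm (f x) \<le> norm (1 + norm (f x) powr p)" for x
    proof (cases "norm (f x) \<le> 1")
      case True
      then show ?thesis using powr_ge_zero[of "norm (f x)" p] by (simp only: real_norm_def abs_of_nonneg)
    next
      case False
      then show ?thesis using powr_mono[of 1 p "norm (f x)"] assms by (simp add: abs_of_nonneg)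
    qed
    then show "AE x in lebesgue. x \<in> U \<longrightarrow> norm (f x) \<le> norm (1 + norm (f x) powr p)" by simp
  qed
qed

text \<open>Sobolev functions are Lebesgue measurable, whereas the translation and Fubini arguments
  are carried out over \<open>lborel\<close>; a Borel representative connects the two.\<close>

lemma ex_borel_version:
  fixes F :: "'a::euclidean_space \<Rightarrow> real"
  assumes "integrable lebesgue F"
  obtains F0 where "integrable lborel F0" "AE x in lebesgue. F x = F0 x"
proof -
  have "F \<in> borel_measurable (completion lborel)" using assms by auto
  then obtain F0 where F0: "F0 \<in> borel_measurable lborel" "AE x in lborel. F x = F0 x"
    using completion_ex_borel_measurable_real by blast
  have ae: "AE x in lebesgue. F x = F0 x" using F0(2) by (rule AE_completion)
  have "integrable lebesgue F0"
    using assms ae F0 by (subst integrable_cong_AE[of F0 _ F]) (auto intro: measurable_completion elim: AE_mp)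
  then show ?thesis using that ae F0(1) integrable_completion by blast
qed

definition C1c :: "'a::euclidean_space set \<Rightarrow> ('a \<Rightarrow> real) \<Rightarrow> ('a \<Rightarrow> 'a) \<Rightarrow> bool" where
  "C1c U f f' \<longleftrightarrow> C1_grad f f' \<and> compact (closure {x. f x \<noteq> 0}) \<and> closure {x. f x \<noteq> 0} \<subseteq> U"

lemma test_function_imp_C1c:
  assumes "test_function U \<phi>"
  shows "C1c U \<phi> (\<lambda>x. \<Sum>b\<in>Basis. frechet_derivative \<phi> (at x) b *\<^sub>R b)"
  using assms C_k_imp_C1_grad unfolding test_function_def C1c_def by blast

lemma C1c_outside:
  assumes "C1c U f f'" "x \<notin> closure {x. f x \<noteq> 0}"
  shows "f x = 0" "f' x = 0"
proof -
  show "f x = 0" using assms(2) closure_subset[of "{x. f x \<noteq> 0}"] by auto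
  show "f' x = 0"
    by (rule GDERIV_eq_zero[of f x _ "- closure {x. f x \<noteq> 0}"])
       (use assms closure_subset[of "{x. f x \<noteq> 0}"] in \<open>auto simp: C1c_def C1_grad_def\<close>)
qed

text \<open>Difference quotients in direction \<open>b\<close> have integral 0 by translation
  invariance, and the integral of the derivative is their limit. By the mean value theorem they are
  bounded by B |b|, and for steps at most 1 they live in the ball of radius \<open>R\<close>, which
  gives dominated convergence. This is the divergence theorem behind the later integrations by
  parts.\<close>

lemma integral_C1c_grad:
  assumes "C1c UNIV f f'"
  shows "(\<integral>x. f' x \<bullet> b \<partial>lborel) = 0"
proof -
  let ?K = "closure {x. f x \<noteq> 0}"
  have c: "continuous_on UNIV f" "continuous_on UNIV f'"
    using assms C1_grad_imp_continuous by (auto simp: C1c_def C1_grad_def)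
  have "bounded ?K" using assms by (simp add: C1c_def compact_imp_bounded)
  then obtain r where r: "\<And>x. x \<in> ?K \<Longrightarrow> norm x \<le> r" by (auto simp: bounded_iff)
  have z: "f x = 0" "f' x = 0" if "norm x > r" for x
    using C1c_outside[OF assms, of x] r[of x] that by fastforce+
  obtain B where B: "B > 0" "\<And>x. norm (f' x) \<le> B"
    using bounded_support_bounded[OF c(2), of "cball 0 r"] z by (auto simp: not_le)
  have [measurable]: "f \<in> borel_measurable borel" "f' \<in> borel_measurable borel"
    using c by (auto intro: borel_measurable_continuous_onI)
  have fi: "integrable lborel f"
    by (rule integrable_continuous_bounded_support[OF c(1), of "r+1"]) (simp add: z)
  define h where "h n = 1 / (real n + 1)" for n
  have h: "h n > 0" "h n \<le> 1" for n by (auto simp: h_def)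
  have hl: "h \<longlonglongrightarrow> 0" unfolding h_def by real_asymp
  define R where "R = r + norm b + 1"
  have lim: "(\<lambda>n. \<integral>x. (f (x + h n *\<^sub>R b) - f x) / h n \<partial>lborel) \<longlonglongrightarrow> (\<integral>x. f' x \<bullet> b \<partial>lborel)"
  proof (rule integral_dominated_convergence[where w = "\<lambda>x. indicator (cball 0 R) x * (B * norm b)"])
    show "integrable lborel (\<lambda>x. indicator (cball 0 R) x * (B * norm b))"
      by (intro integrable_mult_left integrable_real_indicator emeasure_lborel_cball_finite) simp
    show "AE x in lborel. (\<lambda>n. (f (x + h n *\<^sub>R b) - f x) / h n) \<longlonglongrightarrow> f' x \<bullet> b"
    proof (rule AE_I2)
      fix x
      have "GDERIV f (x + 0 *\<^sub>R b) :> f' x" using assms by (simp add: C1c_def C1_grad_def)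
      from GDERIV_line[OF this]
      have "((\<lambda>t. (f (x + t *\<^sub>R b) - f x) / t) \<longlongrightarrow> b \<bullet> f' x) (at 0)"
        by (simp add: DERIV_def)
      moreover have "filterlim h (at 0) sequentially"
        using hl h(1) by (auto simp: filterlim_at intro!: always_eventually) (metis less_irrefl)
      ultimately show "(\<lambda>n. (f (x + h n *\<^sub>R b) - f x) / h n) \<longlonglongrightarrow> f' x \<bullet> b"
        unfolding inner_commute[of b] by (rule filterlim_compose)
    qed
    show "AE x in lborel. norm ((f (x + h n *\<^sub>R b) - f x) / h n) \<le> indicator (cball 0 R) x * (B * norm b)" for n
    proof (rule AE_I2)
      fix x
      have nb: "norm (h n *\<^sub>R b) \<le> norm b" using h[of n] by (simp add: mult_left_le_one_le)
      show "norm ((f (x + h n *\<^sub>R b) - f x) / h n) \<le> indicator (cball 0 R) x * (B * norm b)"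
      proof (cases "norm x \<le> R")
        case True
        obtain t where "f (x + h n *\<^sub>R b) - f x = (x + h n *\<^sub>R b - x) \<bullet> f' (x + t *\<^sub>R (x + h n *\<^sub>R b - x))"
          using C1_grad_mvt assms unfolding C1c_def by blast
        then have "\<bar>f (x + h n *\<^sub>R b) - f x\<bar> \<le> norm (h n *\<^sub>R b) * B"
          by (simp only: ) (rule order_trans[OF Cauchy_Schwarz_ineq2], use B in \<open>auto intro!: mult_left_mono\<close>)
        then show ?thesis using True h[of n] by (simp add: field_simps)
      next
        case False
        have "norm x \<le> norm (x + h n *\<^sub>R b) + norm (h n *\<^sub>R b)"
          using norm_triangle_ineq4[of "x + h n *\<^sub>R b" "h n *\<^sub>R b"] by simp
        then have "norm (x + h n *\<^sub>R b) > r" "norm x > r" using False nb norm_ge_zero[of b] unfolding R_def by linarith+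
        then show ?thesis using z(1) False by simp
      qed
    qed
  qed auto
  have "(\<integral>x. (f (x + h n *\<^sub>R b) - f x) / h n \<partial>lborel) = 0" for n
    using integrable_translate[OF fi, of "h n *\<^sub>R b"] fi integral_translate[of f "h n *\<^sub>R b"] by simp
  with lim have "(\<lambda>n. 0) \<longlonglongrightarrow> (\<integral>x. f' x \<bullet> b \<partial>lborel)" by (simp only:)
  then show ?thesis using LIMSEQ_unique[OF tendsto_const] by metis
qed

lemma C1_grad_shift:
  assumes "C1_grad f f'" shows "C1_grad (\<lambda>y. f (y - x)) (\<lambda>y. f' (y - x))"
proof -
  have "((\<lambda>y. f (y - x)) has_derivative (\<lambda>h. h \<bullet> f' (y - x))) (at y)" for y
  proof -
    have "((\<lambda>y. y - x) has_derivative (\<lambda>h. h)) (at y)" by (auto intro!: derivative_eq_intros)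
    moreover have "(f has_derivative (\<lambda>h. h \<bullet> f' (y - x))) (at (y - x))"
      using assms by (simp add: C1_grad_def gderiv_def)
    ultimately show ?thesis by (rule has_derivative_compose)
  qed
  moreover have "continuous_on UNIV (\<lambda>y. f' (y - x))"
    by (rule continuous_on_compose2[of UNIV f']) (use assms in \<open>auto simp: C1_grad_def intro!: continuous_intros\<close>)
  ultimately show ?thesis by (simp add: C1_grad_def gderiv_def)
qed

text \<open>Lebesgue measure is complete, so \<open>f\<close> and \<open>g\<close> are measurable
  together; if neither is, both integrals have the default value 0.\<close>

lemma integral_lebesgue_cong_AE:
  fixes f g :: "'a::euclidean_space \<Rightarrow> 'b::euclidean_space"
  assumes "AE x in lebesgue. f x = g x"
  shows "integral\<^sup>L lebesgue f = integral\<^sup>L lebesgue g"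
proof (cases "f \<in> borel_measurable lebesgue")
  case True
  then show ?thesis using borel_measurable_AE[OF True assms] assms by (intro integral_cong_AE)
next
  case False
  have "AE x in lebesgue. g x = f x" using assms by eventually_elim simp
  then have "g \<notin> borel_measurable lebesgue" using False borel_measurable_AE by blast
  then show ?thesis
    using False not_integrable_integral_eq borel_measurable_integrable by metis
qed

text \<open>Mollify at radii \<open>d n\<close> so small that balls of that radius around points of
  \<open>K\<close> stay in \<open>U\<close>. For x in \<open>K\<close> the kernel centred at x is
  then a test function on \<open>U\<close>, and the weak derivative identity says that the gradient
  of the mollified function is the mollification of \<open>g\<close>; both converge by
  \<open>smoothing_L1_bound\<close>. Convergence in L^1 on \<open>K\<close> fits the use below,
  where the other factors are bounded and supported in \<open>K\<close>.\<close>

lemma W1p_smooth_approx: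
  fixes u :: "'a::euclidean_space \<Rightarrow> real"
  assumes U: "open U" "bounded U" and p: "p \<ge> 1" and W: "W1p p U u g" and K: "compact K" "K \<subseteq> U"
  obtains F F' where "\<And>n. C1_grad (F n) (F' n)"
    "(\<lambda>n. \<integral>x. indicator K x * \<bar>F n x - u x\<bar> \<partial>lebesgue) \<longlonglongrightarrow> 0"
    "(\<lambda>n. \<integral>x. indicator K x * norm (F' n x - g x) \<partial>lebesgue) \<longlonglongrightarrow> 0"
proof -
  have Um: "U \<in> lmeasurable" using U by (simp add: lmeasurable_open)
  have [measurable]: "K \<in> sets borel" "U \<in> sets borel" using K U by (auto intro: borel_compact)
  have "integrable lebesgue (\<lambda>x. indicator U x *\<^sub>R u x)"
    using W in_Lp_imp_set_integrable[of p U u] p Um by (simp add: W1p_def set_integrable_def)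
  then obtain f0 where f0: "integrable lborel f0" "AE x in lebesgue. indicator U x *\<^sub>R u x = f0 x"
    by (rule ex_borel_version)
  have gi: "integrable lebesgue (\<lambda>x. indicator U x *\<^sub>R g x)"
    using W in_Lp_imp_set_integrable[of p U g] p Um by (simp add: W1p_def set_integrable_def)
  have "\<exists>g0. integrable lborel g0 \<and> (AE x in lebesgue. indicator U x * (g x \<bullet> b) = g0 x)" for b
  proof -
    have "integrable lebesgue (\<lambda>x. (indicator U x *\<^sub>R g x) \<bullet> b)"
      by (rule integrable_inner_left) (rule gi)
    then show ?thesis by (rule ex_borel_version) auto
  qed
  then obtain g0 where g0: "\<And>b. integrable lborel (g0 b)"
      "\<And>b. AE x in lebesgue. indicator U x * (g x \<bullet> b) = g0 b x" by metis
  obtain e where e: "e > 0" "(\<Union>x\<in>K. cball x e) \<subseteq> U"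
    using compact_subset_open_imp_cball_epsilon_subset[OF K(1) U(1) K(2)] by blast
  \<comment> \<open>One radius has to serve \<open>f0\<close> and the finitely many components of
    the gradient, and to stay below \<open>e\<close>.\<close>
  have "\<exists>d>0. d < e \<and> (\<forall>z. norm z < d \<longrightarrow> (\<integral>x. \<bar>f0 (x + z) - f0 x\<bar> \<partial>lborel) \<le> 1 / real (Suc n)
      \<and> (\<forall>b\<in>Basis. (\<integral>x. \<bar>g0 b (x + z) - g0 b x\<bar> \<partial>lborel) \<le> 1 / real (Suc n)))" for n
  proof -
    have pos: "1 / real (Suc n) > 0" by simp
    have "\<forall>\<^sub>F z in at 0. (\<integral>x. \<bar>f0 (x + z) - f0 x\<bar> \<partial>lborel) < 1 / real (Suc n)
      \<and> (\<forall>b\<in>Basis. (\<integral>x. \<bar>g0 b (x + z) - g0 b x\<bar> \<partial>lborel) < 1 / real (Suc n))"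
      by (intro eventually_conj eventually_ball_finite ballI order_tendstoD(2)[OF translation_L1_tendsto] pos f0 g0) auto
    then obtain d where d: "d > 0" "\<And>z. z \<noteq> 0 \<Longrightarrow> norm z < d \<Longrightarrow> (\<integral>x. \<bar>f0 (x + z) - f0 x\<bar> \<partial>lborel) < 1 / real (Suc n)
      \<and> (\<forall>b\<in>Basis. (\<integral>x. \<bar>g0 b (x + z) - g0 b x\<bar> \<partial>lborel) < 1 / real (Suc n))"
      unfolding eventually_at by auto
    have "(\<integral>x. \<bar>f0 (x + z) - f0 x\<bar> \<partial>lborel) \<le> 1 / real (Suc n)
      \<and> (\<forall>b\<in>Basis. (\<integral>x. \<bar>g0 b (x + z) - g0 b x\<bar> \<partial>lborel) \<le> 1 / real (Suc n))" if "norm z < d" for z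
    proof (cases "z = 0")
      case False
      then show ?thesis using d(2)[of z] that by (auto intro: less_imp_le)
    qed simp
    then show ?thesis using d(1) e(1) by (intro exI[of _ "min d (e/2)"]) auto
  qed
  then have "\<exists>d. \<forall>n. d n > 0 \<and> d n < e \<and> (\<forall>z. norm z < d n \<longrightarrow> (\<integral>x. \<bar>f0 (x + z) - f0 x\<bar> \<partial>lborel) \<le> 1 / real (Suc n)
      \<and> (\<forall>b\<in>Basis. (\<integral>x. \<bar>g0 b (x + z) - g0 b x\<bar> \<partial>lborel) \<le> 1 / real (Suc n)))"
    by (intro choice allI)
  then obtain d where d: "\<And>n. d n > 0" "\<And>n. d n < e"
    "\<And>n z. norm z < d n \<Longrightarrow> (\<integral>x. \<bar>f0 (x + z) - f0 x\<bar> \<partial>lborel) \<le> 1 / real (Suc n)"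
    "\<And>n z b. norm z < d n \<Longrightarrow> b \<in> Basis \<Longrightarrow> (\<integral>x. \<bar>g0 b (x + z) - g0 b x\<bar> \<partial>lborel) \<le> 1 / real (Suc n)"
    by auto
  have "\<exists>\<rho> :: 'a \<Rightarrow> real. (\<forall>k. C_k k \<rho>) \<and> (\<forall>x. \<rho> x \<ge> 0) \<and> (\<forall>x. norm x \<ge> d n \<longrightarrow> \<rho> x = 0) \<and> integral\<^sup>L lborel \<rho> = 1" for n
    by (rule ex_smooth_kernel[OF d(1)[of n]]) blast
  then have "\<exists>\<rho>. \<forall>n. (\<forall>k. C_k k (\<rho> n)) \<and> (\<forall>x::'a. \<rho> n x \<ge> 0) \<and> (\<forall>x. norm x \<ge> d n \<longrightarrow> \<rho> n x = 0) \<and> integral\<^sup>L lborel (\<rho> n) = 1"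
    by (intro choice allI)
  then obtain \<rho> where \<rho>0: "\<forall>n. (\<forall>k. C_k k (\<rho> n)) \<and> (\<forall>x::'a. \<rho> n x \<ge> 0) \<and> (\<forall>x. norm x \<ge> d n \<longrightarrow> \<rho> n x = 0) \<and> integral\<^sup>L lborel (\<rho> n) = 1"
    by blast
  have \<rho>: "C_k k (\<rho> n)" "\<rho> n x \<ge> 0" "norm x \<ge> d n \<Longrightarrow> \<rho> n x = 0" "integral\<^sup>L lborel (\<rho> n) = 1" for n k x
    using \<rho>0 by blast+
  define \<rho>' where "\<rho>' n = (\<lambda>x. \<Sum>b\<in>Basis. frechet_derivative (\<rho> n) (at x) b *\<^sub>R b)" for n
  have \<rho>C: "C1_grad (\<rho> n) (\<rho>' n)" for n
    unfolding \<rho>'_def by (rule C_k_imp_C1_grad[OF \<rho>(1)])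
  have \<rho>c: "continuous_on UNIV (\<rho> n)" for n using C1_grad_imp_continuous[OF \<rho>C] .
  have [measurable]: "\<rho> n \<in> borel_measurable borel" "\<rho>' n \<in> borel_measurable borel" for n
    using \<rho>c \<rho>C by (auto intro!: borel_measurable_continuous_onI simp: C1_grad_def)
  define F where "F n x = (\<integral>y. \<rho> n (y - x) * f0 y \<partial>lborel)" for n x
  define F' where "F' n x = (\<integral>y. f0 y *\<^sub>R (- \<rho>' n (y - x)) \<partial>lborel)" for n x
  define G where "G b n x = (\<integral>y. \<rho> n (y - x) * g0 b y \<partial>lborel)" for b n x
  have FC: "C1_grad (F n) (F' n)" for n
    unfolding F_def F'_def by (rule smoothing_C1_grad(1)[OF f0(1) \<rho>C \<rho>(3)])
  have f0m[measurable]: "f0 \<in> borel_measurable borel" "g0 b \<in> borel_measurable borel" for b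
    using f0(1) g0(1)[of b] by auto
  have Fi: "integrable lborel (F n)" "(\<integral>x. \<bar>F n x - f0 x\<bar> \<partial>lborel) \<le> 1 / real (Suc n)" for n
    unfolding F_def by (rule smoothing_L1_bound[OF f0(1) _ d(3) \<rho>c \<rho>(2,3,4)]; simp)+
  have Gi: "integrable lborel (G b n)" "(\<integral>x. \<bar>G b n x - g0 b x\<bar> \<partial>lborel) \<le> 1 / real (Suc n)" if "b \<in> Basis" for b n
    unfolding G_def by (rule smoothing_L1_bound[OF g0(1) _ d(4)[OF _ that] \<rho>c \<rho>(2,3,4)]; simp)+
  have FG: "F' n x \<bullet> b = G b n x" if "x \<in> K" "b \<in> Basis" for n x b
  proof -
    let ?\<phi> = "\<lambda>y. \<rho> n (y - x)"
    have sub: "{y. ?\<phi> y \<noteq> 0} \<subseteq> cball x (d n)"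
      using \<rho>(3)[of n] by (force simp: dist_norm norm_minus_commute not_le)
    then have cl: "closure {y. ?\<phi> y \<noteq> 0} \<subseteq> cball x (d n)" by (rule closure_minimal) simp
    have "test_function U ?\<phi>"
      unfolding test_function_def
    proof (intro conjI allI)
      show "C_k k ?\<phi>" for k using C_k_affine[OF \<rho>(1)[of k n], of 1 "- x" 1] by simp
      show "compact (closure {y. ?\<phi> y \<noteq> 0})"
        using cl by (meson bounded_cball bounded_subset closed_closure compact_eq_bounded_closed)
      show "closure {y. ?\<phi> y \<noteq> 0} \<subseteq> U"
        using cl e(2) that d(2)[of n] by (force dest: subsetD)
    qed
    then have w: "(LINT y:U|lebesgue. u y * frechet_derivative ?\<phi> (at y) b) =
        - (LINT y:U|lebesgue. (g y \<bullet> b) * ?\<phi> y)"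
      using W that unfolding W1p_def by blast
    have "F' n x \<bullet> b = (\<integral>y. (f0 y *\<^sub>R (- \<rho>' n (y - x))) \<bullet> b \<partial>lborel)"
      unfolding F'_def using smoothing_C1_grad(2)[OF f0(1) \<rho>C \<rho>(3)] by (subst integral_inner_left) auto
    also have "\<dots> = (\<integral>y. - (f0 y * (b \<bullet> \<rho>' n (y - x))) \<partial>lborel)"
      by (simp add: inner_commute)
    also have "\<dots> = - (\<integral>y. f0 y * (b \<bullet> \<rho>' n (y - x)) \<partial>lborel)" by simp
    also have "(\<integral>y. f0 y * (b \<bullet> \<rho>' n (y - x)) \<partial>lborel) = (\<integral>y. f0 y * (b \<bullet> \<rho>' n (y - x)) \<partial>lebesgue)"
      by (rule integral_completion[symmetric]) simp
    also have "\<dots> = (LINT y:U|lebesgue. u y * frechet_derivative ?\<phi> (at y) b)"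
      unfolding set_lebesgue_integral_def C1_grad_frechet[OF C1_grad_shift[OF \<rho>C]]
      using f0(2) by (intro integral_lebesgue_cong_AE) (auto elim!: AE_mp)
    also have "\<dots> = - (LINT y:U|lebesgue. (g y \<bullet> b) * ?\<phi> y)" by (rule w)
    also have "(LINT y:U|lebesgue. (g y \<bullet> b) * ?\<phi> y) = (\<integral>y. ?\<phi> y * g0 b y \<partial>lebesgue)"
      unfolding set_lebesgue_integral_def
      using g0(2)[of b] by (intro integral_lebesgue_cong_AE) (auto elim!: AE_mp)
    also have "\<dots> = G b n x" unfolding G_def by (rule integral_completion) simp
    finally show ?thesis by simp
  qed
  have inv: "(\<lambda>n. c / real (Suc n)) \<longlonglongrightarrow> 0" for c :: real by real_asymp
  have ae1: "AE x in lebesgue. x \<in> K \<longrightarrow> f0 x = u x"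
    using f0(2) by eventually_elim (use K in auto)
  have ae2: "AE x in lebesgue. x \<in> K \<longrightarrow> (\<forall>b\<in>Basis. g0 b x = g x \<bullet> b)"
  proof -
    have "AE x in lebesgue. \<forall>b\<in>Basis. indicator U x * (g x \<bullet> b) = g0 b x"
      by (rule AE_finite_allI) (auto intro: g0)
    then show ?thesis by eventually_elim (use K in force)
  qed
  show thesis
  proof (rule that[OF FC])
    show "(\<lambda>n. \<integral>x. indicator K x * \<bar>F n x - u x\<bar> \<partial>lebesgue) \<longlonglongrightarrow> 0"
    proof (rule tendsto_sandwich[OF _ _ tendsto_const inv[of 1]])
      show "\<forall>\<^sub>F n in sequentially. (\<integral>x. indicator K x * \<bar>F n x - u x\<bar> \<partial>lebesgue) \<le> 1 / real (Suc n)"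
      proof (rule always_eventually, rule allI)
        fix n
        have "(\<integral>x. indicator K x * \<bar>F n x - u x\<bar> \<partial>lebesgue) = (\<integral>x. indicator K x * \<bar>F n x - f0 x\<bar> \<partial>lebesgue)"
          using ae1 by (intro integral_lebesgue_cong_AE) (auto elim!: AE_mp simp: indicator_def)
        also have "\<dots> = (\<integral>x. indicator K x * \<bar>F n x - f0 x\<bar> \<partial>lborel)"
          using Fi(1)[of n] by (intro integral_completion) simp
        also have "\<dots> \<le> (\<integral>x. \<bar>F n x - f0 x\<bar> \<partial>lborel)"
          using Fi(1)[of n] f0(1) by (intro integral_mono') (auto simp: indicator_def)
        finally show "(\<integral>x. indicator K x * \<bar>F n x - u x\<bar> \<partial>lebesgue) \<le> 1 / real (Suc n)"
          using Fi(2)[of n] by simp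
      qed
    qed (auto intro!: always_eventually integral_nonneg_AE)
    show "(\<lambda>n. \<integral>x. indicator K x * norm (F' n x - g x) \<partial>lebesgue) \<longlonglongrightarrow> 0"
    proof (rule tendsto_sandwich[OF _ _ tendsto_const inv[of "real DIM('a)"]])
      show "\<forall>\<^sub>F n in sequentially. (\<integral>x. indicator K x * norm (F' n x - g x) \<partial>lebesgue) \<le> real DIM('a) / real (Suc n)"
      proof (rule always_eventually, rule allI)
        fix n
        have int: "integrable lborel (\<lambda>x. \<bar>G b n x - g0 b x\<bar>)" if "b \<in> Basis" for b
          using Gi(1)[OF that, of n] g0(1)[of b] by auto
        have int': "integrable lebesgue (\<lambda>x. \<Sum>b\<in>Basis. \<bar>G b n x - g0 b x\<bar>)"
          using int by (intro Bochner_Integration.integrable_sum) (auto simp: integrable_completion)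
        have "(\<integral>x. indicator K x * norm (F' n x - g x) \<partial>lebesgue) \<le> (\<integral>x. (\<Sum>b\<in>Basis. \<bar>G b n x - g0 b x\<bar>) \<partial>lebesgue)"
        proof (rule integral_mono_AE'[OF int'])
          show "AE x in lebesgue. indicator K x * norm (F' n x - g x) \<le> (\<Sum>b\<in>Basis. \<bar>G b n x - g0 b x\<bar>)"
            using ae2
          proof eventually_elim
            case (elim x)
            show ?case
            proof (cases "x \<in> K")
              case True
              have "norm (F' n x - g x) \<le> (\<Sum>b\<in>Basis. \<bar>(F' n x - g x) \<bullet> b\<bar>)" by (rule norm_le_l1)
              also have "\<dots> = (\<Sum>b\<in>Basis. \<bar>G b n x - g0 b x\<bar>)"
                using elim True FG by (intro sum.cong) (auto simp: inner_diff_left)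
              finally show ?thesis using True by simp
            qed (auto intro: sum_nonneg)
          qed
        qed (auto intro: sum_nonneg)
        also have "\<dots> = (\<integral>x. (\<Sum>b\<in>Basis. \<bar>G b n x - g0 b x\<bar>) \<partial>lborel)"
          using int by (intro integral_completion) (auto intro!: borel_measurable_sum)
        also have "\<dots> = (\<Sum>b\<in>Basis. \<integral>x. \<bar>G b n x - g0 b x\<bar> \<partial>lborel)"
          using int by (rule Bochner_Integration.integral_sum)
        also have "\<dots> \<le> (\<Sum>b\<in>(Basis :: 'a set). 1 / real (Suc n))"
          using Gi(2) by (intro sum_mono) auto
        finally show "(\<integral>x. indicator K x * norm (F' n x - g x) \<partial>lebesgue) \<le> real DIM('a) / real (Suc n)" by simp
      qed
    qed (auto intro!: always_eventually integral_nonneg_AE)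
  qed
qed

section \<open>Calculus of Sobolev functions\<close>

lemma norm_add_powr_le:
  fixes a b :: "'a::real_normed_vector"
  assumes "p \<ge> 0"
  shows "norm (a + b) powr p \<le> 2 powr p * (norm a powr p + norm b powr p)"
proof -
  have "norm (a + b) \<le> 2 * max (norm a) (norm b)" using norm_triangle_ineq[of a b] by linarith
  then have "norm (a + b) powr p \<le> (2 * max (norm a) (norm b)) powr p"
    using assms by (intro powr_mono2) auto
  also have "\<dots> = 2 powr p * (max (norm a) (norm b)) powr p" by (simp add: powr_mult)
  also have "(max (norm a) (norm b)) powr p \<le> norm a powr p + norm b powr p"
    by (auto simp: max_def)
  finally show ?thesis by simp
qed

lemma integrable_powr_add:
  fixes f g :: "'a \<Rightarrow> 'b::euclidean_space"
  assumes "p \<ge> 0" "f \<in> borel_measurable M" "g \<in> borel_measurable M"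
    "integrable M (\<lambda>x. norm (f x) powr p)" "integrable M (\<lambda>x. norm (g x) powr p)"
  shows "integrable M (\<lambda>x. norm (f x + g x) powr p)"
proof (rule Bochner_Integration.integrable_bound)
  show "integrable M (\<lambda>x. 2 powr p * (norm (f x) powr p + norm (g x) powr p))"
    using assms by auto
  show "AE x in M. norm (norm (f x + g x) powr p) \<le> norm (2 powr p * (norm (f x) powr p + norm (g x) powr p))"
    using norm_add_powr_le[OF assms(1)] by (intro AE_I2) (simp add: abs_of_nonneg)
qed (use assms in measurable)

lemma integrable_powr_bounded_mult:
  fixes f :: "'a \<Rightarrow> 'b::euclidean_space" and g :: "'a \<Rightarrow> 'c::euclidean_space"
  assumes "p \<ge> 0" "integrable M (\<lambda>x. norm (f x) powr p)" "g \<in> borel_measurable M"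
    "B \<ge> 0" "\<And>x. norm (g x) \<le> B * norm (f x)"
  shows "integrable M (\<lambda>x. norm (g x) powr p)"
proof (rule Bochner_Integration.integrable_bound)
  show "integrable M (\<lambda>x. B powr p * norm (f x) powr p)" using assms by auto
  show "AE x in M. norm (norm (g x) powr p) \<le> norm (B powr p * norm (f x) powr p)"
    using assms powr_mono2[OF assms(1) norm_ge_zero assms(5)]
    by (intro AE_I2) (simp add: abs_of_nonneg powr_mult)
qed (use assms in measurable)

text \<open>The space W^{1,p} in normalised form: function and gradient vanish outside
  \<open>U\<close>, so that integrals run over the whole space, and test functions are C^1, so that
  products with C^1 cut-offs stay admissible. \<open>W1p_imp_Sob\<close> and
  \<open>Sob_imp_W1p\<close> relate it to \<open>W1p\<close>.\<close>

definition Sob :: "real \<Rightarrow> 'a::euclidean_space set \<Rightarrow> ('a \<Rightarrow> real) \<Rightarrow> ('a \<Rightarrow> 'a) \<Rightarrow> bool" where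
  "Sob p U u g \<longleftrightarrow> u \<in> borel_measurable lebesgue \<and> g \<in> borel_measurable lebesgue \<and>
     (\<forall>x. x \<notin> U \<longrightarrow> u x = 0 \<and> g x = 0) \<and>
     integrable lebesgue (\<lambda>x. norm (u x) powr p) \<and> integrable lebesgue (\<lambda>x. norm (g x) powr p) \<and>
     (\<forall>\<phi> \<phi>' b. C1c U \<phi> \<phi>' \<longrightarrow> b \<in> Basis \<longrightarrow>
        (\<integral>x. u x * (\<phi>' x \<bullet> b) \<partial>lebesgue) = - (\<integral>x. (g x \<bullet> b) * \<phi> x \<partial>lebesgue))"

lemma integrable_of_powr:
  fixes f :: "'a::euclidean_space \<Rightarrow> 'b::euclidean_space"
  assumes "open U" "bounded U" "p \<ge> 1" "f \<in> borel_measurable lebesgue"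
    "\<And>x. x \<notin> U \<Longrightarrow> f x = 0" "integrable lebesgue (\<lambda>x. norm (f x) powr p)"
  shows "integrable lebesgue f"
proof -
  have e: "(\<lambda>x. indicator U x *\<^sub>R f x) = f"
    by (rule ext, case_tac "x \<in> U") (simp_all add: assms(5))
  have e': "(\<lambda>x. indicator U x *\<^sub>R (norm (f x) powr p)) = (\<lambda>x. norm (f x) powr p)"
    by (rule ext, case_tac "x \<in> U") (simp_all add: assms(5))
  have "in_Lp p U f"
    unfolding in_Lp_def set_borel_measurable_def set_integrable_def e e' by (intro conjI assms)
  moreover have "U \<in> lmeasurable" by (intro lmeasurable_open assms)
  ultimately have "set_integrable lebesgue U f" by (intro in_Lp_imp_set_integrable[OF _ assms(3)])
  then show ?thesis by (simp only: set_integrable_def e)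
qed

lemma Sob_integrable:
  assumes "Sob p U u g" "open U" "bounded U" "p \<ge> 1"
  shows "integrable lebesgue u" "integrable lebesgue g"
proof -
  show "integrable lebesgue u" by (rule integrable_of_powr[OF assms(2-4)]) (use assms(1) in \<open>auto simp: Sob_def\<close>)
  show "integrable lebesgue g" by (rule integrable_of_powr[OF assms(2-4)]) (use assms(1) in \<open>auto simp: Sob_def\<close>)
qed

lemma C1c_props:
  assumes "C1c U \<phi> \<phi>'"
  shows "continuous_on UNIV \<phi>" "continuous_on UNIV \<phi>'" "compact (closure {x. \<phi> x \<noteq> 0})"
    "closure {x. \<phi> x \<noteq> 0} \<subseteq> U" "\<phi> \<in> borel_measurable lebesgue" "\<phi>' \<in> borel_measurable lebesgue"
proof -
  show c: "continuous_on UNIV \<phi>" "continuous_on UNIV \<phi>'"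
    using assms C1_grad_imp_continuous by (auto simp: C1c_def C1_grad_def)
  then show "\<phi> \<in> borel_measurable lebesgue" "\<phi>' \<in> borel_measurable lebesgue"
    by (auto intro!: measurable_completion borel_measurable_continuous_onI)
qed (use assms in \<open>auto simp: C1c_def\<close>)

lemma C1c_bounded:
  assumes "C1c U \<phi> \<phi>'"
  obtains B where "B > 0" "\<And>x. norm (\<phi> x) \<le> B" "\<And>x. norm (\<phi>' x) \<le> B"
proof -
  note P = C1c_props[OF assms] and O = C1c_outside[OF assms]
  obtain B1 where "B1 > 0" "\<And>x. norm (\<phi> x) \<le> B1"
    using bounded_support_bounded[OF P(1,3) O(1)] by blast
  moreover obtain B2 where "B2 > 0" "\<And>x. norm (\<phi>' x) \<le> B2"
    using bounded_support_bounded[OF P(2,3) O(2)] by blast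
  ultimately show ?thesis using that[of "max B1 B2"] by (auto simp: le_max_iff_disj)
qed

lemma integrable_mult_bounded:
  fixes f :: "'a \<Rightarrow> real" and h :: "'a \<Rightarrow> 'b::euclidean_space"
  assumes "integrable M h" "f \<in> borel_measurable M" "\<And>x. \<bar>f x\<bar> \<le> B"
  shows "integrable M (\<lambda>x. f x *\<^sub>R h x)"
proof (rule Bochner_Integration.integrable_bound)
  show "integrable M (\<lambda>x. B * norm (h x))" using assms(1) by auto
  show "AE x in M. norm (f x *\<^sub>R h x) \<le> norm (B * norm (h x))"
    using order_trans[OF assms(3) abs_ge_self] by (intro AE_I2) (auto simp: abs_mult intro!: mult_right_mono)
qed (use assms in measurable)

lemma integrable_mult_bounded_real:
  fixes f h :: "'a \<Rightarrow> real"
  assumes "integrable M h" "f \<in> borel_measurable M" "\<And>x. \<bar>f x\<bar> \<le> B"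
  shows "integrable M (\<lambda>x. f x * h x)" "integrable M (\<lambda>x. h x * f x)"
  using integrable_mult_bounded[OF assms] by (auto simp: mult.commute)

lemma C1_grad_compose:
  assumes "C1_grad u u'" "\<And>s. (G has_real_derivative G' s) (at s)" "continuous_on UNIV G'"
  shows "C1_grad (\<lambda>x. G (u x)) (\<lambda>x. G' (u x) *\<^sub>R u' x)"
proof -
  have "continuous_on UNIV (\<lambda>x. G' (u x))"
    by (rule continuous_on_compose2[OF assms(3) C1_grad_imp_continuous[OF assms(1)]]) auto
  then show ?thesis using assms(1) unfolding C1_grad_def
    by (auto intro!: GDERIV_DERIV_compose[OF _ assms(2)] continuous_intros)
qed

lemma C1_grad_mult:
  assumes "C1_grad u u'" "C1_grad v v'"
  shows "C1_grad (\<lambda>x. u x * v x) (\<lambda>x. u x *\<^sub>R v' x + v x *\<^sub>R u' x)"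
  using assms C1_grad_imp_continuous[OF assms(1)] C1_grad_imp_continuous[OF assms(2)] unfolding C1_grad_def
  by (auto intro!: GDERIV_mult continuous_intros)

lemma C1_grad_mult_C1c:
  assumes "C1_grad u u'" "C1c U v v'"
  shows "C1c U (\<lambda>x. u x * v x) (\<lambda>x. u x *\<^sub>R v' x + v x *\<^sub>R u' x)"
proof -
  have "closure {x. u x * v x \<noteq> 0} \<subseteq> closure {x. v x \<noteq> 0}" by (rule closure_mono) auto
  moreover have "compact (closure {x. u x * v x \<noteq> 0})"
    using calculation assms(2) unfolding C1c_def
    by (meson bounded_subset closed_closure compact_eq_bounded_closed)
  ultimately show ?thesis using assms C1_grad_mult unfolding C1c_def by blast
qed

lemma C1_DERIV_bound:
  assumes "\<And>s. (G has_real_derivative G' s) (at s)" "\<And>s. \<bar>G' s\<bar> \<le> B"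
  shows "\<bar>G a - G b\<bar> \<le> B * \<bar>a - b\<bar>"
  using field_differentiable_bound[of UNIV G G' B a b] assms by auto

text \<open>For the approximants \<open>F n\<close> the identity is \<open>integral_C1c_grad\<close>
  applied to G(F n) \<phi>. On the left G is Lipschitz, so L^1 convergence passes to the limit
  (\<open>L1\<close>). On the right, replacing F' by g costs an L^1 error with bounded coefficients
  (\<open>L3\<close>), while G'(F n) \<rightarrow> G'(u) rests on pointwise convergence along a
  subsequence and dominated convergence (\<open>L2\<close>).\<close>

lemma W1p_chain_identity:
  fixes u :: "'a::euclidean_space \<Rightarrow> real"
  assumes U: "open U" "bounded U" and p: "p \<ge> 1" and W: "W1p p U u g"
    and iu: "integrable lebesgue u" and ig: "integrable lebesgue g"
    and G: "\<And>s. (G has_real_derivative G' s) (at s)" "continuous_on UNIV G'" "\<And>s. \<bar>G' s\<bar> \<le> B"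
    and \<phi>: "C1c U \<phi> \<phi>'"
  shows "(\<integral>x. G (u x) * (\<phi>' x \<bullet> b) \<partial>lebesgue) = - (\<integral>x. (G' (u x) * (g x \<bullet> b)) * \<phi> x \<partial>lebesgue)"
proof -
  define K where "K = closure {x. \<phi> x \<noteq> 0}"
  note \<phi>P = C1c_props[OF \<phi>, folded K_def]
  have [measurable]: "u \<in> borel_measurable lebesgue" "g \<in> borel_measurable lebesgue" using iu ig by auto
  have [measurable]: "\<phi> \<in> borel_measurable lebesgue" "\<phi>' \<in> borel_measurable lebesgue" by (fact \<phi>P)+
  have Gc: "continuous_on UNIV G" using DERIV_isCont[OF G(1)] by (simp add: continuous_on_eq_continuous_at)
  have Gm: "G \<in> borel_measurable borel" "G' \<in> borel_measurable borel"
    using Gc G(2) by (auto intro: borel_measurable_continuous_onI)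
  note [measurable] = measurable_compose[OF _ Gm(1)] measurable_compose[OF _ Gm(2)]
  have [measurable]: "K \<in> sets lebesgue" by (simp add: K_def)
  have B: "B \<ge> 0" using G(3)[of 0] by linarith
  obtain C where C: "C > 0" "\<And>x. norm (\<phi> x) \<le> C" "\<And>x. norm (\<phi>' x) \<le> C" by (rule C1c_bounded[OF \<phi>]) blast
  have out: "\<phi> x = 0" "\<phi>' x = 0" if "x \<notin> K" for x using C1c_outside[OF \<phi>, folded K_def, OF that] .
  have C': "\<bar>\<phi> x\<bar> \<le> C * indicator K x" "\<bar>\<phi>' x \<bullet> b\<bar> \<le> C * norm b * indicator K x" for x
  proof -
    show "\<bar>\<phi> x\<bar> \<le> C * indicator K x" using C(2)[of x] out(1)[of x] by (auto simp: indicator_def)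
    have "\<bar>\<phi>' x \<bullet> b\<bar> \<le> norm (\<phi>' x) * norm b" by (rule Cauchy_Schwarz_ineq2)
    also have "\<dots> \<le> C * norm b" using C by (intro mult_right_mono) auto
    finally show "\<bar>\<phi>' x \<bullet> b\<bar> \<le> C * norm b * indicator K x" using out(2)[of x] by (auto simp: indicator_def)
  qed
  have Kf: "integrable lebesgue (indicator K :: 'a \<Rightarrow> real)"
    using lmeasurable_compact[OF \<phi>P(3)] lmeasurable_iff_integrable by blast
  obtain F F' where F: "\<And>n. C1_grad (F n) (F' n)"
    "(\<lambda>n. \<integral>x. indicator K x * \<bar>F n x - u x\<bar> \<partial>lebesgue) \<longlonglongrightarrow> 0"
    "(\<lambda>n. \<integral>x. indicator K x * norm (F' n x - g x) \<partial>lebesgue) \<longlonglongrightarrow> 0"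
    using W1p_smooth_approx[OF U p W \<phi>P(3,4)] by blast
  have Fcont: "continuous_on UNIV (F n)" "continuous_on UNIV (F' n)" for n
    using F(1)[of n] C1_grad_imp_continuous by (auto simp: C1_grad_def)
  have [measurable]: "F n \<in> borel_measurable lebesgue" "F' n \<in> borel_measurable lebesgue" for n
    using Fcont by (auto intro!: measurable_completion borel_measurable_continuous_onI)
  have KF: "integrable lebesgue (\<lambda>x. indicator K x *\<^sub>R f x)" if "continuous_on UNIV f" for f :: "'a \<Rightarrow> 'b::euclidean_space"
  proof -
    have [measurable]: "f \<in> borel_measurable borel" using that by (rule borel_measurable_continuous_onI)
    have [measurable]: "K \<in> sets borel" by (simp add: K_def)
    have "(\<lambda>x. indicator K x *\<^sub>R f x) \<in> borel_measurable lborel" by measurable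
    then show ?thesis
      using borel_integrable_compact[OF \<phi>P(3) continuous_on_subset[OF that subset_UNIV]]
      by (simp add: integrable_completion)
  qed
  have iKF: "integrable lebesgue (\<lambda>x. indicator K x * (F n x - u x))" for n
    using Bochner_Integration.integrable_diff[OF KF[OF Fcont(1)[of n]] integrable_mult_bounded[OF iu, of "indicator K" 1]]
    by (auto simp: right_diff_distrib indicator_def)
  have iKF': "integrable lebesgue (\<lambda>x. indicator K x *\<^sub>R (F' n x - g x))" for n
    using Bochner_Integration.integrable_diff[OF KF[OF Fcont(2)[of n]] integrable_mult_bounded[OF ig, of "indicator K" 1]]
    by (auto simp: scaleR_right_diff_distrib indicator_def)
  have "(\<lambda>n. \<integral>x. norm (indicator K x * (F n x - u x)) \<partial>lebesgue) \<longlonglongrightarrow> 0"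
    using F(2) by (simp add: abs_mult)
  from tendsto_L1_AE_subseq[OF iKF this]
  obtain r where r: "strict_mono r" "AE x in lebesgue. (\<lambda>n. indicator K x * (F (r n) x - u x)) \<longlonglongrightarrow> 0" by blast
  have iGu: "integrable lebesgue (\<lambda>x. G (u x) * (\<phi>' x \<bullet> b))"
  proof (rule Bochner_Integration.integrable_bound[where f = "\<lambda>x. C * norm b * (\<bar>G 0\<bar> * indicator K x + B * \<bar>u x\<bar>)"])
    show "integrable lebesgue (\<lambda>x. C * norm b * (\<bar>G 0\<bar> * indicator K x + B * \<bar>u x\<bar>))"
      using iu Kf by auto
    show "AE x in lebesgue. norm (G (u x) * (\<phi>' x \<bullet> b)) \<le> norm (C * norm b * (\<bar>G 0\<bar> * indicator K x + B * \<bar>u x\<bar>))"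
    proof (rule AE_I2)
      fix x
      have "\<bar>G (u x)\<bar> \<le> \<bar>G 0\<bar> + B * \<bar>u x\<bar>" using C1_DERIV_bound[OF G(1,3), of "u x" 0] by simp
      then have "\<bar>G (u x)\<bar> * \<bar>\<phi>' x \<bullet> b\<bar> \<le> (\<bar>G 0\<bar> + B * \<bar>u x\<bar>) * (C * norm b * indicator K x)"
        using C'(2)[of x] B by (intro mult_mono) auto
      also have "\<dots> \<le> C * norm b * (\<bar>G 0\<bar> * indicator K x + B * \<bar>u x\<bar>)"
        using B C(1) by (auto simp: indicator_def algebra_simps)
      finally show "norm (G (u x) * (\<phi>' x \<bullet> b)) \<le> norm (C * norm b * (\<bar>G 0\<bar> * indicator K x + B * \<bar>u x\<bar>))"
        using B C(1) by (simp add: abs_mult abs_of_nonneg)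
    qed
  qed measurable
  have cG: "continuous_on UNIV (\<lambda>x. G (F n x))" "continuous_on UNIV (\<lambda>x. G' (F n x))" for n
    by (rule continuous_on_compose2[OF Gc Fcont(1)], simp, rule continuous_on_compose2[OF G(2) Fcont(1)], simp)
  have id0: "(\<integral>x. G (F n x) * (\<phi>' x \<bullet> b) \<partial>lebesgue) = - (\<integral>x. (G' (F n x) * (F' n x \<bullet> b)) * \<phi> x \<partial>lebesgue)" for n
  proof -
    have i1: "integrable lebesgue (\<lambda>x. indicator K x *\<^sub>R (G (F n x) * (\<phi>' x \<bullet> b)))"
      by (rule KF) (auto intro!: continuous_intros cG \<phi>P(1,2))
    have i2: "integrable lebesgue (\<lambda>x. indicator K x *\<^sub>R ((G' (F n x) * (F' n x \<bullet> b)) * \<phi> x))"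
      by (rule KF) (auto intro!: continuous_intros cG \<phi>P(1,2) Fcont)
    have e1: "(\<lambda>x. indicator K x *\<^sub>R (G (F n x) * (\<phi>' x \<bullet> b))) = (\<lambda>x. G (F n x) * (\<phi>' x \<bullet> b))"
      "(\<lambda>x. indicator K x *\<^sub>R ((G' (F n x) * (F' n x \<bullet> b)) * \<phi> x)) = (\<lambda>x. (G' (F n x) * (F' n x \<bullet> b)) * \<phi> x)"
      by (rule ext, case_tac "x \<in> K"; simp add: out)+
    have "C1c UNIV \<phi> \<phi>'" using \<phi> by (simp add: C1c_def)
    from C1_grad_mult_C1c[OF C1_grad_compose[OF F(1) G(1,2)] this]
    have c: "C1c UNIV (\<lambda>x. G (F n x) * \<phi> x) (\<lambda>x. G (F n x) *\<^sub>R \<phi>' x + \<phi> x *\<^sub>R (G' (F n x) *\<^sub>R F' n x))" .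
    have "0 = (\<integral>x. (G (F n x) *\<^sub>R \<phi>' x + \<phi> x *\<^sub>R (G' (F n x) *\<^sub>R F' n x)) \<bullet> b \<partial>lborel)"
      using integral_C1c_grad[OF c] by simp
    also have "\<dots> = (\<integral>x. (G (F n x) *\<^sub>R \<phi>' x + \<phi> x *\<^sub>R (G' (F n x) *\<^sub>R F' n x)) \<bullet> b \<partial>lebesgue)"
    proof (rule integral_completion[symmetric])
      have "continuous_on UNIV (\<lambda>x. (G (F n x) *\<^sub>R \<phi>' x + \<phi> x *\<^sub>R (G' (F n x) *\<^sub>R F' n x)) \<bullet> b)"
        by (intro continuous_on_inner C1c_props(2)[OF c] continuous_on_const)
      then show "(\<lambda>x. (G (F n x) *\<^sub>R \<phi>' x + \<phi> x *\<^sub>R (G' (F n x) *\<^sub>R F' n x)) \<bullet> b) \<in> borel_measurable lborel"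
        by (simp add: borel_measurable_continuous_onI)
    qed
    also have "\<dots> = (\<integral>x. G (F n x) * (\<phi>' x \<bullet> b) + (G' (F n x) * (F' n x \<bullet> b)) * \<phi> x \<partial>lebesgue)"
      by (intro Bochner_Integration.integral_cong) (auto simp: inner_add_left)
    also have "\<dots> = (\<integral>x. G (F n x) * (\<phi>' x \<bullet> b) \<partial>lebesgue) + (\<integral>x. (G' (F n x) * (F' n x \<bullet> b)) * \<phi> x \<partial>lebesgue)"
      using i1 i2 unfolding e1 by (rule Bochner_Integration.integral_add)
    finally show ?thesis by simp
  qed
  have iGF: "integrable lebesgue (\<lambda>x. G (F n x) * (\<phi>' x \<bullet> b))" for n
  proof -
    have "integrable lebesgue (\<lambda>x. indicator K x *\<^sub>R (G (F n x) * (\<phi>' x \<bullet> b)))"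
      by (rule KF) (auto intro!: continuous_intros cG \<phi>P(1,2))
    then show ?thesis
      by (rule Bochner_Integration.integrable_cong[THEN iffD1, rotated 2]) (case_tac "x \<in> K"; simp add: out)+
  qed
  have L1: "(\<lambda>n. \<integral>x. G (F n x) * (\<phi>' x \<bullet> b) \<partial>lebesgue) \<longlonglongrightarrow> (\<integral>x. G (u x) * (\<phi>' x \<bullet> b) \<partial>lebesgue)"
  proof (rule Lim_null[THEN iffD2], rule Lim_null_comparison)
    show "(\<lambda>n. B * C * norm b * (\<integral>x. indicator K x * \<bar>F n x - u x\<bar> \<partial>lebesgue)) \<longlonglongrightarrow> 0"
      by (rule tendsto_mult_right_zero[OF F(2)])
    show "\<forall>\<^sub>F n in sequentially. norm ((\<integral>x. G (F n x) * (\<phi>' x \<bullet> b) \<partial>lebesgue) - (\<integral>x. G (u x) * (\<phi>' x \<bullet> b) \<partial>lebesgue))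
       \<le> B * C * norm b * (\<integral>x. indicator K x * \<bar>F n x - u x\<bar> \<partial>lebesgue)"
    proof (rule always_eventually, rule allI)
      fix n
      have "(\<integral>x. G (F n x) * (\<phi>' x \<bullet> b) \<partial>lebesgue) - (\<integral>x. G (u x) * (\<phi>' x \<bullet> b) \<partial>lebesgue)
          = (\<integral>x. (G (F n x) - G (u x)) * (\<phi>' x \<bullet> b) \<partial>lebesgue)"
        using iGF iGu by (simp add: left_diff_distrib)
      also have "norm \<dots> \<le> (\<integral>x. B * C * norm b * (indicator K x * \<bar>F n x - u x\<bar>) \<partial>lebesgue)"
      proof (rule integral_norm_bound[THEN order_trans], rule integral_mono')
        show "integrable lebesgue (\<lambda>x. B * C * norm b * (indicator K x * \<bar>F n x - u x\<bar>))"
          using integrable_norm[OF iKF[of n]] by (intro integrable_mult_right) (simp add: abs_mult)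
        fix x
        have "\<bar>G (F n x) - G (u x)\<bar> * \<bar>\<phi>' x \<bullet> b\<bar> \<le> (B * \<bar>F n x - u x\<bar>) * (C * norm b * indicator K x)"
          using C1_DERIV_bound[OF G(1,3)] C'(2)[of x] B by (intro mult_mono) auto
        then show "norm ((G (F n x) - G (u x)) * (\<phi>' x \<bullet> b)) \<le> B * C * norm b * (indicator K x * \<bar>F n x - u x\<bar>)"
          by (simp add: abs_mult mult_ac)
      qed (use B C in auto)
      finally show "norm ((\<integral>x. G (F n x) * (\<phi>' x \<bullet> b) \<partial>lebesgue) - (\<integral>x. G (u x) * (\<phi>' x \<bullet> b) \<partial>lebesgue))
       \<le> B * C * norm b * (\<integral>x. indicator K x * \<bar>F n x - u x\<bar> \<partial>lebesgue)" by simp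
    qed
  qed
  have igb: "integrable lebesgue (\<lambda>x. g x \<bullet> b)" using ig by auto
  have P2b: "integrable lebesgue (\<lambda>x. (G' (f x) * (g x \<bullet> b)) * \<phi> x)" if [measurable]: "f \<in> borel_measurable lebesgue" for f
  proof -
    have "\<bar>G' (f x) * \<phi> x\<bar> \<le> B * C" for x
      unfolding abs_mult using G(3) C(2) B by (intro mult_mono) auto
    from integrable_mult_bounded_real(1)[OF igb _ this] show ?thesis by (simp add: mult_ac)
  qed
  have L2: "(\<lambda>n. \<integral>x. (G' (F (r n) x) * (g x \<bullet> b)) * \<phi> x \<partial>lebesgue) \<longlonglongrightarrow> (\<integral>x. (G' (u x) * (g x \<bullet> b)) * \<phi> x \<partial>lebesgue)"
  proof (rule integral_dominated_convergence[where w = "\<lambda>x. B * C * \<bar>g x \<bullet> b\<bar>"])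
    show "integrable lebesgue (\<lambda>x. B * C * \<bar>g x \<bullet> b\<bar>)" using igb by auto
    show "AE x in lebesgue. (\<lambda>n. (G' (F (r n) x) * (g x \<bullet> b)) * \<phi> x) \<longlonglongrightarrow> (G' (u x) * (g x \<bullet> b)) * \<phi> x"
      using r(2)
    proof eventually_elim
      case (elim x)
      show ?case
      proof (cases "x \<in> K")
        case True
        then have "(\<lambda>n. F (r n) x) \<longlonglongrightarrow> u x" using elim by (simp add: LIM_zero_iff)
        then have "(\<lambda>n. G' (F (r n) x)) \<longlonglongrightarrow> G' (u x)"
          using G(2) by (intro isCont_tendsto_compose[of _ G']) (auto simp: continuous_on_eq_continuous_at)
        then show ?thesis by (intro tendsto_intros)
      qed (simp add: out)
    qed
    show "AE x in lebesgue. norm ((G' (F (r n) x) * (g x \<bullet> b)) * \<phi> x) \<le> B * C * \<bar>g x \<bullet> b\<bar>" for n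
    proof (rule AE_I2)
      fix x
      have "\<bar>G' (F (r n) x)\<bar> * \<bar>\<phi> x\<bar> * \<bar>g x \<bullet> b\<bar> \<le> B * C * \<bar>g x \<bullet> b\<bar>"
        using G(3) C(2) B by (intro mult_mono mult_right_mono) auto
      then show "norm ((G' (F (r n) x) * (g x \<bullet> b)) * \<phi> x) \<le> B * C * \<bar>g x \<bullet> b\<bar>" by (simp add: abs_mult mult_ac)
    qed
  qed (use P2b in measurable)
  have L3: "(\<lambda>n. (\<integral>x. (G' (F n x) * (F' n x \<bullet> b)) * \<phi> x \<partial>lebesgue) - (\<integral>x. (G' (F n x) * (g x \<bullet> b)) * \<phi> x \<partial>lebesgue)) \<longlonglongrightarrow> 0"
  proof (rule Lim_null_comparison)
    show "(\<lambda>n. B * C * norm b * (\<integral>x. indicator K x * norm (F' n x - g x) \<partial>lebesgue)) \<longlonglongrightarrow> 0"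
      by (rule tendsto_mult_right_zero[OF F(3)])
    show "\<forall>\<^sub>F n in sequentially. norm ((\<integral>x. (G' (F n x) * (F' n x \<bullet> b)) * \<phi> x \<partial>lebesgue) - (\<integral>x. (G' (F n x) * (g x \<bullet> b)) * \<phi> x \<partial>lebesgue))
       \<le> B * C * norm b * (\<integral>x. indicator K x * norm (F' n x - g x) \<partial>lebesgue)"
    proof (rule always_eventually, rule allI)
      fix n
      have "integrable lebesgue (\<lambda>x. indicator K x *\<^sub>R ((G' (F n x) * (F' n x \<bullet> b)) * \<phi> x))"
        by (rule KF) (auto intro!: continuous_intros cG \<phi>P(1,2) Fcont)
      then have i: "integrable lebesgue (\<lambda>x. (G' (F n x) * (F' n x \<bullet> b)) * \<phi> x)"
        by (rule Bochner_Integration.integrable_cong[THEN iffD1, rotated 2]) (case_tac "x \<in> K"; simp add: out)+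
      have "(\<integral>x. (G' (F n x) * (F' n x \<bullet> b)) * \<phi> x \<partial>lebesgue) - (\<integral>x. (G' (F n x) * (g x \<bullet> b)) * \<phi> x \<partial>lebesgue)
          = (\<integral>x. G' (F n x) * ((F' n x - g x) \<bullet> b) * \<phi> x \<partial>lebesgue)"
        using i P2b[of "F n"] by (simp add: inner_diff_left algebra_simps)
      also have "norm \<dots> \<le> (\<integral>x. B * C * norm b * (indicator K x * norm (F' n x - g x)) \<partial>lebesgue)"
      proof (rule integral_norm_bound[THEN order_trans], rule integral_mono')
        show "integrable lebesgue (\<lambda>x. B * C * norm b * (indicator K x * norm (F' n x - g x)))"
          using integrable_norm[OF iKF'[of n]] by (intro integrable_mult_right) simp
        fix x
        have "\<bar>G' (F n x)\<bar> * \<bar>(F' n x - g x) \<bullet> b\<bar> * \<bar>\<phi> x\<bar> \<le> B * (norm (F' n x - g x) * norm b) * (C * indicator K x)"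
          using G(3) C'(1) B Cauchy_Schwarz_ineq2 C(1) by (intro mult_mono) auto
        then show "norm (G' (F n x) * ((F' n x - g x) \<bullet> b) * \<phi> x) \<le> B * C * norm b * (indicator K x * norm (F' n x - g x))"
          by (simp add: abs_mult mult_ac)
      qed (use B C in auto)
      finally show "norm ((\<integral>x. (G' (F n x) * (F' n x \<bullet> b)) * \<phi> x \<partial>lebesgue) - (\<integral>x. (G' (F n x) * (g x \<bullet> b)) * \<phi> x \<partial>lebesgue))
       \<le> B * C * norm b * (\<integral>x. indicator K x * norm (F' n x - g x) \<partial>lebesgue)" by simp
    qed
  qed
  have "(\<lambda>n. ((\<integral>x. (G' (F (r n) x) * (F' (r n) x \<bullet> b)) * \<phi> x \<partial>lebesgue) - (\<integral>x. (G' (F (r n) x) * (g x \<bullet> b)) * \<phi> x \<partial>lebesgue))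
      + (\<integral>x. (G' (F (r n) x) * (g x \<bullet> b)) * \<phi> x \<partial>lebesgue)) \<longlonglongrightarrow> 0 + (\<integral>x. (G' (u x) * (g x \<bullet> b)) * \<phi> x \<partial>lebesgue)"
    using LIMSEQ_subseq_LIMSEQ[OF L3 r(1)] L2 by (intro tendsto_add) (auto simp: o_def)
  then have L5: "(\<lambda>n. - (\<integral>x. G (F (r n) x) * (\<phi>' x \<bullet> b) \<partial>lebesgue)) \<longlonglongrightarrow> (\<integral>x. (G' (u x) * (g x \<bullet> b)) * \<phi> x \<partial>lebesgue)"
    by (simp add: id0)
  have L4: "(\<lambda>n. - (\<integral>x. G (F (r n) x) * (\<phi>' x \<bullet> b) \<partial>lebesgue)) \<longlonglongrightarrow> - (\<integral>x. G (u x) * (\<phi>' x \<bullet> b) \<partial>lebesgue)"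
    using LIMSEQ_subseq_LIMSEQ[OF L1 r(1)] by (intro tendsto_minus) (auto simp: o_def)
  from LIMSEQ_unique[OF L5 L4] show ?thesis by simp
qed

section \<open>The Sobolev space in its original and in its normalised form\<close>

lemma W1p_cong:
  assumes "W1p p U u g" "\<And>x. x \<in> U \<Longrightarrow> u x = u' x" "\<And>x. x \<in> U \<Longrightarrow> g x = g' x"
  shows "W1p p U u' g'"
proof -
  have Lp: "in_Lp p U f'" if "in_Lp p U f" "\<And>x. x \<in> U \<Longrightarrow> f x = f' x" for f f' :: "'a \<Rightarrow> 'b::euclidean_space"
  proof -
    have "(\<lambda>x. indicator U x *\<^sub>R f x) = (\<lambda>x. indicator U x *\<^sub>R f' x)"
      by (rule ext, case_tac "x \<in> U") (simp_all add: that(2))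
    moreover have "(\<lambda>x. indicator U x *\<^sub>R norm (f x) powr p) = (\<lambda>x. indicator U x *\<^sub>R norm (f' x) powr p)"
      by (rule ext, case_tac "x \<in> U") (simp_all add: that(2))
    ultimately show ?thesis
      using that(1) unfolding in_Lp_def set_borel_measurable_def set_integrable_def by simp
  qed
  have "(LINT x:U|lebesgue. u x * f x) = (LINT x:U|lebesgue. u' x * f x)" for f
    unfolding set_lebesgue_integral_def
    by (rule Bochner_Integration.integral_cong[OF refl], case_tac "x \<in> U") (simp_all add: assms(2))
  moreover have "(LINT x:U|lebesgue. (g x \<bullet> b) * f x) = (LINT x:U|lebesgue. (g' x \<bullet> b) * f x)" for f b
    unfolding set_lebesgue_integral_def
    by (rule Bochner_Integration.integral_cong[OF refl], case_tac "x \<in> U") (simp_all add: assms(3))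
  ultimately show ?thesis
    using assms(1) Lp[of u u'] Lp[of g g'] assms(2,3) unfolding W1p_def by simp
qed

lemma in_Lp_iff:
  fixes f :: "'a::euclidean_space \<Rightarrow> 'b::euclidean_space"
  shows "in_Lp p U f \<longleftrightarrow> (\<lambda>x. indicator U x *\<^sub>R f x) \<in> borel_measurable lebesgue \<and>
    integrable lebesgue (\<lambda>x. norm (indicator U x *\<^sub>R f x) powr p)"
proof -
  have "(\<lambda>x. indicator U x *\<^sub>R norm (f x) powr p) = (\<lambda>x. norm (indicator U x *\<^sub>R f x) powr p)"
    by (rule ext, case_tac "x \<in> U") simp_all
  then show ?thesis unfolding in_Lp_def set_borel_measurable_def set_integrable_def by simp
qed

lemma in_Lp_zero_outside:
  fixes f :: "'a::euclidean_space \<Rightarrow> 'b::euclidean_space"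
  assumes "\<And>x. x \<notin> U \<Longrightarrow> f x = 0"
  shows "in_Lp p U f \<longleftrightarrow> f \<in> borel_measurable lebesgue \<and> integrable lebesgue (\<lambda>x. norm (f x) powr p)"
proof -
  have "indicator U x *\<^sub>R f x = f x" for x
    by (cases "x \<in> U") (simp_all add: assms)
  then show ?thesis unfolding in_Lp_iff by (simp only:)
qed

lemma set_integral_zero_outside:
  fixes f :: "'a::euclidean_space \<Rightarrow> 'b::euclidean_space"
  assumes "\<And>x. x \<notin> U \<Longrightarrow> f x = 0"
  shows "(LINT x:U|lebesgue. f x) = integral\<^sup>L lebesgue f"
  unfolding set_lebesgue_integral_def
  by (rule Bochner_Integration.integral_cong[OF refl], case_tac "x \<in> U") (simp_all add: assms)

text \<open>The chain identity with G(s) = s passes from smooth to C^1 test functions, because its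
  proof tests the weak gradient against mollifying kernels alone.\<close>

lemma W1p_imp_Sob:
  fixes u :: "'a::euclidean_space \<Rightarrow> real"
  assumes U: "open U" "bounded U" and p: "p \<ge> 1" and W: "W1p p U u g"
  shows "Sob p U (\<lambda>x. indicator U x *\<^sub>R u x) (\<lambda>x. indicator U x *\<^sub>R g x)"
proof -
  let ?u = "\<lambda>x. indicator U x *\<^sub>R u x" and ?g = "\<lambda>x. indicator U x *\<^sub>R g x"
  have W': "W1p p U ?u ?g" by (rule W1p_cong[OF W]) auto
  have "in_Lp p U u" "in_Lp p U g" using W by (auto simp: W1p_def)
  then have m: "?u \<in> borel_measurable lebesgue" "?g \<in> borel_measurable lebesgue"
    "integrable lebesgue (\<lambda>x. norm (?u x) powr p)" "integrable lebesgue (\<lambda>x. norm (?g x) powr p)"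
    unfolding in_Lp_iff by auto
  have i: "integrable lebesgue ?u" "integrable lebesgue ?g"
    by (rule integrable_of_powr[OF U p m(1) _ m(3)], simp, rule integrable_of_powr[OF U p m(2) _ m(4)], simp)
  show ?thesis unfolding Sob_def
  proof (intro conjI allI impI m)
    fix \<phi> \<phi>' and b :: 'a assume "C1c U \<phi> \<phi>'" "b \<in> Basis"
    from W1p_chain_identity[OF U p W' i, of "\<lambda>s. s" "\<lambda>_. 1" 1, OF _ _ _ this(1)]
    show "(\<integral>x. ?u x * (\<phi>' x \<bullet> b) \<partial>lebesgue) = - (\<integral>x. (?g x \<bullet> b) * \<phi> x \<partial>lebesgue)" by simp
  qed auto
qed

lemma Sob_imp_W1p:
  assumes "Sob p U u g" shows "W1p p U u g"
  unfolding W1p_def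
proof (intro conjI allI impI ballI)
  have z: "u x = 0" "g x = 0" if "x \<notin> U" for x using assms that by (auto simp: Sob_def)
  show "in_Lp p U u" "in_Lp p U g" using assms z by (auto simp: Sob_def in_Lp_zero_outside)
  fix \<phi> and b :: 'a assume t: "test_function U \<phi>" "b \<in> Basis"
  note c = test_function_imp_C1c[OF t(1)]
  have "frechet_derivative \<phi> (at x) b = (\<Sum>b\<in>Basis. frechet_derivative \<phi> (at x) b *\<^sub>R b) \<bullet> b" for x
    by (subst inner_commute) (rule C1_grad_frechet, use c in \<open>simp add: C1c_def\<close>)
  moreover have "(\<integral>x. u x * ((\<Sum>b\<in>Basis. frechet_derivative \<phi> (at x) b *\<^sub>R b) \<bullet> b) \<partial>lebesgue) = - (\<integral>x. (g x \<bullet> b) * \<phi> x \<partial>lebesgue)"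
    using assms c t(2) unfolding Sob_def by blast
  ultimately show "(LINT x:U|lebesgue. u x * frechet_derivative \<phi> (at x) b) = - (LINT x:U|lebesgue. (g x \<bullet> b) * \<phi> x)"
    using z by (simp add: set_integral_zero_outside)
qed

section \<open>Linear combinations, chain rule and product rule\<close>

lemma Sob_weak:
  assumes "Sob p U u g" "C1c U \<phi> \<phi>'" "b \<in> Basis"
  shows "(\<integral>x. u x * (\<phi>' x \<bullet> b) \<partial>lebesgue) = - (\<integral>x. (g x \<bullet> b) * \<phi> x \<partial>lebesgue)"
  using assms unfolding Sob_def by blast

lemma Sob_weak_integrable:
  assumes "Sob p U u g" "C1c V \<phi> \<phi>'" "open U" "bounded U" "p \<ge> 1"
  shows "integrable lebesgue (\<lambda>x. u x * (\<phi>' x \<bullet> b))" "integrable lebesgue (\<lambda>x. (g x \<bullet> b) * \<phi> x)"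
proof -
  note i = Sob_integrable[OF assms(1,3-5)] and P = C1c_props[OF assms(2)]
  obtain B where B: "B > 0" "\<And>x. norm (\<phi> x) \<le> B" "\<And>x. norm (\<phi>' x) \<le> B"
    by (rule C1c_bounded[OF assms(2)]) blast
  have "\<bar>\<phi>' x \<bullet> b\<bar> \<le> B * norm b" for x
    by (rule order_trans[OF Cauchy_Schwarz_ineq2]) (intro mult_right_mono B, simp)
  then show "integrable lebesgue (\<lambda>x. u x * (\<phi>' x \<bullet> b))"
    using i(1) P(6) by (intro integrable_mult_bounded_real(2)) auto
  show "integrable lebesgue (\<lambda>x. (g x \<bullet> b) * \<phi> x)"
    using i(2) P(5) B(2) by (intro integrable_mult_bounded_real(2)[of _ _ _ B]) auto
qed

lemma Sob_lincomb:
  assumes U: "open U" "bounded U" and p: "p \<ge> 1" and S: "Sob p U u g" "Sob p U v h"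
  shows "Sob p U (\<lambda>x. a * u x + c * v x) (\<lambda>x. a *\<^sub>R g x + c *\<^sub>R h x)"
  unfolding Sob_def
proof (intro conjI allI impI)
  have [measurable]: "u \<in> borel_measurable lebesgue" "g \<in> borel_measurable lebesgue"
      "v \<in> borel_measurable lebesgue" "h \<in> borel_measurable lebesgue" using S by (auto simp: Sob_def)
  have ip: "integrable lebesgue (\<lambda>x. norm (k *\<^sub>R f x) powr p)"
    if "integrable lebesgue (\<lambda>x. norm (f x) powr p)" for k and f :: "'a \<Rightarrow> 'b::euclidean_space"
    using that by (simp add: powr_mult)
  show "integrable lebesgue (\<lambda>x. norm (a * u x + c * v x) powr p)"
    using S p ip[of u a] ip[of v c] unfolding Sob_def
    by (intro integrable_powr_add) auto
  show "integrable lebesgue (\<lambda>x. norm (a *\<^sub>R g x + c *\<^sub>R h x) powr p)"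
    using S p ip[of g a] ip[of h c] unfolding Sob_def
    by (intro integrable_powr_add) auto
  fix \<phi> \<phi>' and b :: 'a assume \<phi>: "C1c U \<phi> \<phi>'" "b \<in> Basis"
  note i = Sob_weak_integrable[OF S(1) \<phi>(1) U p, of b] Sob_weak_integrable[OF S(2) \<phi>(1) U p, of b]
  have "(\<integral>x. (a * u x + c * v x) * (\<phi>' x \<bullet> b) \<partial>lebesgue)
     = (\<integral>x. a * (u x * (\<phi>' x \<bullet> b)) + c * (v x * (\<phi>' x \<bullet> b)) \<partial>lebesgue)"
    by (simp add: algebra_simps)
  also have "\<dots> = a * (\<integral>x. u x * (\<phi>' x \<bullet> b) \<partial>lebesgue) + c * (\<integral>x. v x * (\<phi>' x \<bullet> b) \<partial>lebesgue)"
    using i by simp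
  also have "\<dots> = - (a * (\<integral>x. (g x \<bullet> b) * \<phi> x \<partial>lebesgue) + c * (\<integral>x. (h x \<bullet> b) * \<phi> x \<partial>lebesgue))"
    using Sob_weak[OF S(1) \<phi>] Sob_weak[OF S(2) \<phi>] by simp
  also have "\<dots> = - (\<integral>x. a * ((g x \<bullet> b) * \<phi> x) + c * ((h x \<bullet> b) * \<phi> x) \<partial>lebesgue)"
    using i by simp
  finally show "(\<integral>x. (a * u x + c * v x) * (\<phi>' x \<bullet> b) \<partial>lebesgue)
     = - (\<integral>x. ((a *\<^sub>R g x + c *\<^sub>R h x) \<bullet> b) * \<phi> x \<partial>lebesgue)"
    by (simp add: algebra_simps inner_add_left)
qed (use S in \<open>auto simp: Sob_def\<close>)

text \<open>The condition G(0) = 0 keeps the composite equal to 0 outside \<open>U\<close>, as the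
  normalisation demands; the bound on G' keeps function and gradient in L^p.\<close>

lemma Sob_chain:
  assumes U: "open U" "bounded U" and p: "p \<ge> 1" and S: "Sob p U u g"
    and G: "\<And>s. (G has_real_derivative G' s) (at s)" "continuous_on UNIV G'" "\<And>s. \<bar>G' s\<bar> \<le> B" "G 0 = 0"
  shows "Sob p U (\<lambda>x. G (u x)) (\<lambda>x. G' (u x) *\<^sub>R g x)"
  unfolding Sob_def
proof (intro conjI allI impI)
  have [measurable]: "u \<in> borel_measurable lebesgue" "g \<in> borel_measurable lebesgue"
    using S by (auto simp: Sob_def)
  have Gc: "continuous_on UNIV G" using DERIV_isCont[OF G(1)] by (simp add: continuous_on_eq_continuous_at)
  have Gm: "G \<in> borel_measurable borel" "G' \<in> borel_measurable borel"
    using Gc G(2) by (auto intro: borel_measurable_continuous_onI)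
  note [measurable] = measurable_compose[OF _ Gm(1)] measurable_compose[OF _ Gm(2)]
  have B: "B \<ge> 0" using G(3)[of 0] by linarith
  show "(\<lambda>x. G (u x)) \<in> borel_measurable lebesgue" "(\<lambda>x. G' (u x) *\<^sub>R g x) \<in> borel_measurable lebesgue"
    by measurable
  show "integrable lebesgue (\<lambda>x. norm (G (u x)) powr p)"
    by (rule integrable_powr_bounded_mult[of p lebesgue u _ B])
       (use S p B C1_DERIV_bound[OF G(1,3), of _ 0] G(4) in \<open>auto simp: Sob_def\<close>)
  show "integrable lebesgue (\<lambda>x. norm (G' (u x) *\<^sub>R g x) powr p)"
    by (rule integrable_powr_bounded_mult[of p lebesgue g _ B])
       (use S p B G(3) in \<open>auto simp: Sob_def intro!: mult_right_mono\<close>)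
  fix \<phi> \<phi>' and b :: 'a assume \<phi>: "C1c U \<phi> \<phi>'" "b \<in> Basis"
  show "(\<integral>x. G (u x) * (\<phi>' x \<bullet> b) \<partial>lebesgue) = - (\<integral>x. ((G' (u x) *\<^sub>R g x) \<bullet> b) * \<phi> x \<partial>lebesgue)"
    using W1p_chain_identity[OF U p Sob_imp_W1p[OF S] Sob_integrable[OF S U p] G(1-3) \<phi>(1)] by simp
qed (use S G(4) in \<open>auto simp: Sob_def\<close>)

lemma C1_grad_bounded_on:
  assumes "C1_grad \<zeta> \<zeta>'" "bounded U"
  obtains B where "B > 0" "\<And>x. x \<in> U \<Longrightarrow> \<bar>\<zeta> x\<bar> \<le> B" "\<And>x. x \<in> U \<Longrightarrow> norm (\<zeta>' x) \<le> B"
proof -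
  have K: "compact (closure U)" using assms by (simp add: compact_eq_bounded_closed bounded_closure)
  have "bounded (\<zeta> ` closure U)" "bounded (\<zeta>' ` closure U)"
    using K assms(1) C1_grad_imp_continuous[OF assms(1)] unfolding C1_grad_def
    by (auto intro!: compact_imp_bounded compact_continuous_image intro: continuous_on_subset)
  then obtain B1 B2 where "B1 > 0" "\<forall>y\<in>\<zeta> ` closure U. norm y \<le> B1" "\<forall>y\<in>\<zeta>' ` closure U. norm y \<le> B2"
    unfolding bounded_pos by blast
  then have B: "B1 > 0" "\<And>x. x \<in> closure U \<Longrightarrow> \<bar>\<zeta> x\<bar> \<le> B1" "\<And>x. x \<in> closure U \<Longrightarrow> norm (\<zeta>' x) \<le> B2"
    by auto
  show ?thesis
  proof (rule that[of "max B1 B2"])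
    fix x assume "x \<in> U"
    then have "x \<in> closure U" using closure_subset by blast
    then show "\<bar>\<zeta> x\<bar> \<le> max B1 B2" "norm (\<zeta>' x) \<le> max B1 B2" using B(2,3)[of x] by auto
  qed (use B in auto)
qed

text \<open>With \<phi> also \<zeta> \<phi> is an admissible test function; testing \<open>u\<close>
  with it and moving the term with the gradient of \<zeta> to the other side is the product rule.
  Boundedness of \<open>U\<close> bounds \<zeta> and its gradient there.\<close>

lemma Sob_mult:
  assumes U: "open U" "bounded U" and p: "p \<ge> 1" and S: "Sob p U u g" and \<zeta>: "C1_grad \<zeta> \<zeta>'"
  shows "Sob p U (\<lambda>x. \<zeta> x * u x) (\<lambda>x. \<zeta> x *\<^sub>R g x + u x *\<^sub>R \<zeta>' x)"
  unfolding Sob_def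
proof (intro conjI allI impI)
  have z: "u x = 0" "g x = 0" if "x \<notin> U" for x using S that by (auto simp: Sob_def)
  have [measurable]: "u \<in> borel_measurable lebesgue" "g \<in> borel_measurable lebesgue"
    using S by (auto simp: Sob_def)
  have [measurable]: "\<zeta> \<in> borel_measurable lebesgue" "\<zeta>' \<in> borel_measurable lebesgue"
    using \<zeta> C1_grad_imp_continuous[OF \<zeta>] unfolding C1_grad_def
    by (auto intro!: measurable_completion borel_measurable_continuous_onI)
  obtain B where B: "B > 0" "\<And>x. x \<in> U \<Longrightarrow> \<bar>\<zeta> x\<bar> \<le> B" "\<And>x. x \<in> U \<Longrightarrow> norm (\<zeta>' x) \<le> B"
    by (rule C1_grad_bounded_on[OF \<zeta> U(2)]) blast
  have b1: "norm (\<zeta> x * u x) \<le> B * norm (u x)" "norm (\<zeta> x *\<^sub>R g x) \<le> B * norm (g x)"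
    "norm (u x *\<^sub>R \<zeta>' x) \<le> B * norm (u x)" for x
    using B(2,3)[of x] z[of x] mult_right_mono[of "\<bar>\<zeta> x\<bar>" B "\<bar>u x\<bar>"] mult_right_mono[of "\<bar>\<zeta> x\<bar>" B "norm (g x)"]
      mult_right_mono[of "norm (\<zeta>' x)" B "\<bar>u x\<bar>"] by (cases "x \<in> U"; simp add: abs_mult mult.commute)+
  have Lp: "integrable lebesgue (\<lambda>x. norm (u x) powr p)" "integrable lebesgue (\<lambda>x. norm (g x) powr p)"
    using S by (auto simp: Sob_def)
  have p0: "p \<ge> 0" and B0: "B \<ge> 0" using p B by auto
  show "integrable lebesgue (\<lambda>x. norm (\<zeta> x * u x) powr p)"
    by (rule integrable_powr_bounded_mult[OF p0 Lp(1) _ B0 b1(1)]) measurable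
  show "integrable lebesgue (\<lambda>x. norm (\<zeta> x *\<^sub>R g x + u x *\<^sub>R \<zeta>' x) powr p)"
    by (rule integrable_powr_add[OF p0 _ _ integrable_powr_bounded_mult[OF p0 Lp(2) _ B0 b1(2)]
          integrable_powr_bounded_mult[OF p0 Lp(1) _ B0 b1(3)]]) measurable
  show "(\<lambda>x. \<zeta> x * u x) \<in> borel_measurable lebesgue" "(\<lambda>x. \<zeta> x *\<^sub>R g x + u x *\<^sub>R \<zeta>' x) \<in> borel_measurable lebesgue"
    by measurable
  fix \<phi> \<phi>' and b :: 'a assume \<phi>: "C1c U \<phi> \<phi>'" "b \<in> Basis"
  note i = Sob_integrable[OF S U p] and P = C1c_props[OF \<phi>(1)]
  note c = C1_grad_mult_C1c[OF \<zeta> \<phi>(1)]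
  have [measurable]: "\<phi> \<in> borel_measurable lebesgue" "\<phi>' \<in> borel_measurable lebesgue" by (fact P)+
  obtain C where C: "C > 0" "\<And>x. norm (\<phi> x) \<le> C" "\<And>x. norm (\<phi>' x) \<le> C"
    by (rule C1c_bounded[OF \<phi>(1)]) blast
  have i3: "integrable lebesgue (\<lambda>x. (u x *\<^sub>R \<zeta>' x) \<bullet> b * \<phi> x)"
  proof -
    have "integrable lebesgue (\<lambda>x. u x *\<^sub>R \<zeta>' x)"
      by (rule Bochner_Integration.integrable_bound[OF integrable_mult_right[OF integrable_norm[OF i(1)], of B]])
         (use b1(3) B0 in \<open>auto simp: abs_mult abs_of_nonneg\<close>)
    then have "integrable lebesgue (\<lambda>x. (u x *\<^sub>R \<zeta>' x) \<bullet> b)" by (rule integrable_inner_left)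
    then show ?thesis using C(2) by (intro integrable_mult_bounded_real(2)[of _ _ _ C]) auto
  qed
  have e1: "u x * ((\<zeta> x *\<^sub>R \<phi>' x + \<phi> x *\<^sub>R \<zeta>' x) \<bullet> b) = (\<zeta> x * u x) * (\<phi>' x \<bullet> b) + (u x *\<^sub>R \<zeta>' x) \<bullet> b * \<phi> x" for x
    by (simp add: inner_add_left algebra_simps)
  note w = Sob_weak_integrable[OF S c U p, of b]
  have i4: "integrable lebesgue (\<lambda>x. (\<zeta> x * u x) * (\<phi>' x \<bullet> b))"
    using Bochner_Integration.integrable_diff[OF w(1)[unfolded e1] i3] by simp
  have "(\<integral>x. (\<zeta> x * u x) * (\<phi>' x \<bullet> b) \<partial>lebesgue) + (\<integral>x. (u x *\<^sub>R \<zeta>' x) \<bullet> b * \<phi> x \<partial>lebesgue)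
     = - (\<integral>x. (g x \<bullet> b) * (\<zeta> x * \<phi> x) \<partial>lebesgue)"
    using Sob_weak[OF S c \<phi>(2)] i4 i3 unfolding e1 by simp
  moreover have "(\<integral>x. ((\<zeta> x *\<^sub>R g x + u x *\<^sub>R \<zeta>' x) \<bullet> b) * \<phi> x \<partial>lebesgue)
     = (\<integral>x. (g x \<bullet> b) * (\<zeta> x * \<phi> x) + (u x *\<^sub>R \<zeta>' x) \<bullet> b * \<phi> x \<partial>lebesgue)"
    by (rule Bochner_Integration.integral_cong) (auto simp: inner_add_left algebra_simps)
  ultimately show "(\<integral>x. (\<zeta> x * u x) * (\<phi>' x \<bullet> b) \<partial>lebesgue)
     = - (\<integral>x. ((\<zeta> x *\<^sub>R g x + u x *\<^sub>R \<zeta>' x) \<bullet> b) * \<phi> x \<partial>lebesgue)"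
    using w(2) i3 by simp
qed (use S in \<open>auto simp: Sob_def\<close>)

lemma Sob_indicator:
  assumes U: "open U" "bounded U" and p: "p \<ge> 1"
  shows "Sob p U (indicator U :: 'a::euclidean_space \<Rightarrow> real) (\<lambda>x. 0)"
  unfolding Sob_def
proof (intro conjI allI impI)
  have Ul: "U \<in> lmeasurable" using U by (simp add: lmeasurable_open)
  have e: "(\<lambda>x. norm (indicator U x :: real) powr p) = indicator U"
    by (rule ext, case_tac "x \<in> U") simp_all
  show "integrable lebesgue (\<lambda>x. norm (indicator U x :: real) powr p)"
    unfolding e by (rule lmeasurable_iff_integrable[THEN iffD1, OF Ul])
  show "(indicator U :: 'a \<Rightarrow> real) \<in> borel_measurable lebesgue"
    using Ul by (intro borel_measurable_indicator) (auto simp: fmeasurableD)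
  fix \<phi> \<phi>' and b :: 'a assume \<phi>: "C1c U \<phi> \<phi>'" "b \<in> Basis"
  note P = C1c_props[OF \<phi>(1)]
  have out: "\<phi>' x = 0" if "x \<notin> U" for x using C1c_outside(2)[OF \<phi>(1), of x] P(4) that by blast
  have "(\<integral>x. indicator U x * (\<phi>' x \<bullet> b) \<partial>lebesgue) = (\<integral>x. \<phi>' x \<bullet> b \<partial>lebesgue)"
    by (rule Bochner_Integration.integral_cong[OF refl], case_tac "x \<in> U") (simp_all add: out)
  also have "\<dots> = (\<integral>x. \<phi>' x \<bullet> b \<partial>lborel)"
    using P(2) by (intro integral_completion) (auto intro!: borel_measurable_continuous_onI continuous_intros)
  also have "\<dots> = 0" by (rule integral_C1c_grad[of \<phi>]) (use \<phi> in \<open>auto simp: C1c_def\<close>)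
  finally show "(\<integral>x. indicator U x * (\<phi>' x \<bullet> b) \<partial>lebesgue) = - (\<integral>x. (0 \<bullet> b) * \<phi> x \<partial>lebesgue)" by simp
qed auto

lemma Sob_C1:
  assumes U: "open U" "bounded U" and p: "p \<ge> 1" and \<zeta>: "C1_grad \<zeta> \<zeta>'"
  shows "Sob p U (\<lambda>x. indicator U x * \<zeta> x) (\<lambda>x. indicator U x *\<^sub>R \<zeta>' x)"
  using Sob_mult[OF U p Sob_indicator[OF U p] \<zeta>] by (simp add: mult.commute)

text \<open>A tent on [0, 1] with height 2 at 1/2 and area 1; its primitive \<open>ramp\<close> is a
  C^1 step from 0 to 1. The tent is symmetric about 1/2, on which the cancellation in
  \<open>Sob_half\<close> depends.\<close>

definition ramp' :: "real \<Rightarrow> real" where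
  "ramp' s = 4 * (max 0 s - 2 * max 0 (s - 1/2) + max 0 (s - 1))"

definition ramp :: "real \<Rightarrow> real" where
  "ramp s = 2 * ((max 0 s)\<^sup>2 - 2 * (max 0 (s - 1/2))\<^sup>2 + (max 0 (s - 1))\<^sup>2)"

lemma DERIV_pos_part_square: "((\<lambda>s. (max 0 s)\<^sup>2) has_real_derivative 2 * max 0 s) (at (s::real))"
proof -
  consider "s > 0" | "s < 0" | "s = 0" by linarith
  then show ?thesis
  proof cases
    case 1
    have "\<forall>\<^sub>F t in nhds s. t \<in> {0<..}" using 1 by (intro eventually_nhds_in_open) auto
    then have ev: "\<forall>\<^sub>F t in nhds s. t\<^sup>2 = (max 0 t)\<^sup>2" by (rule eventually_mono) simp
    have "((\<lambda>t. t\<^sup>2) has_real_derivative 2 * max 0 s) (at s)"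
      using 1 by (auto intro!: derivative_eq_intros)
    then show ?thesis using DERIV_cong_ev[OF refl ev refl] by simp
  next
    case 2
    have "\<forall>\<^sub>F t in nhds s. t \<in> {..<0}" using 2 by (intro eventually_nhds_in_open) auto
    then have ev: "\<forall>\<^sub>F t in nhds s. 0 = (max 0 t)\<^sup>2" by (rule eventually_mono) simp
    have "((\<lambda>t. 0) has_real_derivative 2 * max 0 s) (at s)" using 2 by simp
    then show ?thesis using DERIV_cong_ev[OF refl ev refl] by simp
  next
    case 3
    have "((\<lambda>h::real. (max 0 h)\<^sup>2 / h) \<longlongrightarrow> 0) (at 0)"
    proof (rule Lim_null_comparison)
      have "norm ((max 0 h)\<^sup>2 / h) \<le> \<bar>h\<bar>" for h :: real
        by (auto simp: max_def power2_eq_square)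
      then show "\<forall>\<^sub>F h in at 0. norm ((max 0 h)\<^sup>2 / h) \<le> \<bar>h::real\<bar>" by simp
      show "((\<lambda>h. \<bar>h::real\<bar>) \<longlongrightarrow> 0) (at 0)" by (rule tendsto_rabs_zero) (rule tendsto_ident_at)
    qed
    then show ?thesis using 3 by (simp add: DERIV_def)
  qed
qed

lemma DERIV_ramp: "(ramp has_real_derivative ramp' s) (at s)"
proof -
  have D: "((\<lambda>s. (max 0 (s - c))\<^sup>2) has_real_derivative 2 * max 0 (s - c)) (at s)" for c
  proof -
    have "((\<lambda>s. s - c) has_real_derivative 1) (at s)" by (auto intro!: derivative_eq_intros)
    from DERIV_chain2[OF DERIV_pos_part_square this] show ?thesis by simp
  qed
  have "((\<lambda>s. 2 * ((max 0 (s - 0))\<^sup>2 - 2 * (max 0 (s - 1/2))\<^sup>2 + (max 0 (s - 1))\<^sup>2)) has_real_derivative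
      2 * (2 * max 0 (s - 0) - 2 * (2 * max 0 (s - 1/2)) + 2 * max 0 (s - 1))) (at s)"
    by (intro DERIV_cmult DERIV_add DERIV_diff D)
  then show ?thesis unfolding ramp_def ramp'_def by (simp add: algebra_simps)
qed

lemma continuous_ramp': "continuous_on UNIV ramp'"
  unfolding ramp'_def by (intro continuous_intros)

lemma ramp'_props: "0 \<le> ramp' s" "ramp' s \<le> 2" "s \<le> 0 \<Longrightarrow> ramp' s = 0" "s \<ge> 1 \<Longrightarrow> ramp' s = 0"
  "ramp' (1 - s) = ramp' s"
  unfolding ramp'_def by (auto simp: max_def)

lemma ramp_props: "s \<le> 0 \<Longrightarrow> ramp s = 0" "s \<ge> 1 \<Longrightarrow> ramp s = 1" "0 \<le> ramp s" "ramp s \<le> 1"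
  "s \<le> t \<Longrightarrow> ramp s \<le> ramp t" "0 < s \<Longrightarrow> 0 < ramp s"
proof -
  show 0: "ramp s = 0" if "s \<le> 0" for s using that by (simp add: ramp_def)
  show 1: "ramp s = 1" if "s \<ge> 1" for s using that by (simp add: ramp_def max_def power2_eq_square algebra_simps)
  show m: "ramp s \<le> ramp t" if "s \<le> t" for s t
    by (rule DERIV_nonneg_imp_nondecreasing[OF that]) (use DERIV_ramp ramp'_props(1) in blast)
  show "0 \<le> ramp s" using m[of 0 s] m[of s 0] 0[of s] 0[of 0] by (cases "s \<le> 0") auto
  show "ramp s \<le> 1" using m[of s 1] 1[of s] 1[of 1] by (cases "s \<le> 1") auto
  show "0 < ramp s" if "0 < s"
  proof -
    have "ramp (min s (1/2)) > 0" using that by (simp add: ramp_def)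
    then show ?thesis using m[of "min s (1/2)" s] by simp
  qed
qed

section \<open>Reflections across a coordinate hyperplane\<close>

definition reflect :: "'a::euclidean_space \<Rightarrow> 'a \<Rightarrow> 'a" where
  "reflect e x = x - (2 * (x \<bullet> e)) *\<^sub>R e"

lemma reflect_inner_Basis:
  "e \<in> Basis \<Longrightarrow> b \<in> Basis \<Longrightarrow> reflect e x \<bullet> b = (if b = e then -1 else 1) * (x \<bullet> b)"
  by (auto simp: reflect_def inner_diff_left inner_Basis)

lemma reflect_self_adjoint: "reflect e x \<bullet> y = x \<bullet> reflect e y"
  by (simp add: reflect_def inner_diff_left inner_diff_right inner_commute)

lemma reflect_reflect [simp]: "e \<in> Basis \<Longrightarrow> reflect e (reflect e x) = x"
  by (simp add: reflect_def inner_diff_left inner_Basis algebra_simps)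

lemma norm_reflect: "e \<in> Basis \<Longrightarrow> norm (reflect e x) = norm x"
  unfolding norm_eq_sqrt_inner by (simp add: reflect_self_adjoint)

lemma reflect_simps [simp]: "reflect e 0 = 0" "reflect e (- x) = - reflect e x"
  "reflect e (x + y) = reflect e x + reflect e y" "reflect e (c *\<^sub>R x) = c *\<^sub>R reflect e x"
  by (auto simp: reflect_def algebra_simps inner_add_left)

lemma has_derivative_reflect: "(reflect e has_derivative reflect e) (at x)"
  unfolding reflect_def[abs_def] by (auto intro!: derivative_eq_intros)

lemma continuous_on_reflect: "continuous_on S (reflect e)"
  unfolding reflect_def[abs_def] by (intro continuous_intros)

lemma lebesgue_reflect:
  assumes "e \<in> (Basis :: 'a::euclidean_space set)"
  shows "distr lebesgue lebesgue (reflect e) = lebesgue" "reflect e \<in> lebesgue \<rightarrow>\<^sub>M lebesgue"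
proof -
  define c where "c j = (if j = e then -1 else 1 :: real)" for j
  have c: "c j \<noteq> 0" for j by (simp add: c_def)
  have T: "reflect e = (\<lambda>x. 0 + (\<Sum>j\<in>Basis. (c j * (x \<bullet> j)) *\<^sub>R j))"
    by (auto simp: fun_eq_iff euclidean_eq_iff[where 'a='a] reflect_inner_Basis[OF assms] c_def)
  have pr: "(\<Prod>j\<in>(Basis :: 'a set). \<bar>c j\<bar>) = 1" by (rule prod.neutral) (simp add: c_def)
  show "distr lebesgue lebesgue (reflect e) = lebesgue"
    using lebesgue_affine_euclidean[of c "0 :: 'a"] c unfolding T pr by (simp add: density_1)
  show "reflect e \<in> lebesgue \<rightarrow>\<^sub>M lebesgue"
    unfolding T by (rule lebesgue_affine_measurable) (rule c)
qed

lemma integral_reflect: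
  fixes f :: "'a::euclidean_space \<Rightarrow> 'b::euclidean_space"
  assumes "e \<in> Basis" "f \<in> borel_measurable lebesgue"
  shows "(\<integral>x. f (reflect e x) \<partial>lebesgue) = integral\<^sup>L lebesgue f"
    "integrable lebesgue (\<lambda>x. f (reflect e x)) = integrable lebesgue f"
    "(\<lambda>x. f (reflect e x)) \<in> borel_measurable lebesgue"
proof -
  note l = lebesgue_reflect[OF assms(1)]
  show "(\<integral>x. f (reflect e x) \<partial>lebesgue) = integral\<^sup>L lebesgue f"
    using integral_distr[OF l(2) assms(2)] by (simp add: l(1))
  show "integrable lebesgue (\<lambda>x. f (reflect e x)) = integrable lebesgue f"
    using integrable_distr_eq[OF l(2) assms(2)] by (simp add: l(1))
  show "(\<lambda>x. f (reflect e x)) \<in> borel_measurable lebesgue"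
    by (rule measurable_compose[OF l(2) assms(2)])
qed

lemma C1_grad_reflect:
  assumes "C1_grad f f'" shows "C1_grad (\<lambda>x. f (reflect e x)) (\<lambda>x. reflect e (f' (reflect e x)))"
proof -
  have "((\<lambda>x. f (reflect e x)) has_derivative (\<lambda>h. h \<bullet> reflect e (f' (reflect e x)))) (at x)" for x
  proof -
    have "(f has_derivative (\<lambda>h. h \<bullet> f' (reflect e x))) (at (reflect e x))"
      using assms by (simp add: C1_grad_def gderiv_def)
    from has_derivative_compose[OF has_derivative_reflect this]
    show ?thesis by (simp add: reflect_self_adjoint)
  qed
  moreover have "continuous_on UNIV (\<lambda>x. reflect e (f' (reflect e x)))"
  proof -
    have "continuous_on UNIV (\<lambda>x. f' (reflect e x))"
      by (rule continuous_on_compose2[of UNIV f', OF _ continuous_on_reflect]) (use assms in \<open>auto simp: C1_grad_def\<close>)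
    then show ?thesis by (intro continuous_on_compose2[OF continuous_on_reflect]) auto
  qed
  ultimately show ?thesis by (simp add: C1_grad_def gderiv_def)
qed

lemma C1c_reflect:
  assumes "C1c U f f'" "e \<in> Basis" "\<And>x. x \<in> U \<Longrightarrow> reflect e x \<in> U"
  shows "C1c U (\<lambda>x. f (reflect e x)) (\<lambda>x. reflect e (f' (reflect e x)))"
proof -
  let ?K = "closure {x. f x \<noteq> 0}"
  have K: "compact ?K" "?K \<subseteq> U" using assms by (auto simp: C1c_def)
  have cK: "compact (reflect e ` ?K)" by (intro compact_continuous_image continuous_on_reflect K)
  have "x \<in> reflect e ` ?K" if "f (reflect e x) \<noteq> 0" for x
  proof -
    have "reflect e x \<in> ?K" using that closure_subset[of "{x. f x \<noteq> 0}"] by blast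
    then have "reflect e (reflect e x) \<in> reflect e ` ?K" by blast
    then show ?thesis using assms(2) by simp
  qed
  then have cl: "closure {x. f (reflect e x) \<noteq> 0} \<subseteq> reflect e ` ?K"
    by (intro closure_minimal compact_imp_closed[OF cK]) blast
  moreover have "compact (closure {x. f (reflect e x) \<noteq> 0})"
    using bounded_subset[OF compact_imp_bounded[OF cK] cl] by (simp add: compact_eq_bounded_closed)
  moreover have "reflect e ` ?K \<subseteq> U" using K assms(3) by blast
  ultimately show ?thesis using assms C1_grad_reflect unfolding C1c_def by blast
qed

lemma Sob_reflect:
  assumes S: "Sob p U u g" and e: "e \<in> Basis" and U: "\<And>x. x \<in> U \<Longrightarrow> reflect e x \<in> U"
  shows "Sob p U (\<lambda>x. u (reflect e x)) (\<lambda>x. reflect e (g (reflect e x)))"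
proof -
  have Sp: "u \<in> borel_measurable lebesgue" "g \<in> borel_measurable lebesgue"
    "\<And>x. x \<notin> U \<Longrightarrow> u x = 0" "\<And>x. x \<notin> U \<Longrightarrow> g x = 0"
    "integrable lebesgue (\<lambda>x. norm (u x) powr p)" "integrable lebesgue (\<lambda>x. norm (g x) powr p)"
    using S by (auto simp: Sob_def)
  have [measurable]: "u \<in> borel_measurable lebesgue" "g \<in> borel_measurable lebesgue" by (fact Sp)+
  have U': "reflect e x \<notin> U" if "x \<notin> U" for x using U[of "reflect e x"] that e by auto
  have rm: "reflect e \<in> borel_measurable borel"
    by (intro borel_measurable_continuous_onI continuous_on_reflect)
  show ?thesis unfolding Sob_def
  proof (intro conjI allI impI)
    show "(\<lambda>x. u (reflect e x)) \<in> borel_measurable lebesgue" by (rule integral_reflect(3)[OF e Sp(1)])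
    show "(\<lambda>x. reflect e (g (reflect e x))) \<in> borel_measurable lebesgue"
      by (rule measurable_compose[OF integral_reflect(3)[OF e Sp(2)] rm])
    show "integrable lebesgue (\<lambda>x. norm (u (reflect e x)) powr p)"
      using integral_reflect(2)[OF e, of "\<lambda>x. norm (u x) powr p"] Sp(5) by simp
    show "integrable lebesgue (\<lambda>x. norm (reflect e (g (reflect e x))) powr p)"
      using integral_reflect(2)[OF e, of "\<lambda>x. norm (g x) powr p"] Sp(6) by (simp add: norm_reflect[OF e])
    fix x assume "x \<notin> U"
    then show "u (reflect e x) = 0" "reflect e (g (reflect e x)) = 0" using Sp(3,4) U' by auto
  next
    fix \<phi> \<phi>' and b :: 'a assume \<phi>: "C1c U \<phi> \<phi>'" "b \<in> Basis"
    define s where "s = (if b = e then -1 else 1 :: real)"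
    have rb: "reflect e y \<bullet> b = s * (y \<bullet> b)" for y
      using reflect_inner_Basis[OF e \<phi>(2), of y] by (simp add: s_def)
    have ss: "s * s = 1" by (simp add: s_def)
    note P = C1c_props[OF \<phi>(1)]
    note c = C1c_reflect[OF \<phi>(1) e U]
    note Pc = C1c_props[OF c]
    have [measurable]: "(\<lambda>x. \<phi>' (reflect e x)) \<in> borel_measurable lebesgue" "(\<lambda>x. \<phi> (reflect e x)) \<in> borel_measurable lebesgue"
      using integral_reflect(3)[OF e] P(5,6) by auto
    have "(\<integral>x. u (reflect e x) * (\<phi>' x \<bullet> b) \<partial>lebesgue) = (\<integral>x. u x * (\<phi>' (reflect e x) \<bullet> b) \<partial>lebesgue)"
      using integral_reflect(1)[OF e, of "\<lambda>x. u x * (\<phi>' (reflect e x) \<bullet> b)"] by (simp add: e)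
    also have "\<dots> = (\<integral>x. s * (u x * (reflect e (\<phi>' (reflect e x)) \<bullet> b)) \<partial>lebesgue)"
      unfolding rb by (intro Bochner_Integration.integral_cong) (auto simp: s_def)
    also have "\<dots> = s * (\<integral>x. u x * (reflect e (\<phi>' (reflect e x)) \<bullet> b) \<partial>lebesgue)" by simp
    also have "\<dots> = - (\<integral>x. s * ((g x \<bullet> b) * \<phi> (reflect e x)) \<partial>lebesgue)"
      using Sob_weak[OF S c \<phi>(2)] by simp
    also have "(\<integral>x. s * ((g x \<bullet> b) * \<phi> (reflect e x)) \<partial>lebesgue) = (\<integral>x. s * ((g (reflect e x) \<bullet> b) * \<phi> x) \<partial>lebesgue)"
      using integral_reflect(1)[OF e, symmetric, of "\<lambda>x. s * ((g x \<bullet> b) * \<phi> (reflect e x))"] by (simp add: e)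
    also have "\<dots> = (\<integral>x. (reflect e (g (reflect e x)) \<bullet> b) * \<phi> x \<partial>lebesgue)"
      unfolding rb by (simp add: mult.assoc)
    finally show "(\<integral>x. u (reflect e x) * (\<phi>' x \<bullet> b) \<partial>lebesgue) = - (\<integral>x. (reflect e (g (reflect e x)) \<bullet> b) * \<phi> x \<partial>lebesgue)" .
  qed
qed

lemma inner_measurable_lebesgue [measurable]: "(\<lambda>x::'a::euclidean_space. x \<bullet> e) \<in> borel_measurable lebesgue"
  by (rule measurable_completion) simp

lemma C1_grad_linear_compose:
  assumes "\<And>s. (G has_real_derivative G' s) (at s)" "continuous_on UNIV G'"
  shows "C1_grad (\<lambda>x. G (c * (x \<bullet> e) + d)) (\<lambda>x. (G' (c * (x \<bullet> e) + d) * c) *\<^sub>R e)"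
proof -
  have "C1_grad (\<lambda>x. c * (x \<bullet> e) + d) (\<lambda>x. c *\<^sub>R e)"
    unfolding C1_grad_def gderiv_def by (auto intro!: derivative_eq_intros continuous_intros)
  from C1_grad_compose[OF this assms] show ?thesis by simp
qed

lemma C1c_Lipschitz:
  assumes "C1c U \<phi> \<phi>'" "\<And>x. norm (\<phi>' x) \<le> B"
  shows "\<bar>\<phi> x - \<phi> y\<bar> \<le> B * norm (x - y)"
proof -
  obtain t where "\<phi> x - \<phi> y = (x - y) \<bullet> \<phi>' (y + t *\<^sub>R (x - y))"
    using C1_grad_mvt assms(1) unfolding C1c_def by metis
  then have "\<bar>\<phi> x - \<phi> y\<bar> \<le> norm (x - y) * norm (\<phi>' (y + t *\<^sub>R (x - y)))"
    by (simp only: Cauchy_Schwarz_ineq2)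
  also have "\<dots> \<le> norm (x - y) * B" by (intro mult_left_mono assms) simp
  finally show ?thesis by (simp add: mult.commute)
qed

text \<open>Cutting with \<open>ramp\<close> in the layer \<open>\<bar>x \<bullet> e\<bar> \<le> 1/k\<close> produces the term
  \<open>k \<integral> w \<phi> ramp'\<close>. Since \<open>w\<close> is odd and the cut-off has an even derivative, only the odd part of
  \<open>\<phi>\<close>, which is \<open>O(1/k)\<close> there, contributes.\<close>

lemma Sob_half:
  fixes w :: "'a::euclidean_space \<Rightarrow> real"
  assumes U: "open U" "bounded U" "\<And>x. x \<in> U \<Longrightarrow> reflect e x \<in> U" and p: "p \<ge> 1"
    and S: "Sob p U w g" and e: "e \<in> Basis" and odd: "\<And>x. w (reflect e x) = - w x"
  shows "Sob p U (\<lambda>x. if x \<bullet> e > 0 then w x else 0) (\<lambda>x. if x \<bullet> e > 0 then g x else 0)"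
proof -
  have Sp: "w \<in> borel_measurable lebesgue" "g \<in> borel_measurable lebesgue"
    "\<And>x. x \<notin> U \<Longrightarrow> w x = 0" "\<And>x. x \<notin> U \<Longrightarrow> g x = 0"
    "integrable lebesgue (\<lambda>x. norm (w x) powr p)" "integrable lebesgue (\<lambda>x. norm (g x) powr p)"
    using S by (auto simp: Sob_def)
  have [measurable]: "w \<in> borel_measurable lebesgue" "g \<in> borel_measurable lebesgue" by (fact Sp)+
  have p0: "p \<ge> 0" using p by simp
  have w0: "w x = 0" if "x \<bullet> e = 0" for x
  proof -
    have "reflect e x = x" using that by (simp add: reflect_def)
    then show ?thesis using odd[of x] by simp
  qed
  have ne: "AE x in lebesgue. x \<bullet> e \<noteq> 0"
  proof -
    have "e \<noteq> 0" using e nonzero_Basis by blast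
    then have "negligible {x. e \<bullet> x = 0}" by (intro negligible_hyperplane) simp
    then have "{x. e \<bullet> x = 0} \<in> null_sets lebesgue" by (simp add: negligible_iff_null_sets)
    then have "AE x in lebesgue. x \<notin> {x. e \<bullet> x = 0}" by (rule AE_not_in)
    then show ?thesis by (simp add: inner_commute)
  qed
  have ee: "e \<bullet> e = 1" using e by (simp add: inner_Basis)
  show ?thesis unfolding Sob_def
  proof (intro conjI allI impI)
    show "integrable lebesgue (\<lambda>x. norm (if x \<bullet> e > 0 then w x else 0) powr p)"
      by (rule integrable_powr_bounded_mult[OF p0 Sp(5), of _ 1]) auto
    show "integrable lebesgue (\<lambda>x. norm (if x \<bullet> e > 0 then g x else 0) powr p)"
      by (rule integrable_powr_bounded_mult[OF p0 Sp(6), of _ 1]) auto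
    fix \<phi> \<phi>' and b :: 'a assume \<phi>: "C1c U \<phi> \<phi>'" "b \<in> Basis"
    note P = C1c_props[OF \<phi>(1)]
    have [measurable]: "\<phi> \<in> borel_measurable lebesgue" "\<phi>' \<in> borel_measurable lebesgue" by (fact P)+
    obtain B where B: "B > 0" "\<And>x. norm (\<phi> x) \<le> B" "\<And>x. norm (\<phi>' x) \<le> B"
      by (rule C1c_bounded[OF \<phi>(1)]) blast
    note iw = Sob_integrable[OF S U(1,2) p]
    define k where "k n = real n + 1" for n
    have kpos: "k n > 0" for n by (simp add: k_def)
    \<comment> \<open>The step rises across |x \<bullet> e| \<le> 1 / k and is centred at the
      hyperplane, so that its derivative, governed by \<open>q\<close>, is even.\<close>
    define \<kappa> where "\<kappa> n x = ramp (k n / 2 * (x \<bullet> e) + 1/2)" for n x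
    define q where "q n x = ramp' (k n / 2 * (x \<bullet> e) + 1/2)" for n x
    have qprops: "0 \<le> q n x" "q n x \<le> 2" "\<bar>x \<bullet> e\<bar> > 1 / k n \<Longrightarrow> q n x = 0" "q n (reflect e x) = q n x" for n x
    proof -
      show "0 \<le> q n x" "q n x \<le> 2" using ramp'_props by (auto simp: q_def)
      have r: "reflect e x \<bullet> e = - (x \<bullet> e)" using reflect_inner_Basis[OF e e] by simp
      show "q n (reflect e x) = q n x"
        using ramp'_props(5)[of "k n / 2 * (x \<bullet> e) + 1/2"] by (simp add: q_def r)
      assume "\<bar>x \<bullet> e\<bar> > 1 / k n"
      then have "1 < \<bar>x \<bullet> e\<bar> * k n" using kpos[of n] by (simp add: field_simps)
      then have "k n / 2 * (x \<bullet> e) + 1/2 \<le> 0 \<or> k n / 2 * (x \<bullet> e) + 1/2 \<ge> 1"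
        by (auto simp: abs_if mult.commute split: if_splits)
      then show "q n x = 0" using ramp'_props by (auto simp: q_def)
    qed
    have rm: "ramp \<in> borel_measurable borel" "ramp' \<in> borel_measurable borel"
      using continuous_ramp' DERIV_isCont[OF DERIV_ramp]
      by (auto intro!: borel_measurable_continuous_onI simp: continuous_on_eq_continuous_at)
    have [measurable]: "\<kappa> n \<in> borel_measurable lebesgue" "q n \<in> borel_measurable lebesgue" for n
      unfolding \<kappa>_def q_def by (rule measurable_compose[OF _ rm(1)] measurable_compose[OF _ rm(2)], measurable)+
    have \<kappa>01: "0 \<le> \<kappa> n x" "\<kappa> n x \<le> 1" for n x using ramp_props by (auto simp: \<kappa>_def)
    have C: "C1_grad (\<kappa> n) (\<lambda>x. (q n x * (k n / 2)) *\<^sub>R e)" for n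
      unfolding \<kappa>_def q_def by (rule C1_grad_linear_compose[OF DERIV_ramp continuous_ramp'])
    note c = C1_grad_mult_C1c[OF C \<phi>(1)]
    have \<kappa>lim: "(\<lambda>n. \<kappa> n x) \<longlonglongrightarrow> (if x \<bullet> e > 0 then 1 else 0)" if "x \<bullet> e \<noteq> 0" for x
    proof -
      have "\<forall>\<^sub>F n in sequentially. k n > 1 / \<bar>x \<bullet> e\<bar>" unfolding k_def by real_asymp
      then have "\<forall>\<^sub>F n in sequentially. \<kappa> n x = (if x \<bullet> e > 0 then 1 else 0)"
      proof eventually_elim
        case (elim n)
        then have "1 < k n * \<bar>x \<bullet> e\<bar>" using that by (simp add: field_simps)
        then show ?case using that ramp_props(1,2)[of "k n / 2 * (x \<bullet> e) + 1/2"]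
          by (auto simp: \<kappa>_def abs_if split: if_splits)
      qed
      then show ?thesis by (rule tendsto_eventually)
    qed
    have ib: "integrable lebesgue (\<lambda>x. w x * (\<phi>' x \<bullet> b))" "integrable lebesgue (\<lambda>x. (g x \<bullet> b) * \<phi> x)"
      using Sob_weak_integrable[OF S \<phi>(1) U(1,2) p] by auto
    have LA: "(\<lambda>n. \<integral>x. \<kappa> n x * (w x * (\<phi>' x \<bullet> b)) \<partial>lebesgue)
       \<longlonglongrightarrow> (\<integral>x. (if x \<bullet> e > 0 then w x else 0) * (\<phi>' x \<bullet> b) \<partial>lebesgue)"
    proof (rule integral_dominated_convergence[where w = "\<lambda>x. \<bar>w x * (\<phi>' x \<bullet> b)\<bar>"])
      show "AE x in lebesgue. (\<lambda>n. \<kappa> n x * (w x * (\<phi>' x \<bullet> b))) \<longlonglongrightarrow> (if x \<bullet> e > 0 then w x else 0) * (\<phi>' x \<bullet> b)"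
        using ne
      proof eventually_elim
        case (elim x)
        from tendsto_mult[OF \<kappa>lim[OF elim] tendsto_const[of "w x * (\<phi>' x \<bullet> b)"]]
        show ?case by (cases "x \<bullet> e > 0") auto
      qed
      show "AE x in lebesgue. norm (\<kappa> n x * (w x * (\<phi>' x \<bullet> b))) \<le> \<bar>w x * (\<phi>' x \<bullet> b)\<bar>" for n
        using \<kappa>01 by (intro AE_I2) (auto simp: abs_mult mult_left_le_one_le)
    qed (use ib in auto)
    have LC: "(\<lambda>n. \<integral>x. \<kappa> n x * ((g x \<bullet> b) * \<phi> x) \<partial>lebesgue)
       \<longlonglongrightarrow> (\<integral>x. ((if x \<bullet> e > 0 then g x else 0) \<bullet> b) * \<phi> x \<partial>lebesgue)"
    proof (rule integral_dominated_convergence[where w = "\<lambda>x. \<bar>(g x \<bullet> b) * \<phi> x\<bar>"])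
      show "AE x in lebesgue. (\<lambda>n. \<kappa> n x * ((g x \<bullet> b) * \<phi> x)) \<longlonglongrightarrow> ((if x \<bullet> e > 0 then g x else 0) \<bullet> b) * \<phi> x"
        using ne
      proof eventually_elim
        case (elim x)
        from tendsto_mult[OF \<kappa>lim[OF elim] tendsto_const[of "(g x \<bullet> b) * \<phi> x"]]
        show ?case by (cases "x \<bullet> e > 0") auto
      qed
      show "AE x in lebesgue. norm (\<kappa> n x * ((g x \<bullet> b) * \<phi> x)) \<le> \<bar>(g x \<bullet> b) * \<phi> x\<bar>" for n
        using \<kappa>01 by (intro AE_I2) (auto simp: abs_mult mult_left_le_one_le)
    qed (use ib in auto)
    define I where "I n = (\<integral>x. w x * \<phi> x * q n x \<partial>lebesgue)" for n
    have iI: "integrable lebesgue (\<lambda>x. w x * \<phi> x * q n x)" for n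
    proof -
      have "\<bar>\<phi> x * q n x\<bar> \<le> B * 2" for x
        unfolding abs_mult using B(2)[of x] qprops(1,2)[of n x] by (intro mult_mono) auto
      from integrable_mult_bounded_real(2)[OF iw(1) _ this] show ?thesis by (simp add: mult.assoc)
    qed
    have LJ: "(\<lambda>n. \<integral>x. \<bar>w x\<bar> * indicator {x. \<bar>x \<bullet> e\<bar> \<le> 1 / k n} x \<partial>lebesgue) \<longlonglongrightarrow> (\<integral>x. 0 \<partial>(lebesgue :: 'a measure))"
    proof (rule integral_dominated_convergence[where w = "\<lambda>x. \<bar>w x\<bar>"])
      show "AE x in lebesgue. (\<lambda>n. \<bar>w x\<bar> * indicator {x. \<bar>x \<bullet> e\<bar> \<le> 1 / k n} x) \<longlonglongrightarrow> 0"
      proof (rule AE_I2)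
        fix x
        show "(\<lambda>n. \<bar>w x\<bar> * indicator {x. \<bar>x \<bullet> e\<bar> \<le> 1 / k n} x) \<longlonglongrightarrow> 0"
        proof (cases "x \<bullet> e = 0")
          case False
          have "\<forall>\<^sub>F n in sequentially. k n > 1 / \<bar>x \<bullet> e\<bar>" unfolding k_def by real_asymp
          then have "\<forall>\<^sub>F n in sequentially. \<bar>w x\<bar> * indicator {x. \<bar>x \<bullet> e\<bar> \<le> 1 / k n} x = 0"
          proof eventually_elim
            case (elim n)
            then have "\<not> \<bar>x \<bullet> e\<bar> \<le> 1 / k n" using False kpos[of n] by (simp add: field_simps)
            then show ?case by simp
          qed
          then show ?thesis by (rule tendsto_eventually)
        qed (simp add: w0)
      qed
    qed (use iw in \<open>auto simp: indicator_def\<close>)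
    have Ib: "\<bar>I n * (k n / 2) * (e \<bullet> b)\<bar> \<le> 2 * B * (\<integral>x. \<bar>w x\<bar> * indicator {x. \<bar>x \<bullet> e\<bar> \<le> 1 / k n} x \<partial>lebesgue)" for n
    proof -
      let ?J = "\<lambda>x. \<bar>w x\<bar> * indicator {x. \<bar>x \<bullet> e\<bar> \<le> 1 / k n} x"
      have ij: "integrable lebesgue ?J"
        using iw(1) by (intro integrable_mult_bounded_real(2)[of _ _ _ 1]) (auto simp: indicator_def)
      have [measurable]: "(\<lambda>x. \<phi> (reflect e x)) \<in> borel_measurable lebesgue"
        by (rule integral_reflect(3)[OF e]) measurable
      have i2: "integrable lebesgue (\<lambda>x. - w x * \<phi> (reflect e x) * q n x)"
        using integral_reflect(2)[OF e, of "\<lambda>x. w x * \<phi> x * q n x"] iI[of n] by (simp add: odd qprops)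
      have "I n = (\<integral>x. - w x * \<phi> (reflect e x) * q n x \<partial>lebesgue)"
        unfolding I_def using integral_reflect(1)[OF e, symmetric, of "\<lambda>x. w x * \<phi> x * q n x"] by (simp add: odd qprops)
      \<comment> \<open>Adding the reflected integral replaces \<phi>(x) by the difference of \<phi>
        at x and at its mirror image, at most 2 B / k in the layer. This cancels the factor k from
        the slope of the cut-off, and the mass of \<open>w\<close> in the shrinking layer tends to
        0.\<close>
      then have "I n + I n = (\<integral>x. w x * \<phi> x * q n x + - w x * \<phi> (reflect e x) * q n x \<partial>lebesgue)"
        using iI[of n] i2 by (subst Bochner_Integration.integral_add) (simp_all add: I_def)
      also have "\<bar>\<dots>\<bar> \<le> (\<integral>x. (4 * B / k n) * ?J x \<partial>lebesgue)"
      proof (rule integral_abs_bound[THEN order_trans], rule integral_mono')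
        show "integrable lebesgue (\<lambda>x. (4 * B / k n) * ?J x)" using ij by (rule integrable_mult_right)
        fix x
        show "0 \<le> (4 * B / k n) * ?J x" using B(1) kpos[of n] by auto
        show "\<bar>w x * \<phi> x * q n x + - w x * \<phi> (reflect e x) * q n x\<bar> \<le> (4 * B / k n) * ?J x"
        proof (cases "\<bar>x \<bullet> e\<bar> \<le> 1 / k n")
          case True
          have "\<bar>\<phi> x - \<phi> (reflect e x)\<bar> \<le> B * norm (x - reflect e x)" by (rule C1c_Lipschitz[OF \<phi>(1) B(3)])
          also have "norm (x - reflect e x) = 2 * \<bar>x \<bullet> e\<bar>" using e by (simp add: reflect_def)
          also have "B * (2 * \<bar>x \<bullet> e\<bar>) \<le> B * (2 * (1 / k n))" using True B(1) by (intro mult_left_mono) auto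
          finally have "\<bar>\<phi> x - \<phi> (reflect e x)\<bar> * q n x \<le> (B * (2 * (1 / k n))) * 2"
            using qprops(1,2)[of n x] B(1) kpos[of n] by (intro mult_mono) auto
          then have "\<bar>w x\<bar> * (\<bar>\<phi> x - \<phi> (reflect e x)\<bar> * q n x) \<le> \<bar>w x\<bar> * ((B * (2 * (1 / k n))) * 2)"
            by (rule mult_left_mono) simp
          moreover have "w x * \<phi> x * q n x + - w x * \<phi> (reflect e x) * q n x = w x * ((\<phi> x - \<phi> (reflect e x)) * q n x)"
            by (simp add: algebra_simps)
          ultimately show ?thesis using True qprops(1)[of n x] by (simp add: abs_mult mult_ac)
        next
          case False
          then have "q n x = 0" by (intro qprops(3)) simp
          then show ?thesis using False by simp
        qed
      qed
      also have "\<dots> = (4 * B / k n) * integral\<^sup>L lebesgue ?J" by simp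
      finally have "\<bar>I n\<bar> \<le> (2 * B / k n) * integral\<^sup>L lebesgue ?J" by simp
      then have "\<bar>I n\<bar> * (k n / 2) \<le> (2 * B / k n) * integral\<^sup>L lebesgue ?J * (k n / 2)"
        using kpos[of n] by (intro mult_right_mono) auto
      also have "\<dots> = B * integral\<^sup>L lebesgue ?J" using kpos[of n] by (simp add: field_simps)
      finally have "\<bar>I n\<bar> * (k n / 2) \<le> B * integral\<^sup>L lebesgue ?J" .
      moreover have "\<bar>e \<bullet> b\<bar> \<le> 1" using e \<phi>(2) by (simp add: inner_Basis)
      moreover have "0 \<le> integral\<^sup>L lebesgue ?J" by (rule integral_nonneg_AE) simp
      ultimately have "\<bar>I n\<bar> * (k n / 2) * \<bar>e \<bullet> b\<bar> \<le> B * integral\<^sup>L lebesgue ?J * 1"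
        using B(1) by (intro mult_mono[of _ _ "\<bar>e \<bullet> b\<bar>" 1]) auto
      also have "\<dots> \<le> 2 * B * integral\<^sup>L lebesgue ?J" using B(1) \<open>0 \<le> integral\<^sup>L lebesgue ?J\<close> by simp
      finally show ?thesis using kpos[of n] by (simp add: abs_mult)
    qed
    have LB: "(\<lambda>n. I n * (k n / 2) * (e \<bullet> b)) \<longlonglongrightarrow> 0"
      by (rule Lim_null_comparison[OF _ tendsto_mult_right_zero[of _ _ "2 * B"]]) (use Ib LJ in auto)
    have id: "(\<integral>x. \<kappa> n x * (w x * (\<phi>' x \<bullet> b)) \<partial>lebesgue) + I n * (k n / 2) * (e \<bullet> b)
        = - (\<integral>x. \<kappa> n x * ((g x \<bullet> b) * \<phi> x) \<partial>lebesgue)" for n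
    proof -
      have i1: "integrable lebesgue (\<lambda>x. \<kappa> n x * (w x * (\<phi>' x \<bullet> b)))"
        by (rule integrable_mult_bounded_real(1)[OF ib(1), of "\<kappa> n" 1]) (use \<kappa>01 in auto)
      have "(\<integral>x. \<kappa> n x * (w x * (\<phi>' x \<bullet> b)) \<partial>lebesgue) + I n * (k n / 2) * (e \<bullet> b)
        = (\<integral>x. \<kappa> n x * (w x * (\<phi>' x \<bullet> b)) + (w x * \<phi> x * q n x) * (k n / 2 * (e \<bullet> b)) \<partial>lebesgue)"
      proof -
        have "(\<integral>x. (w x * \<phi> x * q n x) * (k n / 2 * (e \<bullet> b)) \<partial>lebesgue) = I n * (k n / 2 * (e \<bullet> b))"
          unfolding I_def by (rule integral_mult_left_zero)
        then show ?thesis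
          by (simp only: Bochner_Integration.integral_add[OF i1 integrable_mult_left[OF iI]] mult.assoc[of "I n"])
      qed
      also have "\<dots> = (\<integral>x. w x * ((\<kappa> n x *\<^sub>R \<phi>' x + \<phi> x *\<^sub>R (q n x * (k n / 2)) *\<^sub>R e) \<bullet> b) \<partial>lebesgue)"
        by (intro Bochner_Integration.integral_cong) (auto simp: inner_add_left algebra_simps)
      also have "\<dots> = - (\<integral>x. (g x \<bullet> b) * (\<kappa> n x * \<phi> x) \<partial>lebesgue)"
        by (rule Sob_weak[OF S c \<phi>(2)])
      finally show ?thesis by (simp add: mult_ac)
    qed
    have "(\<lambda>n. (\<integral>x. \<kappa> n x * (w x * (\<phi>' x \<bullet> b)) \<partial>lebesgue) + I n * (k n / 2) * (e \<bullet> b))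
       \<longlonglongrightarrow> (\<integral>x. (if x \<bullet> e > 0 then w x else 0) * (\<phi>' x \<bullet> b) \<partial>lebesgue) + 0"
      by (rule tendsto_add[OF LA LB])
    from LIMSEQ_unique[OF this[unfolded id] tendsto_minus[OF LC]]
    show "(\<integral>x. (if x \<bullet> e > 0 then w x else 0) * (\<phi>' x \<bullet> b) \<partial>lebesgue)
       = - (\<integral>x. ((if x \<bullet> e > 0 then g x else 0) \<bullet> b) * \<phi> x \<partial>lebesgue)" by simp
  qed (use Sp in auto)
qed

text \<open>Small values are at most \<open>d\<close>, and for a > d the factor (a / d)^(p - 1) is
  at least 1. Integrated over a set of finite measure, it takes the place of Hoelder's inequality in
  \<open>Lp_tendsto_zero_imp_L1\<close>.\<close>

lemma powr_young:
  assumes "p \<ge> 1" "d > 0" "a \<ge> (0::real)"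
  shows "a \<le> d + d powr (1 - p) * a powr p"
proof (cases "a \<le> d")
  case True
  then show ?thesis using assms by (intro add_increasing2) auto
next
  case False
  then have "a = a powr (1 - p) * a powr p" using assms by (simp add: powr_add[symmetric])
  also have "\<dots> \<le> d powr (1 - p) * a powr p"
    using False assms by (intro mult_right_mono powr_mono2') auto
  finally show ?thesis using assms by linarith
qed

lemma Lp_AE_subseq:
  fixes f :: "nat \<Rightarrow> 'a \<Rightarrow> 'b::euclidean_space"
  assumes "p > 0" "\<And>n. integrable M (\<lambda>x. norm (f n x) powr p)"
    "(\<lambda>n. \<integral>x. norm (f n x) powr p \<partial>M) \<longlonglongrightarrow> 0"
  obtains r where "strict_mono r" "AE x in M. (\<lambda>n. f (r n) x) \<longlonglongrightarrow> 0"
proof -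
  have "(\<lambda>n. \<integral>x. norm (norm (f n x) powr p) \<partial>M) \<longlonglongrightarrow> 0" using assms(3) by simp
  from tendsto_L1_AE_subseq[OF assms(2) this] obtain r where
    r: "strict_mono r" "AE x in M. (\<lambda>n. norm (f (r n) x) powr p) \<longlonglongrightarrow> 0" by blast
  have "AE x in M. (\<lambda>n. f (r n) x) \<longlonglongrightarrow> 0"
    using r(2)
  proof eventually_elim
    case (elim x)
    have "(\<lambda>n. (norm (f (r n) x) powr p) powr (1/p)) \<longlonglongrightarrow> 0 powr (1/p)"
      by (rule tendsto_powr'[OF elim tendsto_const]) (use assms(1) in auto)
    then have "(\<lambda>n. norm (f (r n) x)) \<longlonglongrightarrow> 0" using assms(1) by (simp add: powr_powr)
    then show ?case by (rule tendsto_norm_zero_cancel)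
  qed
  then show ?thesis using that r(1) by blast
qed

section \<open>The monotone vector field of the p-Laplacian\<close>

definition pfield :: "real \<Rightarrow> 'a::real_inner \<Rightarrow> 'a" where
  "pfield p a = norm a powr (p - 2) *\<^sub>R a"

lemma norm_pfield: "norm (pfield p a) = norm a powr (p - 1)"
proof (cases "a = 0")
  case False
  then have "norm a powr (p - 2) * norm a powr 1 = norm a powr (p - 2 + 1)" by (simp only: powr_add)
  then show ?thesis using False by (simp add: pfield_def)
qed (simp add: pfield_def)

lemma pfield_inner_self: "pfield p a \<bullet> a = norm a powr p"
proof (cases "a = 0")
  case False
  then have "norm a powr (p - 2) * norm a powr 2 = norm a powr (p - 2 + 2)" by (simp only: powr_add)
  then show ?thesis using False by (simp add: pfield_def dot_square_norm)
qed (simp add: pfield_def)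

text \<open>A crude Young inequality: in |a|^(p - 1) |b| the larger of the two norms replaces the
  smaller one. It serves for integrability.\<close>

lemma pfield_inner_bound:
  assumes "p > 1"
  shows "\<bar>pfield p a \<bullet> b\<bar> \<le> norm a powr p + norm b powr p"
proof -
  have "\<bar>pfield p a \<bullet> b\<bar> \<le> norm a powr (p - 1) * norm b"
    using Cauchy_Schwarz_ineq2[of "pfield p a" b] by (simp add: norm_pfield)
  also have "\<dots> \<le> norm a powr p + norm b powr p"
  proof (cases "norm b \<le> norm a")
    case True
    then have "norm a powr (p - 1) * norm b \<le> norm a powr (p - 1) * norm a" by (intro mult_left_mono) auto
    also have "\<dots> = norm a powr p" by (cases "a = 0") (auto simp: powr_diff)
    finally show ?thesis by (simp add: add_increasing2)
  next
    case False
    then have "norm a powr (p - 1) * norm b \<le> norm b powr (p - 1) * norm b"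
      using assms by (intro mult_right_mono powr_mono2) auto
    also have "\<dots> = norm b powr p" by (cases "b = 0") (auto simp: powr_diff)
    finally show ?thesis by (simp add: add_increasing)
  qed
  finally show ?thesis .
qed

text \<open>Writing A for the field, the product equals (|a|^(p - 1) - |b|^(p - 1)) (|a| - |b|) plus
  the two Cauchy-Schwarz defects |a|^(p - 1) |b| - A(a) \<bullet> b and |b|^(p - 1) |a| - A(b)
  \<bullet> a, all nonnegative. If the sum is 0, then |a| = |b| and Cauchy-Schwarz is an equality,
  so a = b.\<close>

lemma pfield_mono:
  assumes "p > 1"
  shows "(pfield p a - pfield p b) \<bullet> (a - b) \<ge> 0"
    and "(pfield p a - pfield p b) \<bullet> (a - b) = 0 \<Longrightarrow> a = b"
proof -
  let ?A = "norm a" and ?B = "norm b"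
  have pw: "norm c powr (p - 1) * norm c = norm c powr p" for c :: 'a
    by (cases "c = 0") (auto simp: powr_diff)
  have e: "(pfield p a - pfield p b) \<bullet> (a - b) = (?A powr (p-1) - ?B powr (p-1)) * (?A - ?B)
     + (?A powr (p-1) * ?B - pfield p a \<bullet> b) + (?B powr (p-1) * ?A - pfield p b \<bullet> a)"
    by (simp add: inner_diff_left inner_diff_right pfield_inner_self algebra_simps pw[symmetric])
  have 1: "(?A powr (p-1) - ?B powr (p-1)) * (?A - ?B) \<ge> 0"
    using assms powr_mono2[of "p - 1" ?A ?B] powr_mono2[of "p - 1" ?B ?A]
    by (cases "?A \<le> ?B") (auto intro: mult_nonneg_nonneg mult_nonpos_nonpos)
  have 2: "?A powr (p-1) * ?B - pfield p a \<bullet> b \<ge> 0" "?B powr (p-1) * ?A - pfield p b \<bullet> a \<ge> 0"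
    using norm_cauchy_schwarz[of "pfield p a" b] norm_cauchy_schwarz[of "pfield p b" a] by (auto simp: norm_pfield)
  show "(pfield p a - pfield p b) \<bullet> (a - b) \<ge> 0" unfolding e using 1 2 by linarith
  assume "(pfield p a - pfield p b) \<bullet> (a - b) = 0"
  then have z: "(?A powr (p-1) - ?B powr (p-1)) * (?A - ?B) = 0" "pfield p a \<bullet> b = ?A powr (p-1) * ?B"
    using 1 2 unfolding e by linarith+
  have AB: "?A = ?B"
  proof (rule ccontr)
    assume "?A \<noteq> ?B"
    then have "?A powr (p-1) = ?B powr (p-1)" using z(1) by simp
    then show False using \<open>?A \<noteq> ?B\<close> powr_less_mono2[of "p-1" ?A ?B] powr_less_mono2[of "p-1" ?B ?A] assms
      by (cases "?A < ?B") auto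
  qed
  show "a = b"
  proof (cases "a = 0")
    case True
    then show ?thesis using AB by simp
  next
    case False
    have "?A powr (p-2) * (a \<bullet> b) = ?A powr (p-2) * (?A * ?B)"
      using z(2) False by (simp add: pfield_def powr_diff field_simps power2_eq_square)
    then have "a \<bullet> b = ?A * ?B" using False by simp
    then show ?thesis using AB by (subst vector_eq) (simp add: dot_square_norm power2_eq_square)
  qed
qed

section \<open>Traces on the circle\<close>

definition rot :: "real \<Rightarrow> real^2 \<Rightarrow> real^2" where
  "rot a x = (cos a * x $ 1 - sin a * x $ 2) *\<^sub>R axis 1 1 + (sin a * x $ 1 + cos a * x $ 2) *\<^sub>R axis 2 1"

definition circ :: "real \<Rightarrow> real \<Rightarrow> real^2" where
  "circ r t = vector [r * cos t, r * sin t]"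

lemma inner_real2: "x \<bullet> y = x $ 1 * y $ 1 + x $ 2 * y $ 2" for x y :: "real^2"
  by (simp add: inner_vec_def sum_2)

lemma norm_real2: "(norm x)\<^sup>2 = (x $ 1)\<^sup>2 + (x $ 2)\<^sup>2" for x :: "real^2"
  unfolding power2_norm_eq_inner inner_real2 by (simp add: power2_eq_square)

lemma vec_eq_real2: "x = y \<longleftrightarrow> x $ 1 = y $ 1 \<and> x $ 2 = y $ 2" for x y :: "real^2"
  by (simp add: vec_eq_iff forall_2)

lemma axis_real2 [simp]: "axis 1 (1::real) $ 1 = 1" "axis 1 (1::real) $ (2::2) = 0"
  "axis 2 (1::real) $ (1::2) = 0" "axis 2 (1::real) $ 2 = 1"
  by (simp_all add: axis_def)

lemma rot_nth [simp]: "rot a x $ 1 = cos a * x $ 1 - sin a * x $ 2" "rot a x $ 2 = sin a * x $ 1 + cos a * x $ 2"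
  by (simp_all add: rot_def)

lemma circ_nth [simp]: "circ r t $ 1 = r * cos t" "circ r t $ 2 = r * sin t"
  by (simp_all add: circ_def)

lemma rot_rot: "rot a (rot b x) = rot (a + b) x"
  by (simp add: vec_eq_real2 cos_add sin_add algebra_simps)

lemma rot_0 [simp]: "rot 0 x = x" by (simp add: vec_eq_real2)

lemma rot_circ: "rot a (circ r t) = circ r (a + t)"
  by (simp add: vec_eq_real2 cos_add sin_add algebra_simps)

lemma norm_circ: "norm (circ r t) = \<bar>r\<bar>"
proof -
  have "(norm (circ r t))\<^sup>2 = r\<^sup>2 * ((cos t)\<^sup>2 + (sin t)\<^sup>2)"
    by (simp only: norm_real2 circ_nth) algebra
  then have "(norm (circ r t))\<^sup>2 = r\<^sup>2" by simp
  then show ?thesis by (metis real_sqrt_abs abs_norm_cancel)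
qed

lemma norm_rot: "norm (rot a x) = norm x"
proof -
  have "(norm (rot a x))\<^sup>2 = ((cos a)\<^sup>2 + (sin a)\<^sup>2) * ((x $ 1)\<^sup>2 + (x $ 2)\<^sup>2)"
    by (simp only: norm_real2 rot_nth) algebra
  then have "(norm (rot a x))\<^sup>2 = (norm x)\<^sup>2" by (simp add: norm_real2)
  then show ?thesis by (metis real_sqrt_abs abs_norm_cancel)
qed

lemma linear_rot: "linear (rot a)"
  by (intro linearI) (simp_all add: vec_eq_real2 algebra_simps)

lemma continuous_rot: "continuous_on UNIV (\<lambda>(a, x). rot a x)"
  unfolding rot_def case_prod_beta by (intro continuous_intros)

lemma continuous_circ: "continuous_on S (\<lambda>t. circ r t)"
proof -
  have "circ r t = (r * cos t) *\<^sub>R axis 1 1 + (r * sin t) *\<^sub>R axis 2 1" for t by (simp add: vec_eq_real2)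
  then show ?thesis by (simp add: continuous_intros)
qed

lemma polar_real2:
  fixes x :: "real^2"
  obtains t where "0 \<le> t" "t \<le> 2 * pi" "x = circ (norm x) t"
proof (cases "x = 0")
  case True
  then show ?thesis using that[of 0] by (simp add: vec_eq_real2)
next
  case False
  have "(x $ 1 / norm x)\<^sup>2 + (x $ 2 / norm x)\<^sup>2 = ((x $ 1)\<^sup>2 + (x $ 2)\<^sup>2) / (norm x)\<^sup>2"
    by (simp add: power_divide add_divide_distrib)
  also have "\<dots> = 1" using False by (simp flip: norm_real2)
  finally obtain t where t: "0 \<le> t" "t \<le> 2 * pi" "x $ 1 / norm x = cos t" "x $ 2 / norm x = sin t"
    using sincos_total_2pi_le by blast
  have "x = circ (norm x) t"
    unfolding vec_eq_real2 circ_nth t(3)[symmetric] t(4)[symmetric] using False by simp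
  then show ?thesis using that t(1,2) by blast
qed

lemma lborel_rot: "distr lborel borel (rot a) = lborel"
proof (rule lborel_eqI[symmetric])
  have m: "rot a \<in> borel_measurable borel"
    by (intro borel_measurable_continuous_onI linear_continuous_on linear_conv_bounded_linear[THEN iffD1] linear_rot)
  have ot: "orthogonal_transformation (rot (- a))"
    using linear_rot norm_rot by (simp add: orthogonal_transformation)
  fix l u :: "real^2" assume lu: "\<And>b. b \<in> Basis \<Longrightarrow> l \<bullet> b \<le> u \<bullet> b"
  have eq: "rot a -` box l u = rot (- a) ` box l u"
  proof (intro equalityI subsetI)
    fix x assume "x \<in> rot a -` box l u"
    then have "rot (- a) (rot a x) \<in> rot (- a) ` box l u" by blast
    then show "x \<in> rot (- a) ` box l u" by (simp add: rot_rot)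
  qed (auto simp: rot_rot)
  have "emeasure (distr lborel borel (rot a)) (box l u) = emeasure lborel (rot a -` box l u)"
    using m by (subst emeasure_distr) auto
  also have "\<dots> = emeasure lebesgue (rot a -` box l u)"
    using measurable_sets[OF m, of "box l u"] by simp
  also have "\<dots> = emeasure lebesgue (box l u)"
  proof -
    have b: "box l u \<in> lmeasurable" by simp
    have "rot (- a) ` box l u \<in> lmeasurable" "measure lebesgue (rot (- a) ` box l u) = measure lebesgue (box l u)"
      using measurable_orthogonal_image[OF ot b] measure_orthogonal_image[OF ot b] by auto
    then show ?thesis unfolding eq using b by (simp only: emeasure_eq_measure2)
  qed
  also have "\<dots> = ennreal (\<Prod>b\<in>Basis. (u - l) \<bullet> b)"
    using lu by (simp add: emeasure_lborel_box)
  finally show "emeasure (distr lborel borel (rot a)) (box l u) = ennreal (\<Prod>b\<in>Basis. (u - l) \<bullet> b)" .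
qed (simp add: sets_distr)

lemma nn_integral_rot:
  assumes "f \<in> borel_measurable borel"
  shows "(\<integral>\<^sup>+x. f (rot a x) \<partial>lborel) = (\<integral>\<^sup>+x. f x \<partial>lborel)"
proof -
  have m: "rot a \<in> borel_measurable borel"
    by (intro borel_measurable_continuous_onI linear_continuous_on linear_conv_bounded_linear[THEN iffD1] linear_rot)
  have "(\<integral>\<^sup>+x. f x \<partial>distr lborel borel (rot a)) = (\<integral>\<^sup>+x. f (rot a x) \<partial>lborel)"
    using m assms by (subst nn_integral_distr) auto
  then show ?thesis by (simp add: lborel_rot)
qed

text \<open>The shifted period [t, t + 2 pi] is covered by [0, 2 pi] and [2 pi, 4 pi], over each of
  which the periodic integrand has the same integral. The factor 2 is absorbed by the constants of
  the trace estimate.\<close>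

lemma nn_integral_circ_shift:
  fixes f :: "real^2 \<Rightarrow> ennreal"
  assumes [measurable]: "f \<in> borel_measurable borel" and t: "0 \<le> t" "t \<le> 2 * pi"
  shows "(\<integral>\<^sup>+a. indicator {0..2*pi} a * f (circ r (a + t)) \<partial>lborel)
     \<le> 2 * (\<integral>\<^sup>+a. indicator {0..2*pi} a * f (circ r a) \<partial>lborel)"
proof -
  have [measurable]: "circ r \<in> borel_measurable borel"
    by (intro borel_measurable_continuous_onI continuous_circ)
  have per: "circ r (2*pi + a) = circ r a" for a by (simp add: vec_eq_real2 add.commute[of "2 * pi"])
  have "(\<integral>\<^sup>+a. indicator {0..2*pi} a * f (circ r (a + t)) \<partial>lborel)
      = (\<integral>\<^sup>+a. indicator {0..2*pi} (- t + 1 * a) * f (circ r ((- t + 1 * a) + t)) \<partial>lborel)"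
    by (subst nn_integral_real_affine[of _ 1 "- t"]) simp_all
  also have "\<dots> \<le> (\<integral>\<^sup>+a. indicator {0..2*pi} a * f (circ r a) + indicator {0..2*pi} (- (2*pi) + 1 * a) * f (circ r (2*pi + (- (2*pi) + 1 * a))) \<partial>lborel)"
    using t by (intro nn_integral_mono) (auto simp: indicator_def)
  also have "\<dots> = (\<integral>\<^sup>+a. indicator {0..2*pi} a * f (circ r a) \<partial>lborel)
      + (\<integral>\<^sup>+a. indicator {0..2*pi} (- (2*pi) + 1 * a) * f (circ r (2*pi + (- (2*pi) + 1 * a))) \<partial>lborel)"
    by (rule nn_integral_add) measurable
  also have "(\<integral>\<^sup>+a. indicator {0..2*pi} (- (2*pi) + 1 * a) * f (circ r (2*pi + (- (2*pi) + 1 * a))) \<partial>lborel)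
      = (\<integral>\<^sup>+a. indicator {0..2*pi} a * f (circ r (2*pi + a)) \<partial>lborel)"
    by (subst nn_integral_real_affine[of "\<lambda>a. indicator {0..2*pi} a * f (circ r (2*pi + a))" 1 "- (2*pi)"]) simp_all
  finally show ?thesis unfolding per by (simp only: mult_2)
qed

text \<open>The integral over a thin shell is an average over rotations, so it is controlled by the
  integral over the circle; this replaces polar coordinates.\<close>

lemma shell_integral_bound:
  fixes W :: "real^2 \<Rightarrow> real"
  assumes Wm [measurable]: "W \<in> borel_measurable borel" and W0: "\<And>x. W x \<ge> 0" and d: "d \<ge> 0"
    and near: "\<And>x. x \<in> S \<Longrightarrow> W x \<le> W ((R / norm x) *\<^sub>R x) + d"
    and S [measurable]: "S \<in> sets borel" and rotS: "\<And>a x. rot a x \<in> S \<longleftrightarrow> x \<in> S" and S0: "0 \<notin> S"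
    and Sf: "emeasure lborel S = ennreal s" "s \<ge> 0"
    and T: "(\<integral>\<^sup>+a. indicator {0..2*pi} a * ennreal (W (circ R a)) \<partial>lborel) = ennreal T" "T \<ge> 0"
  shows "(\<integral>\<^sup>+x. indicator S x * ennreal (W x) \<partial>lborel) \<le> ennreal (s * (T / pi + d))"
proof -
  have [measurable]: "(\<lambda>p. rot (fst p) (snd p)) \<in> borel_measurable (borel \<Otimes>\<^sub>M borel)"
    unfolding borel_prod using continuous_rot
    by (intro borel_measurable_continuous_onI) (simp add: case_prod_beta)
  have [measurable]: "(\<lambda>a. rot a x) \<in> borel_measurable borel" for x
    by (rule borel_measurable_continuous_onI) (unfold rot_def, intro continuous_intros)
  have [measurable]: "(\<lambda>x. rot a x) \<in> borel_measurable borel" for a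
    by (rule borel_measurable_continuous_onI) (unfold rot_def, intro continuous_intros)
  let ?I = "\<integral>\<^sup>+x. indicator S x * ennreal (W x) \<partial>lborel"
  have rI: "(\<integral>\<^sup>+x. indicator S x * ennreal (W (rot a x)) \<partial>lborel) = ?I" for a
    using nn_integral_rot[of "\<lambda>x. indicator S x * ennreal (W x)" a] by (simp add: indicator_def rotS)
  have "ennreal (2 * pi) * ?I = (\<integral>\<^sup>+a. indicator {0..2*pi} a * ?I \<partial>lborel)"
    by (subst nn_integral_multc) (auto simp: ennreal_mult)
  also have "\<dots> = (\<integral>\<^sup>+a. (\<integral>\<^sup>+x. indicator {0..2*pi} a * (indicator S x * ennreal (W (rot a x))) \<partial>lborel) \<partial>lborel)"
    by (subst nn_integral_cmult) (simp_all add: rI)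
  also have "\<dots> = (\<integral>\<^sup>+x. (\<integral>\<^sup>+a. indicator {0..2*pi} a * (indicator S x * ennreal (W (rot a x))) \<partial>lborel) \<partial>lborel)"
    by (rule lborel_pair.Fubini'[symmetric]) (simp add: case_prod_beta)
  also have "\<dots> \<le> (\<integral>\<^sup>+x. indicator S x * ennreal (2 * T + 2 * pi * d) \<partial>lborel)"
  proof (rule nn_integral_mono)
    fix x :: "real^2"
    show "(\<integral>\<^sup>+a. indicator {0..2*pi} a * (indicator S x * ennreal (W (rot a x))) \<partial>lborel)
       \<le> indicator S x * ennreal (2 * T + 2 * pi * d)"
    proof (cases "x \<in> S")
      case True
      then have nx: "norm x \<noteq> 0" using S0 by auto
      \<comment> \<open>The rotations of x sweep the circle through x; projected radially to radius
        \<open>R\<close> they become \<open>circ R (a + t)\<close> with t the polar angle of x, so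
        the inner integral is a shifted integral over the circle.\<close>
      obtain t where t: "0 \<le> t" "t \<le> 2 * pi" "x = circ (norm x) t" by (rule polar_real2)
      have rc: "(R / norm x) *\<^sub>R rot a x = circ R (a + t)" for a
      proof -
        have "(R / k) *\<^sub>R circ k u = circ R u" if "k \<noteq> 0" for k u using that by (simp add: vec_eq_real2)
        moreover have "rot a x = circ (norm x) (a + t)" using t(3) rot_circ by metis
        ultimately show ?thesis using nx by metis
      qed
      have nr: "W (rot a x) \<le> W (circ R (a + t)) + d" for a
        using near[of "rot a x"] True rotS[of a x] rc[of a] by (simp add: norm_rot)
      have "(\<integral>\<^sup>+a. indicator {0..2*pi} a * ennreal (W (rot a x)) \<partial>lborel)
         \<le> (\<integral>\<^sup>+a. indicator {0..2*pi} a * ennreal (W (circ R (a + t))) + indicator {0..2*pi} a * ennreal d \<partial>lborel)"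
        using nr W0 d by (intro nn_integral_mono) (auto simp: indicator_def simp flip: ennreal_plus intro: ennreal_leI)
      also have "\<dots> = (\<integral>\<^sup>+a. indicator {0..2*pi} a * ennreal (W (circ R (a + t))) \<partial>lborel)
           + (\<integral>\<^sup>+a. indicator {0..2*pi} a * ennreal d \<partial>lborel)"
      proof (rule nn_integral_add)
        have [measurable]: "circ R \<in> borel_measurable borel"
          by (intro borel_measurable_continuous_onI continuous_circ)
        show "(\<lambda>a. indicator {0..2*pi} a * ennreal (W (circ R (a + t)))) \<in> borel_measurable lborel" by measurable
      qed measurable
      also have "(\<integral>\<^sup>+a. indicator {0..2*pi} a * ennreal d \<partial>lborel) = ennreal (2 * pi * d)"
        by (subst nn_integral_multc) (auto simp: ennreal_mult d)
      also have "(\<integral>\<^sup>+a. indicator {0..2*pi} a * ennreal (W (circ R (a + t))) \<partial>lborel) \<le> 2 * ennreal T"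
        using nn_integral_circ_shift[OF _ t(1,2), of "\<lambda>x. ennreal (W x)" R] T by simp
      also have "2 * ennreal T + ennreal (2 * pi * d) = ennreal (2 * T + 2 * pi * d)"
        using T(2) d by (simp add: ennreal_plus ennreal_mult)
      finally show ?thesis using True by (simp add: add_right_mono)
    qed simp
  qed
  also have "\<dots> = ennreal (s * (2 * T + 2 * pi * d))"
    using Sf T(2) d by (subst nn_integral_multc) (auto simp: ennreal_mult)
  also have "s * (2 * T + 2 * pi * d) = (2 * pi) * (s * (T / pi + d))" by (simp add: field_simps)
  also have "ennreal ((2 * pi) * (s * (T / pi + d))) = ennreal (2 * pi) * ennreal (s * (T / pi + d))"
    by (rule ennreal_mult) (use Sf T(2) d in auto)
  finally show ?thesis
    by (subst (asm) ennreal_mult_le_mult_iff) auto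
qed

lemma C1_grad_radial_compose:
  assumes "\<And>s. (G has_real_derivative G' s) (at s)" "continuous_on UNIV G'"
  shows "C1_grad (\<lambda>x. G (c * (x \<bullet> x) + d)) (\<lambda>x. (G' (c * (x \<bullet> x) + d) * (2 * c)) *\<^sub>R x)"
proof -
  have "((\<lambda>x. c * (x \<bullet> x) + d) has_derivative (\<lambda>h. h \<bullet> ((2 * c) *\<^sub>R x))) (at x)" for x :: 'a
    by (auto intro!: derivative_eq_intros simp: inner_commute)
  then have "C1_grad (\<lambda>x::'a. c * (x \<bullet> x) + d) (\<lambda>x. (2 * c) *\<^sub>R x)"
    unfolding C1_grad_def gderiv_def by (auto intro!: continuous_intros)
  from C1_grad_compose[OF this assms] show ?thesis by simp
qed

lemma emeasure_shell:
  assumes "0 \<le> r1" "r1 \<le> r2"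
  shows "emeasure lborel (cball 0 r2 - ball (0::real^2) r1) = ennreal (pi * (r2\<^sup>2 - r1\<^sup>2))"
proof -
  have "emeasure lborel (cball 0 r2 - ball (0::real^2) r1) = emeasure lborel (cball (0::real^2) r2) - emeasure lborel (ball (0::real^2) r1)"
    using assms emeasure_lborel_ball_finite[of "0::real^2" r1] by (intro emeasure_Diff) (auto simp: less_top)
  also have "\<dots> = ennreal (pi * r2\<^sup>2) - ennreal (pi * r1\<^sup>2)"
    using assms by (simp add: emeasure_cball emeasure_ball unit_ball_vol_2)
  also have "\<dots> = ennreal (pi * (r2\<^sup>2 - r1\<^sup>2))"
    using assms by (subst ennreal_minus) (auto simp: right_diff_distrib)
  finally show ?thesis .
qed

lemma Lp_tendsto_zero_imp_L1:
  fixes f :: "nat \<Rightarrow> 'a \<Rightarrow> 'b::euclidean_space"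
  assumes p: "p \<ge> 1" and S: "S \<in> sets M" "emeasure M S < \<infinity>"
    and f: "\<And>n. f n \<in> borel_measurable M" "\<And>n x. x \<notin> S \<Longrightarrow> f n x = 0"
    "\<And>n. integrable M (\<lambda>x. norm (f n x) powr p)" "(\<lambda>n. \<integral>x. norm (f n x) powr p \<partial>M) \<longlonglongrightarrow> 0"
  shows "(\<lambda>n. \<integral>x. norm (f n x) \<partial>M) \<longlonglongrightarrow> 0"
proof (rule LIMSEQ_I)
  fix e :: real assume e: "e > 0"
  define m where "m = measure M S"
  have m: "m \<ge> 0" by (simp add: m_def)
  define d where "d = e / (2 * (m + 1))"
  have d: "d > 0" using e m by (simp add: d_def)
  have iS: "integrable M (indicator S :: 'a \<Rightarrow> real)" using S by (intro integrable_real_indicator)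
  have b: "norm (f n x) \<le> d * indicator S x + d powr (1 - p) * norm (f n x) powr p" for n x
    using powr_young[OF p d, of "norm (f n x)"] f(2)[of x n] by (cases "x \<in> S") auto
  have ib: "integrable M (\<lambda>x. d * indicator S x + d powr (1 - p) * norm (f n x) powr p)" for n
    using iS f(3) by auto
  have I: "(\<integral>x. norm (f n x) \<partial>M) \<le> d * m + d powr (1 - p) * (\<integral>x. norm (f n x) powr p \<partial>M)" for n
  proof -
    have "(\<integral>x. norm (f n x) \<partial>M) \<le> (\<integral>x. d * indicator S x + d powr (1 - p) * norm (f n x) powr p \<partial>M)"
      by (rule integral_mono'[OF ib b]) (use d in \<open>auto intro!: add_nonneg_nonneg\<close>)
    also have "\<dots> = d * m + d powr (1 - p) * (\<integral>x. norm (f n x) powr p \<partial>M)"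
      using iS f(3)[of n] S by (simp add: m_def)
    finally show ?thesis .
  qed
  have "(\<lambda>n. d powr (1 - p) * (\<integral>x. norm (f n x) powr p \<partial>M)) \<longlonglongrightarrow> d powr (1 - p) * 0"
    by (intro tendsto_intros f(4))
  then have ev: "\<forall>\<^sub>F n in sequentially. d powr (1 - p) * (\<integral>x. norm (f n x) powr p \<partial>M) < e / 2"
    using e by (intro order_tendstoD(2)) auto
  have dm: "d * m < e / 2" using e m by (simp add: d_def field_simps)
  from ev have "\<forall>\<^sub>F n in sequentially. norm ((\<integral>x. norm (f n x) \<partial>M) - 0) < e"
  proof eventually_elim
    case (elim n)
    have "0 \<le> (\<integral>x. norm (f n x) \<partial>M)" by (rule integral_nonneg_AE) simp
    then show ?case using I[of n] elim dm by simp
  qed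
  then show "\<exists>n0. \<forall>n\<ge>n0. norm ((\<integral>x. norm (f n x) \<partial>M) - 0) < e" by (simp add: eventually_sequentially)
qed

text \<open>In the application \<open>V\<close> is the plane without the closed inclusions. Test
  functions with compact support in \<open>V\<close> may be nonzero on the circle, in contrast to
  those of \<Omega>. The annulus keeps the inclusions away from the circle, so that near it \<Omega>
  is the disc itself.\<close>

locale disc_domain =
  fixes V \<Omega> :: "(real^2) set" and p :: real
  assumes V: "open V" and \<Omega>: "\<Omega> = V \<inter> ball 0 5" and ann: "{x. 4 \<le> norm x \<and> norm x \<le> 5} \<subseteq> V"
    and p: "p \<ge> 1"
begin

lemma \<Omega>_open: "open \<Omega>" and \<Omega>_bounded: "bounded \<Omega>"
  using V bounded_subset[OF bounded_ball, of \<Omega> 0 5] by (auto simp: \<Omega>)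

lemma annulus_closure: "{x. 4 \<le> norm x \<and> norm x \<le> 5} \<subseteq> closure \<Omega>"
proof -
  have "V \<inter> closure (ball 0 5) \<subseteq> closure (V \<inter> ball 0 5)" by (rule open_Int_closure_subset[OF V])
  then show ?thesis using ann by (auto simp: \<Omega>)
qed

text \<open>The defect in the integration by parts is a boundary term on the circle. Cutting \<psi>
  off near the circle turns it into the limit of \<open>E n\<close>, an integral of |v| over a shell
  of area pi / k against a factor of size 20 B k: B bounds \<psi>, 2 bounds the tent, and 2 k |x
  \<bullet> b| \<le> 10 k comes from the gradient of its argument.
  \<open>shell_integral_bound\<close> compares the shell with the circle.\<close>

lemma trace_estimate:
  assumes v: "continuous_on (closure \<Omega>) v" and S: "Sob p \<Omega> (\<lambda>x. indicator \<Omega> x * v x) h"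
    and \<psi>: "C1c V \<psi> \<psi>'" "b \<in> Basis" and B: "B > 0" "\<And>x. norm (\<psi> x) \<le> B"
  shows "\<bar>(\<integral>x. (indicator \<Omega> x * v x) * (\<psi>' x \<bullet> b) \<partial>lebesgue) + (\<integral>x. (h x \<bullet> b) * \<psi> x \<partial>lebesgue)\<bar>
     \<le> 20 * B * (LINT t:{0..2*pi}|lborel. \<bar>v (circ 5 t)\<bar>)" (is "\<bar>?L\<bar> \<le> 20 * B * ?T")
proof -
  define w where "w x = indicator \<Omega> x * v x" for x
  define A where "A = {x::real^2. 4 \<le> norm x \<and> norm x \<le> 5}"
  have Sw: "Sob p \<Omega> w h" using S unfolding w_def .
  have \<Omega>_ball: "norm x < 5" if "x \<in> \<Omega>" for x using that by (auto simp: \<Omega>)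
  have Acl: "closed A" unfolding A_def by (intro closed_Collect_conj closed_Collect_le continuous_intros)
  have Acomp: "compact A"
  proof -
    have "A \<subseteq> cball 0 5" by (auto simp: A_def)
    then show ?thesis using Acl bounded_subset[OF bounded_cball] compact_eq_bounded_closed by blast
  qed
  have vA: "continuous_on A v" by (rule continuous_on_subset[OF v]) (use annulus_closure in \<open>auto simp: A_def\<close>)
  \<comment> \<open>Set to 0 off the annulus, |v| becomes a Borel function on the plane, although
    \<open>v\<close> is continuous just on the closure of \<Omega>.\<close>
  define W where "W x = indicator A x * \<bar>v x\<bar>" for x
  have W0: "W x \<ge> 0" for x by (simp add: W_def)
  have Am: "A \<in> sets borel" using Acl by (rule borel_closed)
  have "(\<lambda>x. indicator A x *\<^sub>R \<bar>v x\<bar>) \<in> borel_measurable borel"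
    by (rule borel_measurable_continuous_on_indicator[OF Am]) (intro continuous_intros vA)
  then have Wm[measurable]: "W \<in> borel_measurable borel" by (simp add: W_def[abs_def])
  have circA: "circ 5 t \<in> A" for t by (simp add: A_def norm_circ)
  have vc: "continuous_on {0..2*pi} (\<lambda>t. \<bar>v (circ 5 t)\<bar>)"
    by (intro continuous_intros continuous_on_compose2[OF vA continuous_circ]) (use circA in auto)
  have Ti: "set_integrable lborel {0..2*pi} (\<lambda>t. \<bar>v (circ 5 t)\<bar>)"
    unfolding set_integrable_def by (rule borel_integrable_compact[OF _ vc]) simp
  have T: "(\<integral>\<^sup>+a. indicator {0..2*pi} a * ennreal (W (circ 5 a)) \<partial>lborel) = ennreal ?T"
  proof -
    have "(\<integral>\<^sup>+a. indicator {0..2*pi} a * ennreal (W (circ 5 a)) \<partial>lborel)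
      = (\<integral>\<^sup>+a. ennreal (indicator {0..2*pi} a *\<^sub>R \<bar>v (circ 5 a)\<bar>) \<partial>lborel)"
      using circA by (intro nn_integral_cong) (auto simp: W_def indicator_def)
    also have "\<dots> = ennreal (\<integral>a. indicator {0..2*pi} a *\<^sub>R \<bar>v (circ 5 a)\<bar> \<partial>lborel)"
      using Ti unfolding set_integrable_def by (intro nn_integral_eq_integral) auto
    finally show ?thesis by (simp add: set_lebesgue_integral_def)
  qed
  have T0: "?T \<ge> 0" unfolding set_lebesgue_integral_def by (rule integral_nonneg_AE) auto
  note iw = Sob_integrable[OF Sw \<Omega>_open \<Omega>_bounded p]
  note P = C1c_props[OF \<psi>(1)]
  have [measurable]: "\<psi> \<in> borel_measurable lebesgue" "\<psi>' \<in> borel_measurable lebesgue" by (fact P)+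
  have [measurable]: "w \<in> borel_measurable lebesgue" "h \<in> borel_measurable lebesgue" using iw by auto
  have wi: "integrable lebesgue (\<lambda>x. w x * (\<psi>' x \<bullet> b))" "integrable lebesgue (\<lambda>x. (h x \<bullet> b) * \<psi> x)"
    using Sob_weak_integrable[OF Sw \<psi>(1) \<Omega>_open \<Omega>_bounded p] by auto
  define k where "k n = real n + 1" for n
  have kp: "k n > 0" "k n \<ge> 1" for n by (auto simp: k_def)
  \<comment> \<open>The cut-off is 1 for |x|^2 \<le> 25 - 2 / k and 0 for |x|^2 \<ge> 25 - 1 / k;
    the offset leaves its support at a positive distance from the circle, hence compact in the open
    disc.\<close>
  define \<eta> where "\<eta> n x = ramp (- k n * (x \<bullet> x) + (25 * k n - 1))" for n and x :: "real^2"
  define q where "q n x = ramp' (- k n * (x \<bullet> x) + (25 * k n - 1))" for n and x :: "real^2"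
  have C: "C1_grad (\<eta> n) (\<lambda>x. (q n x * (2 * - k n)) *\<^sub>R x)" for n
    unfolding \<eta>_def q_def by (rule C1_grad_radial_compose[OF DERIV_ramp continuous_ramp'])
  have \<eta>01: "0 \<le> \<eta> n x" "\<eta> n x \<le> 1" for n x using ramp_props by (auto simp: \<eta>_def)
  have qm: "continuous_on UNIV (q n)" for n unfolding q_def
    by (intro continuous_on_compose2[OF continuous_ramp'] continuous_intros) auto
  have [measurable]: "q n \<in> borel_measurable lebesgue" "\<eta> n \<in> borel_measurable lebesgue" for n
    using qm C1_grad_imp_continuous[OF C[of n]] by (auto intro!: measurable_completion borel_measurable_continuous_onI)
  define r1 r2 where "r1 n = sqrt (25 - 2 / k n)" and "r2 n = sqrt (25 - 1 / k n)" for n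
  define Sh where "Sh n = cball 0 (r2 n) - ball (0::real^2) (r1 n)" for n
  have k2: "2 / k n \<le> 2" "0 < 1 / k n" "1 / k n < 2 / k n" for n using kp[of n] by (auto simp: field_simps)
  have rr: "4 \<le> r1 n" "r1 n \<le> r2 n" "r2 n < 5" for n
  proof -
    show "4 \<le> r1 n" unfolding r1_def using k2[of n] by (intro real_le_rsqrt) auto
    show "r1 n \<le> r2 n" unfolding r1_def r2_def using k2[of n] by simp
    show "r2 n < 5" unfolding r2_def using k2[of n] by (intro real_less_lsqrt) auto
  qed
  have q0: "q n x = 0" if "x \<notin> Sh n" for n x
  proof -
    have "r2 n < norm x \<or> norm x < r1 n" using that by (auto simp: Sh_def)
    then have "- k n * (x \<bullet> x) + (25 * k n - 1) \<le> 0 \<or> - k n * (x \<bullet> x) + (25 * k n - 1) \<ge> 1"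
    proof
      assume "r2 n < norm x"
      then have "(r2 n)\<^sup>2 < (norm x)\<^sup>2" using rr[of n] by (intro power_strict_mono) auto
      moreover have "(r2 n)\<^sup>2 = 25 - 1 / k n" unfolding r2_def using k2[of n] by simp
      ultimately have "25 - 1 / k n < x \<bullet> x" by (simp add: power2_norm_eq_inner)
      then have "k n * (25 - 1 / k n) < k n * (x \<bullet> x)" using kp(1) by (rule mult_strict_left_mono)
      then show ?thesis using kp(1)[of n] by (simp add: right_diff_distrib)
    next
      assume "norm x < r1 n"
      then have "(norm x)\<^sup>2 < (r1 n)\<^sup>2" by (intro power_strict_mono) auto
      moreover have "(r1 n)\<^sup>2 = 25 - 2 / k n" unfolding r1_def using k2[of n] by simp
      ultimately have "x \<bullet> x < 25 - 2 / k n" by (simp add: power2_norm_eq_inner)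
      then have "k n * (x \<bullet> x) < k n * (25 - 2 / k n)" using kp(1) by (rule mult_strict_left_mono)
      then show ?thesis using kp(1)[of n] by (simp add: right_diff_distrib)
    qed
    then show ?thesis using ramp'_props by (auto simp: q_def)
  qed
  define E where "E n = (\<integral>x. w x * (\<psi> x * q n x * (2 * k n) * (x \<bullet> b)) \<partial>lebesgue)" for n
  have bn: "norm b = 1" using \<psi>(2) by simp
  have fb: "\<bar>w x * (\<psi> x * q n x * (2 * k n) * (x \<bullet> b))\<bar> \<le> 20 * B * k n * (indicator (Sh n) x * W x)" for n x
  proof (cases "x \<in> \<Omega> \<and> x \<in> Sh n")
    case True
    then have "norm x < 5" "4 \<le> norm x" using \<Omega>_ball rr(1)[of n] by (auto simp: Sh_def)
    then have xA: "W x = \<bar>w x\<bar>" using True by (simp add: W_def w_def A_def)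
    have xb: "\<bar>x \<bullet> b\<bar> \<le> 5" using Cauchy_Schwarz_ineq2[of x b] \<open>norm x < 5\<close> bn by simp
    have "\<bar>\<psi> x\<bar> * \<bar>q n x\<bar> * (2 * k n) * \<bar>x \<bullet> b\<bar> \<le> B * 2 * (2 * k n) * 5"
      using B ramp'_props(1,2) xb kp[of n] by (intro mult_mono) (auto simp: q_def)
    then have "\<bar>w x\<bar> * (\<bar>\<psi> x\<bar> * \<bar>q n x\<bar> * (2 * k n) * \<bar>x \<bullet> b\<bar>) \<le> \<bar>w x\<bar> * (B * 2 * (2 * k n) * 5)"
      by (rule mult_left_mono) simp
    then show ?thesis using True xA kp[of n] by (simp add: abs_mult mult_ac)
  next
    case False
    then have "w x * (\<psi> x * q n x * (2 * k n) * (x \<bullet> b)) = 0"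
      using q0[of x n] by (auto simp: w_def)
    moreover have "0 \<le> 20 * B * k n * (indicator (Sh n) x * W x)"
      using B(1) kp(1)[of n] W0[of x] by (simp add: indicator_def)
    ultimately show ?thesis by (simp only: abs_zero)
  qed
  have Ei: "integrable lebesgue (\<lambda>x. w x * (\<psi> x * q n x * (2 * k n) * (x \<bullet> b)))" for n
  proof -
    have "continuous_on UNIV (\<lambda>x. \<psi> x * q n x * (2 * k n) * (x \<bullet> b))"
      by (intro continuous_intros P(1) qm)
    moreover have "\<psi> x * q n x * (2 * k n) * (x \<bullet> b) = 0" if "x \<notin> closure {x. \<psi> x \<noteq> 0}" for x
      using C1c_outside(1)[OF \<psi>(1) that] by simp
    ultimately obtain M where M: "M > 0" "\<And>x. norm (\<psi> x * q n x * (2 * k n) * (x \<bullet> b)) \<le> M"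
      using bounded_support_bounded[OF _ P(3)] by blast
    show ?thesis by (rule integrable_mult_bounded_real(2)[OF iw(1), of _ M]) (measurable, use M in auto)
  qed
  have id: "(\<integral>x. \<eta> n x * (w x * (\<psi>' x \<bullet> b)) \<partial>lebesgue) + (\<integral>x. \<eta> n x * ((h x \<bullet> b) * \<psi> x) \<partial>lebesgue) = E n" for n
  proof -
    have c0: "C1c V (\<lambda>x. \<eta> n x * \<psi> x) (\<lambda>x. \<eta> n x *\<^sub>R \<psi>' x + \<psi> x *\<^sub>R (q n x * (2 * - k n)) *\<^sub>R x)"
      by (rule C1_grad_mult_C1c[OF C \<psi>(1)])
    have sub: "{x. \<eta> n x * \<psi> x \<noteq> 0} \<subseteq> closure {x. \<psi> x \<noteq> 0} \<inter> cball 0 (r2 n)"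
    proof
      fix x assume x: "x \<in> {x. \<eta> n x * \<psi> x \<noteq> 0}"
      then have "\<eta> n x \<noteq> 0" by auto
      then have "0 < - k n * (x \<bullet> x) + (25 * k n - 1)" using ramp_props(1) by (auto simp: \<eta>_def not_le[symmetric])
      then have "k n * (x \<bullet> x) < k n * (25 - 1 / k n)" using kp(1)[of n] by (simp add: right_diff_distrib)
      then have "x \<bullet> x < 25 - 1 / k n" using kp(1)[of n] by (simp only: mult_less_cancel_left_pos)
      then have "norm x \<le> r2 n" unfolding r2_def by (intro real_le_rsqrt) (simp add: power2_norm_eq_inner)
      moreover have "x \<in> closure {x. \<psi> x \<noteq> 0}" using x closure_subset[of "{x. \<psi> x \<noteq> 0}"] by auto
      ultimately show "x \<in> closure {x. \<psi> x \<noteq> 0} \<inter> cball 0 (r2 n)" by simp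
    qed
    have "closure {x. \<eta> n x * \<psi> x \<noteq> 0} \<subseteq> closure {x. \<psi> x \<noteq> 0} \<inter> cball 0 (r2 n)"
      by (rule closure_minimal[OF sub]) auto
    moreover have "closure {x. \<psi> x \<noteq> 0} \<inter> cball 0 (r2 n) \<subseteq> \<Omega>" using P(4) rr(3)[of n] by (auto simp: \<Omega>)
    ultimately have c: "C1c \<Omega> (\<lambda>x. \<eta> n x * \<psi> x) (\<lambda>x. \<eta> n x *\<^sub>R \<psi>' x + \<psi> x *\<^sub>R (q n x * (2 * - k n)) *\<^sub>R x)"
      using c0 unfolding C1c_def by blast
    have i1: "integrable lebesgue (\<lambda>x. \<eta> n x * (w x * (\<psi>' x \<bullet> b)))"
      by (rule integrable_mult_bounded_real(1)[OF wi(1), of "\<eta> n" 1]) (use \<eta>01 in auto)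
    have "(\<integral>x. \<eta> n x * (w x * (\<psi>' x \<bullet> b)) \<partial>lebesgue) - E n
      = (\<integral>x. \<eta> n x * (w x * (\<psi>' x \<bullet> b)) - w x * (\<psi> x * q n x * (2 * k n) * (x \<bullet> b)) \<partial>lebesgue)"
      unfolding E_def by (rule Bochner_Integration.integral_diff[OF i1 Ei, symmetric])
    also have "\<dots> = (\<integral>x. w x * ((\<eta> n x *\<^sub>R \<psi>' x + \<psi> x *\<^sub>R (q n x * (2 * - k n)) *\<^sub>R x) \<bullet> b) \<partial>lebesgue)"
      by (intro Bochner_Integration.integral_cong) (auto simp: inner_diff_left inner_add_left algebra_simps)
    also have "\<dots> = - (\<integral>x. (h x \<bullet> b) * (\<eta> n x * \<psi> x) \<partial>lebesgue)"
      by (rule Sob_weak[OF Sw c \<psi>(2)])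
    finally show ?thesis by (simp add: mult_ac)
  qed
  have \<eta>lim: "(\<lambda>n. \<eta> n x) \<longlonglongrightarrow> 1" if "x \<in> \<Omega>" for x
  proof -
    have "x \<bullet> x < 25"
      using \<Omega>_ball[OF that] power_strict_mono[of "norm x" 5 2] by (simp add: power2_norm_eq_inner)
    then have "\<forall>\<^sub>F n in sequentially. k n > 2 / (25 - x \<bullet> x)" unfolding k_def by real_asymp
    then have "\<forall>\<^sub>F n in sequentially. \<eta> n x = 1"
    proof eventually_elim
      case (elim n)
      then have "2 < k n * (25 - x \<bullet> x)" using \<open>x \<bullet> x < 25\<close> by (simp add: field_simps)
      then show ?case unfolding \<eta>_def by (intro ramp_props(2)) (simp add: algebra_simps)
    qed
    then show ?thesis by (rule tendsto_eventually)
  qed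
  have L: "(\<lambda>n. \<integral>x. \<eta> n x * f x \<partial>lebesgue) \<longlonglongrightarrow> integral\<^sup>L lebesgue f"
    if i: "integrable lebesgue f" and z: "\<And>x. x \<notin> \<Omega> \<Longrightarrow> f x = 0" for f :: "real^2 \<Rightarrow> real"
  proof (rule integral_dominated_convergence[where w = "\<lambda>x. \<bar>f x\<bar>"])
    show "AE x in lebesgue. (\<lambda>n. \<eta> n x * f x) \<longlonglongrightarrow> f x"
    proof (rule AE_I2)
      fix x
      show "(\<lambda>n. \<eta> n x * f x) \<longlonglongrightarrow> f x"
      proof (cases "x \<in> \<Omega>")
        case True
        from tendsto_mult[OF \<eta>lim[OF True] tendsto_const[of "f x"]] show ?thesis by simp
      qed (simp add: z)
    qed
    show "AE x in lebesgue. norm (\<eta> n x * f x) \<le> \<bar>f x\<bar>" for n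
      using \<eta>01 by (intro AE_I2) (auto simp: abs_mult mult_left_le_one_le)
  qed (use i in auto)
  have z: "w x = 0" "h x = 0" if "x \<notin> \<Omega>" for x using Sw that by (auto simp: Sob_def)
  have "(\<lambda>n. (\<integral>x. \<eta> n x * (w x * (\<psi>' x \<bullet> b)) \<partial>lebesgue) + (\<integral>x. \<eta> n x * ((h x \<bullet> b) * \<psi> x) \<partial>lebesgue))
     \<longlonglongrightarrow> (\<integral>x. w x * (\<psi>' x \<bullet> b) \<partial>lebesgue) + (\<integral>x. (h x \<bullet> b) * \<psi> x \<partial>lebesgue)"
    by (intro tendsto_add L wi) (simp_all add: z)
  then have "E \<longlonglongrightarrow> (\<integral>x. w x * (\<psi>' x \<bullet> b) \<partial>lebesgue) + (\<integral>x. (h x \<bullet> b) * \<psi> x \<partial>lebesgue)" unfolding id .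
  then have EL: "E \<longlonglongrightarrow> ?L" by (simp add: w_def)
  have Eb: "\<bar>E n\<bar> \<le> 20 * B * (?T + pi * d)" if d: "d > 0"
    and near: "\<And>x. x \<in> Sh n \<Longrightarrow> W x \<le> W ((5 / norm x) *\<^sub>R x) + d" for n d
  proof -
    have Shm: "Sh n \<in> sets borel" by (simp add: Sh_def)
    have em: "emeasure lborel (Sh n) = ennreal (pi / k n)"
    proof -
      have "(r2 n)\<^sup>2 - (r1 n)\<^sup>2 = 1 / k n" unfolding r1_def r2_def using k2[of n] by (simp add: diff_divide_distrib[symmetric])
      then show ?thesis unfolding Sh_def using emeasure_shell[of "r1 n" "r2 n"] rr[of n] by simp
    qed
    have "(\<integral>\<^sup>+x. indicator (Sh n) x * ennreal (W x) \<partial>lborel) \<le> ennreal (pi / k n * (?T / pi + d))"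
    proof (rule shell_integral_bound[where R = 5, OF Wm W0 less_imp_le[OF d] near Shm _ _ em _ T T0])
      show "rot a x \<in> Sh n \<longleftrightarrow> x \<in> Sh n" for a x by (simp add: Sh_def norm_rot)
      show "0 \<notin> Sh n" using rr(1)[of n] by (simp add: Sh_def)
      show "0 \<le> pi / k n" using kp(1)[of n] by simp
    qed
    then have "ennreal (20 * B * k n) * (\<integral>\<^sup>+x. indicator (Sh n) x * ennreal (W x) \<partial>lborel)
        \<le> ennreal (20 * B * k n) * ennreal (pi / k n * (?T / pi + d))" by (rule mult_left_mono) simp
    also have "\<dots> = ennreal (20 * B * k n * (pi / k n * (?T / pi + d)))"
      by (rule ennreal_mult[symmetric]) (use B kp[of n] T0 d in auto)
    also have "20 * B * k n * (pi / k n * (?T / pi + d)) = 20 * B * (?T + pi * d)"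
      using kp(1)[of n] by (simp add: field_simps)
    finally have le: "ennreal (20 * B * k n) * (\<integral>\<^sup>+x. indicator (Sh n) x * ennreal (W x) \<partial>lborel)
        \<le> ennreal (20 * B * (?T + pi * d))" .
    have "ennreal \<bar>E n\<bar> \<le> (\<integral>\<^sup>+x. ennreal \<bar>w x * (\<psi> x * q n x * (2 * k n) * (x \<bullet> b))\<bar> \<partial>lebesgue)"
      unfolding E_def using integral_norm_bound_ennreal[OF Ei] by simp
    also have "\<dots> \<le> (\<integral>\<^sup>+x. ennreal (20 * B * k n) * (indicator (Sh n) x * ennreal (W x)) \<partial>lebesgue)"
    proof (rule nn_integral_mono)
      fix x
      have "ennreal (20 * B * k n) * (indicator (Sh n) x * ennreal (W x)) = ennreal (20 * B * k n * (indicator (Sh n) x * W x))"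
        using B kp[of n] W0[of x] by (cases "x \<in> Sh n") (simp_all add: ennreal_mult)
      then show "ennreal \<bar>w x * (\<psi> x * q n x * (2 * k n) * (x \<bullet> b))\<bar> \<le> ennreal (20 * B * k n) * (indicator (Sh n) x * ennreal (W x))"
        using ennreal_leI[OF fb[of x n]] by simp
    qed
    also have "\<dots> = ennreal (20 * B * k n) * (\<integral>\<^sup>+x. indicator (Sh n) x * ennreal (W x) \<partial>lborel)"
      unfolding nn_integral_completion using Shm by (subst nn_integral_cmult) auto
    also note le
    finally show ?thesis using B T0 d by (simp add: ennreal_le_iff)
  qed
  \<comment> \<open>Radial projection moves a point of the shell by 5 - |x|, which is eventually
    below the distance \<delta> at which \<open>v\<close> varies by less than \<open>d\<close>. The
    excess pi * d is removed at the end because \<open>d\<close> is arbitrary.\<close>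
  have main: "\<bar>?L\<bar> \<le> 20 * B * (?T + pi * d)" if d: "d > 0" for d
  proof -
    have "uniformly_continuous_on A v" by (rule compact_uniformly_continuous[OF vA Acomp])
    then obtain \<delta> where \<delta>: "\<delta> > 0" "\<And>x y. x \<in> A \<Longrightarrow> y \<in> A \<Longrightarrow> dist y x < \<delta> \<Longrightarrow> dist (v y) (v x) < d"
      using d unfolding uniformly_continuous_on_def by metis
    have "(\<lambda>n. sqrt (25 - 2 / k n)) \<longlonglongrightarrow> sqrt 25" unfolding k_def by (intro tendsto_real_sqrt) real_asymp
    then have "r1 \<longlonglongrightarrow> 5" by (simp add: r1_def[abs_def])
    then have "\<forall>\<^sub>F n in sequentially. r1 n > 5 - \<delta>" using \<delta>(1) by (intro order_tendstoD) auto
    then have "\<forall>\<^sub>F n in sequentially. \<bar>E n\<bar> \<le> 20 * B * (?T + pi * d)"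
    proof eventually_elim
      case (elim n)
      show ?case
      proof (rule Eb[OF d])
        fix x assume x: "x \<in> Sh n"
        have n: "norm x < 5" "4 \<le> norm x" "5 - \<delta> < norm x" using x rr[of n] elim by (auto simp: Sh_def)
        have xA: "x \<in> A" using n by (simp add: A_def)
        have nx: "x \<noteq> 0" using n by auto
        have yA: "(5 / norm x) *\<^sub>R x \<in> A" using nx by (simp add: A_def)
        have "(5 / norm x) *\<^sub>R x - x = (5 / norm x - 1) *\<^sub>R x" by (simp add: algebra_simps)
        then have "dist ((5 / norm x) *\<^sub>R x) x = \<bar>5 / norm x - 1\<bar> * norm x" by (simp add: dist_norm)
        also have "\<dots> = 5 - norm x" using n nx by (simp add: abs_if field_simps)
        finally have "dist ((5 / norm x) *\<^sub>R x) x < \<delta>" using n by simp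
        from \<delta>(2)[OF xA yA this] show "W x \<le> W ((5 / norm x) *\<^sub>R x) + d"
          using xA yA by (simp add: W_def dist_real_def)
      qed
    qed
    then show ?thesis using tendsto_upperbound[OF tendsto_rabs[OF EL]] by simp
  qed
  have *: "\<bar>?L\<bar> \<le> 20 * B * ?T + e" if "e > 0" for e
  proof -
    have "\<bar>?L\<bar> \<le> 20 * B * (?T + pi * (e / (20 * B * pi)))" using that B by (intro main) simp
    also have "\<dots> = 20 * B * ?T + e" using B by (simp add: field_simps)
    finally show ?thesis .
  qed
  show ?thesis by (rule field_le_epsilon) (rule *)
qed

lemma circ_integrable:
  fixes v :: "real^2 \<Rightarrow> real"
  assumes "continuous_on (closure \<Omega>) v" "r > 0"
  shows "set_integrable lborel {0..2*pi} (\<lambda>t. \<bar>v (circ 5 t)\<bar> powr r)"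
proof -
  have "circ 5 t \<in> closure \<Omega>" for t using annulus_closure by (rule subsetD) (simp add: norm_circ)
  then have "continuous_on {0..2*pi} (\<lambda>t. v (circ 5 t))"
    by (intro continuous_on_compose2[OF assms(1) continuous_circ]) auto
  then have c: "continuous_on {0..2*pi} (\<lambda>t. \<bar>v (circ 5 t)\<bar>)" by (rule continuous_on_rabs)
  have "continuous_on {0..2*pi} (\<lambda>t. \<bar>v (circ 5 t)\<bar> powr r)"
    by (rule continuous_on_powr'[OF c continuous_on_const]) (use assms(2) in auto)
  then show ?thesis unfolding set_integrable_def by (intro borel_integrable_compact) auto
qed

text \<open>Functions with zero trace extend by zero across the circle as Sobolev functions on
  \<open>V\<close>: the defect of each approximant \<open>v n\<close> is bounded by its L^1 norm on
  the circle, which tends to 0, and the remaining errors are L^1 distances to \<phi> and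
  \<open>D\<close>.\<close>

lemma zero_extension:
  assumes \<phi>: "Sob p \<Omega> \<phi> D"
    and v: "\<And>n. continuous_on (closure \<Omega>) (v n)" and S: "\<And>n. Sob p \<Omega> (\<lambda>x. indicator \<Omega> x * v n x) (h n)"
    and c1: "(\<lambda>n. \<integral>x. norm (indicator \<Omega> x * v n x - \<phi> x) powr p \<partial>lebesgue) \<longlonglongrightarrow> 0"
    and c2: "(\<lambda>n. \<integral>x. norm (h n x - D x) powr p \<partial>lebesgue) \<longlonglongrightarrow> 0"
    and tr: "(\<lambda>n. LINT t:{0..2*pi}|lborel. \<bar>v n (circ 5 t)\<bar> powr p) \<longlonglongrightarrow> 0"
    and \<psi>: "C1c V \<psi> \<psi>'" "b \<in> Basis"
  shows "(\<integral>x. \<phi> x * (\<psi>' x \<bullet> b) \<partial>lebesgue) = - (\<integral>x. (D x \<bullet> b) * \<psi> x \<partial>lebesgue)"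
proof -
  obtain B where B: "B > 0" "\<And>x. norm (\<psi> x) \<le> B" "\<And>x. norm (\<psi>' x) \<le> B"
    by (rule C1c_bounded[OF \<psi>(1)]) blast
  have \<Omega>l: "\<Omega> \<in> lmeasurable" using \<Omega>_open \<Omega>_bounded by (simp add: lmeasurable_open)
  have \<Omega>s: "\<Omega> \<in> sets lebesgue" "emeasure lebesgue \<Omega> < \<infinity>"
    using \<Omega>l by (auto simp: fmeasurable_def)
  have d1: "Sob p \<Omega> (\<lambda>x. indicator \<Omega> x * v n x - \<phi> x) (\<lambda>x. h n x - D x)" for n
    using Sob_lincomb[OF \<Omega>_open \<Omega>_bounded p S \<phi>, of 1 n "-1"] by simp
  have L1: "(\<lambda>n. \<integral>x. norm (indicator \<Omega> x * v n x - \<phi> x) \<partial>lebesgue) \<longlonglongrightarrow> 0"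
    by (rule Lp_tendsto_zero_imp_L1[OF p \<Omega>s _ _ _ c1]) (use d1 in \<open>auto simp: Sob_def\<close>)
  have L2: "(\<lambda>n. \<integral>x. norm (h n x - D x) \<partial>lebesgue) \<longlonglongrightarrow> 0"
    by (rule Lp_tendsto_zero_imp_L1[OF p \<Omega>s _ _ _ c2]) (use d1 in \<open>auto simp: Sob_def\<close>)
  have L3: "(\<lambda>n. LINT t:{0..2*pi}|lborel. \<bar>v n (circ 5 t)\<bar>) \<longlonglongrightarrow> 0"
  proof -
    let ?f = "\<lambda>n t. indicator {0..2*pi} t *\<^sub>R \<bar>v n (circ 5 t)\<bar>"
    have e: "norm (?f n t) powr p = indicator {0..2*pi} t *\<^sub>R \<bar>v n (circ 5 t)\<bar> powr p" for n t
      by (auto simp: indicator_def)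
    have "(\<lambda>n. \<integral>t. norm (?f n t) \<partial>lborel) \<longlonglongrightarrow> 0"
    proof (rule Lp_tendsto_zero_imp_L1[OF p, of "{0..2*pi}"])
      show "integrable lborel (\<lambda>t. norm (?f n t) powr p)" for n
        unfolding e using circ_integrable[OF v[of n], of p] p by (simp add: set_integrable_def)
      show "?f n \<in> borel_measurable lborel" for n
        using circ_integrable[OF v[of n], of 1] by (simp add: set_integrable_def)
      show "(\<lambda>n. \<integral>t. norm (?f n t) powr p \<partial>lborel) \<longlonglongrightarrow> 0"
        unfolding e using tr by (simp add: set_lebesgue_integral_def)
    qed auto
    then show ?thesis by (simp add: set_lebesgue_integral_def abs_mult)
  qed
  let ?L = "(\<integral>x. \<phi> x * (\<psi>' x \<bullet> b) \<partial>lebesgue) + (\<integral>x. (D x \<bullet> b) * \<psi> x \<partial>lebesgue)"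
  have bd: "\<bar>?L\<bar> \<le> 20 * B * (LINT t:{0..2*pi}|lborel. \<bar>v n (circ 5 t)\<bar>)
      + (B * (\<integral>x. norm (indicator \<Omega> x * v n x - \<phi> x) \<partial>lebesgue) + B * (\<integral>x. norm (h n x - D x) \<partial>lebesgue))" for n
  proof -
    note i0 = Sob_integrable[OF d1[of n] \<Omega>_open \<Omega>_bounded p]
    note i1 = Sob_weak_integrable[OF S[of n] \<psi>(1) \<Omega>_open \<Omega>_bounded p, of b]
    note i2 = Sob_weak_integrable[OF \<phi> \<psi>(1) \<Omega>_open \<Omega>_bounded p, of b]
    note i3 = Sob_weak_integrable[OF d1[of n] \<psi>(1) \<Omega>_open \<Omega>_bounded p, of b]
    have bn: "norm b = 1" using \<psi>(2) by simp
    have x1: "(\<integral>x. (indicator \<Omega> x * v n x) * (\<psi>' x \<bullet> b) \<partial>lebesgue) - (\<integral>x. \<phi> x * (\<psi>' x \<bullet> b) \<partial>lebesgue)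
       = (\<integral>x. (indicator \<Omega> x * v n x - \<phi> x) * (\<psi>' x \<bullet> b) \<partial>lebesgue)"
      using i1(1) i2(1) by (simp add: left_diff_distrib)
    have x2: "(\<integral>x. (h n x \<bullet> b) * \<psi> x \<partial>lebesgue) - (\<integral>x. (D x \<bullet> b) * \<psi> x \<partial>lebesgue)
       = (\<integral>x. ((h n x - D x) \<bullet> b) * \<psi> x \<partial>lebesgue)"
      using i1(2) i2(2) by (simp add: left_diff_distrib inner_diff_left)
    have y1: "\<bar>\<integral>x. (indicator \<Omega> x * v n x - \<phi> x) * (\<psi>' x \<bullet> b) \<partial>lebesgue\<bar>
       \<le> B * (\<integral>x. norm (indicator \<Omega> x * v n x - \<phi> x) \<partial>lebesgue)"
    proof -
      have "\<bar>\<integral>x. (indicator \<Omega> x * v n x - \<phi> x) * (\<psi>' x \<bullet> b) \<partial>lebesgue\<bar>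
         \<le> (\<integral>x. B * norm (indicator \<Omega> x * v n x - \<phi> x) \<partial>lebesgue)"
      proof (rule integral_abs_bound[THEN order_trans], rule integral_mono')
        show "integrable lebesgue (\<lambda>x. B * norm (indicator \<Omega> x * v n x - \<phi> x))"
          using i0(1) by (intro integrable_mult_right integrable_norm)
        fix x
        have "\<bar>\<psi>' x \<bullet> b\<bar> \<le> B" using Cauchy_Schwarz_ineq2[of "\<psi>' x" b] B(3)[of x] bn by simp
        then have "\<bar>indicator \<Omega> x * v n x - \<phi> x\<bar> * \<bar>\<psi>' x \<bullet> b\<bar> \<le> \<bar>indicator \<Omega> x * v n x - \<phi> x\<bar> * B"
          by (rule mult_left_mono) simp
        then show "\<bar>(indicator \<Omega> x * v n x - \<phi> x) * (\<psi>' x \<bullet> b)\<bar> \<le> B * norm (indicator \<Omega> x * v n x - \<phi> x)"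
          by (simp add: abs_mult mult.commute)
      qed (use B in auto)
      then show ?thesis by simp
    qed
    have y2: "\<bar>\<integral>x. ((h n x - D x) \<bullet> b) * \<psi> x \<partial>lebesgue\<bar> \<le> B * (\<integral>x. norm (h n x - D x) \<partial>lebesgue)"
    proof -
      have "\<bar>\<integral>x. ((h n x - D x) \<bullet> b) * \<psi> x \<partial>lebesgue\<bar> \<le> (\<integral>x. B * norm (h n x - D x) \<partial>lebesgue)"
      proof (rule integral_abs_bound[THEN order_trans], rule integral_mono')
        show "integrable lebesgue (\<lambda>x. B * norm (h n x - D x))"
          using i0(2) by (intro integrable_mult_right integrable_norm)
        fix x
        have "\<bar>(h n x - D x) \<bullet> b\<bar> \<le> norm (h n x - D x)" using Cauchy_Schwarz_ineq2[of "h n x - D x" b] bn by simp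
        then have "\<bar>(h n x - D x) \<bullet> b\<bar> * \<bar>\<psi> x\<bar> \<le> norm (h n x - D x) * B"
          using B(2)[of x] by (intro mult_mono) auto
        then show "\<bar>((h n x - D x) \<bullet> b) * \<psi> x\<bar> \<le> B * norm (h n x - D x)"
          by (simp add: abs_mult mult.commute)
      qed (use B in auto)
      then show ?thesis by simp
    qed
    show ?thesis using trace_estimate[OF v[of n] S[of n] \<psi> B(1,2)] x1 x2 y1 y2 by linarith
  qed
  have "(\<lambda>n. 20 * B * (LINT t:{0..2*pi}|lborel. \<bar>v n (circ 5 t)\<bar>)
      + (B * (\<integral>x. norm (indicator \<Omega> x * v n x - \<phi> x) \<partial>lebesgue) + B * (\<integral>x. norm (h n x - D x) \<partial>lebesgue)))
      \<longlonglongrightarrow> 20 * B * 0 + (B * 0 + B * 0)"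
    by (intro tendsto_intros L1 L2 L3)
  then have "\<bar>?L\<bar> \<le> 20 * B * 0 + (B * 0 + B * 0)"
    by (rule tendsto_lowerbound) (use bd in auto)
  then show ?thesis by simp
qed


end

section \<open>Symmetry of the solution\<close>

lemma Lp_zero_bound:
  fixes f :: "nat \<Rightarrow> 'a \<Rightarrow> 'b::euclidean_space" and g :: "nat \<Rightarrow> 'a \<Rightarrow> 'c::euclidean_space"
  assumes p: "p \<ge> 0" and B: "B \<ge> 0" and b: "\<And>n x. norm (g n x) \<le> B * norm (f n x)"
    and f: "\<And>n. integrable M (\<lambda>x. norm (f n x) powr p)" "(\<lambda>n. \<integral>x. norm (f n x) powr p \<partial>M) \<longlonglongrightarrow> 0"
  shows "(\<lambda>n. \<integral>x. norm (g n x) powr p \<partial>M) \<longlonglongrightarrow> 0"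
proof (rule tendsto_sandwich[OF _ _ tendsto_const])
  show "(\<lambda>n. B powr p * (\<integral>x. norm (f n x) powr p \<partial>M)) \<longlonglongrightarrow> 0"
    by (rule tendsto_mult_right_zero[OF f(2)])
  have "(\<integral>x. norm (g n x) powr p \<partial>M) \<le> (\<integral>x. B powr p * norm (f n x) powr p \<partial>M)" for n
  proof (rule integral_mono')
    show "integrable M (\<lambda>x. B powr p * norm (f n x) powr p)" using f(1) by simp
    show "norm (g n x) powr p \<le> B powr p * norm (f n x) powr p" for x
      using powr_mono2[OF p norm_ge_zero b[of n x]] B by (simp add: powr_mult)
  qed simp
  then show "\<forall>\<^sub>F n in sequentially. (\<integral>x. norm (g n x) powr p \<partial>M) \<le> B powr p * (\<integral>x. norm (f n x) powr p \<partial>M)" by simp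
qed (auto intro!: always_eventually integral_nonneg_AE)

lemma Lp_zero_add:
  fixes f g :: "nat \<Rightarrow> 'a \<Rightarrow> 'b::euclidean_space"
  assumes p: "p \<ge> 0"
    and f: "\<And>n. integrable M (\<lambda>x. norm (f n x) powr p)" "(\<lambda>n. \<integral>x. norm (f n x) powr p \<partial>M) \<longlonglongrightarrow> 0"
    and g: "\<And>n. integrable M (\<lambda>x. norm (g n x) powr p)" "(\<lambda>n. \<integral>x. norm (g n x) powr p \<partial>M) \<longlonglongrightarrow> 0"
  shows "(\<lambda>n. \<integral>x. norm (f n x + g n x) powr p \<partial>M) \<longlonglongrightarrow> 0"
proof (rule tendsto_sandwich[OF _ _ tendsto_const])
  have "(\<lambda>n. 2 powr p * ((\<integral>x. norm (f n x) powr p \<partial>M) + (\<integral>x. norm (g n x) powr p \<partial>M))) \<longlonglongrightarrow> 2 powr p * (0 + 0)"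
    by (intro tendsto_intros f g)
  then show "(\<lambda>n. 2 powr p * ((\<integral>x. norm (f n x) powr p \<partial>M) + (\<integral>x. norm (g n x) powr p \<partial>M))) \<longlonglongrightarrow> 0" by simp
  have "(\<integral>x. norm (f n x + g n x) powr p \<partial>M) \<le> (\<integral>x. 2 powr p * (norm (f n x) powr p + norm (g n x) powr p) \<partial>M)" for n
    by (rule integral_mono') (use f(1) g(1) norm_add_powr_le[OF p] in auto)
  then show "\<forall>\<^sub>F n in sequentially. (\<integral>x. norm (f n x + g n x) powr p \<partial>M)
     \<le> 2 powr p * ((\<integral>x. norm (f n x) powr p \<partial>M) + (\<integral>x. norm (g n x) powr p \<partial>M))" using f(1) g(1) by simp
qed (auto intro!: always_eventually integral_nonneg_AE)

abbreviation e1 :: "real^2" where "e1 \<equiv> axis 1 1"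

lemma e1_Basis [simp]: "e1 \<in> Basis" by (simp add: axis_in_Basis_iff)

lemma inner_e1 [simp]: "x \<bullet> e1 = x $ 1" by (simp add: inner_axis)

lemma reflect_e1_nth [simp]: "reflect e1 x $ 1 = - (x $ 1)" "reflect e1 x $ 2 = x $ 2"
  by (simp_all add: reflect_def)

lemma reflect_circ: "reflect e1 (circ r t) = circ r (pi - t)"
  by (simp add: vec_eq_real2 cos_diff sin_diff)

lemma nn_integral_circ_reflect:
  fixes f :: "real^2 \<Rightarrow> ennreal"
  assumes [measurable]: "f \<in> borel_measurable borel"
  shows "(\<integral>\<^sup>+t. indicator {0..2*pi} t * f (circ r (pi - t)) \<partial>lborel) \<le> 2 * (\<integral>\<^sup>+t. indicator {0..2*pi} t * f (circ r t) \<partial>lborel)"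
proof -
  have [measurable]: "circ r \<in> borel_measurable borel"
    by (intro borel_measurable_continuous_onI continuous_circ)
  have per: "circ r (2*pi + a) = circ r a" for a by (simp add: vec_eq_real2 add.commute[of "2 * pi"])
  have "(\<integral>\<^sup>+t. indicator {0..2*pi} t * f (circ r (pi - t)) \<partial>lborel)
      = (\<integral>\<^sup>+t. indicator {0..2*pi} (pi + (-1) * t) * f (circ r (pi - (pi + (-1) * t))) \<partial>lborel)"
    by (subst nn_integral_real_affine[of _ "-1" "pi"]) simp_all
  also have "\<dots> \<le> (\<integral>\<^sup>+t. indicator {0..2*pi} t * f (circ r t) + indicator {0..2*pi} (2*pi + 1 * t) * f (circ r (2*pi + 1 * t)) \<partial>lborel)"
    using per by (intro nn_integral_mono) (auto simp: indicator_def)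
  also have "\<dots> = (\<integral>\<^sup>+t. indicator {0..2*pi} t * f (circ r t) \<partial>lborel)
      + (\<integral>\<^sup>+t. indicator {0..2*pi} (2*pi + 1 * t) * f (circ r (2*pi + 1 * t)) \<partial>lborel)"
    by (rule nn_integral_add) measurable
  also have "(\<integral>\<^sup>+t. indicator {0..2*pi} (2*pi + 1 * t) * f (circ r (2*pi + 1 * t)) \<partial>lborel)
      = (\<integral>\<^sup>+t. indicator {0..2*pi} t * f (circ r t) \<partial>lborel)"
    by (subst nn_integral_real_affine[of "\<lambda>t. indicator {0..2*pi} t * f (circ r t)" 1 "2*pi"]) simp_all
  finally show ?thesis by (simp only: mult_2)
qed

locale plap = disc_domain V \<Omega> p for V \<Omega> p +
  assumes p1: "p > 1" and sym: "\<And>x. x \<in> \<Omega> \<Longrightarrow> reflect e1 x \<in> \<Omega>"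
begin

lemma sym_iff: "reflect e1 x \<in> \<Omega> \<longleftrightarrow> x \<in> \<Omega>"
  using sym[of x] sym[of "reflect e1 x"] by auto

lemma closure_sym: "x \<in> closure \<Omega> \<Longrightarrow> reflect e1 x \<in> closure \<Omega>"
  using image_closure_subset[OF continuous_on_reflect[of "closure \<Omega>" e1], of "closure \<Omega>"] sym closure_subset
  by blast

lemma circ_closure: "circ 5 t \<in> closure \<Omega>"
  using annulus_closure by (rule subsetD) (simp add: norm_circ)

definition circle_Lp :: "(real^2 \<Rightarrow> real) \<Rightarrow> real" where
  "circle_Lp y = (\<integral>t. norm (indicator {0..2*pi} t * y (circ 5 t)) powr p \<partial>lborel)"

lemma circle_Lp_eq: "circle_Lp y = (LINT t:{0..2*pi}|lborel. \<bar>y (circ 5 t)\<bar> powr p)"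
  unfolding circle_Lp_def set_lebesgue_integral_def
  by (intro Bochner_Integration.integral_cong) (auto simp: indicator_def)

lemma circle_integrable:
  fixes y :: "real^2 \<Rightarrow> real"
  assumes "continuous_on (closure \<Omega>) y"
  shows "integrable lborel (\<lambda>t. norm (indicator {0..2*pi} t * y (circ 5 t)) powr p)"
proof -
  have "integrable lborel (\<lambda>t. indicator {0..2*pi} t *\<^sub>R \<bar>y (circ 5 t)\<bar> powr p)"
    using circ_integrable[OF assms, of p] p by (simp add: set_integrable_def)
  then show ?thesis
    by (rule Bochner_Integration.integrable_cong[THEN iffD1, rotated 2]) (auto simp: indicator_def)
qed

text \<open>\<open>approx u g f v h\<close>: the functions \<open>v n\<close> witness that \<open>u\<close> has trace \<open>f\<close> on the circle.\<close>

definition approx :: "(real^2 \<Rightarrow> real) \<Rightarrow> (real^2 \<Rightarrow> real^2) \<Rightarrow> (real^2 \<Rightarrow> real) \<Rightarrow>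
    (nat \<Rightarrow> real^2 \<Rightarrow> real) \<Rightarrow> (nat \<Rightarrow> real^2 \<Rightarrow> real^2) \<Rightarrow> bool" where
  "approx u g f v h \<longleftrightarrow> Sob p \<Omega> u g \<and> continuous_on (closure \<Omega>) f \<and>
     (\<forall>n. continuous_on (closure \<Omega>) (v n)) \<and> (\<forall>n. Sob p \<Omega> (\<lambda>x. indicator \<Omega> x * v n x) (h n)) \<and>
     (\<lambda>n. \<integral>x. norm (indicator \<Omega> x * v n x - u x) powr p \<partial>lebesgue) \<longlonglongrightarrow> 0 \<and>
     (\<lambda>n. \<integral>x. norm (h n x - g x) powr p \<partial>lebesgue) \<longlonglongrightarrow> 0 \<and>
     (\<lambda>n. circle_Lp (\<lambda>x. v n x - f x)) \<longlonglongrightarrow> 0"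

lemma approx_diff_Sob:
  assumes "approx u g f v h"
  shows "Sob p \<Omega> (\<lambda>x. indicator \<Omega> x * v n x - u x) (\<lambda>x. h n x - g x)"
  using Sob_lincomb[OF \<Omega>_open \<Omega>_bounded p, of "\<lambda>x. indicator \<Omega> x * v n x" "h n" u g 1 "-1"] assms
  by (simp add: approx_def)

lemma approx_lincomb:
  assumes A: "approx u g f v h" and A': "approx u' g' f' v' h'"
  shows "approx (\<lambda>x. a * u x + c * u' x) (\<lambda>x. a *\<^sub>R g x + c *\<^sub>R g' x) (\<lambda>x. a * f x + c * f' x)
     (\<lambda>n x. a * v n x + c * v' n x) (\<lambda>n x. a *\<^sub>R h n x + c *\<^sub>R h' n x)"
proof -
  have p0: "p \<ge> 0" using p by simp
  note d = approx_diff_Sob[OF A] approx_diff_Sob[OF A']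
  have sc: "(\<lambda>n. \<integral>x. norm (k *\<^sub>R y n x) powr p \<partial>M) \<longlonglongrightarrow> 0 \<and> (\<forall>n. integrable M (\<lambda>x. norm (k *\<^sub>R y n x) powr p))"
    if "\<And>n. integrable M (\<lambda>x. norm (y n x) powr p)" "(\<lambda>n. \<integral>x. norm (y n x) powr p \<partial>M) \<longlonglongrightarrow> 0"
    for k and y :: "nat \<Rightarrow> 'a \<Rightarrow> 'b::euclidean_space" and M
  proof -
    have "(\<lambda>n. \<integral>x. norm (k *\<^sub>R y n x) powr p \<partial>M) \<longlonglongrightarrow> 0"
      by (rule Lp_zero_bound[OF p0 abs_ge_zero[of k] _ that]) simp
    then show ?thesis using that(1) by (simp add: powr_mult)
  qed
  have I: "(\<lambda>n. \<integral>x. norm (a *\<^sub>R y n x + c *\<^sub>R z n x) powr p \<partial>M) \<longlonglongrightarrow> 0"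
    if "\<And>n. integrable M (\<lambda>x. norm (y n x) powr p)" "(\<lambda>n. \<integral>x. norm (y n x) powr p \<partial>M) \<longlonglongrightarrow> 0"
      "\<And>n. integrable M (\<lambda>x. norm (z n x) powr p)" "(\<lambda>n. \<integral>x. norm (z n x) powr p \<partial>M) \<longlonglongrightarrow> 0"
    for y z :: "nat \<Rightarrow> 'a \<Rightarrow> 'b::euclidean_space" and M
    using sc[OF that(1,2), of a] sc[OF that(3,4), of c] by (intro Lp_zero_add p0) auto
  show ?thesis unfolding approx_def
  proof (intro conjI allI)
    show "Sob p \<Omega> (\<lambda>x. a * u x + c * u' x) (\<lambda>x. a *\<^sub>R g x + c *\<^sub>R g' x)"
      using A A' by (intro Sob_lincomb \<Omega>_open \<Omega>_bounded p) (auto simp: approx_def)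
    show "Sob p \<Omega> (\<lambda>x. indicator \<Omega> x * (a * v n x + c * v' n x)) (\<lambda>x. a *\<^sub>R h n x + c *\<^sub>R h' n x)" for n
      using Sob_lincomb[OF \<Omega>_open \<Omega>_bounded p, of "\<lambda>x. indicator \<Omega> x * v n x" "h n" "\<lambda>x. indicator \<Omega> x * v' n x" "h' n" a c] A A'
      by (simp add: approx_def algebra_simps)
    show "continuous_on (closure \<Omega>) (\<lambda>x. a * f x + c * f' x)" "continuous_on (closure \<Omega>) (\<lambda>x. a * v n x + c * v' n x)" for n
      using A A' by (auto simp: approx_def intro!: continuous_intros)
    have "(\<lambda>n. \<integral>x. norm (a *\<^sub>R (indicator \<Omega> x * v n x - u x) + c *\<^sub>R (indicator \<Omega> x * v' n x - u' x)) powr p \<partial>lebesgue) \<longlonglongrightarrow> 0"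
      by (rule I) (use A A' d in \<open>auto simp: approx_def Sob_def\<close>)
    then show "(\<lambda>n. \<integral>x. norm (indicator \<Omega> x * (a * v n x + c * v' n x) - (a * u x + c * u' x)) powr p \<partial>lebesgue) \<longlonglongrightarrow> 0"
      by (simp add: algebra_simps)
    have "(\<lambda>n. \<integral>x. norm (a *\<^sub>R (h n x - g x) + c *\<^sub>R (h' n x - g' x)) powr p \<partial>lebesgue) \<longlonglongrightarrow> 0"
      by (rule I) (use A A' d in \<open>auto simp: approx_def Sob_def\<close>)
    then show "(\<lambda>n. \<integral>x. norm (a *\<^sub>R h n x + c *\<^sub>R h' n x - (a *\<^sub>R g x + c *\<^sub>R g' x)) powr p \<partial>lebesgue) \<longlonglongrightarrow> 0"
      by (simp add: algebra_simps)
    have "(\<lambda>n. \<integral>t. norm (a *\<^sub>R (indicator {0..2*pi} t * (v n (circ 5 t) - f (circ 5 t)))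
        + c *\<^sub>R (indicator {0..2*pi} t * (v' n (circ 5 t) - f' (circ 5 t)))) powr p \<partial>lborel) \<longlonglongrightarrow> 0"
    proof (rule I)
      show "integrable lborel (\<lambda>t. norm (indicator {0..2*pi} t * (v n (circ 5 t) - f (circ 5 t))) powr p)" for n
        by (rule circle_integrable[of "\<lambda>x. v n x - f x"]) (use A in \<open>auto simp: approx_def intro!: continuous_intros\<close>)
      show "integrable lborel (\<lambda>t. norm (indicator {0..2*pi} t * (v' n (circ 5 t) - f' (circ 5 t))) powr p)" for n
        by (rule circle_integrable[of "\<lambda>x. v' n x - f' x"]) (use A' in \<open>auto simp: approx_def intro!: continuous_intros\<close>)
    qed (use A A' in \<open>auto simp: approx_def circle_Lp_def\<close>)
    then show "(\<lambda>n. circle_Lp (\<lambda>x. a * v n x + c * v' n x - (a * f x + c * f' x))) \<longlonglongrightarrow> 0"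
      unfolding circle_Lp_def by (simp add: algebra_simps)
  qed
qed

lemma circle_Lp_reflect:
  assumes y: "continuous_on (closure \<Omega>) y"
  shows "circle_Lp (\<lambda>x. y (reflect e1 x)) \<le> 2 * circle_Lp y"
proof -
  \<comment> \<open>\<open>y\<close> is continuous just on the closure of \<Omega>; cut down to the
    circle it becomes a Borel function on the plane, to which
    \<open>nn_integral_circ_reflect\<close> applies.\<close>
  define Y where "Y x = norm (indicator {x. norm x = 5} x *\<^sub>R y x) powr p" for x
  have sub: "{x::real^2. norm x = 5} \<subseteq> closure \<Omega>" using annulus_closure by auto
  have cl: "{x::real^2. norm x = 5} \<in> sets borel" by (intro borel_closed closed_Collect_eq continuous_intros)
  have "(\<lambda>x. indicator {x. norm x = 5} x *\<^sub>R y x) \<in> borel_measurable borel"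
    by (rule borel_measurable_continuous_on_indicator[OF cl continuous_on_subset[OF y sub]])
  then have [measurable]: "Y \<in> borel_measurable borel" unfolding Y_def[abs_def] by measurable
  have Yc: "Y (circ 5 t) = \<bar>y (circ 5 t)\<bar> powr p" for t by (simp add: Y_def norm_circ)
  have yR: "continuous_on (closure \<Omega>) (\<lambda>x. y (reflect e1 x))"
    by (rule continuous_on_compose2[OF y continuous_on_reflect]) (use closure_sym in auto)
  have E: "ennreal (circle_Lp z) = (\<integral>\<^sup>+t. indicator {0..2*pi} t * ennreal (\<bar>z (circ 5 t)\<bar> powr p) \<partial>lborel)"
    if "continuous_on (closure \<Omega>) z" for z
    unfolding circle_Lp_def
    by (subst nn_integral_eq_integral[symmetric, OF circle_integrable[OF that]])
       (auto intro!: nn_integral_cong simp: indicator_def)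
  have "ennreal (circle_Lp (\<lambda>x. y (reflect e1 x))) = (\<integral>\<^sup>+t. indicator {0..2*pi} t * ennreal (Y (circ 5 (pi - t))) \<partial>lborel)"
    unfolding E[OF yR] Yc reflect_circ ..
  also have "\<dots> \<le> 2 * (\<integral>\<^sup>+t. indicator {0..2*pi} t * ennreal (Y (circ 5 t)) \<partial>lborel)"
    by (rule nn_integral_circ_reflect) measurable
  also have "\<dots> = 2 * ennreal (circle_Lp y)" unfolding E[OF y] Yc ..
  also have "\<dots> = ennreal (2 * circle_Lp y)" by (simp add: ennreal_mult')
  finally show ?thesis
    by (subst (asm) ennreal_le_iff) (auto simp: circle_Lp_def intro!: integral_nonneg_AE)
qed

lemma approx_reflect:
  assumes A: "approx u g f v h"
  shows "approx (\<lambda>x. u (reflect e1 x)) (\<lambda>x. reflect e1 (g (reflect e1 x))) (\<lambda>x. f (reflect e1 x))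
     (\<lambda>n x. v n (reflect e1 x)) (\<lambda>n x. reflect e1 (h n (reflect e1 x)))"
  unfolding approx_def
proof (intro conjI allI)
  note d = approx_diff_Sob[OF A]
  have ind: "indicator \<Omega> (reflect e1 x) = (indicator \<Omega> x :: real)" for x by (simp add: indicator_def sym_iff)
  have cont: "continuous_on (closure \<Omega>) (\<lambda>x. z (reflect e1 x))" if "continuous_on (closure \<Omega>) z" for z :: "real^2 \<Rightarrow> real"
    by (rule continuous_on_compose2[OF that continuous_on_reflect]) (use closure_sym in auto)
  show "Sob p \<Omega> (\<lambda>x. u (reflect e1 x)) (\<lambda>x. reflect e1 (g (reflect e1 x)))"
    by (rule Sob_reflect) (use A sym in \<open>auto simp: approx_def\<close>)
  show "Sob p \<Omega> (\<lambda>x. indicator \<Omega> x * v n (reflect e1 x)) (\<lambda>x. reflect e1 (h n (reflect e1 x)))" for n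
    using Sob_reflect[of p \<Omega> "\<lambda>x. indicator \<Omega> x * v n x" "h n" e1] A sym by (simp add: approx_def ind)
  show "continuous_on (closure \<Omega>) (\<lambda>x. f (reflect e1 x))" "continuous_on (closure \<Omega>) (\<lambda>x. v n (reflect e1 x))" for n
    using A by (auto simp: approx_def intro!: cont)
  have i1: "(\<integral>x. norm (indicator \<Omega> x * v n (reflect e1 x) - u (reflect e1 x)) powr p \<partial>lebesgue)
      = (\<integral>x. norm (indicator \<Omega> x * v n x - u x) powr p \<partial>lebesgue)" for n
  proof -
    have "(\<lambda>x. norm (indicator \<Omega> x * v n x - u x) powr p) \<in> borel_measurable lebesgue"
      using d[of n] unfolding Sob_def by (blast intro: borel_measurable_integrable)
    from integral_reflect(1)[OF e1_Basis this] show ?thesis by (simp add: ind)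
  qed
  show "(\<lambda>n. \<integral>x. norm (indicator \<Omega> x * v n (reflect e1 x) - u (reflect e1 x)) powr p \<partial>lebesgue) \<longlonglongrightarrow> 0"
    unfolding i1 using A by (simp add: approx_def)
  have rd: "reflect e1 a - reflect e1 b = reflect e1 (a - b)" for a b :: "real^2" by (simp add: reflect_def algebra_simps)
  have i2: "(\<integral>x. norm (reflect e1 (h n (reflect e1 x)) - reflect e1 (g (reflect e1 x))) powr p \<partial>lebesgue)
      = (\<integral>x. norm (h n x - g x) powr p \<partial>lebesgue)" for n
  proof -
    have "(\<lambda>x. norm (h n x - g x) powr p) \<in> borel_measurable lebesgue"
      using d[of n] unfolding Sob_def by (blast intro: borel_measurable_integrable)
    from integral_reflect(1)[OF e1_Basis this] show ?thesis by (simp add: rd norm_reflect)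
  qed
  show "(\<lambda>n. \<integral>x. norm (reflect e1 (h n (reflect e1 x)) - reflect e1 (g (reflect e1 x))) powr p \<partial>lebesgue) \<longlonglongrightarrow> 0"
    unfolding i2 using A by (simp add: approx_def)
  show "(\<lambda>n. circle_Lp (\<lambda>x. v n (reflect e1 x) - f (reflect e1 x))) \<longlonglongrightarrow> 0"
  proof (rule tendsto_sandwich[OF _ _ tendsto_const])
    show "(\<lambda>n. 2 * circle_Lp (\<lambda>x. v n x - f x)) \<longlonglongrightarrow> 0"
      by (rule tendsto_mult_right_zero) (use A in \<open>simp add: approx_def\<close>)
    have "circle_Lp (\<lambda>x. v n (reflect e1 x) - f (reflect e1 x)) \<le> 2 * circle_Lp (\<lambda>x. v n x - f x)" for n
      by (rule circle_Lp_reflect[of "\<lambda>x. v n x - f x"]) (use A in \<open>auto simp: approx_def intro!: continuous_intros\<close>)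
    then show "\<forall>\<^sub>F n in sequentially. circle_Lp (\<lambda>x. v n (reflect e1 x) - f (reflect e1 x)) \<le> 2 * circle_Lp (\<lambda>x. v n x - f x)" by simp
  qed (auto simp: circle_Lp_def intro!: always_eventually integral_nonneg_AE)
qed

text \<open>Odd functions vanish on the axis, so the truncated approximants are still continuous,
  \<open>Sob_half\<close> gives the weak gradients of the truncations, and truncation does not
  increase L^p distances.\<close>

lemma approx_half:
  assumes A: "approx u g f v h" and odd: "\<And>x. u (reflect e1 x) = - u x" "\<And>n x. v n (reflect e1 x) = - v n x"
    "\<And>x. f (reflect e1 x) = - f x"
  shows "approx (\<lambda>x. if x $ 1 > 0 then u x else 0) (\<lambda>x. if x $ 1 > 0 then g x else 0) (\<lambda>x. if x $ 1 > 0 then f x else 0)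
     (\<lambda>n x. if x $ 1 > 0 then v n x else 0) (\<lambda>n x. if x $ 1 > 0 then h n x else 0)"
  unfolding approx_def
proof (intro conjI allI)
  note d = approx_diff_Sob[OF A]
  have p0: "p \<ge> 0" using p by simp
  have ind: "indicator \<Omega> (reflect e1 x) = (indicator \<Omega> x :: real)" for x by (simp add: indicator_def sym_iff)
  show "Sob p \<Omega> (\<lambda>x. if x $ 1 > 0 then u x else 0) (\<lambda>x. if x $ 1 > 0 then g x else 0)"
    using Sob_half[OF \<Omega>_open \<Omega>_bounded sym p, of u g] odd(1) A by (simp add: approx_def)
  show "Sob p \<Omega> (\<lambda>x. indicator \<Omega> x * (if x $ 1 > 0 then v n x else 0)) (\<lambda>x. if x $ 1 > 0 then h n x else 0)" for n
  proof -
    have e: "indicator \<Omega> x * (if x $ 1 > 0 then v n x else 0) = (if x \<bullet> e1 > 0 then indicator \<Omega> x * v n x else 0)" for x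
      by simp
    show ?thesis unfolding e
      using Sob_half[OF \<Omega>_open \<Omega>_bounded sym p, of "\<lambda>x. indicator \<Omega> x * v n x" "h n"] A odd(2)
      by (simp add: approx_def ind)
  qed
  have cont: "continuous_on (closure \<Omega>) (\<lambda>x. if x $ 1 > 0 then z x else 0)"
    if z: "continuous_on (closure \<Omega>) z" "\<And>x. z (reflect e1 x) = - z x" for z :: "real^2 \<Rightarrow> real"
  proof -
    have z0: "z x = 0" if "x $ 1 = 0" for x
    proof -
      have "reflect e1 x = x" using that by (simp add: vec_eq_real2)
      then show ?thesis using z(2)[of x] by simp
    qed
    have "continuous_on ({x \<in> closure \<Omega>. x $ 1 \<ge> 0} \<union> {x \<in> closure \<Omega>. x $ 1 \<le> 0}) (\<lambda>x. if x $ 1 > 0 then z x else 0)"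
    proof (rule continuous_on_closed_Un)
      show "closed {x \<in> closure \<Omega>. x $ 1 \<ge> 0}" "closed {x \<in> closure \<Omega>. x $ 1 \<le> 0}"
        by (intro closed_Collect_conj closed_closure[unfolded closed_def] closed_Collect_le continuous_intros; simp)+
      show "continuous_on {x \<in> closure \<Omega>. x $ 1 \<ge> 0} (\<lambda>x. if x $ 1 > 0 then z x else 0)"
        by (rule continuous_on_eq[OF continuous_on_subset[OF z(1)]]) (use z0 in force)+
      show "continuous_on {x \<in> closure \<Omega>. x $ 1 \<le> 0} (\<lambda>x. if x $ 1 > 0 then z x else 0)"
        by (rule continuous_on_eq[OF continuous_on_const[of _ 0]]) auto
    qed
    moreover have "{x \<in> closure \<Omega>. x $ 1 \<ge> 0} \<union> {x \<in> closure \<Omega>. x $ 1 \<le> 0} = closure \<Omega>" by auto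
    ultimately show ?thesis by simp
  qed
  show "continuous_on (closure \<Omega>) (\<lambda>x. if x $ 1 > 0 then f x else 0)" "continuous_on (closure \<Omega>) (\<lambda>x. if x $ 1 > 0 then v n x else 0)" for n
    using A odd by (auto simp: approx_def intro!: cont)
  show "(\<lambda>n. \<integral>x. norm (indicator \<Omega> x * (if x $ 1 > 0 then v n x else 0) - (if x $ 1 > 0 then u x else 0)) powr p \<partial>lebesgue) \<longlonglongrightarrow> 0"
    by (rule Lp_zero_bound[OF p0 zero_le_one, of _ "\<lambda>n x. indicator \<Omega> x * v n x - u x"]) (use A d in \<open>auto simp: approx_def Sob_def\<close>)
  show "(\<lambda>n. \<integral>x. norm ((if x $ 1 > 0 then h n x else 0) - (if x $ 1 > 0 then g x else 0)) powr p \<partial>lebesgue) \<longlonglongrightarrow> 0"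
    by (rule Lp_zero_bound[OF p0 zero_le_one, of _ "\<lambda>n x. h n x - g x"]) (use A d in \<open>auto simp: approx_def Sob_def\<close>)
  show "(\<lambda>n. circle_Lp (\<lambda>x. (if x $ 1 > 0 then v n x else 0) - (if x $ 1 > 0 then f x else 0))) \<longlonglongrightarrow> 0"
    unfolding circle_Lp_def
  proof (rule Lp_zero_bound[OF p0 zero_le_one, of _ "\<lambda>n t. indicator {0..2*pi} t * (v n (circ 5 t) - f (circ 5 t))"])
    show "integrable lborel (\<lambda>t. norm (indicator {0..2*pi} t * (v n (circ 5 t) - f (circ 5 t))) powr p)" for n
      by (rule circle_integrable[of "\<lambda>x. v n x - f x"]) (use A in \<open>auto simp: approx_def intro!: continuous_intros\<close>)
  qed (use A in \<open>auto simp: approx_def circle_Lp_def\<close>)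
qed

end

section \<open>Oddness of the solution by uniqueness\<close>

lemma pfield_reflect: "e \<in> Basis \<Longrightarrow> pfield p (- reflect e a) = - reflect e (pfield p a)"
  by (simp add: pfield_def norm_reflect)

lemma pfield_measurable:
  fixes g :: "'a \<Rightarrow> 'b::euclidean_space"
  assumes [measurable]: "g \<in> borel_measurable M"
  shows "(\<lambda>x. pfield p (g x)) \<in> borel_measurable M"
  unfolding pfield_def by measurable

lemma pfield_integrable:
  fixes g D :: "'a \<Rightarrow> 'b::euclidean_space"
  assumes "p > 1" "g \<in> borel_measurable M" "D \<in> borel_measurable M"
    "integrable M (\<lambda>x. norm (g x) powr p)" "integrable M (\<lambda>x. norm (D x) powr p)"
  shows "integrable M (\<lambda>x. pfield p (g x) \<bullet> D x)"
proof (rule Bochner_Integration.integrable_bound)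
  show "integrable M (\<lambda>x. norm (g x) powr p + norm (D x) powr p)" using assms by simp
  show "(\<lambda>x. pfield p (g x) \<bullet> D x) \<in> borel_measurable M"
    using assms(3) pfield_measurable[OF assms(2)] by measurable
  show "AE x in M. norm (pfield p (g x) \<bullet> D x) \<le> norm (norm (g x) powr p + norm (D x) powr p)"
    using pfield_inner_bound[OF assms(1)] by (intro AE_I2) (simp add: abs_of_nonneg)
qed

context plap
begin

text \<open>This is the uniqueness proof for the two solutions u and -u(Rx), with R the reflection.
  Their difference u + u(Rx) has zero trace because x_1 is odd, and serves as test function. The
  weak equation of the reflected solution is that of u after the change of variables by R, so the
  integral of F(x) + F(Rx), which is the monotonicity product of the two gradients,
  vanishes.\<close>

lemma solution_odd:
  assumes A: "approx u g (\<lambda>x. x $ 1) v h"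
    and weak: "\<And>\<phi> D v' h'. approx \<phi> D (\<lambda>x. 0) v' h' \<Longrightarrow> (\<integral>x. pfield p (g x) \<bullet> D x \<partial>lebesgue) = 0"
  shows "AE x in lebesgue. g x = - reflect e1 (g (reflect e1 x))"
proof -
  define ge where "ge x = g x + reflect e1 (g (reflect e1 x))" for x
  define gt where "gt x = - reflect e1 (g (reflect e1 x))" for x
  note AR = approx_reflect[OF A]
  have Ae: "approx (\<lambda>x. u x + u (reflect e1 x)) ge (\<lambda>x. 0) (\<lambda>n x. v n x + v n (reflect e1 x))
     (\<lambda>n x. h n x + reflect e1 (h n (reflect e1 x)))"
    using approx_lincomb[OF A AR, of 1 1] by (simp add: ge_def[abs_def])
  have Sg: "g \<in> borel_measurable lebesgue" "integrable lebesgue (\<lambda>x. norm (g x) powr p)"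
    using A by (auto simp: approx_def Sob_def)
  have Se: "ge \<in> borel_measurable lebesgue" "integrable lebesgue (\<lambda>x. norm (ge x) powr p)"
    using Ae by (auto simp: approx_def Sob_def)
  define F where "F x = pfield p (g x) \<bullet> ge x" for x
  have Fi: "integrable lebesgue F"
    unfolding F_def using pfield_integrable[OF p1 Sg(1) Se(1) Sg(2) Se(2)] .
  then have Fm: "F \<in> borel_measurable lebesgue" by auto
  have F0: "integral\<^sup>L lebesgue F = 0" unfolding F_def by (rule weak[OF Ae])
  have FR: "pfield p (gt x) \<bullet> ge x = - F (reflect e1 x)" for x
  proof -
    have "reflect e1 (ge x) = ge (reflect e1 x)" by (simp add: ge_def add.commute)
    then show ?thesis unfolding gt_def F_def by (simp add: pfield_reflect reflect_self_adjoint)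
  qed
  have eq: "(pfield p (g x) - pfield p (gt x)) \<bullet> (g x - gt x) = F x + F (reflect e1 x)" for x
  proof -
    have "g x - gt x = ge x" by (simp add: gt_def ge_def)
    then show ?thesis using FR[of x] by (simp add: inner_diff_left F_def)
  qed
  have i: "integrable lebesgue (\<lambda>x. F x + F (reflect e1 x))"
    using Fi integral_reflect(2)[OF e1_Basis Fm] by simp
  have "(\<integral>x. F x + F (reflect e1 x) \<partial>lebesgue) = 0"
    using Fi integral_reflect(1,2)[OF e1_Basis Fm] F0 by simp
  moreover have "0 \<le> F x + F (reflect e1 x)" for x
    using pfield_mono(1)[OF p1, of "g x" "gt x"] unfolding eq .
  ultimately have "AE x in lebesgue. F x + F (reflect e1 x) = 0"
    using integral_nonneg_eq_0_iff_AE[OF i] by simp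
  then show ?thesis
  proof eventually_elim
    case (elim x)
    then have "(pfield p (g x) - pfield p (gt x)) \<bullet> (g x - gt x) = 0" unfolding eq .
    from pfield_mono(2)[OF p1 this] show ?case by (simp add: gt_def)
  qed
qed

text \<open>The symmetry has been shown for the gradient and almost everywhere, so u is replaced by
  its odd part: it is odd at every point, has the same trace and almost everywhere the same
  gradient. The approximants are treated likewise, and then everything is truncated to x_1 >
  0.\<close>

lemma half_solution:
  assumes A: "approx u g (\<lambda>x. x $ 1) v h"
    and weak: "\<And>\<phi> D v' h'. approx \<phi> D (\<lambda>x. 0) v' h' \<Longrightarrow> (\<integral>x. pfield p (g x) \<bullet> D x \<partial>lebesgue) = 0"
  obtains uR gR vR hR where "approx uR gR (\<lambda>x. max 0 (x $ 1)) vR hR"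
    "\<And>x. x $ 1 \<le> 0 \<Longrightarrow> uR x = 0" "\<And>x. x $ 1 \<le> 0 \<Longrightarrow> gR x = 0" "\<And>n x. x $ 1 \<le> 0 \<Longrightarrow> vR n x = 0"
    "\<And>n x. x $ 1 \<le> 0 \<Longrightarrow> hR n x = 0"
    "AE x in lebesgue. x $ 1 > 0 \<longrightarrow> gR x = g x"
    "\<And>\<phi> D v' h'. approx \<phi> D (\<lambda>x. 0) v' h' \<Longrightarrow> (\<And>x. x $ 1 \<le> 0 \<Longrightarrow> D x = 0) \<Longrightarrow>
        (\<integral>x. pfield p (gR x) \<bullet> D x \<partial>lebesgue) = 0"
proof -
  define uo where "uo x = (1/2) * u x + (-1/2) * u (reflect e1 x)" for x
  define go where "go x = (1/2) *\<^sub>R g x + (-1/2) *\<^sub>R reflect e1 (g (reflect e1 x))" for x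
  define vo where "vo n x = (1/2) * v n x + (-1/2) * v n (reflect e1 x)" for n x
  define ho where "ho n x = (1/2) *\<^sub>R h n x + (-1/2) *\<^sub>R reflect e1 (h n (reflect e1 x))" for n x
  have "approx uo go (\<lambda>x. (1/2) * x $ 1 + (-1/2) * reflect e1 x $ 1) vo ho"
    unfolding uo_def[abs_def] go_def[abs_def] vo_def[abs_def] ho_def[abs_def]
    by (rule approx_lincomb[OF A approx_reflect[OF A]])
  then have Ao: "approx uo go (\<lambda>x. x $ 1) vo ho" by simp
  have so: "AE x in lebesgue. g x = - reflect e1 (g (reflect e1 x))"
    by (rule solution_odd[OF A]) (rule weak)
  have goe: "AE x in lebesgue. go x = g x"
    using so
  proof eventually_elim
    case (elim x)
    have "reflect e1 (g (reflect e1 x)) = - g x" using elim by (metis minus_minus)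
    then show ?case by (simp add: go_def scaleR_add_left[symmetric])
  qed
  let ?uR = "\<lambda>x. if x $ 1 > 0 then uo x else 0" and ?gR = "\<lambda>x. if x $ 1 > 0 then go x else 0"
  have m: "max 0 (x $ 1) = (if x $ 1 > 0 then x $ 1 else 0)" for x :: "real^2" by (simp add: max_def)
  show thesis
  proof (rule that[of ?uR ?gR "\<lambda>n x. if x $ 1 > 0 then vo n x else 0" "\<lambda>n x. if x $ 1 > 0 then ho n x else 0"])
    show "approx ?uR ?gR (\<lambda>x. max 0 (x $ 1)) (\<lambda>n x. if x $ 1 > 0 then vo n x else 0) (\<lambda>n x. if x $ 1 > 0 then ho n x else 0)"
      unfolding m by (rule approx_half[OF Ao]) (auto simp: uo_def vo_def)
    show "AE x in lebesgue. x $ 1 > 0 \<longrightarrow> ?gR x = g x" using goe by eventually_elim simp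
    fix \<phi> D v' h' assume a: "approx \<phi> D (\<lambda>x. 0) v' h'" and D0: "\<And>x. x $ 1 \<le> 0 \<Longrightarrow> D x = 0"
    have "(\<integral>x. pfield p (?gR x) \<bullet> D x \<partial>lebesgue) = (\<integral>x. pfield p (g x) \<bullet> D x \<partial>lebesgue)"
    proof (rule integral_lebesgue_cong_AE)
      show "AE x in lebesgue. pfield p (?gR x) \<bullet> D x = pfield p (g x) \<bullet> D x"
        using goe
      proof eventually_elim
        case (elim x)
        then show ?case using D0[of x] by (cases "x $ 1 > 0") auto
      qed
    qed
    then show "(\<integral>x. pfield p (?gR x) \<bullet> D x \<partial>lebesgue) = 0" using weak[OF a] by simp
  qed auto
qed

end

text \<open>In the application \<open>V\<close> is the complement of two closed inclusions, described by the defining functions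
  \<open>d1\<close>, \<open>d2\<close>.\<close>

locale plap_insulated = plap V \<Omega> p for V \<Omega> p +
  fixes d1 d2 :: "real^2 \<Rightarrow> real" and d1' d2' :: "real^2 \<Rightarrow> real^2"
  assumes C1_d: "C1_grad d1 d1'" "C1_grad d2 d2'" and V_eq: "V = {x. d1 x > 0 \<and> d2 x > 0}"
    and d_mono: "\<And>x. x $ 1 > 0 \<Longrightarrow> d1' x $ 1 \<ge> 0" "\<And>x. x $ 1 > 0 \<Longrightarrow> d2' x $ 1 \<ge> 0"
begin

text \<open>By \<open>zero_extension\<close> the pair (\<phi>, D) may be tested with the field
  (\<tau>1, \<tau>2) times cut-offs \<open>c n\<close> that vanish near the inclusions, even across
  the circle. The gradient of the cut-off contributes \<phi> times its product with the field, which
  is nonnegative because the gradients of \<open>d1\<close> and \<open>d2\<close> point away from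
  the inclusions. Dropping this term leaves an inequality in place of a boundary integral.\<close>

lemma subsolution_inequality:
  assumes A: "approx \<phi> D (\<lambda>x. 0) v h" and \<phi>0: "\<And>x. \<phi> x \<ge> 0"
    and \<tau>: "C1_grad \<tau>1 \<tau>1'" "C1_grad \<tau>2 \<tau>2'"
    and bdry: "\<And>x. x \<in> \<Omega> \<Longrightarrow> \<phi> x \<noteq> 0 \<Longrightarrow> \<tau>1 x * d1' x $ 1 + \<tau>2 x * d1' x $ 2 \<ge> 0"
      "\<And>x. x \<in> \<Omega> \<Longrightarrow> \<phi> x \<noteq> 0 \<Longrightarrow> \<tau>1 x * d2' x $ 1 + \<tau>2 x * d2' x $ 2 \<ge> 0"
  shows "(\<integral>x. \<tau>1 x * D x $ 1 + \<tau>2 x * D x $ 2 \<partial>lebesgue)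
     \<le> - (\<integral>x. \<phi> x * (\<tau>1' x $ 1 + \<tau>2' x $ 2) \<partial>lebesgue)"
    and "integrable lebesgue (\<lambda>x. \<tau>1 x * D x $ 1 + \<tau>2 x * D x $ 2)"
proof -
  have S: "Sob p \<Omega> \<phi> D" using A by (simp add: approx_def)
  note iS = Sob_integrable[OF S \<Omega>_open \<Omega>_bounded p]
  have z: "\<phi> x = 0" "D x = 0" if "x \<notin> \<Omega>" for x using S that by (auto simp: Sob_def)
  have [measurable]: "\<phi> \<in> borel_measurable lebesgue" "D \<in> borel_measurable lebesgue" using iS by auto
  have C1m: "f \<in> borel_measurable lebesgue" "f' \<in> borel_measurable lebesgue" if "C1_grad f f'" for f f' :: "real^2 \<Rightarrow> _"
    using that C1_grad_imp_continuous[OF that] unfolding C1_grad_def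
    by (auto intro!: measurable_completion borel_measurable_continuous_onI)
  have nth_m: "(\<lambda>x. f x $ i) \<in> borel_measurable lebesgue" if "f \<in> borel_measurable lebesgue" for f :: "real^2 \<Rightarrow> real^2" and i
    using that by (rule measurable_compose) simp
  have bdd: "\<exists>B. \<forall>x\<in>\<Omega>. \<bar>f x\<bar> \<le> B" if "continuous_on UNIV f" for f :: "real^2 \<Rightarrow> real"
  proof -
    have "compact (closure \<Omega>)" using \<Omega>_bounded by (simp add: compact_eq_bounded_closed bounded_closure)
    then have "bounded (f ` closure \<Omega>)" by (intro compact_imp_bounded compact_continuous_image continuous_on_subset[OF that]) auto
    then show ?thesis using closure_subset unfolding bounded_iff by (metis imageI real_norm_def subsetD)
  qed
  have prod_i: "integrable lebesgue (\<lambda>x. f x * y x)"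
    if c: "continuous_on UNIV f" and y: "integrable lebesgue y" "\<And>x. x \<notin> \<Omega> \<Longrightarrow> y x = 0" for f y :: "real^2 \<Rightarrow> real"
  proof -
    obtain B where B: "\<forall>x\<in>\<Omega>. \<bar>f x\<bar> \<le> B" using bdd[OF c] by blast
    have [measurable]: "f \<in> borel_measurable lebesgue" using c by (auto intro!: measurable_completion borel_measurable_continuous_onI)
    show ?thesis
    proof (rule Bochner_Integration.integrable_bound[OF integrable_mult_right[OF integrable_abs[OF y(1)], of B]])
      show "AE x in lebesgue. norm (f x * y x) \<le> norm (B * \<bar>y x\<bar>)"
      proof (rule AE_I2)
        fix x
        show "norm (f x * y x) \<le> norm (B * \<bar>y x\<bar>)"
        proof (cases "x \<in> \<Omega>")
          case True
          then have "\<bar>f x\<bar> * \<bar>y x\<bar> \<le> B * \<bar>y x\<bar>" using B by (intro mult_right_mono) auto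
          also have "\<dots> \<le> norm (B * \<bar>y x\<bar>)" by simp
          finally show ?thesis by (simp add: abs_mult)
        qed (simp add: y(2))
      qed
    qed (use y in auto)
  qed
  have Di: "integrable lebesgue (\<lambda>x. D x $ i)" for i
    using integrable_inner_left[of "axis i 1" lebesgue D] iS(2) by (simp add: inner_axis)
  have \<tau>c: "continuous_on UNIV \<tau>1" "continuous_on UNIV \<tau>2" "continuous_on UNIV \<tau>1'" "continuous_on UNIV \<tau>2'"
    using \<tau> C1_grad_imp_continuous by (auto simp: C1_grad_def)
  have divc: "continuous_on UNIV (\<lambda>x. \<tau>1' x $ 1 + \<tau>2' x $ 2)" by (intro continuous_intros \<tau>c)
  have iD: "integrable lebesgue (\<lambda>x. \<tau>1 x * D x $ 1 + \<tau>2 x * D x $ 2)"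
    by (intro Bochner_Integration.integrable_add prod_i \<tau>c Di) (simp_all add: z)
  then show "integrable lebesgue (\<lambda>x. \<tau>1 x * D x $ 1 + \<tau>2 x * D x $ 2)" .
  have idiv: "integrable lebesgue (\<lambda>x. (\<tau>1' x $ 1 + \<tau>2' x $ 2) * \<phi> x)"
    by (rule prod_i[OF divc iS(1)]) (simp add: z)
  define k where "k n = real n + 1" for n
  have kp: "k n > 0" for n by (simp add: k_def)
  \<comment> \<open>Equal to 1 on the disc and 0 beyond radius 6; it gives the test functions
    compact support without being seen by the integrals over \<Omega>.\<close>
  define \<omega> where "\<omega> x = ramp (- 1 * (x \<bullet> x) + 36)" for x :: "real^2"
  define \<omega>' where "\<omega>' x = (ramp' (- 1 * (x \<bullet> x) + 36) * (2 * -1)) *\<^sub>R x" for x :: "real^2"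
  have C\<omega>: "C1_grad \<omega> \<omega>'"
    unfolding \<omega>_def[abs_def] \<omega>'_def[abs_def] by (rule C1_grad_radial_compose[OF DERIV_ramp continuous_ramp'])
  have \<omega>1: "\<omega> x = 1" "\<omega>' x = 0" if "x \<in> \<Omega>" for x
  proof -
    have "norm x < 5" using that by (auto simp: \<Omega>)
    then have "x \<bullet> x < 25" using power_strict_mono[of "norm x" 5 2] by (simp add: power2_norm_eq_inner)
    then have "1 \<le> - 1 * (x \<bullet> x) + 36" by simp
    then show "\<omega> x = 1" "\<omega>' x = 0" using ramp_props(2) ramp'_props(4) by (auto simp: \<omega>_def \<omega>'_def)
  qed
  \<comment> \<open>The shift by 1 makes the cut-off vanish for \<open>d1 x \<le> 1 / k n\<close>,
    so the support stays inside \<open>V\<close>; it is 1 once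
    \<open>d1 x \<ge> 2 / k n\<close>.\<close>
  define a where "a n x = ramp (k n * d1 x - 1)" for n x
  define b where "b n x = ramp (k n * d2 x - 1)" for n x
  define a' where "a' n x = (ramp' (k n * d1 x - 1) * k n) *\<^sub>R d1' x" for n x
  define b' where "b' n x = (ramp' (k n * d2 x - 1) * k n) *\<^sub>R d2' x" for n x
  have DR: "((\<lambda>s. ramp (k n * s - 1)) has_real_derivative ramp' (k n * s - 1) * k n) (at s)" for n s
  proof -
    have "((\<lambda>s. k n * s - 1) has_real_derivative k n) (at s)" by (auto intro!: derivative_eq_intros)
    from DERIV_chain2[OF DERIV_ramp this] show ?thesis by simp
  qed
  have cR: "continuous_on UNIV (\<lambda>s. ramp' (k n * s - 1) * k n)" for n
    by (intro continuous_intros continuous_on_compose2[OF continuous_ramp']) auto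
  have Ca: "C1_grad (a n) (a' n)" for n
    unfolding a_def[abs_def] a'_def[abs_def] using C1_grad_compose[OF C1_d(1) DR cR, of n] by simp
  have Cb: "C1_grad (b n) (b' n)" for n
    unfolding b_def[abs_def] b'_def[abs_def] using C1_grad_compose[OF C1_d(2) DR cR, of n] by simp
  define c where "c n x = a n x * b n x" for n x
  define c' where "c' n x = a n x *\<^sub>R b' n x + b n x *\<^sub>R a' n x" for n x
  have Cc: "C1_grad (c n) (c' n)" for n
    unfolding c_def[abs_def] c'_def[abs_def] by (rule C1_grad_mult[OF Ca Cb])
  have c01: "0 \<le> c n x" "c n x \<le> 1" for n x
    using ramp_props(3,4) by (auto simp: c_def a_def b_def intro!: mult_nonneg_nonneg mult_le_one)
  have nonneg: "\<phi> x * (\<tau>1 x * c' n x $ 1 + \<tau>2 x * c' n x $ 2) \<ge> 0" if "x \<in> \<Omega>" for n x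
  proof (cases "\<phi> x = 0")
    case False
    have "\<tau>1 x * c' n x $ 1 + \<tau>2 x * c' n x $ 2
       = a n x * (ramp' (k n * d2 x - 1) * k n) * (\<tau>1 x * d2' x $ 1 + \<tau>2 x * d2' x $ 2)
       + b n x * (ramp' (k n * d1 x - 1) * k n) * (\<tau>1 x * d1' x $ 1 + \<tau>2 x * d1' x $ 2)"
      by (simp add: c'_def a'_def b'_def algebra_simps)
    moreover have "a n x * (ramp' (k n * d2 x - 1) * k n) \<ge> 0" "b n x * (ramp' (k n * d1 x - 1) * k n) \<ge> 0"
      using ramp_props(3) ramp'_props(1) kp[of n]
      by (auto simp: a_def b_def less_imp_le intro!: mult_nonneg_nonneg)
    then have "a n x * (ramp' (k n * d2 x - 1) * k n) * (\<tau>1 x * d2' x $ 1 + \<tau>2 x * d2' x $ 2)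
       + b n x * (ramp' (k n * d1 x - 1) * k n) * (\<tau>1 x * d1' x $ 1 + \<tau>2 x * d1' x $ 2) \<ge> 0"
      by (intro add_nonneg_nonneg mult_nonneg_nonneg[OF _ bdry(1)[OF that False]] mult_nonneg_nonneg[OF _ bdry(2)[OF that False]])
    ultimately show ?thesis using \<phi>0[of x] by simp
  qed simp
  have dc: "continuous_on UNIV d1" "continuous_on UNIV d2" using C1_d C1_grad_imp_continuous by auto
  have test: "C1c V (\<lambda>x. (c n x * \<omega> x) * t x) (\<lambda>x. (c n x * \<omega> x) *\<^sub>R t' x + t x *\<^sub>R (c n x *\<^sub>R \<omega>' x + \<omega> x *\<^sub>R c' n x))"
    if t: "C1_grad t t'" for t t' n
  proof -
    let ?K = "cball 0 6 \<inter> {x. 1 / k n \<le> d1 x} \<inter> {x. 1 / k n \<le> d2 x}"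
    have "{x. (c n x * \<omega> x) * t x \<noteq> 0} \<subseteq> ?K"
    proof
      fix x assume "x \<in> {x. (c n x * \<omega> x) * t x \<noteq> 0}"
      then have nz: "a n x \<noteq> 0" "b n x \<noteq> 0" "\<omega> x \<noteq> 0" by (auto simp: c_def)
      have "- 1 * (x \<bullet> x) + 36 > 0" using nz(3) ramp_props(1) by (auto simp: \<omega>_def not_le[symmetric])
      then have "norm x \<le> 6" using power2_le_imp_le[of "norm x" 6] by (simp add: power2_norm_eq_inner)
      moreover have "k n * d1 x - 1 > 0" "k n * d2 x - 1 > 0"
        using nz(1,2) ramp_props(1) by (auto simp: a_def b_def not_le[symmetric])
      ultimately show "x \<in> ?K" using kp[of n] by (simp add: field_simps)
    qed
    moreover have "closed ?K" by (intro closed_Int closed_cball closed_Collect_le continuous_intros dc)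
    ultimately have cl: "closure {x. (c n x * \<omega> x) * t x \<noteq> 0} \<subseteq> ?K" by (rule closure_minimal)
    moreover have "?K \<subseteq> V" using kp[of n] unfolding V_eq by (auto intro: less_le_trans[of 0 "1 / k n"])
    moreover have "compact (closure {x. (c n x * \<omega> x) * t x \<noteq> 0})"
      using bounded_subset[OF bounded_cball, of _ "0::real^2" 6] cl by (simp add: compact_eq_bounded_closed)
    ultimately show ?thesis
      unfolding C1c_def using C1_grad_mult[OF C1_grad_mult[OF Cc[of n] C\<omega>] t] by blast
  qed
  have E: "approx \<phi> D (\<lambda>x. 0) v h" by fact
  have ext: "(\<integral>x. \<phi> x * (\<psi>' x \<bullet> b) \<partial>lebesgue) = - (\<integral>x. (D x \<bullet> b) * \<psi> x \<partial>lebesgue)"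
    if "C1c V \<psi> \<psi>'" "b \<in> Basis" for \<psi> \<psi>' b
    using E that unfolding approx_def circle_Lp_eq
    by (intro zero_extension[of \<phi> D v h]) auto
  have one: "(\<integral>x. (c n x * t' x $ i) * \<phi> x + (t x * c' n x $ i) * \<phi> x \<partial>lebesgue) = - (\<integral>x. c n x * (t x * D x $ i) \<partial>lebesgue)"
    if t: "C1_grad t t'" for t t' n i
  proof -
    have "axis i 1 \<in> (Basis :: (real^2) set)" by (simp add: axis_in_Basis_iff)
    from ext[OF test[OF t] this, of n]
    have "(\<integral>x. \<phi> x * (((c n x * \<omega> x) *\<^sub>R t' x + t x *\<^sub>R (c n x *\<^sub>R \<omega>' x + \<omega> x *\<^sub>R c' n x)) $ i) \<partial>lebesgue)
       = - (\<integral>x. D x $ i * ((c n x * \<omega> x) * t x) \<partial>lebesgue)"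
      by (simp add: inner_axis)
    moreover have "(\<integral>x. \<phi> x * (((c n x * \<omega> x) *\<^sub>R t' x + t x *\<^sub>R (c n x *\<^sub>R \<omega>' x + \<omega> x *\<^sub>R c' n x)) $ i) \<partial>lebesgue)
       = (\<integral>x. (c n x * t' x $ i) * \<phi> x + (t x * c' n x $ i) * \<phi> x \<partial>lebesgue)"
      by (rule Bochner_Integration.integral_cong[OF refl], case_tac "x \<in> \<Omega>") (simp_all add: \<omega>1 z algebra_simps)
    moreover have "(\<integral>x. D x $ i * ((c n x * \<omega> x) * t x) \<partial>lebesgue) = (\<integral>x. c n x * (t x * D x $ i) \<partial>lebesgue)"
      by (rule Bochner_Integration.integral_cong[OF refl], case_tac "x \<in> \<Omega>") (simp_all add: \<omega>1 z)
    ultimately show ?thesis by simp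
  qed
  have cc: "continuous_on UNIV (c n)" "continuous_on UNIV (c' n)" for n
    using Cc[of n] C1_grad_imp_continuous by (auto simp: C1_grad_def)
  have le: "(\<integral>x. c n x * (\<tau>1 x * D x $ 1 + \<tau>2 x * D x $ 2) \<partial>lebesgue)
     \<le> - (\<integral>x. c n x * ((\<tau>1' x $ 1 + \<tau>2' x $ 2) * \<phi> x) \<partial>lebesgue)" for n
  proof -
    have j: "integrable lebesgue (\<lambda>x. (c n x * t' x $ i) * \<phi> x)" "integrable lebesgue (\<lambda>x. (t x * c' n x $ i) * \<phi> x)"
      "integrable lebesgue (\<lambda>x. c n x * (t x * D x $ i))" if t: "C1_grad t t'" for t t' i
    proof -
      have tc: "continuous_on UNIV t" "continuous_on UNIV t'" using t C1_grad_imp_continuous by (auto simp: C1_grad_def)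
      show "integrable lebesgue (\<lambda>x. (c n x * t' x $ i) * \<phi> x)"
        by (rule prod_i) (auto intro!: continuous_intros cc tc iS z)
      show "integrable lebesgue (\<lambda>x. (t x * c' n x $ i) * \<phi> x)"
        by (rule prod_i) (auto intro!: continuous_intros cc tc iS z)
      have "integrable lebesgue (\<lambda>x. (c n x * t x) * D x $ i)"
        by (rule prod_i) (auto intro!: continuous_intros cc tc Di simp: z)
      then show "integrable lebesgue (\<lambda>x. c n x * (t x * D x $ i))" by (simp add: mult.assoc)
    qed
    note s1 = Bochner_Integration.integrable_add[OF j(1)[OF \<tau>(1), of 1] j(2)[OF \<tau>(1), of 1]]
    note s2 = Bochner_Integration.integrable_add[OF j(1)[OF \<tau>(2), of 2] j(2)[OF \<tau>(2), of 2]]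
    have "(\<integral>x. c n x * (\<tau>1 x * D x $ 1 + \<tau>2 x * D x $ 2) \<partial>lebesgue)
      = (\<integral>x. c n x * (\<tau>1 x * D x $ 1) \<partial>lebesgue) + (\<integral>x. c n x * (\<tau>2 x * D x $ 2) \<partial>lebesgue)"
      by (subst Bochner_Integration.integral_add[symmetric, OF j(3)[OF \<tau>(1)] j(3)[OF \<tau>(2)]]) (simp add: distrib_left)
    also have "\<dots> = - ((\<integral>x. (c n x * \<tau>1' x $ 1) * \<phi> x + (\<tau>1 x * c' n x $ 1) * \<phi> x \<partial>lebesgue)
        + (\<integral>x. (c n x * \<tau>2' x $ 2) * \<phi> x + (\<tau>2 x * c' n x $ 2) * \<phi> x \<partial>lebesgue))"
      using one[OF \<tau>(1), of n 1] one[OF \<tau>(2), of n 2] by simp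
    also have "\<dots> = - (\<integral>x. ((c n x * \<tau>1' x $ 1) * \<phi> x + (\<tau>1 x * c' n x $ 1) * \<phi> x)
        + ((c n x * \<tau>2' x $ 2) * \<phi> x + (\<tau>2 x * c' n x $ 2) * \<phi> x) \<partial>lebesgue)"
      by (simp only: Bochner_Integration.integral_add[OF s1 s2])
    also have "\<dots> \<le> - (\<integral>x. c n x * ((\<tau>1' x $ 1 + \<tau>2' x $ 2) * \<phi> x) \<partial>lebesgue)"
    proof (rule le_imp_neg_le, rule integral_mono)
      show "integrable lebesgue (\<lambda>x. c n x * ((\<tau>1' x $ 1 + \<tau>2' x $ 2) * \<phi> x))"
        using Bochner_Integration.integrable_add[OF j(1)[OF \<tau>(1), of 1] j(1)[OF \<tau>(2), of 2]] by (simp add: algebra_simps)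
      show "integrable lebesgue (\<lambda>x. ((c n x * \<tau>1' x $ 1) * \<phi> x + (\<tau>1 x * c' n x $ 1) * \<phi> x)
        + ((c n x * \<tau>2' x $ 2) * \<phi> x + (\<tau>2 x * c' n x $ 2) * \<phi> x))"
        by (rule Bochner_Integration.integrable_add[OF s1 s2])
      fix x
      show "c n x * ((\<tau>1' x $ 1 + \<tau>2' x $ 2) * \<phi> x) \<le> ((c n x * \<tau>1' x $ 1) * \<phi> x + (\<tau>1 x * c' n x $ 1) * \<phi> x)
        + ((c n x * \<tau>2' x $ 2) * \<phi> x + (\<tau>2 x * c' n x $ 2) * \<phi> x)"
        using nonneg[of x n] z(1)[of x] by (cases "x \<in> \<Omega>") (simp_all add: algebra_simps)
    qed
    finally show ?thesis .
  qed
  have clim: "(\<lambda>n. c n x) \<longlonglongrightarrow> 1" if "x \<in> \<Omega>" for x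
  proof -
    have d: "d1 x > 0" "d2 x > 0" using that by (auto simp: \<Omega> V_eq)
    have "\<forall>\<^sub>F n in sequentially. k n > 2 / d1 x" "\<forall>\<^sub>F n in sequentially. k n > 2 / d2 x"
      unfolding k_def by real_asymp+
    then have "\<forall>\<^sub>F n in sequentially. c n x = 1"
    proof eventually_elim
      case (elim n)
      then have "k n * d1 x - 1 \<ge> 1" "k n * d2 x - 1 \<ge> 1" using d by (auto simp: field_simps)
      then show ?case unfolding c_def a_def b_def by (simp add: ramp_props(2))
    qed
    then show ?thesis by (rule tendsto_eventually)
  qed
  have L: "(\<lambda>n. \<integral>x. c n x * f x \<partial>lebesgue) \<longlonglongrightarrow> integral\<^sup>L lebesgue f"
    if i: "integrable lebesgue f" and z: "\<And>x. x \<notin> \<Omega> \<Longrightarrow> f x = 0" for f :: "real^2 \<Rightarrow> real"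
  proof (rule integral_dominated_convergence[where w = "\<lambda>x. \<bar>f x\<bar>"])
    have [measurable]: "c n \<in> borel_measurable lebesgue" for n by (rule C1m(1)[OF Cc])
    show "(\<lambda>x. c n x * f x) \<in> borel_measurable lebesgue" for n using i by measurable
    show "AE x in lebesgue. (\<lambda>n. c n x * f x) \<longlonglongrightarrow> f x"
    proof (rule AE_I2)
      fix x
      show "(\<lambda>n. c n x * f x) \<longlonglongrightarrow> f x"
      proof (cases "x \<in> \<Omega>")
        case True
        from tendsto_mult[OF clim[OF True] tendsto_const[of "f x"]] show ?thesis by simp
      qed (simp add: z)
    qed
    show "AE x in lebesgue. norm (c n x * f x) \<le> \<bar>f x\<bar>" for n
      using c01 by (intro AE_I2) (auto simp: abs_mult mult_left_le_one_le)
  qed (use i in auto)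
  have "(\<integral>x. \<tau>1 x * D x $ 1 + \<tau>2 x * D x $ 2 \<partial>lebesgue) \<le> - (\<integral>x. (\<tau>1' x $ 1 + \<tau>2' x $ 2) * \<phi> x \<partial>lebesgue)"
  proof (rule LIMSEQ_le[OF L[OF iD] tendsto_minus[OF L[OF idiv]]])
    show "\<exists>N. \<forall>n\<ge>N. (\<integral>x. c n x * (\<tau>1 x * D x $ 1 + \<tau>2 x * D x $ 2) \<partial>lebesgue)
       \<le> - (\<integral>x. c n x * ((\<tau>1' x $ 1 + \<tau>2' x $ 2) * \<phi> x) \<partial>lebesgue)" using le by blast
  qed (simp_all add: z)
  then show "(\<integral>x. \<tau>1 x * D x $ 1 + \<tau>2 x * D x $ 2 \<partial>lebesgue)
     \<le> - (\<integral>x. \<phi> x * (\<tau>1' x $ 1 + \<tau>2' x $ 2) \<partial>lebesgue)" by (simp add: mult.commute)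
qed

end

section \<open>Comparison\<close>

text \<open>The test function is a cutoff times \<open>posG (S - u)\<close>; a convex $C^1$ substitute for the positive part with
  bounded derivative, so that the chain rule applies.\<close>

definition posG :: "real \<Rightarrow> real" where "posG s = sqrt (1 + (max 0 s)\<^sup>2) - 1"

definition posG' :: "real \<Rightarrow> real" where "posG' s = max 0 s / sqrt (1 + (max 0 s)\<^sup>2)"

lemma DERIV_posG: "(posG has_real_derivative posG' s) (at s)"
proof -
  have pos: "1 + (max 0 s)\<^sup>2 > 0" by (simp add: add_pos_nonneg)
  have D0: "((\<lambda>s. 1 + (max 0 s)\<^sup>2) has_real_derivative 2 * max 0 s) (at s)"
    using DERIV_add[OF DERIV_const[of 1] DERIV_pos_part_square] by simp
  have D1: "((\<lambda>s. sqrt (1 + (max 0 s)\<^sup>2)) has_real_derivative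
      (inverse (sqrt (1 + (max 0 s)\<^sup>2)) / 2) * (2 * max 0 s)) (at s)"
    by (rule DERIV_chain2[where f = sqrt and g = "\<lambda>s. 1 + (max 0 s)\<^sup>2", OF DERIV_real_sqrt[OF pos] D0])
  have "((\<lambda>s. sqrt (1 + (max 0 s)\<^sup>2) - 1) has_real_derivative
      (inverse (sqrt (1 + (max 0 s)\<^sup>2)) / 2) * (2 * max 0 s) - 0) (at s)"
    by (rule DERIV_diff[OF D1 DERIV_const])
  moreover have "inverse q / 2 * (2 * m) - 0 = m / q" for q m :: real
    by (cases "q = 0") (simp_all add: field_simps)
  ultimately show ?thesis unfolding posG_def[abs_def] posG'_def by (simp only:)
qed

lemma posG_props:
  "continuous_on UNIV posG'" "\<bar>posG' s\<bar> \<le> 1" "posG' s \<ge> 0" "posG s \<ge> 0"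
  "s \<le> 0 \<Longrightarrow> posG s = 0" "s \<le> 0 \<Longrightarrow> posG' s = 0" "s > 0 \<Longrightarrow> posG s > 0" "s > 0 \<Longrightarrow> posG' s > 0"
proof -
  have p: "sqrt (1 + (max 0 s)\<^sup>2) > 0" for s by (simp add: add_pos_nonneg)
  then have "sqrt (1 + (max 0 s)\<^sup>2) \<noteq> 0" for s by (metis less_irrefl)
  then show "continuous_on UNIV posG'" unfolding posG'_def[abs_def] by (intro continuous_intros) blast
  have "max 0 s \<le> sqrt (1 + (max 0 s)\<^sup>2)" by (rule real_le_rsqrt) simp
  then have q: "max 0 s / sqrt (1 + (max 0 s)\<^sup>2) \<le> 1" using p[of s] by (simp only: divide_le_eq_1_pos)
  show q': "posG' s \<ge> 0" unfolding posG'_def using p[of s] by (intro divide_nonneg_nonneg) auto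
  show "\<bar>posG' s\<bar> \<le> 1" using q q' by (simp only: posG'_def abs_of_nonneg)
  show "posG s \<ge> 0" by (simp add: posG_def)
  show "s \<le> 0 \<Longrightarrow> posG s = 0" "s \<le> 0 \<Longrightarrow> posG' s = 0" by (auto simp: posG_def posG'_def)
  show "s > 0 \<Longrightarrow> posG s > 0" by (simp add: posG_def)
  show "s > 0 \<Longrightarrow> posG' s > 0" unfolding posG'_def using p[of s] by (intro divide_pos_pos) auto
qed

lemma posG_Lipschitz: "\<bar>posG a - posG b\<bar> \<le> \<bar>a - b\<bar>"
  using C1_DERIV_bound[of posG posG' 1, OF DERIV_posG posG_props(2)] by simp

locale half_solution = plap_insulated V \<Omega> p d1 d2 d1' d2' for V \<Omega> p d1 d2 d1' d2' +
  fixes uR :: "real^2 \<Rightarrow> real" and gR :: "real^2 \<Rightarrow> real^2" and vR hR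
  assumes AR: "approx uR gR (\<lambda>x. max 0 (x $ 1)) vR hR"
    and R0: "\<And>x. x $ 1 \<le> 0 \<Longrightarrow> uR x = 0" "\<And>x. x $ 1 \<le> 0 \<Longrightarrow> gR x = 0"
    and weakR: "\<And>\<phi> D v' h'. approx \<phi> D (\<lambda>x. 0) v' h' \<Longrightarrow> (\<And>x. x $ 1 \<le> 0 \<Longrightarrow> D x = 0) \<Longrightarrow>
        (\<integral>x. pfield p (gR x) \<bullet> D x \<partial>lebesgue) = 0"
begin

text \<open>Zero trace is inherited from the approximants \<open>vR\<close> of u: on the circle
  \<zeta> posG(S - vR) is at most a multiple of |vR - max 0 x_1|, since S lies below the boundary
  values where \<zeta> > 0.\<close>

lemma comparison_test_function:
  assumes \<zeta>: "C1_grad \<zeta> \<zeta>'" "\<And>x. \<zeta> x \<ge> 0"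
    and S: "Sob p \<Omega> (\<lambda>x. indicator \<Omega> x * SR x) DS" "continuous_on (closure \<Omega>) SR"
    and circ: "\<And>t. \<zeta> (circ 5 t) > 0 \<Longrightarrow> SR (circ 5 t) \<le> max 0 (circ 5 t $ 1)"
  defines "w \<equiv> \<lambda>x. indicator \<Omega> x * SR x - uR x"
  shows "\<exists>v h. approx (\<lambda>x. \<zeta> x * posG (w x))
     (\<lambda>x. \<zeta> x *\<^sub>R (posG' (w x) *\<^sub>R (DS x - gR x)) + posG (w x) *\<^sub>R \<zeta>' x) (\<lambda>x. 0) v h"
proof -
  have p0: "p \<ge> 0" and pp: "p > 0" using p by auto
  define Dw where "Dw x = DS x - gR x" for x
  have SuR: "Sob p \<Omega> uR gR" using AR by (simp add: approx_def)
  have Sw: "Sob p \<Omega> w Dw"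
    using Sob_lincomb[OF \<Omega>_open \<Omega>_bounded p S(1) SuR, of 1 "-1"] by (simp add: w_def Dw_def[abs_def])
  note d = approx_diff_Sob[OF AR]
  have dL: "integrable lebesgue (\<lambda>x. norm (indicator \<Omega> x * vR n x - uR x) powr p)"
      "integrable lebesgue (\<lambda>x. norm (hR n x - gR x) powr p)" for n
    using d[of n] by (auto simp: Sob_def)
  have dT: "(\<lambda>n. \<integral>x. norm (indicator \<Omega> x * vR n x - uR x) powr p \<partial>lebesgue) \<longlonglongrightarrow> 0"
     "(\<lambda>n. \<integral>x. norm (hR n x - gR x) powr p \<partial>lebesgue) \<longlonglongrightarrow> 0"
     "(\<lambda>n. circle_Lp (\<lambda>x. vR n x - max 0 (x $ 1))) \<longlonglongrightarrow> 0"
    using AR by (auto simp: approx_def)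
  obtain r where r: "strict_mono r" "AE x in lebesgue. (\<lambda>n. indicator \<Omega> x * vR (r n) x - uR x) \<longlonglongrightarrow> 0"
    by (rule Lp_AE_subseq[OF pp dL(1) dT(1)])
  define w' where "w' n x = indicator \<Omega> x * SR x - indicator \<Omega> x * vR (r n) x" for n x
  define Dw' where "Dw' n x = DS x - hR (r n) x" for n x
  have Sw': "Sob p \<Omega> (w' n) (Dw' n)" for n
    using Sob_lincomb[OF \<Omega>_open \<Omega>_bounded p S(1), of "\<lambda>x. indicator \<Omega> x * vR (r n) x" "hR (r n)" 1 "-1"] AR
    by (simp add: w'_def[abs_def] Dw'_def[abs_def] approx_def)
  have ww: "w' n x - w x = - (indicator \<Omega> x * vR (r n) x - uR x)" for n x by (simp add: w'_def w_def)
  have DD: "Dw' n x - Dw x = - (hR (r n) x - gR x)" for n x by (simp add: Dw'_def Dw_def)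
  have wwn: "\<bar>w' n x - w x\<bar> = norm (indicator \<Omega> x * vR (r n) x - uR x)" for n x
    unfolding ww by (simp only: abs_minus_cancel real_norm_def)
  have DDn: "norm (Dw' n x - Dw x) = norm (hR (r n) x - gR x)" for n x
    unfolding DD by (rule norm_minus_cancel)
  have pG0: "posG 0 = 0" by (simp add: posG_props)
  define \<phi> where "\<phi> x = \<zeta> x * posG (w x)" for x
  define D where "D x = \<zeta> x *\<^sub>R (posG' (w x) *\<^sub>R Dw x) + posG (w x) *\<^sub>R \<zeta>' x" for x
  define h where "h n x = \<zeta> x *\<^sub>R (posG' (w' n x) *\<^sub>R Dw' n x) + posG (w' n x) *\<^sub>R \<zeta>' x" for n x
  define v where "v n x = \<zeta> x * posG (SR x - vR (r n) x)" for n x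
  have bdd: "bounded (closure \<Omega>)" using \<Omega>_bounded by (rule bounded_closure)
  obtain B where B: "B > 0" "\<And>x. x \<in> closure \<Omega> \<Longrightarrow> \<bar>\<zeta> x\<bar> \<le> B" "\<And>x. x \<in> closure \<Omega> \<Longrightarrow> norm (\<zeta>' x) \<le> B"
    by (rule C1_grad_bounded_on[OF \<zeta>(1) bdd]) blast
  have cl: "x \<in> closure \<Omega>" if "x \<in> \<Omega>" for x using that closure_subset by blast
  have z: "w x = 0" "Dw x = 0" "w' n x = 0" "Dw' n x = 0" if "x \<notin> \<Omega>" for x n
    using Sw Sw'[of n] that by (auto simp: Sob_def)
  have C: "Sob p \<Omega> \<phi> D"
    unfolding \<phi>_def[abs_def] D_def[abs_def]
    by (rule Sob_mult[OF \<Omega>_open \<Omega>_bounded p Sob_chain[OF \<Omega>_open \<Omega>_bounded p Sw DERIV_posG posG_props(1,2) pG0] \<zeta>(1)])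
  have C': "Sob p \<Omega> (\<lambda>x. \<zeta> x * posG (w' n x)) (h n)" for n
    unfolding h_def[abs_def]
    by (rule Sob_mult[OF \<Omega>_open \<Omega>_bounded p Sob_chain[OF \<Omega>_open \<Omega>_bounded p Sw' DERIV_posG posG_props(1,2) pG0] \<zeta>(1)])
  have iv: "indicator \<Omega> x * v n x = \<zeta> x * posG (w' n x)" for n x
    by (cases "x \<in> \<Omega>") (simp_all add: v_def w'_def pG0)
  have posGc: "continuous_on UNIV posG"
    using DERIV_isCont[OF DERIV_posG] by (simp add: continuous_on_eq_continuous_at)
  have \<zeta>c: "continuous_on UNIV \<zeta>" by (rule C1_grad_imp_continuous[OF \<zeta>(1)])
  have m1[measurable]: "posG \<in> borel_measurable borel" "posG' \<in> borel_measurable borel"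
    using posGc posG_props(1) by (auto intro: borel_measurable_continuous_onI)
  have [measurable]: "\<zeta> \<in> borel_measurable lebesgue" "\<zeta>' \<in> borel_measurable lebesgue"
    using \<zeta>(1) \<zeta>c by (auto intro!: measurable_completion borel_measurable_continuous_onI simp: C1_grad_def)
  have [measurable]: "w \<in> borel_measurable lebesgue" "Dw \<in> borel_measurable lebesgue"
     "w' n \<in> borel_measurable lebesgue" "Dw' n \<in> borel_measurable lebesgue" for n
    using Sw Sw'[of n] by (auto simp: Sob_def)
  note [measurable] = measurable_compose[OF _ m1(1)] measurable_compose[OF _ m1(2)]
  note sub = LIMSEQ_subseq_LIMSEQ[OF dT(1) r(1), unfolded o_def] LIMSEQ_subseq_LIMSEQ[OF dT(2) r(1), unfolded o_def]
  have iDw: "integrable lebesgue (\<lambda>x. norm (Dw x) powr p)" using Sw by (simp add: Sob_def)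
  have "approx \<phi> D (\<lambda>x. 0) v h"
    unfolding approx_def
  proof (intro conjI allI)
    show "Sob p \<Omega> \<phi> D" by (rule C)
    show "continuous_on (closure \<Omega>) (v n)" for n
    proof -
      have "continuous_on (closure \<Omega>) (\<lambda>x. SR x - vR (r n) x)"
        using S(2) AR by (auto simp: approx_def intro!: continuous_intros)
      then have "continuous_on (closure \<Omega>) (\<lambda>x. posG (SR x - vR (r n) x))"
        by (rule continuous_on_compose2[OF posGc]) simp
      then show ?thesis unfolding v_def[abs_def]
        by (intro continuous_on_mult continuous_on_subset[OF \<zeta>c]) auto
    qed
    show "Sob p \<Omega> (\<lambda>x. indicator \<Omega> x * v n x) (h n)" for n unfolding iv by (rule C')
    have b1: "\<bar>\<zeta> x * posG (w' n x) - \<phi> x\<bar> \<le> B * norm (indicator \<Omega> x * vR (r n) x - uR x)" for n x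
    proof (cases "x \<in> \<Omega>")
      case True
      have "\<bar>\<zeta> x\<bar> * \<bar>posG (w' n x) - posG (w x)\<bar> \<le> B * \<bar>w' n x - w x\<bar>"
        using B(1,2) cl[OF True] posG_Lipschitz by (intro mult_mono) auto
      then show ?thesis unfolding wwn \<phi>_def by (simp only: abs_mult[symmetric] right_diff_distrib)
    next
      case False
      then show ?thesis using B(1) by (simp add: \<phi>_def z pG0)
    qed
    show "(\<lambda>n. \<integral>x. norm (indicator \<Omega> x * v n x - \<phi> x) powr p \<partial>lebesgue) \<longlonglongrightarrow> 0"
      unfolding iv by (rule Lp_zero_bound[OF p0 less_imp_le[OF B(1)] _ dL(1) sub(1)]) (use b1 in simp)
    \<comment> \<open>\<open>T1\<close> and \<open>T3\<close> are controlled by the L^p distances of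
      the approximants. \<open>T2\<close> multiplies the fixed gradient \<open>Dw\<close> by a
      coefficient that is small just pointwise, hence the almost everywhere convergent subsequence
      \<open>r\<close> and dominated convergence.\<close>
    define T1 where "T1 n x = (\<zeta> x * posG' (w' n x)) *\<^sub>R (Dw' n x - Dw x)" for n x
    define T2 where "T2 n x = (\<zeta> x * (posG' (w' n x) - posG' (w x))) *\<^sub>R Dw x" for n x
    define T3 where "T3 n x = (posG (w' n x) - posG (w x)) *\<^sub>R \<zeta>' x" for n x
    have hD: "h n x - D x = T1 n x + (T2 n x + T3 n x)" for n x
      unfolding h_def D_def T1_def T2_def T3_def by (simp add: algebra_simps)
    have n1: "norm (T1 n x) \<le> B * norm (hR (r n) x - gR x)" for n x
    proof (cases "x \<in> \<Omega>")
      case True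
      have "\<bar>\<zeta> x\<bar> * \<bar>posG' (w' n x)\<bar> \<le> B * 1"
        using B(1,2) cl[OF True] posG_props(2) by (intro mult_mono) auto
      then have "\<bar>\<zeta> x * posG' (w' n x)\<bar> * norm (Dw' n x - Dw x) \<le> B * norm (Dw' n x - Dw x)"
        by (intro mult_right_mono) (auto simp: abs_mult)
      then show ?thesis unfolding T1_def DDn[symmetric] by simp
    next
      case False
      then show ?thesis using B(1) by (simp add: T1_def z)
    qed
    have n3: "norm (T3 n x) \<le> B * norm (indicator \<Omega> x * vR (r n) x - uR x)" for n x
    proof (cases "x \<in> \<Omega>")
      case True
      have "\<bar>posG (w' n x) - posG (w x)\<bar> * norm (\<zeta>' x) \<le> \<bar>w' n x - w x\<bar> * B"
        using B(1,3) cl[OF True] posG_Lipschitz by (intro mult_mono) auto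
      then show ?thesis unfolding T3_def wwn[symmetric] by (simp add: mult.commute)
    next
      case False
      then show ?thesis using B(1) by (simp add: T3_def z)
    qed
    have n2: "norm (T2 n x) \<le> (2 * B) * norm (Dw x)" for n x
    proof (cases "x \<in> \<Omega>")
      case True
      have "\<bar>posG' (w' n x) - posG' (w x)\<bar> \<le> 2" using posG_props(2)[of "w' n x"] posG_props(2)[of "w x"] by linarith
      then have "\<bar>\<zeta> x\<bar> * \<bar>posG' (w' n x) - posG' (w x)\<bar> \<le> B * 2"
        using B(1,2) cl[OF True] by (intro mult_mono) auto
      then have "\<bar>\<zeta> x * (posG' (w' n x) - posG' (w x))\<bar> * norm (Dw x) \<le> (B * 2) * norm (Dw x)"
        by (intro mult_right_mono) (auto simp: abs_mult)
      then show ?thesis unfolding T2_def by (simp add: mult.commute)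
    next
      case False
      then show ?thesis using B(1) by (simp add: T2_def z)
    qed
    have B0: "B \<ge> 0" "2 * B \<ge> 0" using B(1) by auto
    have mT: "T1 n \<in> borel_measurable lebesgue" "T2 n \<in> borel_measurable lebesgue" "T3 n \<in> borel_measurable lebesgue" for n
      unfolding T1_def[abs_def] T2_def[abs_def] T3_def[abs_def] by measurable
    have iT: "integrable lebesgue (\<lambda>x. norm (T1 n x) powr p)" "integrable lebesgue (\<lambda>x. norm (T2 n x) powr p)"
      "integrable lebesgue (\<lambda>x. norm (T3 n x) powr p)" for n
      by (rule integrable_powr_bounded_mult[OF p0 dL(2) mT(1) B0(1) n1], rule integrable_powr_bounded_mult[OF p0 iDw mT(2) B0(2) n2],
          rule integrable_powr_bounded_mult[OF p0 dL(1) mT(3) B0(1) n3])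
    have t1: "(\<lambda>n. \<integral>x. norm (T1 n x) powr p \<partial>lebesgue) \<longlonglongrightarrow> 0"
      by (rule Lp_zero_bound[OF p0 B0(1) n1 dL(2) sub(2)])
    have t3: "(\<lambda>n. \<integral>x. norm (T3 n x) powr p \<partial>lebesgue) \<longlonglongrightarrow> 0"
      by (rule Lp_zero_bound[OF p0 B0(1) n3 dL(1) sub(1)])
    have t2: "(\<lambda>n. \<integral>x. norm (T2 n x) powr p \<partial>lebesgue) \<longlonglongrightarrow> (\<integral>x. 0 \<partial>(lebesgue :: (real^2) measure))"
    proof (rule integral_dominated_convergence[where w = "\<lambda>x. (2 * B) powr p * norm (Dw x) powr p"])
      show "integrable lebesgue (\<lambda>x. (2 * B) powr p * norm (Dw x) powr p)" using iDw by simp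
      show "AE x in lebesgue. norm (norm (T2 n x) powr p) \<le> (2 * B) powr p * norm (Dw x) powr p" for n
        using powr_mono2[OF p0 norm_ge_zero n2[of n]] B(1) by (intro AE_I2) (simp add: powr_mult)
      show "AE x in lebesgue. (\<lambda>n. norm (T2 n x) powr p) \<longlonglongrightarrow> 0"
        using r(2)
      proof eventually_elim
        case (elim x)
        have "(\<lambda>n. w x + - (indicator \<Omega> x * vR (r n) x - uR x)) \<longlonglongrightarrow> w x + - 0"
          by (intro tendsto_intros elim)
        moreover have "w x + - (indicator \<Omega> x * vR (r n) x - uR x) = w' n x" for n using ww[of n x] by simp
        ultimately have "(\<lambda>n. w' n x) \<longlonglongrightarrow> w x" by simp
        then have "(\<lambda>n. posG' (w' n x)) \<longlonglongrightarrow> posG' (w x)"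
          using posG_props(1) by (intro isCont_tendsto_compose[of _ posG']) (auto simp: continuous_on_eq_continuous_at)
        then have "(\<lambda>n. T2 n x) \<longlonglongrightarrow> (\<zeta> x * (posG' (w x) - posG' (w x))) *\<^sub>R Dw x"
          unfolding T2_def by (intro tendsto_intros)
        then have "(\<lambda>n. norm (T2 n x)) \<longlonglongrightarrow> 0" using tendsto_norm_zero by fastforce
        then have "(\<lambda>n. norm (T2 n x) powr p) \<longlonglongrightarrow> 0 powr p"
          by (intro tendsto_powr') (use pp in auto)
        then show ?case by simp
      qed
    qed (use iT(2) in auto)
    have mS: "(\<lambda>x. T2 n x + T3 n x) \<in> borel_measurable lebesgue" for n using mT by measurable
    show "(\<lambda>n. \<integral>x. norm (h n x - D x) powr p \<partial>lebesgue) \<longlonglongrightarrow> 0"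
      unfolding hD
      by (intro Lp_zero_add[OF p0 iT(1) t1] Lp_zero_add[OF p0 iT(2) t2[simplified] iT(3) t3] integrable_powr_add[OF p0 mT(2,3) iT(2,3)])
    have b4: "\<bar>v n (circ 5 t) - 0\<bar> \<le> B * \<bar>vR (r n) (circ 5 t) - max 0 (circ 5 t $ 1)\<bar>" for n t
    proof (cases "\<zeta> (circ 5 t) > 0")
      case True
      let ?y = "circ 5 t"
      have "posG (SR ?y - vR (r n) ?y) \<le> \<bar>vR (r n) ?y - max 0 (?y $ 1)\<bar>"
      proof (cases "SR ?y - vR (r n) ?y \<le> 0")
        case False
        then show ?thesis
          using posG_Lipschitz[of "SR ?y - vR (r n) ?y" 0] circ[OF True] posG_props(4)[of "SR ?y - vR (r n) ?y"] pG0 by linarith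
      qed (simp add: posG_props)
      then have "\<bar>\<zeta> ?y\<bar> * \<bar>posG (SR ?y - vR (r n) ?y)\<bar> \<le> B * \<bar>vR (r n) ?y - max 0 (?y $ 1)\<bar>"
        using B(1,2) circ_closure[of t] posG_props(4) by (intro mult_mono) auto
      then show ?thesis by (simp add: v_def abs_mult)
    next
      case False
      then have "\<zeta> (circ 5 t) = 0" using \<zeta>(2)[of "circ 5 t"] by linarith
      then show ?thesis using B(1) by (simp add: v_def)
    qed
    show "(\<lambda>n. circle_Lp (\<lambda>x. v n x - 0)) \<longlonglongrightarrow> 0"
      unfolding circle_Lp_def
    proof (rule Lp_zero_bound[OF p0 B0(1), of _ "\<lambda>n t. indicator {0..2*pi} t * (vR (r n) (circ 5 t) - max 0 (circ 5 t $ 1))"])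
      show "integrable lborel (\<lambda>t. norm (indicator {0..2*pi} t * (vR (r n) (circ 5 t) - max 0 (circ 5 t $ 1))) powr p)" for n
        by (rule circle_integrable[of "\<lambda>x. vR (r n) x - max 0 (x $ 1)"]) (use AR in \<open>auto simp: approx_def intro!: continuous_intros\<close>)
      show "(\<lambda>n. \<integral>t. norm (indicator {0..2*pi} t * (vR (r n) (circ 5 t) - max 0 (circ 5 t $ 1))) powr p \<partial>lborel) \<longlonglongrightarrow> 0"
        using LIMSEQ_subseq_LIMSEQ[OF dT(3) r(1)] by (simp add: o_def circle_Lp_def)
      show "norm (indicator {0..2*pi} t * (v n (circ 5 t) - 0)) \<le> B * norm (indicator {0..2*pi} t * (vR (r n) (circ 5 t) - max 0 (circ 5 t $ 1)))" for n t
        using b4[of n t] by (simp add: indicator_def)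
    qed
  qed auto
  then show ?thesis unfolding \<phi>_def[abs_def] D_def[abs_def] Dw_def by blast
qed

text \<open>With \<phi> = \<zeta> posG(S - u) as test function both in the equation and in
  \<open>subsolution_inequality\<close>, the integral of \<zeta> posG'(S - u) (A(DS) - A(Du))
  \<bullet> (DS - Du) is at most 0, where A is the field \<open>pfield p\<close>; strict
  monotonicity makes the gradient of \<phi> vanish. The hypothesis \<open>cut\<close> removes the
  gradient of \<zeta> wherever S > u, so S \<le> u has to be known beforehand in the layers where
  \<zeta> varies.\<close>

theorem comparison:
  assumes \<zeta>: "C1_grad \<zeta> \<zeta>'" "\<And>x. \<zeta> x \<ge> 0"
    and S: "Sob p \<Omega> (\<lambda>x. indicator \<Omega> x * SR x) DS" "continuous_on (closure \<Omega>) SR"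
    and circ: "\<And>t. \<zeta> (circ 5 t) > 0 \<Longrightarrow> SR (circ 5 t) \<le> max 0 (circ 5 t $ 1)"
    and left: "\<And>x. x \<in> \<Omega> \<Longrightarrow> x $ 1 \<le> 0 \<Longrightarrow> SR x \<le> 0 \<or> \<zeta> x = 0 \<and> \<zeta>' x = 0"
    and cut: "AE x in lebesgue. x \<in> \<Omega> \<longrightarrow> uR x < SR x \<longrightarrow> \<zeta>' x = 0"
    and \<tau>: "C1_grad \<tau>1 \<tau>1'" "C1_grad \<tau>2 \<tau>2'"
    and field: "\<And>x. x \<in> \<Omega> \<Longrightarrow> x $ 1 > 0 \<Longrightarrow> \<zeta> x > 0 \<Longrightarrow> pfield p (DS x) $ 1 = \<tau>1 x \<and> pfield p (DS x) $ 2 = \<tau>2 x"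
    and div: "\<And>x. x \<in> \<Omega> \<Longrightarrow> x $ 1 > 0 \<Longrightarrow> \<zeta> x > 0 \<Longrightarrow> \<tau>1' x $ 1 + \<tau>2' x $ 2 \<ge> 0"
    and bdry: "\<And>x. x \<in> \<Omega> \<Longrightarrow> x $ 1 > 0 \<Longrightarrow> \<zeta> x > 0 \<Longrightarrow> \<tau>1 x * d1' x $ 1 + \<tau>2 x * d1' x $ 2 \<ge> 0"
      "\<And>x. x \<in> \<Omega> \<Longrightarrow> x $ 1 > 0 \<Longrightarrow> \<zeta> x > 0 \<Longrightarrow> \<tau>1 x * d2' x $ 1 + \<tau>2 x * d2' x $ 2 \<ge> 0"
  shows "AE x in lebesgue. x \<in> \<Omega> \<longrightarrow> \<zeta> x > 0 \<longrightarrow> SR x \<le> uR x"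
proof -
  define w where "w x = indicator \<Omega> x * SR x - uR x" for x
  define \<phi> where "\<phi> x = \<zeta> x * posG (w x)" for x
  define D where "D x = \<zeta> x *\<^sub>R (posG' (w x) *\<^sub>R (DS x - gR x)) + posG (w x) *\<^sub>R \<zeta>' x" for x
  obtain v h where A: "approx \<phi> D (\<lambda>x. 0) v h"
    using comparison_test_function[OF \<zeta> S circ] unfolding \<phi>_def[abs_def] D_def[abs_def] w_def[abs_def] by blast
  have SD: "Sob p \<Omega> \<phi> D" using A by (simp add: approx_def)
  have \<phi>0: "\<phi> x \<ge> 0" for x using \<zeta>(2) posG_props(4) by (simp add: \<phi>_def)
  have uz: "uR x = 0" if "x \<notin> \<Omega>" for x using AR that by (auto simp: approx_def Sob_def)
  have wpos: "x \<in> \<Omega> \<and> uR x < SR x \<and> (x $ 1 > 0 \<or> \<zeta> x = 0 \<and> \<zeta>' x = 0)" if "w x > 0" for x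
  proof -
    have x: "x \<in> \<Omega>" using that uz[of x] by (cases "x \<in> \<Omega>") (auto simp: w_def)
    then have "uR x < SR x" using that by (simp add: w_def)
    then show ?thesis using x left[OF x] R0(1)[of x] by (cases "x $ 1 > 0") auto
  qed
  have D0: "D x = 0" if "x $ 1 \<le> 0" for x
  proof (cases "w x > 0")
    case True
    then show ?thesis using wpos[OF True] that by (simp add: D_def)
  qed (simp add: D_def posG_props)
  have \<phi>pos: "x \<in> \<Omega>" "x $ 1 > 0" "\<zeta> x > 0" if "\<phi> x \<noteq> 0" for x
  proof -
    have "\<zeta> x \<noteq> 0" "w x > 0" using that posG_props(5)[of "w x"] by (auto simp: \<phi>_def not_le[symmetric])
    then show "x \<in> \<Omega>" "x $ 1 > 0" "\<zeta> x > 0" using wpos[of x] \<zeta>(2)[of x] by auto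
  qed
  have weak0: "(\<integral>x. pfield p (gR x) \<bullet> D x \<partial>lebesgue) = 0" by (rule weakR[OF A D0])
  have sub: "(\<integral>x. \<tau>1 x * D x $ 1 + \<tau>2 x * D x $ 2 \<partial>lebesgue) \<le> - (\<integral>x. \<phi> x * (\<tau>1' x $ 1 + \<tau>2' x $ 2) \<partial>lebesgue)"
    and iD: "integrable lebesgue (\<lambda>x. \<tau>1 x * D x $ 1 + \<tau>2 x * D x $ 2)"
    by (rule subsolution_inequality[OF A \<phi>0 \<tau>]; use bdry \<phi>pos in blast)+
  have "\<phi> x * (\<tau>1' x $ 1 + \<tau>2' x $ 2) \<ge> 0" for x
    using \<phi>0[of x] div[OF \<phi>pos] by (cases "\<phi> x = 0") auto
  then have "(\<integral>x. \<phi> x * (\<tau>1' x $ 1 + \<tau>2' x $ 2) \<partial>lebesgue) \<ge> 0" by (intro integral_nonneg_AE) simp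
  then have le0: "(\<integral>x. \<tau>1 x * D x $ 1 + \<tau>2 x * D x $ 2 \<partial>lebesgue) \<le> 0" using sub by linarith
  define X where "X x = (\<zeta> x * posG' (w x)) * ((pfield p (DS x) - pfield p (gR x)) \<bullet> (DS x - gR x))" for x
  have X0: "X x \<ge> 0" for x
    unfolding X_def using \<zeta>(2) posG_props(3) pfield_mono(1)[OF p1] by (intro mult_nonneg_nonneg) auto
  have iF: "integrable lebesgue (\<lambda>x. pfield p (gR x) \<bullet> D x)"
    by (rule pfield_integrable[OF p1]) (use AR SD in \<open>auto simp: approx_def Sob_def\<close>)
  have ae: "AE x in lebesgue. X x = (\<tau>1 x * D x $ 1 + \<tau>2 x * D x $ 2) - pfield p (gR x) \<bullet> D x
      \<and> D x = (\<zeta> x * posG' (w x)) *\<^sub>R (DS x - gR x)"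
    using cut
  proof eventually_elim
    case (elim x)
    have De: "D x = (\<zeta> x * posG' (w x)) *\<^sub>R (DS x - gR x)"
    proof (cases "w x > 0")
      case True
      then show ?thesis using wpos[OF True] elim by (simp add: D_def)
    qed (simp add: D_def posG_props)
    have "X x = pfield p (DS x) \<bullet> D x - pfield p (gR x) \<bullet> D x"
      unfolding X_def De by (simp add: inner_diff_left algebra_simps)
    moreover have "pfield p (DS x) \<bullet> D x = \<tau>1 x * D x $ 1 + \<tau>2 x * D x $ 2"
    proof (cases "D x = 0")
      case False
      then have "\<zeta> x \<noteq> 0" "posG' (w x) \<noteq> 0" by (auto simp: De)
      then have "w x > 0" using posG_props(6)[of "w x"] by (auto simp: not_le[symmetric])
      then have "x \<in> \<Omega>" "x $ 1 > 0" "\<zeta> x > 0" using wpos[of x] \<open>\<zeta> x \<noteq> 0\<close> \<zeta>(2)[of x] by auto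
      then show ?thesis using field[of x] by (simp add: inner_real2)
    qed simp
    ultimately show ?case using De by simp
  qed
  have mX: "X \<in> borel_measurable lebesgue"
  proof (rule borel_measurable_AE)
    show "(\<lambda>x. (\<tau>1 x * D x $ 1 + \<tau>2 x * D x $ 2) - pfield p (gR x) \<bullet> D x) \<in> borel_measurable lebesgue"
      using iD iF by auto
    show "AE x in lebesgue. (\<tau>1 x * D x $ 1 + \<tau>2 x * D x $ 2) - pfield p (gR x) \<bullet> D x = X x"
      using ae by eventually_elim simp
  qed
  have iX: "integrable lebesgue X"
    by (rule integrable_cong_AE_imp[OF Bochner_Integration.integrable_diff[OF iD iF] mX])
       (use ae in eventually_elim, simp)
  have "integral\<^sup>L lebesgue X = (\<integral>x. (\<tau>1 x * D x $ 1 + \<tau>2 x * D x $ 2) - pfield p (gR x) \<bullet> D x \<partial>lebesgue)"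
    by (rule integral_lebesgue_cong_AE) (use ae in eventually_elim, simp)
  also have "\<dots> \<le> 0" using iD iF weak0 le0 by simp
  finally have "integral\<^sup>L lebesgue X \<le> 0" .
  moreover have "integral\<^sup>L lebesgue X \<ge> 0" by (rule integral_nonneg_AE) (simp add: X0)
  ultimately have "integral\<^sup>L lebesgue X = 0" by simp
  then have "AE x in lebesgue. X x = 0"
    using integral_nonneg_eq_0_iff_AE[OF iX] X0 by simp
  then have DAE: "AE x in lebesgue. D x = 0"
    using ae
  proof eventually_elim
    case (elim x)
    show ?case
    proof (cases "\<zeta> x * posG' (w x) = 0")
      case False
      then have "(pfield p (DS x) - pfield p (gR x)) \<bullet> (DS x - gR x) = 0" using elim(1) by (auto simp: X_def)
      from pfield_mono(2)[OF p1 this] show ?thesis using elim(2) by simp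
    qed (use elim in simp)
  qed
  \<comment> \<open>From D = 0 to \<phi> = 0: the field (x_1, 0) has divergence 1, and where \<phi>
    is nonzero its flux leaves the inclusions by \<open>d_mono\<close>, so
    \<open>subsolution_inequality\<close> bounds the integral of \<phi> by that of -x_1 D_1, which
    is 0. This plays the part of a Poincare inequality.\<close>
  have cx: "C1_grad (\<lambda>x::real^2. x $ 1) (\<lambda>x. e1)"
    unfolding C1_grad_def gderiv_def by (simp add: bounded_linear_imp_has_derivative[OF bounded_linear_vec_nth])
  have c0: "C1_grad (\<lambda>x::real^2. 0) (\<lambda>x. 0)" by (simp add: C1_grad_def GDERIV_const)
  have "(\<integral>x. x $ 1 * D x $ 1 + 0 * D x $ 2 \<partial>lebesgue) \<le> - (\<integral>x. \<phi> x * (e1 $ 1 + (0::real^2) $ 2) \<partial>lebesgue)"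
  proof (rule subsolution_inequality(1)[OF A \<phi>0 cx c0])
    fix x assume "\<phi> x \<noteq> 0"
    then have x: "x $ 1 > 0" by (rule \<phi>pos)
    show "0 \<le> x $ 1 * d1' x $ 1 + 0 * d1' x $ 2" "0 \<le> x $ 1 * d2' x $ 1 + 0 * d2' x $ 2"
      using d_mono[OF x] x by simp_all
  qed
  moreover have "(\<integral>x. x $ 1 * D x $ 1 + 0 * D x $ 2 \<partial>lebesgue) = (\<integral>x. 0 \<partial>(lebesgue :: (real^2) measure))"
    by (rule integral_lebesgue_cong_AE) (use DAE in eventually_elim, simp)
  ultimately have "integral\<^sup>L lebesgue \<phi> \<le> 0" by simp
  moreover have i\<phi>: "integrable lebesgue \<phi>" by (rule Sob_integrable(1)[OF SD \<Omega>_open \<Omega>_bounded p])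
  moreover have "integral\<^sup>L lebesgue \<phi> \<ge> 0" by (rule integral_nonneg_AE) (simp add: \<phi>0)
  ultimately have "integral\<^sup>L lebesgue \<phi> = 0" by simp
  then have "AE x in lebesgue. \<phi> x = 0"
    using integral_nonneg_eq_0_iff_AE[OF i\<phi>] \<phi>0 by simp
  then show ?thesis
  proof eventually_elim
    case (elim x)
    show ?case
    proof (intro impI)
      assume x: "x \<in> \<Omega>" "\<zeta> x > 0"
      then have "posG (w x) = 0" using elim by (simp add: \<phi>_def)
      then have "w x \<le> 0" using posG_props(7)[of "w x"] by force
      then show "SR x \<le> uR x" using x by (simp add: w_def)
    qed
  qed
qed

end

section \<open>The insulated domain\<close>

lemma DERIV_abs_powr:
  assumes "m > 2"
  shows "((\<lambda>x. \<bar>x\<bar> powr m) has_real_derivative m * \<bar>x\<bar> powr (m - 2) * x) (at (x::real))"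
proof -
  consider "x > 0" | "x < 0" | "x = 0" by linarith
  then show ?thesis
  proof cases
    case 1
    have "\<forall>\<^sub>F t in nhds x. t \<in> {0<..}" using 1 by (intro eventually_nhds_in_open) auto
    then have ev: "\<forall>\<^sub>F t in nhds x. t powr m = \<bar>t\<bar> powr m" by (rule eventually_mono) simp
    have "x powr (m - 2) * x = x powr (m - 1)" using 1 by (simp add: powr_diff power2_eq_square)
    then have "((\<lambda>t. t powr m) has_real_derivative m * \<bar>x\<bar> powr (m - 2) * x) (at x)"
      using has_real_derivative_powr[OF 1, of m] 1 by (simp add: mult.assoc)
    then show ?thesis using DERIV_cong_ev[OF refl ev refl] by simp
  next
    case 2
    have "\<forall>\<^sub>F t in nhds x. t \<in> {..<0}" using 2 by (intro eventually_nhds_in_open) auto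
    then have ev: "\<forall>\<^sub>F t in nhds x. (- t) powr m = \<bar>t\<bar> powr m" by (rule eventually_mono) simp
    have e: "(- x) powr (m - 2) * (- x) = (- x) powr (m - 1)" using 2 by (simp add: powr_diff power2_eq_square)
    have "((\<lambda>t. (- t) powr m) has_real_derivative (m * (- x) powr (m - 1)) * (- 1)) (at x)"
      by (rule DERIV_chain2[where f = "\<lambda>t. t powr m" and g = uminus])
         (use 2 has_real_derivative_powr[of "- x" m] in \<open>auto intro!: derivative_eq_intros\<close>)
    then have "((\<lambda>t. (- t) powr m) has_real_derivative m * \<bar>x\<bar> powr (m - 2) * x) (at x)"
      using 2 unfolding e[symmetric] by (simp add: mult.assoc)
    then show ?thesis using DERIV_cong_ev[OF refl ev refl] by simp
  next
    case 3
    have "((\<lambda>h. \<bar>h\<bar> powr m / h) \<longlongrightarrow> 0) (at (0::real))"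
    proof (rule Lim_null_comparison)
      have "norm (\<bar>h\<bar> powr m / h) = \<bar>h\<bar> powr (m - 1)" for h :: real
        by (cases "h = 0") (auto simp: powr_diff)
      then show "\<forall>\<^sub>F h in at 0. norm (\<bar>h\<bar> powr m / h) \<le> \<bar>h::real\<bar> powr (m - 1)" by simp
      have "((\<lambda>h. \<bar>h::real\<bar> powr (m - 1)) \<longlongrightarrow> 0 powr (m - 1)) (at 0)"
        by (rule tendsto_powr'[OF tendsto_rabs_zero[OF tendsto_ident_at] tendsto_const]) (use assms in auto)
      then show "((\<lambda>h. \<bar>h::real\<bar> powr (m - 1)) \<longlongrightarrow> 0) (at 0)" by simp
    qed
    then show ?thesis using 3 by (simp add: DERIV_def)
  qed
qed

lemma continuous_abs_powr: "m > 2 \<Longrightarrow> continuous_on UNIV (\<lambda>x::real. m * \<bar>x\<bar> powr (m - 2) * x)"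
  by (intro continuous_intros continuous_on_powr') auto

lemma C1_grad_add:
  assumes "C1_grad u u'" "C1_grad v v'" shows "C1_grad (\<lambda>x. u x + v x) (\<lambda>x. u' x + v' x)"
  using assms unfolding C1_grad_def by (auto intro!: GDERIV_add continuous_intros)

lemma C1_grad_const: "C1_grad (\<lambda>x. c) (\<lambda>x. 0)"
  by (simp add: C1_grad_def GDERIV_const)

text \<open>Negative inside the inclusion with centre (0, c), and with gradient pointing out of it:
  a defining function of the kind that \<open>plap_insulated\<close> works with.\<close>

definition lev :: "real \<Rightarrow> real \<Rightarrow> real^2 \<Rightarrow> real" where
  "lev m c x = \<bar>x $ 1\<bar> powr m + \<bar>x $ 2 - c\<bar> powr m - 1"

definition lev' :: "real \<Rightarrow> real \<Rightarrow> real^2 \<Rightarrow> real^2" where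
  "lev' m c x = (m * \<bar>x $ 1\<bar> powr (m - 2) * x $ 1) *\<^sub>R axis 1 1
     + (m * \<bar>x $ 2 - c\<bar> powr (m - 2) * (x $ 2 - c)) *\<^sub>R axis 2 1"

lemma C1_grad_lev:
  assumes "m > 2" shows "C1_grad (lev m c) (lev' m c)"
proof -
  note D = C1_grad_linear_compose[OF DERIV_abs_powr[OF assms] continuous_abs_powr[OF assms]]
  have 1: "C1_grad (\<lambda>x::real^2. \<bar>x $ 1\<bar> powr m) (\<lambda>x. (m * \<bar>x $ 1\<bar> powr (m - 2) * x $ 1) *\<^sub>R axis 1 1)"
    using D[of 1 e1 0] by simp
  have 2: "C1_grad (\<lambda>x::real^2. \<bar>x $ 2 - c\<bar> powr m) (\<lambda>x. (m * \<bar>x $ 2 - c\<bar> powr (m - 2) * (x $ 2 - c)) *\<^sub>R axis 2 1)"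
    using D[of 1 "axis 2 1" "- c"] by (simp add: cart_eq_inner_axis)
  show ?thesis
    using C1_grad_add[OF C1_grad_add[OF 1 2] C1_grad_const[of "-1"]]
    unfolding lev_def[abs_def] lev'_def[abs_def] by simp
qed

text \<open>Shrinking towards the centre (0, c) by a factor s < 1 multiplies
  \<open>lev m c x + 1\<close> by s^m, so each point of the closed sublevel set is a limit of points
  where \<open>lev\<close> is negative. \<open>Omega\<close> is defined by removing closures,
  whereas the cut-offs see the sign of \<open>lev\<close>.\<close>

lemma closure_sublevel_lev:
  assumes m: "m > 2"
  shows "closure {x. lev m c x < 0} = {x. lev m c x \<le> 0}"
proof
  have "continuous_on UNIV (lev m c)" by (rule C1_grad_imp_continuous[OF C1_grad_lev[OF m]])
  then have "closed {x. lev m c x \<le> 0}" by (intro closed_Collect_le continuous_intros)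
  then show "closure {x. lev m c x < 0} \<subseteq> {x. lev m c x \<le> 0}" by (intro closure_minimal) auto
  show "{x. lev m c x \<le> 0} \<subseteq> closure {x. lev m c x < 0}"
  proof
    fix x assume "x \<in> {x. lev m c x \<le> 0}"
    then have x: "\<bar>x $ 1\<bar> powr m + \<bar>x $ 2 - c\<bar> powr m \<le> 1" by (simp add: lev_def)
    define z :: "real^2" where "z = c *\<^sub>R axis 2 1"
    define s where "s n = 1 - 1 / (real n + 2)" for n
    have s: "0 < s n" "s n < 1" for n by (auto simp: s_def field_simps)
    define y where "y n = z + s n *\<^sub>R (x - z)" for n
    have "lev m c (y n) < 0" for n
    proof -
      have "y n $ 1 = s n * x $ 1" "y n $ 2 - c = s n * (x $ 2 - c)" by (auto simp: y_def z_def algebra_simps)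
      then have "\<bar>y n $ 1\<bar> powr m + \<bar>y n $ 2 - c\<bar> powr m = s n powr m * (\<bar>x $ 1\<bar> powr m + \<bar>x $ 2 - c\<bar> powr m)"
        using s[of n] by (simp add: abs_mult powr_mult distrib_left)
      also have "\<dots> \<le> s n powr m * 1" using x by (intro mult_left_mono) auto
      also have "\<dots> < 1" using s[of n] m powr_less_mono2[of m "s n" 1] by simp
      finally show ?thesis by (simp add: lev_def)
    qed
    moreover have "y \<longlonglongrightarrow> z + 1 *\<^sub>R (x - z)"
    proof -
      have "s \<longlonglongrightarrow> 1" unfolding s_def by real_asymp
      then show ?thesis unfolding y_def by (intro tendsto_intros)
    qed
    ultimately show "x \<in> closure {x. lev m c x < 0}" unfolding closure_sequential by (intro exI[of _ y]) auto
  qed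
qed

definition gap_center :: "real \<Rightarrow> real" where "gap_center \<epsilon> = \<epsilon>/2 + 1"

definition exterior :: "real \<Rightarrow> real \<Rightarrow> (real^2) set" where
  "exterior m \<epsilon> = {x. lev m (gap_center \<epsilon>) x > 0 \<and> lev m (- gap_center \<epsilon>) x > 0}"

lemma Omega_eq:
  assumes "m > 2" shows "Omega m \<epsilon> = exterior m \<epsilon> \<inter> ball 0 5"
proof -
  have g: "x $ 2 - gap_center \<epsilon> = x $ 2 - \<epsilon>/2 - 1" "x $ 2 - (- gap_center \<epsilon>) = x $ 2 + \<epsilon>/2 + 1" for x :: "real^2"
    by (simp_all add: gap_center_def)
  have "D1 m \<epsilon> = {x. lev m (gap_center \<epsilon>) x < 0}" "D2 m \<epsilon> = {x. lev m (- gap_center \<epsilon>) x < 0}"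
    unfolding D1_def D2_def lev_def g by auto
  then show ?thesis
    unfolding Omega_def D_outer_def closure_Un exterior_def using closure_sublevel_lev[OF assms] by auto
qed

text \<open>For \<epsilon> \<le> 1/2 the centres have height at most 5/4, so the inclusions lie in
  |x_1| \<le> 1, |x_2| \<le> 9/4, inside the radius 4 where the free annulus of
  \<open>disc_domain\<close> begins.\<close>

lemma lev_le_0_imp_norm_less:
  assumes "m > 2" "\<bar>c\<bar> \<le> 5/4" "lev m c x \<le> 0"
  shows "norm x < 4"
proof -
  have le1: "a \<le> 1" if "a powr m \<le> 1" "a \<ge> 0" for a :: real
  proof (rule ccontr)
    assume "\<not> a \<le> 1"
    then have "1 powr m < a powr m" using assms(1) by (intro powr_less_mono2) auto
    then show False using that by simp
  qed
  have "\<bar>x $ 1\<bar> powr m + \<bar>x $ 2 - c\<bar> powr m \<le> 1" using assms(3) by (simp add: lev_def)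
  then have "\<bar>x $ 1\<bar> powr m \<le> 1" "\<bar>x $ 2 - c\<bar> powr m \<le> 1"
    using powr_ge_zero[of "\<bar>x $ 1\<bar>" m] powr_ge_zero[of "\<bar>x $ 2 - c\<bar>" m] by linarith+
  then have "\<bar>x $ 1\<bar> \<le> 1" "\<bar>x $ 2 - c\<bar> \<le> 1" using le1 by auto
  then have a: "\<bar>x $ 1\<bar> \<le> 1" "\<bar>x $ 2\<bar> \<le> 9/4" using assms(2) by linarith+
  have "(x $ 1)\<^sup>2 \<le> 1\<^sup>2" "(x $ 2)\<^sup>2 \<le> (9/4)\<^sup>2" 
    using abs_le_square_iff[of "x $ 1" 1] abs_le_square_iff[of "x $ 2" "9/4"] a by simp_all
  then have "(norm x)\<^sup>2 < 4\<^sup>2" unfolding norm_real2 by (simp add: power2_eq_square)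
  then show ?thesis by (rule power2_less_imp_less) simp
qed

lemma plap_insulated_Omega:
  assumes m: "m > 2" and p: "p > 1" and \<epsilon>: "0 < \<epsilon>" "\<epsilon> \<le> 1/2"
  shows "plap_insulated (exterior m \<epsilon>) (Omega m \<epsilon>) p (lev m (gap_center \<epsilon>)) (lev m (- gap_center \<epsilon>))
    (lev' m (gap_center \<epsilon>)) (lev' m (- gap_center \<epsilon>))"
proof
  have c: "continuous_on UNIV (lev m c)" for c by (rule C1_grad_imp_continuous[OF C1_grad_lev[OF m]])
  show "open (exterior m \<epsilon>)"
    unfolding exterior_def by (intro open_Collect_conj open_Collect_less continuous_intros c)
  show "Omega m \<epsilon> = exterior m \<epsilon> \<inter> ball 0 5" by (rule Omega_eq[OF m])
  show "{x. 4 \<le> norm x \<and> norm x \<le> 5} \<subseteq> exterior m \<epsilon>"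
  proof
    fix x :: "real^2" assume x: "x \<in> {x. 4 \<le> norm x \<and> norm x \<le> 5}"
    have "\<bar>gap_center \<epsilon>\<bar> \<le> 5/4" "\<bar>- gap_center \<epsilon>\<bar> \<le> 5/4" using \<epsilon> by (simp_all add: gap_center_def)
    then show "x \<in> exterior m \<epsilon>"
      using lev_le_0_imp_norm_less[OF m, of "gap_center \<epsilon>" x] lev_le_0_imp_norm_less[OF m, of "- gap_center \<epsilon>" x] x
      unfolding exterior_def by (auto simp: not_le[symmetric])
  qed
  show "1 \<le> p" "1 < p" using p by auto
  show "reflect e1 x \<in> Omega m \<epsilon>" if "x \<in> Omega m \<epsilon>" for x
    using that unfolding Omega_eq[OF m] by (simp add: exterior_def lev_def norm_reflect)
  show "C1_grad (lev m (gap_center \<epsilon>)) (lev' m (gap_center \<epsilon>))"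
    "C1_grad (lev m (- gap_center \<epsilon>)) (lev' m (- gap_center \<epsilon>))" by (rule C1_grad_lev[OF m])+
  show "exterior m \<epsilon> = {x. 0 < lev m (gap_center \<epsilon>) x \<and> 0 < lev m (- gap_center \<epsilon>) x}"
    by (simp add: exterior_def)
  show "lev' m (gap_center \<epsilon>) x $ 1 \<ge> 0" "lev' m (- gap_center \<epsilon>) x $ 1 \<ge> 0" if "x $ 1 > 0" for x
    using that m by (auto simp: lev'_def)
qed

section \<open>The weak formulation in normalised form\<close>

context plap
begin

lemma approx_imp_trace:
  assumes A: "approx \<phi> D f v h"
  shows "W1p p \<Omega> \<phi> D" "has_trace_outer p \<Omega> \<phi> D f"
proof -
  have S: "Sob p \<Omega> \<phi> D" and Sv: "\<And>n. Sob p \<Omega> (\<lambda>x. indicator \<Omega> x * v n x) (h n)" using A by (auto simp: approx_def)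
  show W: "W1p p \<Omega> \<phi> D" by (rule Sob_imp_W1p[OF S])
  have Wv: "W1p p \<Omega> (v n) (h n)" for n
    by (rule W1p_cong[OF Sob_imp_W1p[OF Sv]]) auto
  have z: "\<phi> x = 0" "D x = 0" "h n x = 0" if "x \<notin> \<Omega>" for x n using S Sv[of n] that by (auto simp: Sob_def)
  have L1: "(LINT x:\<Omega>|lebesgue. norm (v n x - \<phi> x) powr p) = (\<integral>x. norm (indicator \<Omega> x * v n x - \<phi> x) powr p \<partial>lebesgue)" for n
    unfolding set_lebesgue_integral_def
    by (rule Bochner_Integration.integral_cong[OF refl], case_tac "x \<in> \<Omega>") (simp_all add: z)
  have L2: "(LINT x:\<Omega>|lebesgue. norm (h n x - D x) powr p) = (\<integral>x. norm (h n x - D x) powr p \<partial>lebesgue)" for n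
    unfolding set_lebesgue_integral_def
    by (rule Bochner_Integration.integral_cong[OF refl], case_tac "x \<in> \<Omega>") (simp_all add: z)
  have L3: "(LINT t:{0..2*pi}|lborel. 5 * \<bar>v n (vector [5 * cos t, 5 * sin t]) - f (vector [5 * cos t, 5 * sin t])\<bar> powr p)
      = 5 * circle_Lp (\<lambda>x. v n x - f x)" for n
    unfolding circle_Lp_eq circ_def by simp
  show "has_trace_outer p \<Omega> \<phi> D f"
    unfolding has_trace_outer_def
  proof (intro exI[of _ v] exI[of _ h] conjI allI)
    show "continuous_on (closure \<Omega>) (v n)" "W1p p \<Omega> (v n) (h n)" for n using A Wv by (auto simp: approx_def)
    show "Lp_tendsto p \<Omega> v \<phi>" "Lp_tendsto p \<Omega> h D"
      unfolding Lp_tendsto_def L1 L2 using W Wv A by (auto simp: W1p_def approx_def)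
    show "(\<lambda>n. LINT t:{0..2*pi}|lborel. 5 * \<bar>v n (vector [5 * cos t, 5 * sin t]) - f (vector [5 * cos t, 5 * sin t])\<bar> powr p) \<longlonglongrightarrow> 0"
      unfolding L3 using A by (intro tendsto_mult_right_zero) (simp add: approx_def)
  qed
qed

lemma trace_imp_approx:
  assumes W: "W1p p \<Omega> u g" and t: "has_trace_outer p \<Omega> u g f" and f: "continuous_on (closure \<Omega>) f"
  obtains v h where "approx (\<lambda>x. indicator \<Omega> x *\<^sub>R u x) (\<lambda>x. indicator \<Omega> x *\<^sub>R g x) f v h"
proof -
  obtain v h where vh: "\<And>n. continuous_on (closure \<Omega>) (v n)" "\<And>n. W1p p \<Omega> (v n) (h n)"
    "Lp_tendsto p \<Omega> v u" "Lp_tendsto p \<Omega> h g"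
    "(\<lambda>n. LINT t:{0..2*pi}|lborel. 5 * \<bar>v n (vector [5 * cos t, 5 * sin t]) - f (vector [5 * cos t, 5 * sin t])\<bar> powr p) \<longlonglongrightarrow> 0"
    using t unfolding has_trace_outer_def by blast
  have L1: "(\<integral>x. norm (indicator \<Omega> x *\<^sub>R a x - indicator \<Omega> x *\<^sub>R b x) powr p \<partial>lebesgue) = (LINT x:\<Omega>|lebesgue. norm (a x - b x) powr p)"
    for a b :: "real^2 \<Rightarrow> 'b::euclidean_space"
    unfolding set_lebesgue_integral_def
    by (rule Bochner_Integration.integral_cong[OF refl], case_tac "x \<in> \<Omega>") simp_all
  have L3: "(LINT t:{0..2*pi}|lborel. 5 * \<bar>v n (vector [5 * cos t, 5 * sin t]) - f (vector [5 * cos t, 5 * sin t])\<bar> powr p)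
      = 5 * circle_Lp (\<lambda>x. v n x - f x)" for n
    unfolding circle_Lp_eq circ_def by simp
  have "approx (\<lambda>x. indicator \<Omega> x *\<^sub>R u x) (\<lambda>x. indicator \<Omega> x *\<^sub>R g x) f v (\<lambda>n x. indicator \<Omega> x *\<^sub>R h n x)"
    unfolding approx_def
  proof (intro conjI allI f vh(1))
    show "Sob p \<Omega> (\<lambda>x. indicator \<Omega> x *\<^sub>R u x) (\<lambda>x. indicator \<Omega> x *\<^sub>R g x)"
      by (rule W1p_imp_Sob[OF \<Omega>_open \<Omega>_bounded p W])
    show "Sob p \<Omega> (\<lambda>x. indicator \<Omega> x * v n x) (\<lambda>x. indicator \<Omega> x *\<^sub>R h n x)" for n
      using W1p_imp_Sob[OF \<Omega>_open \<Omega>_bounded p vh(2)[of n]] by simp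
    show "(\<lambda>n. \<integral>x. norm (indicator \<Omega> x * v n x - indicator \<Omega> x *\<^sub>R u x) powr p \<partial>lebesgue) \<longlonglongrightarrow> 0"
      using vh(3) L1[of "v _" u] by (simp add: Lp_tendsto_def)
    show "(\<lambda>n. \<integral>x. norm (indicator \<Omega> x *\<^sub>R h n x - indicator \<Omega> x *\<^sub>R g x) powr p \<partial>lebesgue) \<longlonglongrightarrow> 0"
      unfolding L1 using vh(4) by (simp add: Lp_tendsto_def)
    have "(\<lambda>n. (1/5) * (5 * circle_Lp (\<lambda>x. v n x - f x))) \<longlonglongrightarrow> (1/5) * 0"
      using vh(5) unfolding L3 by (intro tendsto_mult tendsto_const)
    then show "(\<lambda>n. circle_Lp (\<lambda>x. v n x - f x)) \<longlonglongrightarrow> 0" by simp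
  qed
  then show ?thesis by (rule that)
qed

end

text \<open>The equality of \<open>gR\<close> and \<open>Du\<close> on the right half is the only
  trace of the original solution that the estimates below see; it carries a lower bound for
  \<open>gR\<close> back to \<open>Du\<close>.\<close>

lemma weak_solution_imp_half_solution:
  assumes m: "m > 2" and p: "p > 1" and \<epsilon>: "0 < \<epsilon>" "\<epsilon> \<le> 1/2" and W: "weak_solution m p \<epsilon> u Du"
  obtains uR gR vR hR where
    "half_solution (exterior m \<epsilon>) (Omega m \<epsilon>) p (lev m (gap_center \<epsilon>)) (lev m (- gap_center \<epsilon>))
       (lev' m (gap_center \<epsilon>)) (lev' m (- gap_center \<epsilon>)) uR gR vR hR"
    "AE x in lebesgue. x \<in> Omega m \<epsilon> \<longrightarrow> x $ 1 > 0 \<longrightarrow> gR x = Du x"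
proof -
  interpret plap_insulated "exterior m \<epsilon>" "Omega m \<epsilon>" p "lev m (gap_center \<epsilon>)" "lev m (- gap_center \<epsilon>)"
    "lev' m (gap_center \<epsilon>)" "lev' m (- gap_center \<epsilon>)"
    by (rule plap_insulated_Omega[OF m p \<epsilon>])
  let ?u = "\<lambda>x. indicator (Omega m \<epsilon>) x *\<^sub>R u x" and ?g = "\<lambda>x. indicator (Omega m \<epsilon>) x *\<^sub>R Du x"
  have Wu: "W1p p (Omega m \<epsilon>) u Du" "has_trace_outer p (Omega m \<epsilon>) u Du (\<lambda>x. x $ 1)"
    and weak: "\<And>\<phi> D\<phi>. W1p p (Omega m \<epsilon>) \<phi> D\<phi> \<Longrightarrow> has_trace_outer p (Omega m \<epsilon>) \<phi> D\<phi> (\<lambda>x. 0) \<Longrightarrow>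
        (LINT x:Omega m \<epsilon>|lebesgue. (norm (Du x) powr (p - 2) *\<^sub>R Du x) \<bullet> D\<phi> x) = 0"
    using W unfolding weak_solution_def by blast+
  obtain v h where A: "approx ?u ?g (\<lambda>x. x $ 1) v h"
    by (rule trace_imp_approx[OF Wu]) (auto intro!: continuous_intros)
  have weak': "(\<integral>x. pfield p (?g x) \<bullet> D x \<partial>lebesgue) = 0" if "approx \<phi> D (\<lambda>x. 0) v' h'" for \<phi> D v' h'
  proof -
    have "(\<integral>x. pfield p (?g x) \<bullet> D x \<partial>lebesgue) = (LINT x:Omega m \<epsilon>|lebesgue. (norm (Du x) powr (p - 2) *\<^sub>R Du x) \<bullet> D x)"
      unfolding set_lebesgue_integral_def
      by (rule Bochner_Integration.integral_cong[OF refl], case_tac "x \<in> Omega m \<epsilon>") (simp_all add: pfield_def)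
    then show ?thesis using weak[OF approx_imp_trace[OF that]] by simp
  qed
  show thesis
  proof (rule half_solution[OF A weak'])
    fix uR gR vR hR
    assume R: "approx uR gR (\<lambda>x. max 0 (x $ 1)) vR hR"
    "\<And>x. x $ 1 \<le> 0 \<Longrightarrow> uR x = 0" "\<And>x. x $ 1 \<le> 0 \<Longrightarrow> gR x = 0" "\<And>n x. x $ 1 \<le> 0 \<Longrightarrow> vR n x = 0"
    "\<And>n x. x $ 1 \<le> 0 \<Longrightarrow> hR n x = 0" "AE x in lebesgue. x $ 1 > 0 \<longrightarrow> gR x = ?g x"
    "\<And>\<phi> D v' h'. approx \<phi> D (\<lambda>x. 0) v' h' \<Longrightarrow> (\<And>x. x $ 1 \<le> 0 \<Longrightarrow> D x = 0) \<Longrightarrow>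
        (\<integral>x. pfield p (gR x) \<bullet> D x \<partial>lebesgue) = 0"
    show thesis
    proof (rule that)
      show "half_solution (exterior m \<epsilon>) (Omega m \<epsilon>) p (lev m (gap_center \<epsilon>)) (lev m (- gap_center \<epsilon>))
       (lev' m (gap_center \<epsilon>)) (lev' m (- gap_center \<epsilon>)) uR gR vR hR"
      by unfold_locales (use R in auto)
    show "AE x in lebesgue. x \<in> Omega m \<epsilon> \<longrightarrow> x $ 1 > 0 \<longrightarrow> gR x = Du x"
      using R(6) by eventually_elim simp
    qed
  qed blast
qed

section \<open>The neck between the inclusions\<close>

lemma C1_grad_powr:
  assumes u: "C1_grad u u'" and pos: "\<And>x. u x > 0"
  shows "C1_grad (\<lambda>x. u x powr \<alpha>) (\<lambda>x. (\<alpha> * u x powr (\<alpha> - 1)) *\<^sub>R u' x)"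
  unfolding C1_grad_def
proof (intro conjI allI)
  show "GDERIV (\<lambda>x. u x powr \<alpha>) x :> (\<alpha> * u x powr (\<alpha> - 1)) *\<^sub>R u' x" for x
    by (rule GDERIV_DERIV_compose[where g = "\<lambda>t. t powr \<alpha>"])
       (use u pos in \<open>auto simp: C1_grad_def intro!: has_real_derivative_powr\<close>)
  have "u x \<noteq> 0" for x using pos[of x] by simp
  then show "continuous_on UNIV (\<lambda>x. (\<alpha> * u x powr (\<alpha> - 1)) *\<^sub>R u' x)"
    using u C1_grad_imp_continuous[OF u] unfolding C1_grad_def
    by (auto intro!: continuous_intros)
qed

lemma C1_grad_coord:
  fixes i :: "'n::finite"
  assumes "\<And>s. (G has_real_derivative G' s) (at s)" "continuous_on UNIV G'"
  shows "C1_grad (\<lambda>x::real^'n. G (c * x $ i + d)) (\<lambda>x. (G' (c * x $ i + d) * c) *\<^sub>R axis i 1)"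
  using C1_grad_linear_compose[OF assms, of c "axis i 1" d] by (simp add: cart_eq_inner_axis)

text \<open>Small |x_1| also occurs above and below the inclusions; this factor singles out the
  neck. By \<open>thin\<close> its transition zone contains no point of \<Omega> with 0 < x_1 \<le>
  1/2, so its gradient does not contribute there.\<close>

definition plateau :: "real^2 \<Rightarrow> real" where
  "plateau x = ramp (-4 * x $ 2 + 3) * ramp (4 * x $ 2 + 3)"

definition plateau' :: "real^2 \<Rightarrow> real^2" where
  "plateau' x = ramp (-4 * x $ 2 + 3) *\<^sub>R ((ramp' (4 * x $ 2 + 3) * 4) *\<^sub>R axis 2 1)
     + ramp (4 * x $ 2 + 3) *\<^sub>R ((ramp' (-4 * x $ 2 + 3) * -4) *\<^sub>R axis 2 1)"

lemma C1_grad_plateau: "C1_grad plateau plateau'"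
  unfolding plateau_def[abs_def] plateau'_def[abs_def]
  by (rule C1_grad_mult; rule C1_grad_coord[OF DERIV_ramp continuous_ramp'])

lemma plateau_props:
  "plateau x \<ge> 0"
  "\<bar>x $ 2\<bar> \<le> 1/2 \<Longrightarrow> plateau x = 1" "\<bar>x $ 2\<bar> \<le> 1/2 \<Longrightarrow> plateau' x = 0"
  "\<bar>x $ 2\<bar> \<ge> 3/4 \<Longrightarrow> plateau x = 0" "\<bar>x $ 2\<bar> \<ge> 3/4 \<Longrightarrow> plateau' x = 0"
proof -
  show "plateau x \<ge> 0" unfolding plateau_def by (intro mult_nonneg_nonneg ramp_props)
  show "plateau x = 1" "plateau' x = 0" if "\<bar>x $ 2\<bar> \<le> 1/2"
  proof -
    have "-4 * x $ 2 + 3 \<ge> 1" "4 * x $ 2 + 3 \<ge> 1" using that by linarith+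
    note f = ramp_props(2)[OF this(1)] ramp_props(2)[OF this(2)] ramp'_props(4)[OF this(1)] ramp'_props(4)[OF this(2)]
    show "plateau x = 1" "plateau' x = 0" unfolding plateau_def plateau'_def f by simp_all
  qed
  show "plateau x = 0" "plateau' x = 0" if h: "\<bar>x $ 2\<bar> \<ge> 3/4"
  proof -
    consider "-4 * x $ 2 + 3 \<le> 0" | "4 * x $ 2 + 3 \<le> 0" using h by linarith
    then have "plateau x = 0 \<and> plateau' x = 0"
    proof cases
      case 1
      note f = ramp_props(1)[OF 1] ramp'_props(3)[OF 1]
      show ?thesis unfolding plateau_def plateau'_def f by simp
    next
      case 2
      note f = ramp_props(1)[OF 2] ramp'_props(3)[OF 2]
      show ?thesis unfolding plateau_def plateau'_def f by simp
    qed
    then show "plateau x = 0" "plateau' x = 0" by auto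
  qed
qed

text \<open>With q = |x_2| - \<epsilon>/2, lying outside the nearer inclusion means 1 - s < (1 -
  q)^m \<le> exp (-m q), and exp (m q) \<ge> 1 + m q solves this for q. The leading coefficient 1/m
  is that of the curve 1 - (1 - s)^(1/m) itself, which lets \<lambda> come arbitrarily close to
  m.\<close>

lemma neck_bound:
  assumes m: "m > 2" and x: "x \<in> exterior m \<epsilon>" "\<bar>x $ 1\<bar> < 1" "\<bar>x $ 2\<bar> < 1" and \<epsilon>: "\<epsilon> > 0"
  defines "s \<equiv> \<bar>x $ 1\<bar> powr m"
  shows "\<bar>x $ 2\<bar> \<le> \<epsilon>/2 + s / (m * (1 - s))"
proof (cases "\<bar>x $ 2\<bar> \<le> \<epsilon>/2")
  have s: "0 \<le> s" "s < 1" using x(2) m powr_less_mono2[of m "\<bar>x $ 1\<bar>" 1] by (auto simp: s_def)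
  case True
  moreover have "0 \<le> s / (m * (1 - s))" using s m by (intro divide_nonneg_nonneg) auto
  ultimately show ?thesis by linarith
next
  have s: "0 \<le> s" "s < 1" using x(2) m powr_less_mono2[of m "\<bar>x $ 1\<bar>" 1] by (auto simp: s_def)
  case False
  define q where "q = \<bar>x $ 2\<bar> - \<epsilon>/2"
  have q: "0 < q" "q < 1" using False x(3) \<epsilon> by (auto simp: q_def)
  have "\<bar>x $ 2 - gap_center \<epsilon>\<bar> = 1 - q \<or> \<bar>x $ 2 - - gap_center \<epsilon>\<bar> = 1 - q"
    using x(3) \<epsilon> unfolding q_def gap_center_def by linarith
  then have "1 < s + (1 - q) powr m" using x(1) by (auto simp: exterior_def lev_def s_def)
  also have "(1 - q) powr m = exp (m * ln (1 - q))" using q by (simp add: powr_def)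
  also have "\<dots> \<le> exp (- (m * q))"
    using ln_le_minus_one[of "1 - q"] q m mult_left_mono[of "ln (1 - q)" "- q" m] by simp
  finally have 1: "1 - s < exp (- (m * q))" by simp
  have "(1 - s) * (1 + m * q) \<le> (1 - s) * exp (m * q)"
    using s by (intro mult_left_mono exp_ge_add_one_self) auto
  also have "\<dots> < exp (- (m * q)) * exp (m * q)" using 1 by simp
  finally have "(1 - s) * (1 + m * q) < 1" by (simp add: exp_minus)
  then have "q * (m * (1 - s)) \<le> s" by (simp add: algebra_simps)
  then have "q \<le> s / (m * (1 - s))" using s m by (subst pos_le_divide_eq) auto
  then show ?thesis by (simp add: q_def)
qed

text \<open>For a barrier localised in the neck this empties the trace condition of
  \<open>comparison\<close> on the right half of the circle.\<close>

lemma circ_not_neck: "\<not> (\<bar>circ 5 t $ 1\<bar> \<le> 1/2 \<and> \<bar>circ 5 t $ 2\<bar> \<le> 3/4)"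
proof
  assume h: "\<bar>circ 5 t $ 1\<bar> \<le> 1/2 \<and> \<bar>circ 5 t $ 2\<bar> \<le> 3/4"
  have "norm (circ 5 t) \<le> \<bar>circ 5 t $ 1\<bar> + \<bar>circ 5 t $ 2\<bar>"
    using norm_le_l1_cart[of "circ 5 t"] by (simp only: sum_2)
  then have "5 \<le> \<bar>circ 5 t $ 1\<bar> + \<bar>circ 5 t $ 2\<bar>" unfolding norm_circ by simp
  with h show False by linarith
qed

section \<open>Linear barriers\<close>

context half_solution
begin

lemma Sob_pos_part:
  "Sob p \<Omega> (\<lambda>x. indicator \<Omega> x * (c * max 0 (x $ 1))) (\<lambda>x. if x $ 1 > 0 then indicator \<Omega> x *\<^sub>R (c *\<^sub>R e1) else 0)"
proof -
  have "C1_grad (\<lambda>x::real^2. c * x $ 1) (\<lambda>x. c *\<^sub>R e1)"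
    using C1_grad_coord[where G = "\<lambda>s. s" and G' = "\<lambda>_. 1" and c = c and i = 1 and d = 0] by simp
  from Sob_half[OF \<Omega>_open \<Omega>_bounded sym_iff[THEN iffD2] p Sob_C1[OF \<Omega>_open \<Omega>_bounded p this]]
  have "Sob p \<Omega> (\<lambda>x. if x $ 1 > 0 then indicator \<Omega> x * (c * x $ 1) else 0)
     (\<lambda>x. if x $ 1 > 0 then indicator \<Omega> x *\<^sub>R (c *\<^sub>R e1) else 0)"
    by (simp add: indicator_def sym_iff)
  moreover have "(\<lambda>x. if x $ 1 > 0 then indicator \<Omega> x * (c * x $ 1) else 0) = (\<lambda>x. indicator \<Omega> x * (c * max 0 (x $ 1)))"
    by (auto simp: fun_eq_iff)
  ultimately show ?thesis by simp
qed

text \<open>The field of c x_1 is the constant c^(p - 1) e_1: divergence free, and leaving the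
  inclusions on the right half by \<open>d_mono\<close>. The cut-off admits slopes c > 1, for which
  c x_1 exceeds the boundary values on the circle.\<close>

lemma linear_barrier:
  assumes \<zeta>: "C1_grad \<zeta> \<zeta>'" "\<And>x. \<zeta> x \<ge> 0" and c: "c > 0"
    and circ: "\<And>t. \<zeta> (circ 5 t) > 0 \<Longrightarrow> c * max 0 (circ 5 t $ 1) \<le> max 0 (circ 5 t $ 1)"
    and cut: "AE x in lebesgue. x \<in> \<Omega> \<longrightarrow> x $ 1 > 0 \<longrightarrow> uR x < c * x $ 1 \<longrightarrow> \<zeta>' x = 0"
  shows "AE x in lebesgue. x \<in> \<Omega> \<longrightarrow> \<zeta> x > 0 \<longrightarrow> c * max 0 (x $ 1) \<le> uR x"
proof (rule comparison[OF \<zeta> Sob_pos_part _ circ])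
  show "continuous_on (closure \<Omega>) (\<lambda>x. c * max 0 (x $ 1))" by (intro continuous_intros)
  show "AE x in lebesgue. x \<in> \<Omega> \<longrightarrow> uR x < c * max 0 (x $ 1) \<longrightarrow> \<zeta>' x = 0"
    using cut
  proof eventually_elim
    case (elim x)
    then show ?case using R0(1)[of x] by (cases "x $ 1 > 0") (auto simp: max_def)
  qed
  define K where "K = norm (c *\<^sub>R e1) powr (p - 2) * c"
  show "C1_grad (\<lambda>x::real^2. K) (\<lambda>x. 0)" "C1_grad (\<lambda>x::real^2. 0) (\<lambda>x. 0)" by (rule C1_grad_const)+
  have K: "K \<ge> 0" using c by (simp add: K_def)
  show "pfield p (if x $ 1 > 0 then indicator \<Omega> x *\<^sub>R (c *\<^sub>R e1) else 0) $ 1 = K \<and>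
      pfield p (if x $ 1 > 0 then indicator \<Omega> x *\<^sub>R (c *\<^sub>R e1) else 0) $ 2 = 0" if "x \<in> \<Omega>" "x $ 1 > 0" for x
    using that by (simp add: pfield_def K_def)
  show "K * d1' x $ 1 + 0 * d1' x $ 2 \<ge> 0" "K * d2' x $ 1 + 0 * d2' x $ 2 \<ge> 0" if "x $ 1 > 0" for x
    using d_mono[OF that] K by simp_all
qed (auto simp: mult_nonneg_nonpos)

lemma linear_lower_bound: "AE x in lebesgue. x \<in> \<Omega> \<longrightarrow> max 0 (x $ 1) \<le> uR x"
  using linear_barrier[OF C1_grad_const[of 1], of 1] by simp

end

text \<open>The divergence of $|\nabla S|^{p-2}\nabla S$ for $S = (x_1^2 + \lambda x_2^2)^{\gamma/2}$ is a positive
  factor times \<open>barrier_div p \<gamma> \<lambda> (x\<^sub>2\<^sup>2 / x\<^sub>1\<^sup>2)\<close>.\<close>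

definition barrier_div :: "real \<Rightarrow> real \<Rightarrow> real \<Rightarrow> real \<Rightarrow> real" where
  "barrier_div p \<gamma> l z = (1 + l) + (\<gamma> - 2) * (p - 1) * ((1 + l\<^sup>2 * z) / (1 + l * z))
     + (p - 2) * ((1 + l^3 * z) / (1 + l\<^sup>2 * z))"

text \<open>\<open>l\<close> is \<lambda>, and \<open>r\<close>, later chosen before \<epsilon>,
  bounds the part of the neck in use. The scale \<open>a\<close> is \<epsilon>^(1/m) / r, so that
  \<epsilon> \<le> r^m x_1^m for x_1 \<ge> a. \<open>flat\<close> is the flux condition,
  \<open>div_nonneg\<close> the sign of the divergence for the slopes x_2 / x_1 that occur,
  \<open>slope\<close> makes \<open>quad l\<close> at most 4 x_1^2, and 32 a \<le> r leaves room for
  the layers from a to 2 a, from 8 a to 16 a and from r/2 to r.\<close>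

locale neck = half_solution "exterior m \<epsilon>" "Omega m \<epsilon>" p "lev m (gap_center \<epsilon>)" "lev m (- gap_center \<epsilon>)"
    "lev' m (gap_center \<epsilon>)" "lev' m (- gap_center \<epsilon>)" uR gR vR hR
  for m \<epsilon> p uR gR vR hR +
  fixes \<gamma> l r a :: real
  assumes m: "m > 2" and \<epsilon>: "0 < \<epsilon>" "\<epsilon> \<le> 1/2" "\<epsilon> \<le> r" and \<gamma>: "0 < \<gamma>" and l: "0 < l"
    and r: "0 < r" "r \<le> 1/2" and a: "0 < a" "32 * a \<le> r" "\<epsilon> = (a * r) powr m"
    and flat: "l * (r powr m / 2 + 1 / (m * (1 - r powr m))) * (1 + r) powr (m - 1) \<le> 1"
    and div_nonneg: "\<And>z. 0 \<le> z \<Longrightarrow> z \<le> (r powr (m - 1) / l)\<^sup>2 \<Longrightarrow> barrier_div p \<gamma> l z \<ge> 0"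
    and slope: "l * (r powr (m - 1) / l)\<^sup>2 \<le> 3"
begin

text \<open>From s \<le> (1/2)^2 the curved part of the height is at most (1/4) / (3/2) = 1/6, and
  \<epsilon>/2 is at most 1/4.\<close>

lemma thin:
  assumes "x \<in> Omega m \<epsilon>" "0 < x $ 1" "x $ 1 \<le> 1/2" "\<bar>x $ 2\<bar> < 3/4"
  shows "\<bar>x $ 2\<bar> \<le> 1/2"
proof -
  define s where "s = \<bar>x $ 1\<bar> powr m"
  have "s \<le> (1/2) powr m" unfolding s_def using assms m by (intro powr_mono2) auto
  also have "\<dots> \<le> (1/2) powr 2" using m by (intro powr_mono') auto
  finally have s: "0 \<le> s" "s \<le> 1/4" by (auto simp: s_def power2_eq_square)
  have "2 * (3/4) \<le> m * (1 - s)" using s m by (intro mult_mono) auto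
  then have "s / (m * (1 - s)) \<le> (1/4) / (2 * (3/4))" using s by (intro frac_le) auto
  moreover have "\<bar>x $ 2\<bar> \<le> \<epsilon>/2 + s / (m * (1 - s))"
    using neck_bound[OF m, of x \<epsilon>] assms \<epsilon> by (simp add: Omega_eq[OF m] s_def)
  ultimately show ?thesis using \<epsilon> by simp
qed

text \<open>For x_1 \<ge> a both parts of the height are bounded by multiples of x_1^m: \<epsilon>/2
  by the choice of \<open>a\<close>, the curved part by \<open>neck_bound\<close>.
  \<open>flat\<close> is the condition on the sum of the two coefficients. The second claim bounds
  the slope x_2 / x_1, whose square is the argument of \<open>barrier_div\<close>.\<close>

lemma gap:
  assumes "x \<in> Omega m \<epsilon>" "a \<le> x $ 1" "x $ 1 \<le> r" "\<bar>x $ 2\<bar> < 3/4"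
  shows "l * \<bar>x $ 2\<bar> * (1 + r) powr (m - 1) \<le> x $ 1 powr m"
    and "\<bar>x $ 2\<bar> \<le> r powr (m - 1) / l * x $ 1"
proof -
  define s where "s = x $ 1 powr m"
  have x: "x $ 1 > 0" "x $ 1 < 1" using assms a r by linarith+
  have s: "0 < s" "s \<le> r powr m" "r powr m < 1"
    using assms x m r powr_less_mono2[of m r 1] by (auto simp: s_def intro!: powr_mono2)
  have "\<epsilon> = r powr m * a powr m" unfolding a(3) using a r by (simp add: powr_mult)
  also have "\<dots> \<le> r powr m * s" unfolding s_def using a assms m by (intro mult_left_mono powr_mono2) auto
  finally have e: "\<epsilon> / 2 \<le> s * (r powr m / 2)" by (simp add: mult.commute)
  have "s / (m * (1 - s)) \<le> s / (m * (1 - r powr m))"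
    using s m by (intro divide_left_mono mult_left_mono mult_pos_pos) auto
  moreover have "\<bar>x $ 2\<bar> \<le> \<epsilon>/2 + s / (m * (1 - s))"
    using neck_bound[OF m, of x \<epsilon>] assms x \<epsilon> by (simp add: Omega_eq[OF m] s_def)
  ultimately have "\<bar>x $ 2\<bar> \<le> s * (r powr m / 2 + 1 / (m * (1 - r powr m)))" using e by (simp add: distrib_left)
  then have "l * \<bar>x $ 2\<bar> * (1 + r) powr (m - 1)
      \<le> l * (s * (r powr m / 2 + 1 / (m * (1 - r powr m)))) * (1 + r) powr (m - 1)"
    using l by (intro mult_right_mono mult_left_mono) auto
  also have "\<dots> = s * (l * (r powr m / 2 + 1 / (m * (1 - r powr m))) * (1 + r) powr (m - 1))" by (simp only: mult_ac)
  also have "\<dots> \<le> s" using mult_left_mono[OF flat, of s] s by simp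
  finally show g: "l * \<bar>x $ 2\<bar> * (1 + r) powr (m - 1) \<le> x $ 1 powr m" by (simp add: s_def)
  have "l * \<bar>x $ 2\<bar> * 1 \<le> l * \<bar>x $ 2\<bar> * (1 + r) powr (m - 1)"
    using l r m by (intro mult_left_mono ge_one_powr_ge_zero) auto
  also note g
  also have "x $ 1 powr m = x $ 1 powr (m - 1) * x $ 1" using x by (simp add: powr_diff)
  also have "\<dots> \<le> r powr (m - 1) * x $ 1" using x assms m by (intro mult_right_mono powr_mono2) auto
  finally show "\<bar>x $ 2\<bar> \<le> r powr (m - 1) / l * x $ 1" using l by (simp add: field_simps)
qed

text \<open>The modification for \<open>t < a\<close>, outside the support of the cutoff, keeps \<open>mu\<close> positive, so that the
  powers below are $C^1$ on the whole plane.\<close>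

definition mu :: "real \<Rightarrow> real" where "mu t = t\<^sup>2 + 2 * (max 0 (a - t))\<^sup>2"

definition quad :: "real \<Rightarrow> real^2 \<Rightarrow> real" where "quad k x = mu (x $ 1) + k * (x $ 2)\<^sup>2"

definition quad' :: "real \<Rightarrow> real^2 \<Rightarrow> real^2" where
  "quad' k x = (2 * x $ 1 - 4 * max 0 (a - x $ 1)) *\<^sub>R axis 1 1 + (2 * k * x $ 2) *\<^sub>R axis 2 1"

lemma C1_grad_quad: "C1_grad (quad k) (quad' k)"
proof -
  have "((\<lambda>t. (max 0 (a - t))\<^sup>2) has_real_derivative 2 * max 0 (a - t) * -1) (at t)" for t
    by (rule DERIV_chain2[where f = "\<lambda>s. (max 0 s)\<^sup>2" and g = "\<lambda>t. a - t", OF DERIV_pos_part_square])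
       (auto intro!: derivative_eq_intros)
  from DERIV_add[OF DERIV_power[OF DERIV_ident, where n = 2] DERIV_cmult[OF this, of 2]]
  have "(mu has_real_derivative (2 * t - 4 * max 0 (a - t))) (at t)" for t
    unfolding mu_def[abs_def] by (simp add: mult_ac)
  from C1_grad_coord[of mu, OF this, where c = 1 and d = 0 and i = 1]
  have 1: "C1_grad (\<lambda>x::real^2. mu (x $ 1)) (\<lambda>x. (2 * x $ 1 - 4 * max 0 (a - x $ 1)) *\<^sub>R axis 1 1)"
    by (simp add: continuous_intros)
  have "((\<lambda>t. k * t\<^sup>2) has_real_derivative 2 * k * t) (at t)" for t
    by (auto intro!: derivative_eq_intros)
  from C1_grad_coord[of "\<lambda>t. k * t\<^sup>2", OF this, where c = 1 and d = 0 and i = 2]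
  have 2: "C1_grad (\<lambda>x::real^2. k * (x $ 2)\<^sup>2) (\<lambda>x. (2 * k * x $ 2) *\<^sub>R axis 2 1)"
    by (simp add: continuous_intros)
  show ?thesis unfolding quad_def[abs_def] quad'_def[abs_def] by (rule C1_grad_add[OF 1 2])
qed

lemma quad_pos: "k \<ge> 0 \<Longrightarrow> quad k x > 0"
proof -
  assume k: "k \<ge> 0"
  have "mu (x $ 1) > 0"
  proof (cases "x $ 1 \<ge> a")
    case True
    then show ?thesis using a by (simp add: mu_def add_pos_nonneg)
  next
    case False
    then show ?thesis by (simp add: mu_def add_nonneg_pos)
  qed
  then show ?thesis using k by (simp add: quad_def add_pos_nonneg)
qed

lemma quad_eq: "x $ 1 \<ge> a \<Longrightarrow> quad k x = (x $ 1)\<^sup>2 + k * (x $ 2)\<^sup>2"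
  by (simp add: quad_def mu_def max_def)

lemma quad'_eq: "x $ 1 \<ge> a \<Longrightarrow> quad' k x = (2 * x $ 1) *\<^sub>R axis 1 1 + (2 * k * x $ 2) *\<^sub>R axis 2 1"
  by (simp add: quad'_def max_def)

lemma quad_le:
  assumes "x \<in> Omega m \<epsilon>" "a \<le> x $ 1" "x $ 1 \<le> r" "\<bar>x $ 2\<bar> < 3/4"
  shows "quad l x \<le> (2 * x $ 1)\<^sup>2"
proof -
  have "\<bar>x $ 2\<bar>\<^sup>2 \<le> (r powr (m - 1) / l * x $ 1)\<^sup>2" by (rule power_mono[OF gap(2)[OF assms]]) simp
  then have "l * (x $ 2)\<^sup>2 \<le> l * (r powr (m - 1) / l * x $ 1)\<^sup>2" using l by simp
  also have "\<dots> = l * (r powr (m - 1) / l)\<^sup>2 * (x $ 1)\<^sup>2" by (simp only: power_mult_distrib mult_ac)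
  also have "\<dots> \<le> 3 * (x $ 1)\<^sup>2" by (rule mult_right_mono[OF slope]) simp
  finally show ?thesis by (simp add: quad_eq[OF assms(2)] power2_eq_square)
qed

text \<open>Normalises the barrier so that in the neck up to x_1 = r it is at most c0 (2 r)^\<gamma>
  = r/2, hence below x_1 \<le> u in the outer layer r/2 < x_1 < r.\<close>

definition c0 :: real where "c0 = (r/2) / (2 * r) powr \<gamma>"

lemma c0_pos: "c0 > 0" using r by (simp add: c0_def)

text \<open>In the neck \<open>quad l x\<close> is at most (2 x_1)^2, so subtracting (4 a)^\<gamma>
  makes the barrier nonpositive for a \<le> x_1 \<le> 2 a, the inner layer of the cut-off.\<close>

definition barrier :: "real^2 \<Rightarrow> real" where
  "barrier x = c0 * (quad l x powr (\<gamma>/2) - (4 * a) powr \<gamma>)"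

definition barrier' :: "real^2 \<Rightarrow> real^2" where
  "barrier' x = (c0 * (\<gamma>/2 * quad l x powr (\<gamma>/2 - 1))) *\<^sub>R quad' l x"

lemma C1_grad_barrier: "C1_grad barrier barrier'"
proof -
  have q: "quad l x > 0" for x using quad_pos l by simp
  have "C1_grad (\<lambda>x. c0 * (quad l x powr (\<gamma>/2) + (- ((4 * a) powr \<gamma>))))
      (\<lambda>x. c0 *\<^sub>R ((\<gamma>/2 * quad l x powr (\<gamma>/2 - 1)) *\<^sub>R quad' l x + 0) + (quad l x powr (\<gamma>/2) + (- ((4 * a) powr \<gamma>))) *\<^sub>R 0)"
    by (intro C1_grad_mult C1_grad_const C1_grad_add C1_grad_powr C1_grad_quad q)
  then show ?thesis unfolding barrier_def[abs_def] barrier'_def[abs_def] by simp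
qed

definition cutR :: "real^2 \<Rightarrow> real" where
  "cutR x = (ramp (1/a * x $ 1 + -1) * ramp (-2/r * x $ 1 + 2)) * plateau x"

definition cutR' :: "real^2 \<Rightarrow> real^2" where
  "cutR' x = (ramp (1/a * x $ 1 + -1) * ramp (-2/r * x $ 1 + 2)) *\<^sub>R plateau' x
     + plateau x *\<^sub>R (ramp (1/a * x $ 1 + -1) *\<^sub>R ((ramp' (-2/r * x $ 1 + 2) * (-2/r)) *\<^sub>R axis 1 1)
        + ramp (-2/r * x $ 1 + 2) *\<^sub>R ((ramp' (1/a * x $ 1 + -1) * (1/a)) *\<^sub>R axis 1 1))"

lemma C1_grad_cutR: "C1_grad cutR cutR'"
  unfolding cutR_def[abs_def] cutR'_def[abs_def]
  by (intro C1_grad_mult C1_grad_plateau; rule C1_grad_coord[OF DERIV_ramp continuous_ramp'])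

lemma cutR_props:
  "cutR x \<ge> 0"
  "x $ 1 \<le> a \<Longrightarrow> cutR x = 0 \<and> cutR' x = 0" "x $ 1 \<ge> r \<Longrightarrow> cutR x = 0 \<and> cutR' x = 0"
  "\<bar>x $ 2\<bar> \<ge> 3/4 \<Longrightarrow> cutR x = 0 \<and> cutR' x = 0"
  "2 * a \<le> x $ 1 \<Longrightarrow> x $ 1 \<le> r/2 \<Longrightarrow> \<bar>x $ 2\<bar> \<le> 1/2 \<Longrightarrow> cutR x = 1 \<and> cutR' x = 0"
proof -
  show "cutR x \<ge> 0" unfolding cutR_def by (intro mult_nonneg_nonneg ramp_props plateau_props)
  show "cutR x = 0 \<and> cutR' x = 0" if "x $ 1 \<le> a"
  proof -
    have "1/a * x $ 1 + -1 \<le> 0" using that a by (simp add: field_simps)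
    note f = ramp_props(1)[OF this] ramp'_props(3)[OF this]
    show ?thesis unfolding cutR_def cutR'_def f by simp
  qed
  show "cutR x = 0 \<and> cutR' x = 0" if "x $ 1 \<ge> r"
  proof -
    have "-2/r * x $ 1 + 2 \<le> 0" using that r by (simp add: field_simps)
    note f = ramp_props(1)[OF this] ramp'_props(3)[OF this]
    show ?thesis unfolding cutR_def cutR'_def f by simp
  qed
  show "cutR x = 0 \<and> cutR' x = 0" if "\<bar>x $ 2\<bar> \<ge> 3/4"
    unfolding cutR_def cutR'_def plateau_props(4,5)[OF that] by simp
  show "cutR x = 1 \<and> cutR' x = 0" if "2 * a \<le> x $ 1" "x $ 1 \<le> r/2" "\<bar>x $ 2\<bar> \<le> 1/2"
  proof -
    have "1/a * x $ 1 + -1 \<ge> 1" "-2/r * x $ 1 + 2 \<ge> 1" using that a r by (simp_all add: field_simps)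
    note f = ramp_props(2)[OF this(1)] ramp'_props(4)[OF this(1)] ramp_props(2)[OF this(2)] ramp'_props(4)[OF this(2)]
    show ?thesis unfolding cutR_def cutR'_def f plateau_props(2,3)[OF that(3)] by simp
  qed
qed

lemma barrier_div_eq:
  fixes X Y :: real
  assumes X: "X > 0"
  shows "barrier_div p \<gamma> l (Y\<^sup>2 / X\<^sup>2) = (1 + l) + (\<gamma> - 2) * (p - 1) * ((X\<^sup>2 + l\<^sup>2 * Y\<^sup>2) / (X\<^sup>2 + l * Y\<^sup>2))
     + (p - 2) * ((X\<^sup>2 + l^3 * Y\<^sup>2) / (X\<^sup>2 + l\<^sup>2 * Y\<^sup>2))"
proof -
  have "(1 + k * (Y\<^sup>2 / X\<^sup>2)) = (X\<^sup>2 + k * Y\<^sup>2) / X\<^sup>2" for k using X by (simp add: field_simps)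
  then show ?thesis unfolding barrier_div_def using X by simp
qed

definition K0 :: real where "K0 = (c0 * \<gamma>) powr (p - 1)"

text \<open>For x_1 > a the gradient of the barrier is c0 \<gamma> P^(\<gamma>/2 - 1) (x_1, l x_2)
  with P = \<open>quad l x\<close>, and the vector (x_1, l x_2) has squared length
  \<open>quad (l\<^sup>2) x\<close>. So K0 times this weight times (x_1, l x_2) is its p-Laplace
  flux. Positivity of both quadratics makes it C^1 on the whole plane, as \<open>comparison\<close>
  demands of \<tau>1 and \<tau>2.\<close>

definition weight :: "real^2 \<Rightarrow> real" where
  "weight x = quad l x powr ((\<gamma>/2 - 1) * (p - 1)) * quad (l\<^sup>2) x powr ((p - 2)/2)"

definition weight' :: "real^2 \<Rightarrow> real^2" where
  "weight' x = quad l x powr ((\<gamma>/2 - 1) * (p - 1)) *\<^sub>R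
       (((p - 2)/2 * quad (l\<^sup>2) x powr ((p - 2)/2 - 1)) *\<^sub>R quad' (l\<^sup>2) x)
     + quad (l\<^sup>2) x powr ((p - 2)/2) *\<^sub>R
       (((\<gamma>/2 - 1) * (p - 1) * quad l x powr ((\<gamma>/2 - 1) * (p - 1) - 1)) *\<^sub>R quad' l x)"

lemma C1_grad_flux:
  "C1_grad (\<lambda>x. weight x * (k * x $ i)) (\<lambda>x. weight x *\<^sub>R (k *\<^sub>R axis i 1) + (k * x $ i) *\<^sub>R weight' x)"
proof -
  have q: "quad l x > 0" "quad (l\<^sup>2) x > 0" for x using quad_pos l by simp_all
  have "C1_grad weight weight'"
    unfolding weight_def[abs_def] weight'_def[abs_def]
    by (intro C1_grad_mult C1_grad_powr C1_grad_quad q)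
  moreover have "C1_grad (\<lambda>x::real^2. k * x $ i) (\<lambda>x. k *\<^sub>R axis i 1)"
    using C1_grad_coord[where G = "\<lambda>s. s" and G' = "\<lambda>_. 1" and c = k and i = i and d = 0] by simp
  ultimately show ?thesis by (rule C1_grad_mult)
qed

lemma pfield_barrier:
  assumes x: "x $ 1 > a"
  shows "pfield p (barrier' x) $ 1 = weight x * (K0 * x $ 1)"
    and "pfield p (barrier' x) $ 2 = weight x * (K0 * l * x $ 2)"
proof -
  define P Q where "P = quad l x" and "Q = quad (l\<^sup>2) x"
  have PQ: "P > 0" "Q > 0" using quad_pos l by (simp_all add: P_def Q_def)
  define k where "k = c0 * \<gamma> * P powr (\<gamma>/2 - 1)"
  have k: "k > 0" using c0_pos \<gamma> PQ by (simp add: k_def)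
  have b: "barrier' x $ 1 = k * x $ 1" "barrier' x $ 2 = k * (l * x $ 2)"
    using x by (simp_all add: barrier'_def quad'_eq k_def P_def)
  have "(norm (barrier' x))\<^sup>2 = k\<^sup>2 * Q"
    using x by (simp add: norm_real2 b Q_def quad_eq power_mult_distrib algebra_simps)
  then have "norm (barrier' x) = sqrt (k\<^sup>2 * Q)" by (metis norm_ge_zero real_sqrt_unique)
  also have "\<dots> = k * Q powr (1/2)" using k PQ by (simp add: real_sqrt_mult powr_half_sqrt)
  finally have n: "norm (barrier' x) powr (p - 2) = k powr (p - 2) * Q powr ((p - 2)/2)"
    using k by (simp add: powr_mult powr_powr)
  have "k powr (p - 2) * k = k powr (p - 1)" using k by (simp add: powr_diff power2_eq_square)
  also have "\<dots> = K0 * P powr ((\<gamma>/2 - 1) * (p - 1))"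
    using c0_pos \<gamma> by (simp add: k_def K0_def powr_mult powr_powr)
  finally have kk: "k powr (p - 2) * k = K0 * P powr ((\<gamma>/2 - 1) * (p - 1))" .
  have w: "weight x * K0 = norm (barrier' x) powr (p - 2) * k"
    unfolding n weight_def P_def[symmetric] Q_def[symmetric] using kk by (simp add: mult_ac)
  show "pfield p (barrier' x) $ 1 = weight x * (K0 * x $ 1)"
    "pfield p (barrier' x) $ 2 = weight x * (K0 * l * x $ 2)"
    unfolding pfield_def using w by (simp_all add: b mult.assoc[symmetric])
qed

text \<open>The left side is the divergence of the weight times (x_1, l x_2); each power in the
  weight contributes its logarithmic derivative along (x_1, l x_2), which gives the two quotients in
  \<open>barrier_div\<close>.\<close>

lemma weight_div:
  assumes x: "x $ 1 > a"
  shows "x $ 1 * weight' x $ 1 + l * x $ 2 * weight' x $ 2 + (1 + l) * weight x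
    = weight x * barrier_div p \<gamma> l ((x $ 2)\<^sup>2 / (x $ 1)\<^sup>2)"
proof -
  define P Q where "P = quad l x" and "Q = quad (l\<^sup>2) x"
  have PQ: "P > 0" "Q > 0" using quad_pos l by (simp_all add: P_def Q_def)
  define A B where "A = P powr ((\<gamma>/2 - 1) * (p - 1))" and "B = Q powr ((p - 2)/2)"
  have AB: "P powr ((\<gamma>/2 - 1) * (p - 1) - 1) = A / P" "Q powr ((p - 2)/2 - 1) = B / Q"
    using PQ by (simp_all add: A_def B_def powr_diff)
  define X Y where "X = x $ 1" and "Y = x $ 2"
  have X: "X > 0" using x a by (simp add: X_def)
  have q: "P = X\<^sup>2 + l * Y\<^sup>2" "Q = X\<^sup>2 + l\<^sup>2 * Y\<^sup>2"
    using x by (simp_all add: P_def Q_def quad_eq X_def Y_def)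
  have w': "weight' x $ 1 = A * ((p - 2)/2 * (B / Q) * (2 * X)) + B * ((\<gamma>/2 - 1) * (p - 1) * (A / P) * (2 * X))"
    "weight' x $ 2 = A * ((p - 2)/2 * (B / Q) * (2 * l\<^sup>2 * Y)) + B * ((\<gamma>/2 - 1) * (p - 1) * (A / P) * (2 * l * Y))"
    using x unfolding weight'_def P_def[symmetric] Q_def[symmetric] A_def[symmetric] B_def[symmetric] AB X_def Y_def
    by (simp_all add: quad'_eq)
  have w: "weight x = A * B" by (simp add: weight_def A_def B_def P_def Q_def)
  have "X * weight' x $ 1 + l * Y * weight' x $ 2
     = A * B * ((p - 2) * ((X\<^sup>2 + l^3 * Y\<^sup>2) / Q) + (\<gamma> - 2) * (p - 1) * ((X\<^sup>2 + l\<^sup>2 * Y\<^sup>2) / P))"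
    unfolding w' using PQ by (simp add: field_simps power2_eq_square power3_eq_cube)
  then have "X * weight' x $ 1 + l * Y * weight' x $ 2 + (1 + l) * weight x
     = weight x * barrier_div p \<gamma> l (Y\<^sup>2 / X\<^sup>2)"
    unfolding barrier_div_eq[OF X] q[symmetric] w by (simp add: algebra_simps)
  then show ?thesis by (simp only: X_def Y_def)
qed

end

section \<open>Comparison with the barriers in the neck\<close>

lemma square_powr_half: "z > 0 \<Longrightarrow> (z\<^sup>2) powr (\<gamma>/2) = z powr (\<gamma>::real)"
proof -
  assume "z > 0"
  then have "z\<^sup>2 = z powr 2" by simp
  then show ?thesis by (simp only: powr_powr) simp
qed

context neck
begin

lemma lev'_nth: "lev' m c x $ 1 = m * \<bar>x $ 1\<bar> powr (m - 2) * x $ 1"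
  "lev' m c x $ 2 = m * \<bar>x $ 2 - c\<bar> powr (m - 2) * (x $ 2 - c)"
  by (simp_all add: lev'_def)

text \<open>The first term is m x_1^m. The second is negative only if x_2 lies strictly between 0
  and c; then |x_2 - c| \<le> 1 + \<epsilon>/2 \<le> 1 + r, and its size is at most m l |x_2| (1 +
  r)^(m - 1) \<le> m x_1^m by \<open>gap\<close>.\<close>

lemma barrier_boundary:
  assumes x: "x \<in> Omega m \<epsilon>" "a \<le> x $ 1" "x $ 1 \<le> r" "\<bar>x $ 2\<bar> < 3/4"
    and c: "c = gap_center \<epsilon> \<or> c = - gap_center \<epsilon>"
  shows "x $ 1 * lev' m c x $ 1 + l * x $ 2 * lev' m c x $ 2 \<ge> 0"
proof -
  define s where "s = x $ 1 powr m"
  define y where "y = \<bar>x $ 2 - c\<bar>"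
  have x1: "x $ 1 > 0" using x a by linarith
  have "x $ 1 * (\<bar>x $ 1\<bar> powr (m - 2) * x $ 1) = s"
    using x1 by (simp add: s_def powr_diff power2_eq_square)
  then have e: "x $ 1 * lev' m c x $ 1 + l * x $ 2 * lev' m c x $ 2
      = m * (s + l * y powr (m - 2) * (x $ 2 * (x $ 2 - c)))"
    unfolding lev'_nth y_def by (simp add: algebra_simps)
  have "- s \<le> l * y powr (m - 2) * (x $ 2 * (x $ 2 - c))"
  proof (cases "x $ 2 * (x $ 2 - c) \<ge> 0")
    case True
    then have "l * y powr (m - 2) * (x $ 2 * (x $ 2 - c)) \<ge> 0" using l by simp
    moreover have "s \<ge> 0" by (simp add: s_def)
    ultimately show ?thesis by linarith
  next
    case False
    then have neg: "x $ 2 > 0 \<and> x $ 2 < c \<or> x $ 2 < 0 \<and> c < x $ 2" by (auto simp: zero_le_mult_iff not_le)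
    then have yy: "y = gap_center \<epsilon> - \<bar>x $ 2\<bar>" using c \<epsilon> unfolding y_def gap_center_def by auto
    then have y: "0 < y" "y \<le> 1 + r" using x \<epsilon> unfolding gap_center_def by linarith+
    have "x $ 2 * (x $ 2 - c) = - (\<bar>x $ 2\<bar> * y)" using neg unfolding y_def by (auto simp: abs_if algebra_simps)
    then have "l * y powr (m - 2) * (x $ 2 * (x $ 2 - c)) = - (l * \<bar>x $ 2\<bar> * (y powr (m - 2) * y))" by simp
    moreover have "y powr (m - 2) * y = y powr (m - 1)" using y by (simp add: powr_diff power2_eq_square)
    moreover have "l * \<bar>x $ 2\<bar> * y powr (m - 1) \<le> l * \<bar>x $ 2\<bar> * (1 + r) powr (m - 1)"
      using y l m by (intro mult_left_mono powr_mono2) auto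
    moreover note gap(1)[OF x]
    ultimately show ?thesis by (simp add: s_def)
  qed
  then have "s + l * y powr (m - 2) * (x $ 2 * (x $ 2 - c)) \<ge> 0" by linarith
  then show ?thesis unfolding e using m by (intro mult_nonneg_nonneg) auto
qed

text \<open>Inside \<Omega> the gradient of \<open>cutR\<close> lives in the layers a < x_1 < 2 a
  and r/2 < x_1 < r. In the first the barrier is at most 0, in the second at most r/2, in both cases
  below x_1 and so below u by \<open>linear_lower_bound\<close>; this verifies
  \<open>cut\<close>.\<close>

lemma radial_barrier:
  "AE x in lebesgue. x \<in> Omega m \<epsilon> \<longrightarrow> cutR x > 0 \<longrightarrow> barrier x \<le> uR x"
proof (rule comparison[OF C1_grad_cutR cutR_props(1) Sob_C1[OF \<Omega>_open \<Omega>_bounded p C1_grad_barrier]])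
  have in_neck: "a < x $ 1 \<and> x $ 1 < r \<and> \<bar>x $ 2\<bar> < 3/4" if "cutR x \<noteq> 0 \<or> cutR' x \<noteq> 0" for x
    using cutR_props(2-4)[of x] that by (meson not_le)
  have K0: "K0 \<ge> 0" by (simp add: K0_def)
  have w: "weight x \<ge> 0" for x by (simp add: weight_def)
  show "continuous_on (closure (Omega m \<epsilon>)) barrier"
    using C1_grad_imp_continuous[OF C1_grad_barrier] by (rule continuous_on_subset) simp
  show "barrier (circ 5 t) \<le> max 0 (circ 5 t $ 1)" if "cutR (circ 5 t) > 0" for t
  proof -
    have "a < circ 5 t $ 1 \<and> circ 5 t $ 1 < r \<and> \<bar>circ 5 t $ 2\<bar> < 3/4" 
      using in_neck[of "circ 5 t"] that by (simp del: circ_nth)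
    then have "\<bar>circ 5 t $ 1\<bar> \<le> 1/2 \<and> \<bar>circ 5 t $ 2\<bar> \<le> 3/4" using a r by linarith
    then show ?thesis using circ_not_neck by blast
  qed
  show "barrier x \<le> 0 \<or> cutR x = 0 \<and> cutR' x = 0" if "x $ 1 \<le> 0" for x
    using cutR_props(2)[of x] that a by simp
  show "AE x in lebesgue. x \<in> Omega m \<epsilon> \<longrightarrow> uR x < barrier x \<longrightarrow> cutR' x = 0"
    using linear_lower_bound
  proof eventually_elim
    case (elim x)
    show ?case
    proof (intro impI, rule ccontr)
      assume x: "x \<in> Omega m \<epsilon>" "uR x < barrier x" and n: "cutR' x \<noteq> 0"
      have nk: "a < x $ 1" "x $ 1 < r" "\<bar>x $ 2\<bar> < 3/4" using in_neck[of x] n by auto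
      have x1: "x $ 1 > 0" "x $ 1 \<le> 1/2" using nk a r by linarith+
      have t: "\<bar>x $ 2\<bar> \<le> 1/2" by (rule thin[OF x(1) x1 nk(3)])
      have out: "x $ 1 < 2 * a \<or> r/2 < x $ 1" using cutR_props(5)[of x] n t by (meson not_le)
      have "quad l x powr (\<gamma>/2) \<le> ((2 * x $ 1)\<^sup>2) powr (\<gamma>/2)"
        using quad_le[OF x(1)] nk \<gamma> quad_pos[of l x] l by (intro powr_mono2) auto
      also have "\<dots> = (2 * x $ 1) powr \<gamma>" using x1 by (intro square_powr_half) simp
      finally have b: "barrier x \<le> c0 * ((2 * x $ 1) powr \<gamma> - (4 * a) powr \<gamma>)"
        unfolding barrier_def using c0_pos by (intro mult_left_mono) auto
      have u: "x $ 1 \<le> uR x" using elim x(1) by simp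
      from out show False
      proof
        assume "x $ 1 < 2 * a"
        then have "(2 * x $ 1) powr \<gamma> \<le> (4 * a) powr \<gamma>" using x1 \<gamma> by (intro powr_mono2) auto
        then have "c0 * ((2 * x $ 1) powr \<gamma> - (4 * a) powr \<gamma>) \<le> 0" using c0_pos by (intro mult_nonneg_nonpos) auto
        then show False using b u x x1 by linarith
      next
        assume h: "r/2 < x $ 1"
        have "c0 * ((2 * x $ 1) powr \<gamma> - (4 * a) powr \<gamma>) \<le> c0 * (2 * r) powr \<gamma>"
          using c0_pos x1 nk \<gamma> powr_mono2[of \<gamma> "2 * x $ 1" "2 * r"] powr_ge_zero[of "4 * a" \<gamma>]
          by (intro mult_left_mono) linarith+
        also have "\<dots> = r/2" using r by (simp add: c0_def)
        finally show False using b u x h by linarith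
      qed
    qed
  qed
  show "C1_grad (\<lambda>x. weight x * (K0 * x $ 1)) (\<lambda>x. weight x *\<^sub>R (K0 *\<^sub>R axis 1 1) + (K0 * x $ 1) *\<^sub>R weight' x)"
    "C1_grad (\<lambda>x. weight x * (K0 * l * x $ 2)) (\<lambda>x. weight x *\<^sub>R ((K0 * l) *\<^sub>R axis 2 1) + (K0 * l * x $ 2) *\<^sub>R weight' x)"
    by (rule C1_grad_flux)+
  fix x assume x: "x \<in> Omega m \<epsilon>" "0 < cutR x"
  have nk: "a < x $ 1" "x $ 1 < r" "\<bar>x $ 2\<bar> < 3/4" using in_neck[of x] x by auto
  show "pfield p (indicator (Omega m \<epsilon>) x *\<^sub>R barrier' x) $ 1 = weight x * (K0 * x $ 1) \<and>
      pfield p (indicator (Omega m \<epsilon>) x *\<^sub>R barrier' x) $ 2 = weight x * (K0 * l * x $ 2)"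
    using x pfield_barrier[OF nk(1)] by simp
  show "(weight x *\<^sub>R (K0 *\<^sub>R axis 1 1) + (K0 * x $ 1) *\<^sub>R weight' x) $ 1 +
      (weight x *\<^sub>R ((K0 * l) *\<^sub>R axis 2 1) + (K0 * l * x $ 2) *\<^sub>R weight' x) $ 2 \<ge> 0"
  proof -
    have x1: "x $ 1 > 0" using nk a by simp
    have "\<bar>x $ 2\<bar>\<^sup>2 \<le> (r powr (m - 1) / l * x $ 1)\<^sup>2" using gap(2)[OF x(1)] nk by (intro power_mono) auto
    then have "(x $ 2)\<^sup>2 / (x $ 1)\<^sup>2 \<le> (r powr (m - 1) / l)\<^sup>2"
      using x1 by (simp add: pos_divide_le_eq power_mult_distrib power_divide)
    then have "weight x * barrier_div p \<gamma> l ((x $ 2)\<^sup>2 / (x $ 1)\<^sup>2) \<ge> 0"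
      using div_nonneg w by simp
    then have "K0 * (x $ 1 * weight' x $ 1 + l * x $ 2 * weight' x $ 2 + (1 + l) * weight x) \<ge> 0"
      unfolding weight_div[OF nk(1)] using K0 by simp
    then show ?thesis by (simp add: algebra_simps)
  qed
  have "weight x * (K0 * x $ 1) * lev' m c x $ 1 + weight x * (K0 * l * x $ 2) * lev' m c x $ 2
     = weight x * K0 * (x $ 1 * lev' m c x $ 1 + l * x $ 2 * lev' m c x $ 2)" for c
    by (simp only: algebra_simps)
  then show "weight x * (K0 * x $ 1) * lev' m (gap_center \<epsilon>) x $ 1 + weight x * (K0 * l * x $ 2) * lev' m (gap_center \<epsilon>) x $ 2 \<ge> 0"
    "weight x * (K0 * x $ 1) * lev' m (- gap_center \<epsilon>) x $ 1 + weight x * (K0 * l * x $ 2) * lev' m (- gap_center \<epsilon>) x $ 2 \<ge> 0"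
    using barrier_boundary[OF x(1)] nk w K0 by simp_all
qed

text \<open>For x_1 \<ge> 8 a the barrier is at least c0 ((8 a)^\<gamma> - (4 a)^\<gamma>); dividing
  by 16 a, where \<open>cutL\<close> ends, gives a line through the origin that stays below the
  barrier on 8 a < x_1 < 16 a. The slope is a constant times a^(\<gamma> - 1).\<close>

definition slope_bound :: real where "slope_bound = c0 * ((8 * a) powr \<gamma> - (4 * a) powr \<gamma>) / (16 * a)"

lemma slope_bound_pos: "slope_bound > 0"
  using c0_pos a \<gamma> powr_less_mono2[of \<gamma> "4 * a" "8 * a"] by (simp add: slope_bound_def)

definition cutL :: "real^2 \<Rightarrow> real" where "cutL x = ramp (-1/(8*a) * x $ 1 + 2) * plateau x"

definition cutL' :: "real^2 \<Rightarrow> real^2" where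
  "cutL' x = ramp (-1/(8*a) * x $ 1 + 2) *\<^sub>R plateau' x
     + plateau x *\<^sub>R ((ramp' (-1/(8*a) * x $ 1 + 2) * (-1/(8*a))) *\<^sub>R axis 1 1)"

text \<open>On the right half of \<Omega> the gradient of \<open>cutL\<close> lives in 8 a < x_1 <
  16 a, a layer where \<open>cutR\<close> is 1 because 16 a \<le> r/2; there
  \<open>radial_barrier\<close> puts u above the line. The cut-off does not stop at the axis, where
  both u and the linear barrier vanish.\<close>

lemma neck_lower_bound:
  "AE x in lebesgue. x \<in> Omega m \<epsilon> \<longrightarrow> 0 < x $ 1 \<longrightarrow> x $ 1 \<le> 8 * a \<longrightarrow> \<bar>x $ 2\<bar> \<le> 1/2 \<longrightarrow> slope_bound * x $ 1 \<le> uR x"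
proof -
  have C: "C1_grad cutL cutL'"
    unfolding cutL_def[abs_def] cutL'_def[abs_def]
    by (intro C1_grad_mult C1_grad_plateau; rule C1_grad_coord[OF DERIV_ramp continuous_ramp'])
  have nn: "cutL x \<ge> 0" for x unfolding cutL_def by (intro mult_nonneg_nonneg ramp_props plateau_props)
  have z1: "cutL x = 0 \<and> cutL' x = 0" if "x $ 1 \<ge> 16 * a" for x
  proof -
    have "-1/(8*a) * x $ 1 + 2 \<le> 0" using that a by (simp add: field_simps)
    note f = ramp_props(1)[OF this] ramp'_props(3)[OF this]
    show ?thesis unfolding cutL_def cutL'_def f by simp
  qed
  have z2: "cutL x = 0 \<and> cutL' x = 0" if "\<bar>x $ 2\<bar> \<ge> 3/4" for x
    unfolding cutL_def cutL'_def plateau_props(4,5)[OF that] by simp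
  have z3: "cutL x = 1 \<and> cutL' x = 0" if "x $ 1 \<le> 8 * a" "\<bar>x $ 2\<bar> \<le> 1/2" for x
  proof -
    have "-1/(8*a) * x $ 1 + 2 \<ge> 1" using that a by (simp add: field_simps)
    note f = ramp_props(2)[OF this] ramp'_props(4)[OF this]
    show ?thesis unfolding cutL_def cutL'_def f plateau_props(2,3)[OF that(2)] by simp
  qed
  have "AE x in lebesgue. x \<in> Omega m \<epsilon> \<longrightarrow> cutL x > 0 \<longrightarrow> slope_bound * max 0 (x $ 1) \<le> uR x"
  proof (rule linear_barrier[OF C nn slope_bound_pos])
    fix t assume t: "cutL (circ 5 t) > 0"
    have "circ 5 t $ 1 < 16 * a" "\<bar>circ 5 t $ 2\<bar> < 3/4" 
      using z1[of "circ 5 t"] z2[of "circ 5 t"] t by (auto simp: not_le[symmetric] simp del: circ_nth)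
    then have "circ 5 t $ 1 \<le> 0" using circ_not_neck[of t] a r by linarith
    then show "slope_bound * max 0 (circ 5 t $ 1) \<le> max 0 (circ 5 t $ 1)" by (simp only: max_absorb1 mult_zero_right order_refl)
  next
    show "AE x in lebesgue. x \<in> Omega m \<epsilon> \<longrightarrow> x $ 1 > 0 \<longrightarrow> uR x < slope_bound * x $ 1 \<longrightarrow> cutL' x = 0"
      using radial_barrier
    proof eventually_elim
      case (elim x)
      show ?case
      proof (intro impI, rule ccontr)
        assume x: "x \<in> Omega m \<epsilon>" "x $ 1 > 0" "uR x < slope_bound * x $ 1" and n: "cutL' x \<noteq> 0"
        have nk: "x $ 1 < 16 * a" "\<bar>x $ 2\<bar> < 3/4" using z1[of x] z2[of x] n by (meson not_le)+
        have t: "\<bar>x $ 2\<bar> \<le> 1/2" using thin[OF x(1,2) _ nk(2)] nk a r by linarith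
        have h: "8 * a < x $ 1" using z3[of x] n t by (meson not_le)
        have "cutR x = 1" using cutR_props(5)[of x] h nk t a by linarith
        then have "barrier x \<le> uR x" using elim x by simp
        have "((8 * a)\<^sup>2) powr (\<gamma>/2) \<le> quad l x powr (\<gamma>/2)"
        proof (rule powr_mono2)
          have "(8 * a)\<^sup>2 \<le> (x $ 1)\<^sup>2" using h a by (intro power_mono) auto
          then show "(8 * a)\<^sup>2 \<le> quad l x" using h a l by (simp add: quad_eq add_increasing2)
        qed (use \<gamma> in auto)
        then have "(8 * a) powr \<gamma> \<le> quad l x powr (\<gamma>/2)"
          using a by (subst (asm) square_powr_half) simp_all
        then have "c0 * ((8 * a) powr \<gamma> - (4 * a) powr \<gamma>) \<le> barrier x"
          unfolding barrier_def using c0_pos by (intro mult_left_mono) auto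
        then have "slope_bound * (16 * a) \<le> barrier x" using a by (simp add: slope_bound_def)
        moreover have "slope_bound * x $ 1 \<le> slope_bound * (16 * a)"
          using slope_bound_pos nk by (intro mult_left_mono) auto
        ultimately show False using \<open>barrier x \<le> uR x\<close> x by linarith
      qed
    qed
  qed
  then show ?thesis
  proof eventually_elim
    case (elim x)
    show ?case
    proof (intro impI)
      assume x: "x \<in> Omega m \<epsilon>" "0 < x $ 1" "x $ 1 \<le> 8 * a" "\<bar>x $ 2\<bar> \<le> 1/2"
      show "slope_bound * x $ 1 \<le> uR x" using elim x(1,2) z3[OF x(3,4)] by simp
    qed
  qed
qed

end

section \<open>The gradient lower bound\<close>

definition bump :: "real \<Rightarrow> real" where "bump s = (max 0 (1 - s\<^sup>2))\<^sup>2"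

definition bump' :: "real \<Rightarrow> real" where "bump' s = 2 * max 0 (1 - s\<^sup>2) * (- (2 * s))"

lemma DERIV_bump: "(bump has_real_derivative bump' s) (at s)"
  unfolding bump_def[abs_def] bump'_def
  by (rule DERIV_chain2[where f = "\<lambda>s. (max 0 s)\<^sup>2" and g = "\<lambda>s. 1 - s\<^sup>2", OF DERIV_pos_part_square])
     (auto intro!: derivative_eq_intros)

lemma continuous_bump': "continuous_on UNIV bump'"
  unfolding bump'_def[abs_def] by (intro continuous_intros)

lemma bump_props:
  "bump s \<ge> 0" "\<bar>s\<bar> \<ge> 1 \<Longrightarrow> bump s = 0" "\<bar>s\<bar> \<ge> 1 \<Longrightarrow> bump' s = 0" "\<bar>s\<bar> < 1 \<Longrightarrow> bump s > 0" "s \<ge> 0 \<Longrightarrow> bump' s \<le> 0"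
proof -
  show "bump s \<ge> 0" by (simp add: bump_def)
  show "s \<ge> 0 \<Longrightarrow> bump' s \<le> 0" unfolding bump'_def by (intro mult_nonneg_nonpos) auto
  show "bump s = 0" "bump' s = 0" if "\<bar>s\<bar> \<ge> 1"
    using abs_le_square_iff[of 1 s] that by (simp_all add: bump_def bump'_def)
  show "bump s > 0" if "\<bar>s\<bar> < 1"
    using abs_square_less_1[of s] that by (simp add: bump_def)
qed

text \<open>A weak form of the mean value argument on [0, x_1], with u equal to 0 at the left end
  and at least c x_1 at the right. The bump \<phi> decreases for x_1 > 0, so multiplying by its
  x_1-derivative reverses u \<ge> c x_1; integrating both sides by parts bounds c times the integral
  of \<psi>, the part of \<phi> on x_1 > 0, by the integral of (gR \<bullet> e1) \<phi>, hence by M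
  times that of \<psi>.\<close>

lemma (in half_solution) gradient_lower_bound:
  assumes t: "t > 0" and h: "h > 0" and R: "\<And>x. \<bar>x $ 1\<bar> < t \<Longrightarrow> \<bar>x $ 2\<bar> < h \<Longrightarrow> x \<in> \<Omega>"
    and L: "AE x in lebesgue. \<bar>x $ 1\<bar> < t \<longrightarrow> \<bar>x $ 2\<bar> < h \<longrightarrow> x $ 1 > 0 \<longrightarrow> c * x $ 1 \<le> uR x"
    and G: "AE x in lebesgue. \<bar>x $ 1\<bar> < t \<longrightarrow> \<bar>x $ 2\<bar> < h \<longrightarrow> x $ 1 > 0 \<longrightarrow> norm (gR x) \<le> M"
  shows "c \<le> M"
proof -
  define \<phi> :: "real^2 \<Rightarrow> real" where "\<phi> x = bump (2/t * x $ 1 + 0) * bump (2/h * x $ 2 + 0)" for x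
  define \<phi>' :: "real^2 \<Rightarrow> real^2" where "\<phi>' x = bump (2/t * x $ 1 + 0) *\<^sub>R ((bump' (2/h * x $ 2 + 0) * (2/h)) *\<^sub>R axis 2 1)
     + bump (2/h * x $ 2 + 0) *\<^sub>R ((bump' (2/t * x $ 1 + 0) * (2/t)) *\<^sub>R axis 1 1)" for x
  have C: "C1_grad \<phi> \<phi>'"
    unfolding \<phi>_def[abs_def] \<phi>'_def[abs_def]
    by (rule C1_grad_mult; rule C1_grad_coord[OF DERIV_bump continuous_bump'])
  have big: "\<bar>2/k * y + 0\<bar> \<ge> 1 \<longleftrightarrow> k/2 \<le> \<bar>y\<bar>" if "k > 0" for k y :: real
    using that by (simp add: abs_mult field_simps)
  have \<phi>0: "\<phi> x \<ge> 0" for x unfolding \<phi>_def by (intro mult_nonneg_nonneg bump_props)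
  have z: "\<phi> x = 0 \<and> \<phi>' x = 0" if "\<not> (\<bar>x $ 1\<bar> < t/2 \<and> \<bar>x $ 2\<bar> < h/2)" for x
  proof -
    from that consider "\<bar>2/t * x $ 1 + 0\<bar> \<ge> 1" | "\<bar>2/h * x $ 2 + 0\<bar> \<ge> 1"
      unfolding big[OF t] big[OF h] by linarith
    then show ?thesis
    proof cases
      case 1 show ?thesis unfolding \<phi>_def \<phi>'_def bump_props(2,3)[OF 1] by simp
    next
      case 2 show ?thesis unfolding \<phi>_def \<phi>'_def bump_props(2,3)[OF 2] by simp
    qed
  qed
  have pos: "\<phi> x > 0" if "\<bar>x $ 1\<bar> < t/2" "\<bar>x $ 2\<bar> < h/2" for x
    unfolding \<phi>_def using big[OF t, of "x $ 1"] big[OF h, of "x $ 2"] that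
    by (intro mult_pos_pos bump_props(4)) (auto simp: not_le[symmetric])
  define S where "S = {x::real^2. \<bar>x $ 1\<bar> \<le> t/2 \<and> \<bar>x $ 2\<bar> \<le> h/2}"
  have "closed S" unfolding S_def by (intro closed_Collect_conj closed_Collect_le continuous_intros)
  moreover have "{x. \<phi> x \<noteq> 0} \<subseteq> S"
  proof
    fix x assume "x \<in> {x. \<phi> x \<noteq> 0}"
    then have "\<bar>x $ 1\<bar> < t/2 \<and> \<bar>x $ 2\<bar> < h/2" using z[of x] by blast
    then show "x \<in> S" by (simp add: S_def)
  qed
  ultimately have cS: "closure {x. \<phi> x \<noteq> 0} \<subseteq> S" by (rule closure_minimal[rotated])
  moreover have "S \<subseteq> \<Omega>"
  proof
    fix x assume "x \<in> S"
    then show "x \<in> \<Omega>" using t h by (intro R) (auto simp: S_def)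
  qed
  ultimately have cU: "closure {x. \<phi> x \<noteq> 0} \<subseteq> \<Omega>" by blast
  then have "bounded (closure {x. \<phi> x \<noteq> 0})" using \<Omega>_bounded bounded_subset by blast
  then have cc: "C1c \<Omega> \<phi> \<phi>'" unfolding C1c_def using C cU by (simp add: compact_eq_bounded_closed)
  have SuR: "Sob p \<Omega> uR gR" using AR by (simp add: approx_def)
  have e1B: "e1 \<in> Basis" by (simp add: axis_in_Basis_iff)
  define D where "D k x = (if x $ 1 > 0 then indicator \<Omega> x *\<^sub>R (k *\<^sub>R e1) else 0)" for k and x :: "real^2"
  note SP = Sob_pos_part[folded D_def]
  define \<psi> where "\<psi> x = (if x $ 1 > 0 then \<phi> x else 0)" for x
  have D\<psi>: "(D k x \<bullet> e1) * \<phi> x = k * \<psi> x" for k x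
  proof (cases "x \<in> \<Omega>")
    case False
    then have "\<phi> x = 0" using z[of x] R[of x] t h by linarith
    then show ?thesis by (simp add: \<psi>_def)
  qed (simp add: D_def \<psi>_def)
  note wi = Sob_weak_integrable[OF _ cc \<Omega>_open \<Omega>_bounded p]
  have i\<psi>: "integrable lebesgue \<psi>" using wi(2)[OF SP[of 1], of e1] unfolding D\<psi> by simp
  have "(\<integral>x. uR x * (\<phi>' x \<bullet> e1) \<partial>lebesgue) \<le> (\<integral>x. indicator \<Omega> x * (c * max 0 (x $ 1)) * (\<phi>' x \<bullet> e1) \<partial>lebesgue)"
  proof (rule integral_mono_AE[OF wi(1)[OF SuR] wi(1)[OF SP]])
    show "AE x in lebesgue. uR x * (\<phi>' x \<bullet> e1) \<le> indicator \<Omega> x * (c * max 0 (x $ 1)) * (\<phi>' x \<bullet> e1)"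
      using L
    proof eventually_elim
      case (elim x)
      show ?case
      proof (cases "x $ 1 > 0 \<and> \<bar>x $ 1\<bar> < t/2 \<and> \<bar>x $ 2\<bar> < h/2")
        case True
        have "\<phi>' x \<bullet> e1 = bump (2/h * x $ 2 + 0) * (bump' (2/t * x $ 1 + 0) * (2/t))" by (simp add: \<phi>'_def)
        also have "\<dots> \<le> 0"
          using True t by (intro mult_nonneg_nonpos mult_nonpos_nonneg bump_props) auto
        finally have n: "\<phi>' x \<bullet> e1 \<le> 0" .
        have "x \<in> \<Omega>" "c * x $ 1 \<le> uR x" using True elim R[of x] t h by auto
        then show ?thesis using True n by (simp add: mult_right_mono_neg)
      next
        case False
        then consider "x $ 1 \<le> 0" | "\<phi>' x = 0" using z[of x] by linarith
        then show ?thesis by cases (auto simp: R0)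
      qed
    qed
  qed
  then have "(\<integral>x. (D c x \<bullet> e1) * \<phi> x \<partial>lebesgue) \<le> (\<integral>x. (gR x \<bullet> e1) * \<phi> x \<partial>lebesgue)"
    unfolding Sob_weak[OF SuR cc e1B] Sob_weak[OF SP cc e1B] by simp
  also have "\<dots> \<le> (\<integral>x. M * \<psi> x \<partial>lebesgue)"
  proof (rule integral_mono_AE[OF wi(2)[OF SuR] integrable_mult_right[OF i\<psi>]])
    show "AE x in lebesgue. gR x \<bullet> e1 * \<phi> x \<le> M * \<psi> x"
      using G
    proof eventually_elim
      case (elim x)
      consider "x $ 1 \<le> 0" | "\<phi> x = 0" | "x $ 1 > 0" "\<bar>x $ 1\<bar> < t/2" "\<bar>x $ 2\<bar> < h/2" using z[of x] by linarith
      then show ?case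
      proof cases
        case 3
        have "gR x \<bullet> e1 \<le> norm (gR x)" using norm_cauchy_schwarz[of "gR x" e1] by simp
        also have "\<dots> \<le> M" using elim 3 t h by auto
        finally show ?thesis using 3 \<phi>0[of x] by (simp add: \<psi>_def mult_right_mono)
      qed (auto simp: R0 \<psi>_def)
    qed
  qed
  finally have le: "c * (\<integral>x. \<psi> x \<partial>lebesgue) \<le> M * (\<integral>x. \<psi> x \<partial>lebesgue)" unfolding D\<psi> by simp
  have \<psi>0: "\<psi> x \<ge> 0" for x using \<phi>0 by (simp add: \<psi>_def)
  have "(\<integral>x. \<psi> x \<partial>lebesgue) \<noteq> 0"
  proof
    assume "(\<integral>x. \<psi> x \<partial>lebesgue) = 0"
    then have ae: "AE x in lebesgue. \<psi> x = 0"
      using integral_nonneg_eq_0_iff_AE[OF i\<psi>] \<psi>0 by simp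
    define W where "W = {x::real^2. 0 < x $ 1 \<and> \<bar>x $ 1\<bar> < t/2 \<and> \<bar>x $ 2\<bar> < h/2}"
    have oW: "open W" unfolding W_def by (intro open_Collect_conj open_Collect_less continuous_intros)
    have "(t/4) *\<^sub>R e1 \<in> W" using t h by (simp add: W_def)
    then have "\<not> negligible W" using open_not_negligible[OF oW] by blast
    moreover have "AE x in lebesgue. x \<notin> W"
      using ae
    proof eventually_elim
      case (elim x)
      then show ?case using pos[of x] by (auto simp: W_def \<psi>_def)
    qed
    then have "W \<in> null_sets lebesgue" using oW by (subst AE_iff_null_sets) auto
    then have "negligible W" by (simp add: negligible_iff_null_sets)
    ultimately show False by blast
  qed
  moreover have "(\<integral>x. \<psi> x \<partial>lebesgue) \<ge> 0" using \<psi>0 by simp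
  ultimately have "(\<integral>x. \<psi> x \<partial>lebesgue) > 0" by simp
  then show ?thesis using le by simp
qed

section \<open>From the integrated estimate to the essential supremum\<close>

lemma Linf_norm_ge:
  assumes U: "U \<in> sets lebesgue"
    and c: "\<And>M. M \<ge> 0 \<Longrightarrow> AE x in lebesgue. x \<in> U \<longrightarrow> norm (f x) \<le> M \<Longrightarrow> c \<le> M"
  shows "ennreal c \<le> Linf_norm U f"
proof (cases "Linf_norm U f")
  case (real M)
  have "AE x in restrict_space lebesgue U. ennreal (norm (f x)) \<le> ennreal M"
    using esssup_AE[of "\<lambda>x. ennreal (norm (f x))" "restrict_space lebesgue U"] real by (simp add: Linf_norm_def)
  then have "AE x in lebesgue. x \<in> U \<longrightarrow> norm (f x) \<le> M"
    using U real by (subst (asm) AE_restrict_space_iff) (auto elim: eventually_mono)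
  then show ?thesis using c[of M] real by (simp add: ennreal_leI)
qed simp

lemma narrow_region_sets: "narrow_region m \<epsilon> t \<in> sets lebesgue"
proof -
  have [measurable]: "(\<lambda>x::real^2. x $ i) \<in> borel_measurable borel" for i
    by (intro borel_measurable_continuous_onI continuous_intros)
  have "{x \<in> space borel. \<bar>x $ 1\<bar> < t \<and> \<bar>x $ 2\<bar> < \<epsilon>/2 + 1 - (1 - \<bar>x $ 1\<bar> powr m) powr (1/m)} \<in> sets (borel :: (real^2) measure)"
    by measurable
  then show ?thesis by (simp add: narrow_region_def sets_completionI_sets)
qed

text \<open>A point with |x_2| < \<epsilon>/4 has vertical distance more than 1 from both centres,
  whatever x_1 is. This open rectangle is the part of the narrow region in which
  \<open>gradient_lower_bound\<close> is applied.\<close>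

lemma rectangle_subset:
  assumes m: "m > 2" and \<epsilon>: "0 < \<epsilon>" "\<epsilon> \<le> 1/2" and t: "t \<le> 1" and x: "\<bar>x $ 1\<bar> < t" "\<bar>x $ 2\<bar> < \<epsilon>/4"
  shows "x \<in> Omega m \<epsilon>" "x \<in> narrow_region m \<epsilon> t"
proof -
  have "1 < \<bar>x $ 2 - gap_center \<epsilon>\<bar>" "1 < \<bar>x $ 2 - - gap_center \<epsilon>\<bar>" using x \<epsilon> unfolding gap_center_def by linarith+
  then have "1 < \<bar>x $ 2 - gap_center \<epsilon>\<bar> powr m" "1 < \<bar>x $ 2 - - gap_center \<epsilon>\<bar> powr m"
    using m powr_less_mono2[of m 1] by force+
  then have "x \<in> exterior m \<epsilon>"
    using powr_ge_zero[of "\<bar>x $ 1\<bar>" m] unfolding exterior_def lev_def mem_Collect_eq by (intro conjI) linarith+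
  moreover have "norm x \<le> \<bar>x $ 1\<bar> + \<bar>x $ 2\<bar>" using norm_le_l1_cart[of x] by (simp add: sum_2)
  then have "norm x < 5" using x t \<epsilon> by linarith
  ultimately show "x \<in> Omega m \<epsilon>" by (simp add: Omega_eq[OF m])
  have "\<bar>x $ 1\<bar> powr m \<le> 1" using x t m by (intro powr_le1) auto
  then have "(1 - \<bar>x $ 1\<bar> powr m) powr (1/m) \<le> 1" using m by (intro powr_le1) auto
  then show "x \<in> narrow_region m \<epsilon> t" using x \<epsilon> unfolding narrow_region_def by simp
qed

lemma (in neck) Linf_norm_lower_bound:
  assumes t: "0 < t" "t \<le> a" and g: "AE x in lebesgue. x \<in> Omega m \<epsilon> \<longrightarrow> x $ 1 > 0 \<longrightarrow> gR x = Du x"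
  shows "ennreal slope_bound \<le> Linf_norm (narrow_region m \<epsilon> t) Du"
proof (rule Linf_norm_ge[OF narrow_region_sets])
  fix M assume M: "AE x in lebesgue. x \<in> narrow_region m \<epsilon> t \<longrightarrow> norm (Du x) \<le> M"
  have t1: "t \<le> 1" using t a r by linarith
  note sub = rectangle_subset[OF m \<epsilon>(1,2) t1]
  show "slope_bound \<le> M"
  proof (rule gradient_lower_bound[OF t(1), of "\<epsilon>/4"])
    show "AE x in lebesgue. \<bar>x $ 1\<bar> < t \<longrightarrow> \<bar>x $ 2\<bar> < \<epsilon>/4 \<longrightarrow> x $ 1 > 0 \<longrightarrow> slope_bound * x $ 1 \<le> uR x"
      using neck_lower_bound
    proof eventually_elim
      case (elim x)
      then show ?case using sub(1)[of x] t a(1) \<epsilon> by auto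
    qed
    show "AE x in lebesgue. \<bar>x $ 1\<bar> < t \<longrightarrow> \<bar>x $ 2\<bar> < \<epsilon>/4 \<longrightarrow> x $ 1 > 0 \<longrightarrow> norm (gR x) \<le> M"
      using g M
    proof eventually_elim
      case (elim x)
      then show ?case using sub[of x] by auto
    qed
  qed (use \<epsilon> sub in auto)
qed

text \<open>All conditions hold strictly in the limit r \<rightarrow> 0: \<open>barrier_div\<close>
  at 0 is l - (1 - \<gamma>) (p - 1) > 0, the flux quantity tends to l / m < 1, and the slope
  quantity to 0. The bound \<kappa> r \<le> 1 will place \<kappa> \<epsilon>^(1/m) below a =
  \<epsilon>^(1/m) / r.\<close>

lemma neck_constants:
  fixes m p \<gamma> l \<kappa> :: real
  assumes m: "m > 2" and l: "0 < l" "l < m" and l2: "(1 - \<gamma>) * (p - 1) < l"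
  obtains r where "0 < r" "r \<le> 1/2" "\<kappa> * r \<le> 1"
    "l * (r powr m / 2 + 1 / (m * (1 - r powr m))) * (1 + r) powr (m - 1) \<le> 1"
    "\<And>z. 0 \<le> z \<Longrightarrow> z \<le> (r powr (m - 1) / l)\<^sup>2 \<Longrightarrow> barrier_div p \<gamma> l z \<ge> 0"
    "l * (r powr (m - 1) / l)\<^sup>2 \<le> 3"
proof -
  have id0: "((\<lambda>r::real. r) \<longlongrightarrow> 0) (at_right 0)" by (rule tendsto_ident_at)
  have pz: "((\<lambda>r::real. r powr k) \<longlongrightarrow> 0) (at_right 0)" if "k > 0" for k
  proof -
    have "((\<lambda>r::real. r powr k) \<longlongrightarrow> 0 powr k) (at_right 0)"
      using that by (intro tendsto_powr' tendsto_const id0) (auto simp: eventually_at_right_less eventually_at_filter)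
    then show ?thesis by simp
  qed
  have "isCont (barrier_div p \<gamma> l) 0"
    unfolding barrier_div_def[abs_def] by (intro continuous_intros) auto
  moreover have B0: "barrier_div p \<gamma> l 0 > 0" using l2 by (simp add: barrier_div_def algebra_simps)
  ultimately have "\<forall>\<^sub>F z in at 0. barrier_div p \<gamma> l z > 0"
    unfolding isCont_def by (rule order_tendstoD)
  then obtain d where d: "d > 0" "\<And>z. z \<noteq> 0 \<Longrightarrow> dist z 0 < d \<Longrightarrow> barrier_div p \<gamma> l z > 0"
    unfolding eventually_at by blast
  have z2: "((\<lambda>r. (r powr (m - 1) / l)\<^sup>2) \<longlongrightarrow> (0 / l)\<^sup>2) (at_right 0)"
    using l m by (intro tendsto_intros pz) auto
  have e1: "\<forall>\<^sub>F r in at_right 0. (r powr (m - 1) / l)\<^sup>2 < min d (3/l)"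
    by (rule order_tendstoD(2)[OF z2]) (use d l in auto)
  have "((\<lambda>r. l * (r powr m / 2 + 1 / (m * (1 - r powr m))) * (1 + r) powr (m - 1)) \<longlongrightarrow>
      l * (0 / 2 + 1 / (m * (1 - 0))) * (1 + 0) powr (m - 1)) (at_right 0)"
    using m by (intro tendsto_intros pz id0) auto
  then have e2: "\<forall>\<^sub>F r in at_right 0. l * (r powr m / 2 + 1 / (m * (1 - r powr m))) * (1 + r) powr (m - 1) < 1"
    by (rule order_tendstoD) (use l m in simp)
  have "((\<lambda>r. \<kappa> * r) \<longlongrightarrow> \<kappa> * 0) (at_right 0)" by (intro tendsto_intros id0)
  then have e3: "\<forall>\<^sub>F r in at_right 0. \<kappa> * r < 1" by (rule order_tendstoD) simp
  have e4: "\<forall>\<^sub>F r in at_right 0. r < (1/2::real)" by (rule order_tendstoD[OF id0]) simp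
  have "\<forall>\<^sub>F r in at_right (0::real). r > 0" by (rule eventually_at_right_less)
  then have "\<forall>\<^sub>F r in at_right 0. 0 < r \<and> r < 1/2 \<and> \<kappa> * r < 1
      \<and> l * (r powr m / 2 + 1 / (m * (1 - r powr m))) * (1 + r) powr (m - 1) < 1 \<and> (r powr (m - 1) / l)\<^sup>2 < min d (3/l)"
    using e1 e2 e3 e4 by eventually_elim simp
  then obtain r where r: "0 < r" "r < 1/2" "\<kappa> * r < 1"
    "l * (r powr m / 2 + 1 / (m * (1 - r powr m))) * (1 + r) powr (m - 1) < 1" "(r powr (m - 1) / l)\<^sup>2 < min d (3/l)"
    using eventually_happens'[OF trivial_limit_at_right_real] by blast
  show thesis
  proof (rule that[OF r(1) less_imp_le[OF r(2)] less_imp_le[OF r(3)] less_imp_le[OF r(4)]])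
    show "barrier_div p \<gamma> l z \<ge> 0" if "0 \<le> z" "z \<le> (r powr (m - 1) / l)\<^sup>2" for z
    proof (cases "z = 0")
      case False
      then show ?thesis using d(2)[of z] that r(5) by (simp add: dist_real_def less_imp_le)
    qed (use B0 in simp)
    have "(r powr (m - 1) / l)\<^sup>2 < 3/l" using r(5) by simp
    then have "(r powr (m - 1) / l)\<^sup>2 * l < 3" using l by (subst (asm) pos_less_divide_eq) auto
    then show "l * (r powr (m - 1) / l)\<^sup>2 \<le> 3" by (simp only: mult.commute less_imp_le)
  qed
qed

lemma gradient_blow_up:
  fixes m p \<gamma> \<kappa> :: real
  assumes m: "m > 2" and p: "p > 1" and \<gamma>: "0 < \<gamma>" "\<gamma> < 1" "(1 - \<gamma>) * (p - 1) < m" and \<kappa>: "\<kappa> > 0"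
  shows "\<exists>C>0. \<forall>\<^sub>F \<epsilon> in at_right 0. \<forall>u Du. weak_solution m p \<epsilon> u Du \<longrightarrow>
    ennreal (C * \<epsilon> powr ((\<gamma> - 1) / m)) \<le> Linf_norm (narrow_region m \<epsilon> (\<kappa> * \<epsilon> powr (1/m))) Du"
proof -
  \<comment> \<open>The midpoint of the interval that the equation and the boundary condition leave
    for \<lambda>.\<close>
  define l where "l = ((1 - \<gamma>) * (p - 1) + m) / 2"
  have "(1 - \<gamma>) * (p - 1) > 0" using \<gamma> p by simp
  then have l: "0 < l" "l < m" "(1 - \<gamma>) * (p - 1) < l" using \<gamma>(3) m by (auto simp: l_def)
  obtain r where r: "0 < r" "r \<le> 1/2" and \<kappa>r: "\<kappa> * r \<le> 1"
    and K: "l * (r powr m / 2 + 1 / (m * (1 - r powr m))) * (1 + r) powr (m - 1) \<le> 1"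
    "\<And>z. 0 \<le> z \<Longrightarrow> z \<le> (r powr (m - 1) / l)\<^sup>2 \<Longrightarrow> barrier_div p \<gamma> l z \<ge> 0"
    "l * (r powr (m - 1) / l)\<^sup>2 \<le> 3"
    by (rule neck_constants[OF m l, of \<kappa>]) blast
  define C where "C = (r/2) / (2 * r) powr \<gamma> * (8 powr \<gamma> - 4 powr \<gamma>) / 16 / r powr (\<gamma> - 1)"
  have C: "C > 0" using r \<gamma> powr_less_mono2[of \<gamma> 4 8] by (simp add: C_def)
  have id0: "((\<lambda>\<epsilon>::real. \<epsilon>) \<longlongrightarrow> 0) (at_right 0)" by (rule tendsto_ident_at)
  have "((\<lambda>\<epsilon>::real. \<epsilon> powr (1/m)) \<longlongrightarrow> 0 powr (1/m)) (at_right 0)"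
    using m by (intro tendsto_powr' tendsto_const id0) (auto simp: eventually_at_filter)
  then have e1: "\<forall>\<^sub>F \<epsilon> in at_right 0. \<epsilon> powr (1/m) < r * r / 32"
    by (rule order_tendstoD) (use r in simp)
  have e2: "\<forall>\<^sub>F \<epsilon> in at_right 0. \<epsilon> < r" by (rule order_tendstoD[OF id0]) (use r in simp)
  have e3: "\<forall>\<^sub>F \<epsilon> in at_right (0::real). \<epsilon> > 0" by (rule eventually_at_right_less)
  have "\<forall>\<^sub>F \<epsilon> in at_right 0. \<forall>u Du. weak_solution m p \<epsilon> u Du \<longrightarrow>
    ennreal (C * \<epsilon> powr ((\<gamma> - 1) / m)) \<le> Linf_norm (narrow_region m \<epsilon> (\<kappa> * \<epsilon> powr (1/m))) Du"
    using e1 e2 e3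
  proof eventually_elim
    case (elim \<epsilon>)
    show ?case
    proof (intro allI impI)
      fix u Du assume W: "weak_solution m p \<epsilon> u Du"
      \<comment> \<open>\<open>r\<close> and \<open>C\<close> were fixed before \<epsilon>, so all
        dependence on \<epsilon> sits in \<open>a\<close>, and \<open>slope_bound\<close>, a
        constant times a^(\<gamma> - 1), becomes C \<epsilon>^((\<gamma> - 1) / m).\<close>
      define a where "a = \<epsilon> powr (1/m) / r"
      have \<epsilon>: "0 < \<epsilon>" "\<epsilon> \<le> 1/2" "\<epsilon> \<le> r" using elim r by linarith+
      have a: "0 < a" "32 * a \<le> r" using elim r by (simp_all add: a_def field_simps)
      have ae: "\<epsilon> = (a * r) powr m" using r m \<epsilon> by (simp add: a_def powr_powr)
      obtain uR gR vR hR where H: "half_solution (exterior m \<epsilon>) (Omega m \<epsilon>) p (lev m (gap_center \<epsilon>))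
          (lev m (- gap_center \<epsilon>)) (lev' m (gap_center \<epsilon>)) (lev' m (- gap_center \<epsilon>)) uR gR vR hR"
        and g: "AE x in lebesgue. x \<in> Omega m \<epsilon> \<longrightarrow> x $ 1 > 0 \<longrightarrow> gR x = Du x"
        by (rule weak_solution_imp_half_solution[OF m p \<epsilon>(1,2) W])
      interpret half_solution "exterior m \<epsilon>" "Omega m \<epsilon>" p "lev m (gap_center \<epsilon>)" "lev m (- gap_center \<epsilon>)"
        "lev' m (gap_center \<epsilon>)" "lev' m (- gap_center \<epsilon>)" uR gR vR hR by (rule H)
      interpret neck m \<epsilon> p uR gR vR hR \<gamma> l r a
        by unfold_locales (use m \<epsilon> \<gamma> l r a ae K in auto)
      have t: "0 < \<kappa> * \<epsilon> powr (1/m)" "\<kappa> * \<epsilon> powr (1/m) \<le> a"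
      proof -
        show "0 < \<kappa> * \<epsilon> powr (1/m)" using \<kappa> \<epsilon> by simp
        have "(\<kappa> * r) * \<epsilon> powr (1/m) \<le> 1 * \<epsilon> powr (1/m)" by (rule mult_right_mono[OF \<kappa>r]) simp
        then show "\<kappa> * \<epsilon> powr (1/m) \<le> a" using r by (simp add: a_def field_simps)
      qed
      have "slope_bound = (r/2) / (2 * r) powr \<gamma> * (8 powr \<gamma> - 4 powr \<gamma>) / 16 * (a powr \<gamma> / a)"
      proof -
        have "A * (E * q - F * q) / (16 * a) = A * (E - F) / 16 * (q / a)" for A E F q :: real
          by (simp only: left_diff_distrib[symmetric] times_divide_eq_right times_divide_eq_left divide_divide_eq_left mult_ac)
        then show ?thesis unfolding slope_bound_def c0_def using a by (simp only: powr_mult)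
      qed
      also have "a powr \<gamma> / a = a powr (\<gamma> - 1)" using a by (simp add: powr_diff)
      also have "\<dots> = \<epsilon> powr ((\<gamma> - 1) / m) / r powr (\<gamma> - 1)"
        unfolding a_def using r \<epsilon> by (simp add: powr_divide powr_powr)
      finally have "slope_bound = C * \<epsilon> powr ((\<gamma> - 1) / m)" by (simp add: C_def)
      with Linf_norm_lower_bound[OF t g]
      show "ennreal (C * \<epsilon> powr ((\<gamma> - 1) / m)) \<le> Linf_norm (narrow_region m \<epsilon> (\<kappa> * \<epsilon> powr (1/m))) Du" by simp
    qed
  qed
  with C show ?thesis by blast
qed

theorem theorem1p9:
  fixes m p \<tau> :: real
  assumes "m > 2" and "p > 1" and "0 < \<tau>" and "\<tau> < m - 2"
  shows "\<exists>C>0. \<forall>\<^sub>F \<epsilon> in at_right (0::real). \<forall>u Du. weak_solution m p \<epsilon> u Du \<longrightarrow>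
    (p \<le> m + 1 \<longrightarrow>
       Linf_norm (narrow_region m \<epsilon> (t_eps m \<tau> \<epsilon>)) Du
         \<ge> ennreal (1 / C * \<epsilon> powr ((\<tau> - 1) / m))) \<and>
    (p > m + 1 \<longrightarrow>
       Linf_norm (narrow_region m \<epsilon> (t_eps m \<tau> \<epsilon>)) Du
         \<ge> ennreal (1 / C * \<epsilon> powr ((2 * \<tau> - m) / (m * (p - 1)))))"
proof -
  \<comment> \<open>Pulling \<epsilon>^(1/m) out of \<open>t_eps\<close> puts the width in the form
    of \<open>gradient_blow_up\<close>, where any fixed positive multiple is allowed.\<close>
  define \<kappa> where "\<kappa> = (4 * m / (m - 2 - \<tau>)) powr (1/m)"
  have \<kappa>: "\<kappa> > 0" using assms by (simp add: \<kappa>_def)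
  have t: "t_eps m \<tau> \<epsilon> = \<kappa> * \<epsilon> powr (1/m)" if "\<epsilon> > 0" for \<epsilon>
  proof -
    have "4 * m * \<epsilon> / (m - 2 - \<tau>) = (4 * m / (m - 2 - \<tau>)) * \<epsilon>" by simp
    then show ?thesis unfolding t_eps_def \<kappa>_def using assms that by (simp only: powr_mult)
  qed
  define e where "e = (if p \<le> m + 1 then (\<tau> - 1) / m else (2 * \<tau> - m) / (m * (p - 1)))"
  obtain \<gamma> where \<gamma>: "0 < \<gamma>" "\<gamma> < 1" "(1 - \<gamma>) * (p - 1) < m" "(\<gamma> - 1) / m \<le> e"
  proof (cases "p \<le> m + 1")
    case True
    \<comment> \<open>\<gamma> \<le> \<tau> gives the exponent, and 1/2 keeps \<gamma> < 1 when
      \<tau> is large. Since p - 1 \<le> m, the condition (1 - \<gamma>) (p - 1) < m holds for every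
      \<gamma> between 0 and 1.\<close>
    define \<gamma> where "\<gamma> = min \<tau> (1/2)"
    have g: "0 < \<gamma>" "\<gamma> < 1" "\<gamma> \<le> \<tau>" using assms by (auto simp: \<gamma>_def)
    have "(1 - \<gamma>) * (p - 1) \<le> (1 - \<gamma>) * m" using True g by (intro mult_left_mono) auto
    also have "\<dots> < m" using g assms by (simp add: algebra_simps)
    finally show thesis using g True assms by (intro that[of \<gamma>]) (auto simp: e_def divide_right_mono)
  next
    case False
    \<comment> \<open>\<open>q\<close> is the intended value of (1 - \<gamma>) (p - 1): q \<ge> m -
      2 \<tau> gives the exponent, q < m the condition on \<gamma>, and m/2 keeps q positive, hence
      \<gamma> < 1, when 2 \<tau> \<ge> m. Positivity of \<gamma> is q < m < p - 1.\<close>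
    define q where "q = max (m - 2 * \<tau>) (m/2)"
    have q: "0 < q" "q < m" "m - 2 * \<tau> \<le> q" using assms by (auto simp: q_def)
    define \<gamma> where "\<gamma> = 1 - q / (p - 1)"
    have qp: "q / (p - 1) < 1" "q / (p - 1) > 0" using q False assms by simp_all
    have "(\<gamma> - 1) / m = (- q) / (m * (p - 1))" by (simp add: \<gamma>_def)
    also have "\<dots> \<le> (2 * \<tau> - m) / (m * (p - 1))" using q assms by (intro divide_right_mono) auto
    finally have "(\<gamma> - 1) / m \<le> e" using False by (simp add: e_def)
    then show thesis using q qp assms by (intro that[of \<gamma>]) (simp_all add: \<gamma>_def)
  qed
  obtain C where C: "C > 0" and ev: "\<forall>\<^sub>F \<epsilon> in at_right 0. \<forall>u Du. weak_solution m p \<epsilon> u Du \<longrightarrow>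
    ennreal (C * \<epsilon> powr ((\<gamma> - 1) / m)) \<le> Linf_norm (narrow_region m \<epsilon> (\<kappa> * \<epsilon> powr (1/m))) Du"
    using gradient_blow_up[OF assms(1,2) \<gamma>(1-3) \<kappa>] by blast
  have "\<forall>\<^sub>F \<epsilon> in at_right (0::real). \<epsilon> < 1" by (rule order_tendstoD[OF tendsto_ident_at]) simp
  with ev eventually_at_right_less[of "0::real"]
  have "\<forall>\<^sub>F \<epsilon> in at_right 0. \<forall>u Du. weak_solution m p \<epsilon> u Du \<longrightarrow>
    ennreal (1 / (1 / C) * \<epsilon> powr e) \<le> Linf_norm (narrow_region m \<epsilon> (t_eps m \<tau> \<epsilon>)) Du"
  proof eventually_elim
    case (elim \<epsilon>)
    \<comment> \<open>For 0 < \<epsilon> < 1 the smaller exponent gives the larger power, so the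
      bound obtained with \<gamma> implies the stated one.\<close>
    have "\<epsilon> powr e \<le> \<epsilon> powr ((\<gamma> - 1) / m)" using elim \<gamma>(4) by (intro powr_mono') auto
    then have "ennreal (1 / (1 / C) * \<epsilon> powr e) \<le> ennreal (C * \<epsilon> powr ((\<gamma> - 1) / m))"
      using C by (intro ennreal_leI) simp
    then show ?case using elim(1) t[OF elim(2)] by (auto intro: order_trans)
  qed
  then show ?thesis using C by (intro exI[of _ "1 / C"]) (auto simp: e_def elim!: eventually_mono)
qed

end
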